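(* Let $(E^{\mathcal C}_{\bar D},\rho^{\mathcal C},D_{E^{\mathcal C}_{\bar D}}:E^{\mathcal C}_{\bar D}\to R^{\mathcal C}_{\bar D})$ be the Cayley–Hamilton representation of $G$ constructed below from $(E_{\bar D},\rho^u,D^u_{E_{\bar D}})$ and the stable condition $\mathcal C$. Then it is an object of $\mathcal{CH}^{\mathcal C}_{G,\bar D}$, and it is a universal object of $\mathcal{CH}^{\mathcal C}_{G,\bar D}$: for every object $(E,\rho,D)$ of $\mathcal{CH}^{\mathcal C}_{G,\bar D}$ there is a unique morphism of Cayley–Hamilton representations $(E^{\mathcal C}_{\bar D},\rho^{\mathcal C},D_{E^{\mathcal C}_{\bar D}})\to(E,\rho,D)$.
   Context: Fix a prime $p$ and a profinite group $G$ satisfying Mazur's condition $\Phi_p$ (for every open subgroup $H$ of $G$, the maximal pro-$p$ quotient of $H$ is topologically finitely generated). Commutative rings are Noetherian; algebras are associative but not necessarily commutative; actions of $G$ and homomorphisms out of $G$ are continuous. For a ring $R$ and an $R$-algebra $E$, a $d$-dimensional pseudorepresentation $D:E\to R$ is a multiplicative polynomial law of degree $d$: a family of maps $D_A:E\otimes_RA\to A$, natural in commutative $R$-algebras $A$, with $D_A(1)=1$, $D_A(xy)=D_A(x)D_A(y)$ and $D_A(bx)=b^dD_A(x)$ for $b\in A$. A pseudorepresentation of $G$ over $A$ is a (continuous) pseudorepresentation of $A[G]$. A morphism of pseudorepresentations $(E,D:E\to R)\to(E',D':E'\to R')$ is a pair $(f,g)$ of a ring map $f:R\to R'$ and an $R'$-algebra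 map $g:E\otimes_RR'\to E'$ with $f\circ D=D'\circ g$ (base change of $D$ along $f$ equals $D'$ composed with $g$). The pair $(E,D)$ is a Cayley–Hamilton $R$-algebra if $E$ is a finitely generated $R$-algebra and $\chi_D(x,x)=0$ for every commutative $R$-algebra $A$ and every $x\in E\otimes_RA$, where $\chi_D(x,t)=D_{A[t]}(t-x)$; then $E$ is a finite $R$-module. A Cayley–Hamilton representation of $G$ over $A$ is a triple $(E,\rho,D)$ with $(E,D:E\to A)$ a Cayley–Hamilton $A$-algebra and $\rho:G\to E^\times$ a homomorphism; its induced pseudorepresentation is $D\circ\rho$. A morphism $(E,\rho,D)\to(E',\rho',D')$ is a morphism of pseudorepresentations $(f,g)$ with $g\circ\rho=\rho'$. Fix a finite field $\mathbb F$ of characteristic $p$ and a pseudorepresentation $\bar D:G\to\mathbb F$. Let $\hat{\mathcal C}_{W(\mathbb F)}$ be the category of complete Noetherian local $W(\mathbb F)$-algebras with residue field $\mathbb F$. The functor of deformations of $\bar D$ (pseudorepresentations $D:G\to A$, $A\in\hat{\mathcal C}_{W(\mathbb F)}$, with $D\otimes_A\mathbb F=\bar D$) is represented by $(R_{\bar D},\mathfrak m_{\bar D})$ with universal deformation $D^u_{\bar D}$. A pseudorepresentation of $G$ over a complete Noetherian local $\mathbb Z_p$-algebra $A$ has residual pseudorepresentation $\bar D$ if it is the base change of $D^u_{\bar D}$ along a local homomorphism $R_{\bar D}\to A$; a Cayley–Hamilton representation has residual pseudorepresentation $\bar D$ if its induced pseudorepresentation does. Let $\mathcal{CH}_{G,\bar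 D}$ be the category of such Cayley–Hamilton representations. It has a universal (initial) object $(E_{\bar D},\rho^u,D^u_{E_{\bar D}}:E_{\bar D}\to R_{\bar D})$; $E_{\bar D}$ is a finite $R_{\bar D}$-module, $R_{\bar D}[G]\to E_{\bar D}$ is surjective, and $D^u_{E_{\bar D}}\circ\rho^u=D^u_{\bar D}$. Let $\mathrm{Mod}^{\mathrm{fin}}_{\mathbb Z_p[G]}$ be the category of finite-cardinality $\mathbb Z_p[G]$-modules. A stable condition is a full subcategory $\mathcal C$ of it closed under isomorphisms, submodules, quotients and finite direct sums; fix one. For a complete Noetherian local $\mathbb Z_p$-algebra $(A,\mathfrak m_A)$ and an $A[G]$-module $M$ finitely generated over $A$, say $M$ satisfies $\mathcal C$ if $M/\mathfrak m_A^iM\in\mathcal C$ for all $i\ge1$. A Cayley–Hamilton representation $(E,\rho,D)$ over such $A$ with residual pseudorepresentation $\bar D$ satisfies $\mathcal C$ if $E$, as a left $A[G]$-module via $\rho$ and left multiplication, satisfies $\mathcal C$. Let $\mathcal{CH}^{\mathcal C}_{G,\bar D}$ be the full subcategory of $\mathcal{CH}_{G,\bar D}$ of objects satisfying $\mathcal C$. Construction: for $i\ge1$ let $E^{\mathcal C}_{\bar D}(i)$ be the quotient of the finite left $\mathbb Z_p[G]$-module $E_{\bar D}/\mathfrak m_{\bar D}^iE_{\bar D}$ by the intersection of the kernels of all its $\mathbb Z_p[G]$-module surjections onto objects of $\mathcal C$; these are $R_{\bar D}$-algebra quotients of $E_{\bar D}$ forming an inverse system. Let $K^{\mathcal C}\subset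 E_{\bar D}$ be the kernel of $E_{\bar D}\to\varprojlim_iE^{\mathcal C}_{\bar D}(i)$ (a two-sided ideal). Let $\mathfrak a\subset R_{\bar D}$ be the ideal generated by the non-constant coefficients of the polynomials $(D^u_{E_{\bar D}})_{R_{\bar D}[t]}(1-xt)$ for $x\in K^{\mathcal C}$. Put $R^{\mathcal C}_{\bar D}=R_{\bar D}/\mathfrak a$ and $E^{\mathcal C}_{\bar D}=E_{\bar D}/(K^{\mathcal C}+\mathfrak aE_{\bar D})$; there is a unique pseudorepresentation $D_{E^{\mathcal C}_{\bar D}}:E^{\mathcal C}_{\bar D}\to R^{\mathcal C}_{\bar D}$ such that the quotient maps form a morphism of Cayley–Hamilton algebras $(E_{\bar D},D^u_{E_{\bar D}})\to(E^{\mathcal C}_{\bar D},D_{E^{\mathcal C}_{\bar D}})$, and $\rho^{\mathcal C}$ is the composite of $\rho^u$ with $E_{\bar D}\to E^{\mathcal C}_{\bar D}$.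
   Formalization: Membership in CH^C is asserted only when R^C is not the zero ring: for C consisting of zero modules and d ≥ 1 one gets R^C = 0, which is not local, so membership fails; the universal property is proved without this condition. *)

theory Defs
  imports
    "HOL-Analysis.Abstract_Topology_2"
    "HOL-Analysis.Product_Topology"
    "HOL-Analysis.T1_Spaces"
    "HOL-Computational_Algebra.Primes"
    "HOL-Algebra.Ring_Divisibility"
    "HOL-Algebra.Ideal_Product"
    "HOL-Algebra.Subrings"
    "HOL-Algebra.QuotRing"
    "HOL-Algebra.UnivPoly"
begin

text \<open>
  Universe convention.  The category of all commutative rings (and of all algebras) is rendered by
  the rings whose carrier lies in one fixed infinite type \<open>'u\<close>.  As \<open>'u\<close> is infinite, this class of
  rings is closed, up to isomorphism, under finitely generated algebras, polynomial rings, quotients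
  and tensor products.  A polynomial law over \<open>R\<close> is determined by its values on finitely generated
  \<open>R\<close>-algebras, so nothing is lost by evaluating laws only on algebras with carrier in \<open>'u\<close>.  The type
  \<open>'u\<close> is a free type variable, hence arbitrarily large.
\<close>


section \<open>Algebras and modules\<close>

definition assoc_algebra :: "('r, 'x) ring_scheme \<Rightarrow> ('r, 'e) module \<Rightarrow> bool" where
  "assoc_algebra R E \<longleftrightarrow> Module.module R E \<and> ring E \<and>
     (\<forall>r\<in>carrier R. \<forall>x\<in>carrier E. \<forall>y\<in>carrier E.
        (r \<odot>\<^bsub>E\<^esub> x) \<otimes>\<^bsub>E\<^esub> y = r \<odot>\<^bsub>E\<^esub> (x \<otimes>\<^bsub>E\<^esub> y) \<and>
        x \<otimes>\<^bsub>E\<^esub> (r \<odot>\<^bsub>E\<^esub> y) = r \<odot>\<^bsub>E\<^esub> (x \<otimes>\<^bsub>E\<^esub> y))"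

definition alg_hom :: "('r, 'x) ring_scheme \<Rightarrow> ('r, 'a) module \<Rightarrow> ('r, 'b) module \<Rightarrow> ('a \<Rightarrow> 'b) set" where
  "alg_hom R A B = {h \<in> ring_hom A B.
     \<forall>r\<in>carrier R. \<forall>x\<in>carrier A. h (r \<odot>\<^bsub>A\<^esub> x) = r \<odot>\<^bsub>B\<^esub> h x}"

definition self_alg :: "('r, 'x) ring_scheme \<Rightarrow> ('r, 'r) module" where
  "self_alg R = \<lparr>carrier = carrier R, monoid.mult = monoid.mult R, one = one R,
     zero = zero R, add = add R, smult = monoid.mult R\<rparr>"

definition str_map :: "('r, 'a) module \<Rightarrow> 'r \<Rightarrow> 'a" where
  "str_map A r = r \<odot>\<^bsub>A\<^esub> \<one>\<^bsub>A\<^esub>"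

text \<open>Restriction of scalars along \<open>f\<close>.\<close>

definition restr :: "('s \<Rightarrow> 'r) \<Rightarrow> ('r, 'm) module \<Rightarrow> ('s, 'm) module" where
  "restr f M = \<lparr>carrier = carrier M, monoid.mult = monoid.mult M, one = one M,
     zero = zero M, add = add M, smult = (\<lambda>s x. f s \<odot>\<^bsub>M\<^esub> x)\<rparr>"

definition fg_module :: "('r, 'x) ring_scheme \<Rightarrow> ('r, 'm) module \<Rightarrow> bool" where
  "fg_module R M \<longleftrightarrow> (\<exists>S. finite S \<and> S \<subseteq> carrier M \<and>
     carrier M = {finsum M (\<lambda>s. c s \<odot>\<^bsub>M\<^esub> s) S | c. c \<in> S \<rightarrow> carrier R})"

definition fg_algebra :: "('r, 'x) ring_scheme \<Rightarrow> ('r, 'e) module \<Rightarrow> bool" where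
  "fg_algebra R E \<longleftrightarrow> (\<exists>S. finite S \<and> S \<subseteq> carrier E \<and>
     (\<forall>B. subring B E \<and> (\<forall>r\<in>carrier R. \<forall>x\<in>B. r \<odot>\<^bsub>E\<^esub> x \<in> B) \<and> S \<subseteq> B \<longrightarrow> B = carrier E))"

definition ideal_smult :: "('r, 'x) ring_scheme \<Rightarrow> 'r set \<Rightarrow> ('r, 'm) module \<Rightarrow> 'm set" where
  "ideal_smult R I M = generate (add_monoid M) {a \<odot>\<^bsub>M\<^esub> x | a x. a \<in> I \<and> x \<in> carrier M}"

fun ideal_pow :: "('r, 'x) ring_scheme \<Rightarrow> 'r set \<Rightarrow> nat \<Rightarrow> 'r set" where
  "ideal_pow R I 0 = carrier R"
| "ideal_pow R I (Suc n) = I \<cdot>\<^bsub>R\<^esub> ideal_pow R I n"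

text \<open>
  The quotient \<open>M/N\<close>.  The multiplicative part is meaningful when \<open>M\<close> is an algebra and \<open>N\<close> a
  two-sided ideal; for a mere module it is irrelevant.
\<close>

definition quot_module :: "('r, 'm) module \<Rightarrow> 'm set \<Rightarrow> ('r, 'm set) module" where
  "quot_module M N = \<lparr>carrier = a_rcosets\<^bsub>M\<^esub> N, monoid.mult = rcoset_mult M N,
     one = N +>\<^bsub>M\<^esub> \<one>\<^bsub>M\<^esub>, zero = N, add = set_add M,
     smult = (\<lambda>r X. \<Union>x\<in>X. N +>\<^bsub>M\<^esub> (r \<odot>\<^bsub>M\<^esub> x))\<rparr>"

text \<open>\<open>E/J\<close> as an algebra over the quotient \<open>R/I\<close>, for \<open>J\<close> a two-sided ideal containing \<open>I E\<close>.\<close>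

definition quot_alg :: "('r, 'e) module \<Rightarrow> 'e set \<Rightarrow> ('r set, 'e set) module" where
  "quot_alg E J = \<lparr>carrier = a_rcosets\<^bsub>E\<^esub> J, monoid.mult = rcoset_mult E J,
     one = J +>\<^bsub>E\<^esub> \<one>\<^bsub>E\<^esub>, zero = J, add = set_add E,
     smult = (\<lambda>C X. \<Union>r\<in>C. \<Union>x\<in>X. J +>\<^bsub>E\<^esub> (r \<odot>\<^bsub>E\<^esub> x))\<rparr>"


section \<open>Tensor products\<close>

text \<open>
  Elements of \<open>E \<otimes>\<^sub>R A\<close> are classes of finite formal sums of pairs, written as lists, modulo the
  congruence generated by the relations of the tensor product.
\<close>

inductive teq :: "('r, 'x) ring_scheme \<Rightarrow> ('r, 'e) module \<Rightarrow> ('r, 'a) module \<Rightarrow>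
    ('e \<times> 'a) list \<Rightarrow> ('e \<times> 'a) list \<Rightarrow> bool"
  for R E A where
  teq_refl: "set l \<subseteq> carrier E \<times> carrier A \<Longrightarrow> teq R E A l l"
| teq_sym: "teq R E A l k \<Longrightarrow> teq R E A k l"
| teq_trans: "teq R E A l k \<Longrightarrow> teq R E A k m \<Longrightarrow> teq R E A l m"
| teq_append: "teq R E A l l' \<Longrightarrow> teq R E A k k' \<Longrightarrow> teq R E A (l @ k) (l' @ k')"
| teq_swap: "\<lbrakk>u \<in> carrier E \<times> carrier A; v \<in> carrier E \<times> carrier A\<rbrakk> \<Longrightarrow> teq R E A [u, v] [v, u]"
| teq_zero: "a \<in> carrier A \<Longrightarrow> teq R E A [(\<zero>\<^bsub>E\<^esub>, a)] []"
| teq_add_left: "\<lbrakk>x \<in> carrier E; y \<in> carrier E; a \<in> carrier A\<rbrakk> \<Longrightarrow>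
    teq R E A [(x \<oplus>\<^bsub>E\<^esub> y, a)] [(x, a), (y, a)]"
| teq_add_right: "\<lbrakk>x \<in> carrier E; a \<in> carrier A; b \<in> carrier A\<rbrakk> \<Longrightarrow>
    teq R E A [(x, a \<oplus>\<^bsub>A\<^esub> b)] [(x, a), (x, b)]"
| teq_smult: "\<lbrakk>r \<in> carrier R; x \<in> carrier E; a \<in> carrier A\<rbrakk> \<Longrightarrow>
    teq R E A [(r \<odot>\<^bsub>E\<^esub> x, a)] [(x, r \<odot>\<^bsub>A\<^esub> a)]"

definition tclass :: "('r, 'x) ring_scheme \<Rightarrow> ('r, 'e) module \<Rightarrow> ('r, 'a) module \<Rightarrow>
    ('e \<times> 'a) list \<Rightarrow> ('e \<times> 'a) list set" where
  "tclass R E A l = {k. teq R E A l k}"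

abbreviation pure :: "('r, 'x) ring_scheme \<Rightarrow> ('r, 'e) module \<Rightarrow> ('r, 'a) module \<Rightarrow>
    'e \<Rightarrow> 'a \<Rightarrow> ('e \<times> 'a) list set" where
  "pure R E A x a \<equiv> tclass R E A [(x, a)]"

text \<open>\<open>E \<otimes>\<^sub>R A\<close> as an \<open>A\<close>-algebra.\<close>

definition tensor :: "('r, 'x) ring_scheme \<Rightarrow> ('r, 'e) module \<Rightarrow> ('r, 'a) module \<Rightarrow>
    ('a, ('e \<times> 'a) list set) module" where
  "tensor R E A = \<lparr>
     carrier = {tclass R E A l | l. set l \<subseteq> carrier E \<times> carrier A},
     monoid.mult = (\<lambda>X Y. \<Union>l\<in>X. \<Union>k\<in>Y. tclass R E A
        (concat (map (\<lambda>(x, a). map (\<lambda>(y, b). (x \<otimes>\<^bsub>E\<^esub> y, a \<otimes>\<^bsub>A\<^esub> b)) k) l))),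
     one = pure R E A \<one>\<^bsub>E\<^esub> \<one>\<^bsub>A\<^esub>,
     zero = tclass R E A [],
     add = (\<lambda>X Y. \<Union>l\<in>X. \<Union>k\<in>Y. tclass R E A (l @ k)),
     smult = (\<lambda>b X. \<Union>l\<in>X. tclass R E A (map (\<lambda>(x, a). (x, b \<otimes>\<^bsub>A\<^esub> a)) l))\<rparr>"

text \<open>The additive map with \<open>x \<otimes> a \<mapsto> h x a\<close>, for balanced biadditive \<open>h\<close> with values in \<open>M\<close>.\<close>

definition tensor_lift :: "('s, 'm) module \<Rightarrow> ('e \<Rightarrow> 'a \<Rightarrow> 'm) \<Rightarrow> ('e \<times> 'a) list set \<Rightarrow> 'm" where
  "tensor_lift M h X = the_elem ((\<lambda>l. foldr (\<lambda>(x, a) s. h x a \<oplus>\<^bsub>M\<^esub> s) l \<zero>\<^bsub>M\<^esub>) ` X)"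

text \<open>\<open>g \<otimes> h\<close> with values in \<open>E' \<otimes>\<^sub>R\<^sub>' A'\<close>.\<close>

definition tmap :: "('s, 'x) ring_scheme \<Rightarrow> ('s, 'f) module \<Rightarrow> ('s, 'b) module \<Rightarrow>
    ('e \<Rightarrow> 'f) \<Rightarrow> ('a \<Rightarrow> 'b) \<Rightarrow> ('e \<times> 'a) list set \<Rightarrow> ('f \<times> 'b) list set" where
  "tmap R' E' A' g h = tensor_lift (tensor R' E' A') (\<lambda>x a. pure R' E' A' (g x) (h a))"


section \<open>Pseudorepresentations\<close>

type_synonym ('r, 'e, 'u) law = "('r, 'u) module \<Rightarrow> ('e \<times> 'u) list set \<Rightarrow> 'u"

text \<open>\<open>algebra R A\<close> is the library's notion of a commutative \<open>R\<close>-algebra.\<close>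

definition pseudorep :: "('r, 'x) ring_scheme \<Rightarrow> ('r, 'e) module \<Rightarrow> nat \<Rightarrow> ('r, 'e, 'u) law \<Rightarrow> bool" where
  "pseudorep R E d D \<longleftrightarrow>
     cring R \<and> assoc_algebra R E \<and>
     (\<forall>A. algebra R A \<longrightarrow>
        D A \<in> carrier (tensor R E A) \<rightarrow> carrier A \<and>
        D A \<one>\<^bsub>tensor R E A\<^esub> = \<one>\<^bsub>A\<^esub> \<and>
        (\<forall>x\<in>carrier (tensor R E A). \<forall>y\<in>carrier (tensor R E A).
           D A (x \<otimes>\<^bsub>tensor R E A\<^esub> y) = D A x \<otimes>\<^bsub>A\<^esub> D A y) \<and>
        (\<forall>b\<in>carrier A. \<forall>x\<in>carrier (tensor R E A).
           D A (b \<odot>\<^bsub>tensor R E A\<^esub> x) = (b [^]\<^bsub>A\<^esub> d) \<otimes>\<^bsub>A\<^esub> D A x)) \<and>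
     (\<forall>A B h. algebra R A \<and> algebra R B \<and> h \<in> alg_hom R A B \<longrightarrow>
        (\<forall>x\<in>carrier (tensor R E A). D B (tmap R E B (\<lambda>e. e) h x) = h (D A x)))"

definition law_eq :: "('r, 'x) ring_scheme \<Rightarrow> ('r, 'e) module \<Rightarrow>
    ('r, 'e, 'u) law \<Rightarrow> ('r, 'e, 'u) law \<Rightarrow> bool" where
  "law_eq R E D D' \<longleftrightarrow> (\<forall>A. algebra R A \<longrightarrow> (\<forall>x\<in>carrier (tensor R E A). D A x = D' A x))"

text \<open>
  A copy of \<open>A[t]\<close> with carrier in the universe \<open>'u\<close>, so that a law can be evaluated on it;
  \<open>poly_code A\<close> is the coding of polynomials.
\<close>

definition poly_code :: "('r, 'a) module \<Rightarrow> (nat \<Rightarrow> 'a) \<Rightarrow> 'u" where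
  "poly_code A = (SOME e. inj_on e (carrier (UP A)))"

definition poly_decode :: "('r, 'a) module \<Rightarrow> 'u \<Rightarrow> (nat \<Rightarrow> 'a)" where
  "poly_decode A = inv_into (carrier (UP A)) (poly_code A)"

definition poly_alg :: "('r, 'a) module \<Rightarrow> ('r, 'u) module" where
  "poly_alg A = \<lparr>carrier = poly_code A ` carrier (UP A),
     monoid.mult = (\<lambda>x y. poly_code A (poly_decode A x \<otimes>\<^bsub>UP A\<^esub> poly_decode A y)),
     one = poly_code A \<one>\<^bsub>UP A\<^esub>,
     zero = poly_code A \<zero>\<^bsub>UP A\<^esub>,
     add = (\<lambda>x y. poly_code A (poly_decode A x \<oplus>\<^bsub>UP A\<^esub> poly_decode A y)),
     smult = (\<lambda>r x. poly_code A (str_map A r \<odot>\<^bsub>UP A\<^esub> poly_decode A x))\<rparr>"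

definition poly_const :: "('r, 'a) module \<Rightarrow> 'a \<Rightarrow> 'u" where
  "poly_const A a = poly_code A (up_ring.monom (UP A) a 0)"

definition poly_var :: "('r, 'a) module \<Rightarrow> 'u" where
  "poly_var A = poly_code A (up_ring.monom (UP A) \<one>\<^bsub>A\<^esub> 1)"

text \<open>\<open>\<chi>\<^sub>D(x, t) = D\<^bsub>A[t]\<^esub>(t - x)\<close> for \<open>x \<in> E \<otimes>\<^sub>R A\<close>, as an element of \<open>UP A\<close>.\<close>

definition char_poly :: "('r, 'x) ring_scheme \<Rightarrow> ('r, 'e) module \<Rightarrow> ('r, 'e, 'u) law \<Rightarrow>
    ('r, 'a) module \<Rightarrow> ('e \<times> 'a) list set \<Rightarrow> nat \<Rightarrow> 'a" where
  "char_poly R E D A x = (let B = poly_alg A; T = tensor R E B in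
     poly_decode A (D B (pure R E B \<one>\<^bsub>E\<^esub> (poly_var A) \<ominus>\<^bsub>T\<^esub> tmap R E B (\<lambda>e. e) (poly_const A) x)))"

text \<open>\<open>D\<^bsub>R[t]\<^esub>(1 - x t)\<close> for \<open>x \<in> E\<close>, as an element of \<open>UP R\<close>.\<close>

definition rev_char_poly :: "('r, 'x) ring_scheme \<Rightarrow> ('r, 'e) module \<Rightarrow> ('r, 'e, 'u) law \<Rightarrow>
    'e \<Rightarrow> nat \<Rightarrow> 'r" where
  "rev_char_poly R E D x = (let B = poly_alg (self_alg R); T = tensor R E B in
     poly_decode (self_alg R) (D B (\<one>\<^bsub>T\<^esub> \<ominus>\<^bsub>T\<^esub> pure R E B x (poly_var (self_alg R)))))"

text \<open>
  Base change of \<open>D : E \<rightarrow> R\<close> along \<open>f : R \<rightarrow> R'\<close>, a law \<open>E \<otimes>\<^sub>R R' \<rightarrow> R'\<close>: on an \<open>R'\<close>-algebra \<open>B\<close> it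
  is \<open>D\<^sub>B\<close> composed with \<open>(E \<otimes>\<^sub>R R') \<otimes>\<^sub>R\<^sub>' B \<cong> E \<otimes>\<^sub>R B\<close>.
\<close>

definition bc_alg :: "('r, 'x) ring_scheme \<Rightarrow> ('r, 'e) module \<Rightarrow> ('r \<Rightarrow> 's) \<Rightarrow> ('s, 'y) ring_scheme \<Rightarrow>
    ('s, ('e \<times> 's) list set) module" where
  "bc_alg R E f R' = tensor R E (restr f (self_alg R'))"

definition bc_law :: "('r, 'x) ring_scheme \<Rightarrow> ('r, 'e) module \<Rightarrow> ('r, 'e, 'u) law \<Rightarrow> ('r \<Rightarrow> 's) \<Rightarrow>
    ('s, ('e \<times> 's) list set, 'u) law" where
  "bc_law R E D f B Y = D (restr f B)
     (tensor_lift (tensor R E (restr f B))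
        (\<lambda>X b. b \<odot>\<^bsub>tensor R E (restr f B)\<^esub> tmap R E (restr f B) (\<lambda>e. e) (str_map B) X) Y)"

definition pseudo_morphism :: "('r, 'x) ring_scheme \<Rightarrow> ('r, 'e) module \<Rightarrow> ('r, 'e, 'u) law \<Rightarrow>
    ('s, 'y) ring_scheme \<Rightarrow> ('s, 'f) module \<Rightarrow> ('s, 'f, 'u) law \<Rightarrow>
    ('r \<Rightarrow> 's) \<Rightarrow> (('e \<times> 's) list set \<Rightarrow> 'f) \<Rightarrow> bool" where
  "pseudo_morphism R E D R' E' D' f g \<longleftrightarrow>
     f \<in> ring_hom R R' \<and>
     g \<in> alg_hom R' (bc_alg R E f R') E' \<and>
     law_eq R' (bc_alg R E f R') (bc_law R E D f) (\<lambda>B Y. D' B (tmap R' E' B g (\<lambda>b. b) Y))"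

text \<open>The \<open>R'\<close>-linear extension \<open>E \<otimes>\<^sub>R R' \<rightarrow> E'\<close> of a semilinear map \<open>E \<rightarrow> E'\<close>.\<close>

definition lin_ext :: "('s, 'f) module \<Rightarrow> ('e \<Rightarrow> 'f) \<Rightarrow> ('e \<times> 's) list set \<Rightarrow> 'f" where
  "lin_ext E' g = tensor_lift E' (\<lambda>x r. r \<odot>\<^bsub>E'\<^esub> g x)"

definition cayley_hamilton :: "('r, 'x) ring_scheme \<Rightarrow> ('r, 'e) module \<Rightarrow> nat \<Rightarrow> ('r, 'e, 'u) law \<Rightarrow> bool" where
  "cayley_hamilton R E d D \<longleftrightarrow>
     pseudorep R E d D \<and> fg_algebra R E \<and>
     (\<forall>A :: ('r, 'u) module. algebra R A \<longrightarrow> (\<forall>x\<in>carrier (tensor R E A).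
        finsum (tensor R E A)
          (\<lambda>i. up_ring.coeff (UP A) (char_poly R E D A x) i \<odot>\<^bsub>tensor R E A\<^esub> (x [^]\<^bsub>tensor R E A\<^esub> i))
          {..deg A (char_poly R E D A x)} = \<zero>\<^bsub>tensor R E A\<^esub>))"


section \<open>Complete local rings, p-adic integers, Witt vectors\<close>

definition max_ideal :: "('r, 'x) ring_scheme \<Rightarrow> 'r set" where
  "max_ideal R = (THE m. maximalideal m R)"

text \<open>
  Bijectivity of \<open>R \<rightarrow> lim R/I\<^sup>n\<close>; a sequence of cosets is compatible iff each one contains the next.
\<close>

definition adically_complete :: "('r, 'x) ring_scheme \<Rightarrow> 'r set \<Rightarrow> bool" where
  "adically_complete R I \<longleftrightarrow>
     bij_betw (\<lambda>x n. ideal_pow R I n +>\<^bsub>R\<^esub> x) (carrier R)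
       {s. \<forall>n. s n \<in> a_rcosets\<^bsub>R\<^esub> (ideal_pow R I n) \<and> s (Suc n) \<subseteq> s n}"

definition complete_noetherian_local :: "('r, 'x) ring_scheme \<Rightarrow> bool" where
  "complete_noetherian_local R \<longleftrightarrow>
     cring R \<and> noetherian_ring R \<and> (\<exists>!m. maximalideal m R) \<and> adically_complete R (max_ideal R)"

definition local_hom :: "('r, 'x) ring_scheme \<Rightarrow> ('s, 'y) ring_scheme \<Rightarrow> ('r \<Rightarrow> 's) set" where
  "local_hom R R' = {f \<in> ring_hom R R'. f ` max_ideal R \<subseteq> max_ideal R'}"

definition adic_topology :: "('r, 'x) ring_scheme \<Rightarrow> 'r set \<Rightarrow> ('r, 'm) module \<Rightarrow> 'm topology" where
  "adic_topology R I M = topology (\<lambda>U. U \<subseteq> carrier M \<and>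
     (\<forall>x\<in>U. \<exists>n. ideal_smult R (ideal_pow R I n) M +>\<^bsub>M\<^esub> x \<subseteq> U))"

text \<open>\<open>\<int>\<^sub>p\<close> as the compatible sequences of residues \<open>x n \<in> {0..<p\<^sup>n}\<close>.\<close>

type_synonym padic = "nat \<Rightarrow> int"

definition Zp :: "nat \<Rightarrow> padic ring" where
  "Zp p = \<lparr>carrier = {x. \<forall>n. x n \<in> {0..<int p ^ n} \<and> x (Suc n) mod int p ^ n = x n},
     monoid.mult = (\<lambda>x y n. (x n * y n) mod int p ^ n),
     one = (\<lambda>n. 1 mod int p ^ n),
     zero = (\<lambda>n. 0),
     add = (\<lambda>x y n. (x n + y n) mod int p ^ n)\<rparr>"

text \<open>
  \<open>W(\<F>)\<close> in Serre's characterization, as the strict \<open>p\<close>-ring with residue ring \<open>\<F>\<close>: \<open>p\<close> is not a zero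
  divisor, \<open>W\<close> is \<open>p\<close>-adically complete, and \<open>\<pi>\<close> induces \<open>W/pW \<cong> \<F>\<close>.
\<close>

definition witt_ring :: "nat \<Rightarrow> ('k, 'x) ring_scheme \<Rightarrow> (padic, 'w) module \<Rightarrow> ('w \<Rightarrow> 'k) \<Rightarrow> bool" where
  "witt_ring p F W \<pi> \<longleftrightarrow> algebra (Zp p) W \<and>
     (\<forall>x\<in>carrier W. [p] \<cdot>\<^bsub>W\<^esub> x = \<zero>\<^bsub>W\<^esub> \<longrightarrow> x = \<zero>\<^bsub>W\<^esub>) \<and>
     adically_complete W (PIdl\<^bsub>W\<^esub> ([p] \<cdot>\<^bsub>W\<^esub> \<one>\<^bsub>W\<^esub>)) \<and>
     \<pi> \<in> ring_hom W F \<and> \<pi> ` carrier W = carrier F \<and>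
     a_kernel W F \<pi> = PIdl\<^bsub>W\<^esub> ([p] \<cdot>\<^bsub>W\<^esub> \<one>\<^bsub>W\<^esub>)"


section \<open>Profinite groups\<close>

definition profinite_group :: "('g, 'x) monoid_scheme \<Rightarrow> 'g topology \<Rightarrow> bool" where
  "profinite_group G T \<longleftrightarrow>
     group G \<and> topspace T = carrier G \<and>
     continuous_map (prod_topology T T) T (\<lambda>(x, y). x \<otimes>\<^bsub>G\<^esub> y) \<and>
     continuous_map T T (\<lambda>x. inv\<^bsub>G\<^esub> x) \<and>
     compact_space T \<and> Hausdorff_space T \<and>
     (\<forall>S. connectedin T S \<longrightarrow> (\<exists>x. S \<subseteq> {x}))"

text \<open>The kernel of the map from \<open>H\<close> to its maximal pro-\<open>p\<close> quotient.\<close>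

definition pro_p_kernel :: "nat \<Rightarrow> ('g, 'x) monoid_scheme \<Rightarrow> 'g topology \<Rightarrow> 'g set" where
  "pro_p_kernel p H T = \<Inter>{U. U \<lhd> H \<and> openin T U \<and> (\<exists>k. card (rcosets\<^bsub>H\<^esub> U) = p ^ k)}"

definition coset_topology :: "('g, 'x) monoid_scheme \<Rightarrow> 'g topology \<Rightarrow> 'g set \<Rightarrow> 'g set topology" where
  "coset_topology H T N = topology (\<lambda>V. V \<subseteq> rcosets\<^bsub>H\<^esub> N \<and> openin T (\<Union>V))"

definition top_fin_gen :: "('g, 'x) monoid_scheme \<Rightarrow> 'g topology \<Rightarrow> bool" where
  "top_fin_gen H T \<longleftrightarrow> (\<exists>S. finite S \<and> S \<subseteq> carrier H \<and> T closure_of (generate H S) = carrier H)"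

definition mazur_Phi :: "nat \<Rightarrow> 'g monoid \<Rightarrow> 'g topology \<Rightarrow> bool" where
  "mazur_Phi p G T \<longleftrightarrow> (\<forall>H. subgroup H G \<and> openin T H \<longrightarrow>
     (let H' = G\<lparr>carrier := H\<rparr>; T' = subtopology T H; N = pro_p_kernel p H' T' in
        top_fin_gen (H' Mod N) (coset_topology H' T' N)))"


section \<open>Pseudorepresentations of a group\<close>

text \<open>Elements of \<open>A[G]\<close> are finitely supported functions, vanishing outside \<open>carrier G\<close>.\<close>

definition group_alg :: "('g, 'y) monoid_scheme \<Rightarrow> ('a, 'x) ring_scheme \<Rightarrow> ('a, 'g \<Rightarrow> 'a) module" where
  "group_alg G A = \<lparr>
     carrier = {\<phi>. (\<forall>s. \<phi> s \<in> carrier A) \<and> finite {s. \<phi> s \<noteq> \<zero>\<^bsub>A\<^esub>} \<and> {s. \<phi> s \<noteq> \<zero>\<^bsub>A\<^esub>} \<subseteq> carrier G},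
     monoid.mult = (\<lambda>\<phi> \<psi> s. if s \<in> carrier G
        then finsum A (\<lambda>h. \<phi> h \<otimes>\<^bsub>A\<^esub> \<psi> (inv\<^bsub>G\<^esub> h \<otimes>\<^bsub>G\<^esub> s)) {h. \<phi> h \<noteq> \<zero>\<^bsub>A\<^esub>} else \<zero>\<^bsub>A\<^esub>),
     one = (\<lambda>s. if s = \<one>\<^bsub>G\<^esub> then \<one>\<^bsub>A\<^esub> else \<zero>\<^bsub>A\<^esub>),
     zero = (\<lambda>s. \<zero>\<^bsub>A\<^esub>),
     add = (\<lambda>\<phi> \<psi> s. \<phi> s \<oplus>\<^bsub>A\<^esub> \<psi> s),
     smult = (\<lambda>a \<phi> s. a \<otimes>\<^bsub>A\<^esub> \<phi> s)\<rparr>"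

definition group_elt :: "('a, 'x) ring_scheme \<Rightarrow> 'g \<Rightarrow> ('g \<Rightarrow> 'a)" where
  "group_elt A g = (\<lambda>s. if s = g then \<one>\<^bsub>A\<^esub> else \<zero>\<^bsub>A\<^esub>)"

text \<open>The \<open>A\<close>-linear extension \<open>A[G] \<rightarrow> E\<close> of \<open>\<rho> : G \<rightarrow> E\<^sup>\<times>\<close>.\<close>

definition group_alg_ext :: "('a, 'x) ring_scheme \<Rightarrow> ('a, 'e) module \<Rightarrow> ('g \<Rightarrow> 'e) \<Rightarrow> ('g \<Rightarrow> 'a) \<Rightarrow> 'e" where
  "group_alg_ext A E \<rho> \<phi> = finsum E (\<lambda>s. \<phi> s \<odot>\<^bsub>E\<^esub> \<rho> s) {s. \<phi> s \<noteq> \<zero>\<^bsub>A\<^esub>}"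

text \<open>
  Continuity of \<open>D : A[G] \<rightarrow> A\<close> means continuity, for the maximal-adic topology of the local ring
  \<open>A\<close>, of the coefficients of \<open>g \<mapsto> \<chi>\<^sub>D(g, t) \<in> A[t]\<close>.
\<close>

definition group_pseudorep :: "'g monoid \<Rightarrow> 'g topology \<Rightarrow> ('a, 'x) ring_scheme \<Rightarrow> nat \<Rightarrow>
    ('a, 'g \<Rightarrow> 'a, 'u) law \<Rightarrow> bool" where
  "group_pseudorep G T A d D \<longleftrightarrow>
     pseudorep A (group_alg G A) d D \<and>
     (\<forall>i. continuous_map T (adic_topology A (max_ideal A) (self_alg A))
        (\<lambda>g. up_ring.coeff (UP (self_alg A)) (char_poly A (group_alg G A) D (self_alg A)
           (pure A (group_alg G A) (self_alg A) (group_elt A g) \<one>\<^bsub>A\<^esub>)) i))"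

text \<open>\<open>D'\<close> (on \<open>A'[G]\<close>) is the base change of \<open>D\<close> (on \<open>A[G]\<close>) along \<open>f\<close>, through \<open>A[G] \<otimes>\<^sub>A A' \<cong> A'[G]\<close>.\<close>

definition group_base_change :: "'g monoid \<Rightarrow> ('a, 'x) ring_scheme \<Rightarrow> ('a, 'g \<Rightarrow> 'a, 'u) law \<Rightarrow>
    ('b, 'y) ring_scheme \<Rightarrow> ('b, 'g \<Rightarrow> 'b, 'u) law \<Rightarrow> ('a \<Rightarrow> 'b) \<Rightarrow> bool" where
  "group_base_change G A D A' D' f \<longleftrightarrow>
     pseudo_morphism A (group_alg G A) D A' (group_alg G A') D' f
       (lin_ext (group_alg G A') (\<lambda>\<phi>. f \<circ> \<phi>))"

definition induced_law :: "('a, 'x) ring_scheme \<Rightarrow> ('a, 'e) module \<Rightarrow> ('g \<Rightarrow> 'e) \<Rightarrow>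
    ('a, 'e, 'u) law \<Rightarrow> ('a, 'g \<Rightarrow> 'a, 'u) law" where
  "induced_law A E \<rho> D B y = D B (tmap A E B (group_alg_ext A E \<rho>) (\<lambda>b. b) y)"

text \<open>
  Objects of the category of complete Noetherian local \<open>W\<close>-algebras with residue field \<open>\<F>\<close>; \<open>r\<close> is
  the reduction map, compatible with \<open>\<pi> : W \<rightarrow> \<F>\<close> (it is determined by \<open>A\<close>).
\<close>

definition coeff_ring :: "('k, 'x) ring_scheme \<Rightarrow> (padic, 'w) module \<Rightarrow> ('w \<Rightarrow> 'k) \<Rightarrow>
    ('w, 'a) module \<Rightarrow> ('a \<Rightarrow> 'k) \<Rightarrow> bool" where
  "coeff_ring F W \<pi> A r \<longleftrightarrow> algebra W A \<and> complete_noetherian_local A \<and>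
     r \<in> ring_hom A F \<and> r ` carrier A = carrier F \<and> a_kernel A F r = max_ideal A \<and>
     (\<forall>w\<in>carrier W. r (str_map A w) = \<pi> w)"

definition deformation :: "'g monoid \<Rightarrow> 'g topology \<Rightarrow> nat \<Rightarrow> 'k ring \<Rightarrow> ('k, 'g \<Rightarrow> 'k, 'u) law \<Rightarrow>
    ('w, 'a) module \<Rightarrow> ('a \<Rightarrow> 'k) \<Rightarrow> ('a, 'g \<Rightarrow> 'a, 'u) law \<Rightarrow> bool" where
  "deformation G T d F Dbar A r D \<longleftrightarrow>
     group_pseudorep G T A d D \<and> group_base_change G A D F Dbar r"

definition universal_deformation :: "'g monoid \<Rightarrow> 'g topology \<Rightarrow> nat \<Rightarrow> 'u ring \<Rightarrow>
    ('u, 'g \<Rightarrow> 'u, 'u) law \<Rightarrow> (padic, 'u) module \<Rightarrow> ('u \<Rightarrow> 'u) \<Rightarrow>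
    ('u, 'u) module \<Rightarrow> ('u \<Rightarrow> 'u) \<Rightarrow> ('u, 'g \<Rightarrow> 'u, 'u) law \<Rightarrow> bool" where
  "universal_deformation G T d F Dbar W \<pi> R r Du \<longleftrightarrow>
     coeff_ring F W \<pi> R r \<and> deformation G T d F Dbar R r Du \<and>
     (\<forall>(A :: ('u, 'u) module) r' D. coeff_ring F W \<pi> A r' \<and> deformation G T d F Dbar A r' D \<longrightarrow>
        (\<exists>!f. f \<in> extensional (carrier R) \<and> f \<in> alg_hom W R A \<and> f \<in> local_hom R A \<and>
           group_base_change G R Du A D f))"


section \<open>Cayley--Hamilton representations\<close>

text \<open>
  \<open>(A, E, \<rho>, D)\<close> with \<open>\<rho>\<close> continuous for the \<open>m\<^sub>A\<close>-adic topology on \<open>E\<close>.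
\<close>

definition CH_rep :: "'g monoid \<Rightarrow> 'g topology \<Rightarrow> nat \<Rightarrow> ('a, 'x) ring_scheme \<Rightarrow> ('a, 'e) module \<Rightarrow>
    ('g \<Rightarrow> 'e) \<Rightarrow> ('a, 'e, 'u) law \<Rightarrow> bool" where
  "CH_rep G T d A E \<rho> D \<longleftrightarrow>
     cayley_hamilton A E d D \<and> \<rho> \<in> hom G (units_of E) \<and>
     continuous_map T (adic_topology A (max_ideal A) E) \<rho>"

text \<open>A law \<open>D\<close> on \<open>A[G]\<close> has the residual pseudorepresentation whose universal deformation is \<open>(R, Du)\<close>.\<close>

definition has_residual :: "'g monoid \<Rightarrow> ('r, 'x) ring_scheme \<Rightarrow> ('r, 'g \<Rightarrow> 'r, 'u) law \<Rightarrow>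
    ('a, 'y) ring_scheme \<Rightarrow> ('a, 'g \<Rightarrow> 'a, 'u) law \<Rightarrow> bool" where
  "has_residual G R Du A D \<longleftrightarrow> (\<exists>f\<in>local_hom R A. group_base_change G R Du A D f)"

definition CH_object :: "nat \<Rightarrow> 'g monoid \<Rightarrow> 'g topology \<Rightarrow> nat \<Rightarrow>
    (padic, 'r) module \<Rightarrow> ('r, 'g \<Rightarrow> 'r, 'u) law \<Rightarrow>
    (padic, 'a) module \<Rightarrow> ('a, 'e) module \<Rightarrow> ('g \<Rightarrow> 'e) \<Rightarrow> ('a, 'e, 'u) law \<Rightarrow> bool" where
  "CH_object p G T d R Du A E \<rho> D \<longleftrightarrow>
     algebra (Zp p) A \<and> complete_noetherian_local A \<and>
     CH_rep G T d A E \<rho> D \<and> has_residual G R Du A (induced_law A E \<rho> D)"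

text \<open>Extensionality makes equality of functions mean equality on the carriers.\<close>

definition CH_hom :: "'g monoid \<Rightarrow>
    ('r, 'x) ring_scheme \<Rightarrow> ('r, 'e) module \<Rightarrow> ('g \<Rightarrow> 'e) \<Rightarrow> ('r, 'e, 'u) law \<Rightarrow>
    ('s, 'y) ring_scheme \<Rightarrow> ('s, 'f) module \<Rightarrow> ('g \<Rightarrow> 'f) \<Rightarrow> ('s, 'f, 'u) law \<Rightarrow>
    (('r \<Rightarrow> 's) \<times> (('e \<times> 's) list set \<Rightarrow> 'f)) set" where
  "CH_hom G A E \<rho> D A' E' \<rho>' D' = {(f, g).
     f \<in> extensional (carrier A) \<and> g \<in> extensional (carrier (bc_alg A E f A')) \<and>
     pseudo_morphism A E D A' E' D' f g \<and>
     (\<forall>s\<in>carrier G. g (pure A E (restr f (self_alg A')) (\<rho> s) \<one>\<^bsub>A'\<^esub>) = \<rho>' s)}"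

definition universal_CH :: "nat \<Rightarrow> 'g monoid \<Rightarrow> 'g topology \<Rightarrow> nat \<Rightarrow>
    (padic, 'u) module \<Rightarrow> ('u, 'g \<Rightarrow> 'u, 'u) law \<Rightarrow>
    ('u, 'u) module \<Rightarrow> ('g \<Rightarrow> 'u) \<Rightarrow> ('u, 'u, 'u) law \<Rightarrow> bool" where
  "universal_CH p G T d R Du E \<rho> D \<longleftrightarrow>
     CH_object p G T d R Du R E \<rho> D \<and>
     (\<forall>(A :: (padic, 'u) module) (E' :: ('u, 'u) module) \<rho>' D'.
        CH_object p G T d R Du A E' \<rho>' D' \<longrightarrow> (\<exists>!h. h \<in> CH_hom G R E \<rho> D A E' \<rho>' D'))"


section \<open>Stable conditions\<close>

text \<open>A \<open>\<int>\<^sub>p[G]\<close>-module is a \<open>\<int>\<^sub>p\<close>-module \<open>M\<close> together with a \<open>\<int>\<^sub>p\<close>-linear action \<open>\<alpha>\<close> of \<open>G\<close>.\<close>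

definition fin_gmodule :: "nat \<Rightarrow> 'g monoid \<Rightarrow> 'g topology \<Rightarrow> (padic, 'm) module \<Rightarrow>
    ('g \<Rightarrow> 'm \<Rightarrow> 'm) \<Rightarrow> bool" where
  "fin_gmodule p G T M \<alpha> \<longleftrightarrow>
     Module.module (Zp p) M \<and> finite (carrier M) \<and>
     (\<forall>s\<in>carrier G. \<alpha> s \<in> carrier M \<rightarrow> carrier M) \<and>
     (\<forall>x\<in>carrier M. \<alpha> \<one>\<^bsub>G\<^esub> x = x) \<and>
     (\<forall>s\<in>carrier G. \<forall>t\<in>carrier G. \<forall>x\<in>carrier M. \<alpha> (s \<otimes>\<^bsub>G\<^esub> t) x = \<alpha> s (\<alpha> t x)) \<and>
     (\<forall>s\<in>carrier G. \<forall>x\<in>carrier M. \<forall>y\<in>carrier M. \<alpha> s (x \<oplus>\<^bsub>M\<^esub> y) = \<alpha> s x \<oplus>\<^bsub>M\<^esub> \<alpha> s y) \<and>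
     (\<forall>s\<in>carrier G. \<forall>z\<in>carrier (Zp p). \<forall>x\<in>carrier M. \<alpha> s (z \<odot>\<^bsub>M\<^esub> x) = z \<odot>\<^bsub>M\<^esub> \<alpha> s x) \<and>
     continuous_map (prod_topology T (discrete_topology (carrier M)))
       (discrete_topology (carrier M)) (\<lambda>(s, x). \<alpha> s x)"

definition gmodule_hom :: "nat \<Rightarrow> 'g monoid \<Rightarrow> (padic, 'm) module \<Rightarrow> ('g \<Rightarrow> 'm \<Rightarrow> 'm) \<Rightarrow>
    (padic, 'n) module \<Rightarrow> ('g \<Rightarrow> 'n \<Rightarrow> 'n) \<Rightarrow> ('m \<Rightarrow> 'n) set" where
  "gmodule_hom p G M \<alpha> N \<beta> = {\<phi> \<in> carrier M \<rightarrow> carrier N.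
     (\<forall>x\<in>carrier M. \<forall>y\<in>carrier M. \<phi> (x \<oplus>\<^bsub>M\<^esub> y) = \<phi> x \<oplus>\<^bsub>N\<^esub> \<phi> y) \<and>
     (\<forall>z\<in>carrier (Zp p). \<forall>x\<in>carrier M. \<phi> (z \<odot>\<^bsub>M\<^esub> x) = z \<odot>\<^bsub>N\<^esub> \<phi> x) \<and>
     (\<forall>s\<in>carrier G. \<forall>x\<in>carrier M. \<phi> (\<alpha> s x) = \<beta> s (\<phi> x))}"

definition quot_act :: "('r, 'm) module \<Rightarrow> 'm set \<Rightarrow> ('g \<Rightarrow> 'm \<Rightarrow> 'm) \<Rightarrow> 'g \<Rightarrow> 'm set \<Rightarrow> 'm set" where
  "quot_act M N \<alpha> s X = (\<Union>x\<in>X. N +>\<^bsub>M\<^esub> \<alpha> s x)"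

text \<open>The direct sum of two modules; the ring-theoretic fields are irrelevant.\<close>

definition dsum :: "('r, 'm) module \<Rightarrow> ('r, 'n) module \<Rightarrow> ('r, 'm \<times> 'n) module" where
  "dsum M N = \<lparr>carrier = carrier M \<times> carrier N,
     monoid.mult = (\<lambda>(x, y) (x', y'). (x \<otimes>\<^bsub>M\<^esub> x', y \<otimes>\<^bsub>N\<^esub> y')),
     one = (\<one>\<^bsub>M\<^esub>, \<one>\<^bsub>N\<^esub>), zero = (\<zero>\<^bsub>M\<^esub>, \<zero>\<^bsub>N\<^esub>),
     add = (\<lambda>(x, y) (x', y'). (x \<oplus>\<^bsub>M\<^esub> x', y \<oplus>\<^bsub>N\<^esub> y')),
     smult = (\<lambda>r (x, y). (r \<odot>\<^bsub>M\<^esub> x, r \<odot>\<^bsub>N\<^esub> y))\<rparr>"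

text \<open>
  Every finite module is isomorphic to one with carrier in \<open>nat\<close>, so an isomorphism-closed full
  subcategory of finite modules is given by its members \<open>C\<close> with carrier in \<open>nat\<close>; a finite module
  of any type belongs to it iff it is isomorphic to a member of \<open>C\<close>.
\<close>

type_synonym 'g condition = "((padic, nat) module \<times> ('g \<Rightarrow> nat \<Rightarrow> nat)) set"

definition in_condition :: "nat \<Rightarrow> 'g monoid \<Rightarrow> 'g topology \<Rightarrow> 'g condition \<Rightarrow>
    (padic, 'm) module \<Rightarrow> ('g \<Rightarrow> 'm \<Rightarrow> 'm) \<Rightarrow> bool" where
  "in_condition p G T C M \<alpha> \<longleftrightarrow> fin_gmodule p G T M \<alpha> \<and>
     (\<exists>(N, \<beta>)\<in>C. \<exists>\<phi>\<in>gmodule_hom p G M \<alpha> N \<beta>. bij_betw \<phi> (carrier M) (carrier N))"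

definition stable_condition :: "nat \<Rightarrow> 'g monoid \<Rightarrow> 'g topology \<Rightarrow> 'g condition \<Rightarrow> bool" where
  "stable_condition p G T C \<longleftrightarrow>
     (\<forall>(M, \<alpha>)\<in>C. fin_gmodule p G T M \<alpha>) \<and>
     (\<forall>M \<alpha>. in_condition p G T C M \<alpha> \<longrightarrow> (M, \<alpha>) \<in> C) \<and>
     (\<forall>(M, \<alpha>)\<in>C. \<forall>H. submodule H (Zp p) M \<and> (\<forall>s\<in>carrier G. \<alpha> s \<in> H \<rightarrow> H) \<longrightarrow>
        in_condition p G T C (M\<lparr>carrier := H\<rparr>) \<alpha> \<and>
        in_condition p G T C (quot_module M H) (quot_act M H \<alpha>)) \<and>
     (\<forall>M \<alpha>. fin_gmodule p G T M \<alpha> \<and> carrier M = {\<zero>\<^bsub>M\<^esub>} \<longrightarrow> (M, \<alpha>) \<in> C) \<and>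
     (\<forall>(M, \<alpha>)\<in>C. \<forall>(N, \<beta>)\<in>C. in_condition p G T C (dsum M N) (\<lambda>s (x, y). (\<alpha> s x, \<beta> s y)))"

text \<open>
  For an \<open>A[G]\<close>-module \<open>(M, \<alpha>)\<close> over a local \<open>\<int>\<^sub>p\<close>-algebra \<open>A\<close>: \<open>M/m\<^sub>A\<^sup>iM\<close> as a \<open>\<int>\<^sub>p[G]\<close>-module.
\<close>

definition red_mod :: "(padic, 'a) module \<Rightarrow> ('a, 'm) module \<Rightarrow> nat \<Rightarrow> (padic, 'm set) module" where
  "red_mod A M i =
     restr (str_map A) (quot_module M (ideal_smult A (ideal_pow A (max_ideal A) i) M))"

definition red_act :: "(padic, 'a) module \<Rightarrow> ('a, 'm) module \<Rightarrow> ('g \<Rightarrow> 'm \<Rightarrow> 'm) \<Rightarrow> nat \<Rightarrow>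
    'g \<Rightarrow> 'm set \<Rightarrow> 'm set" where
  "red_act A M \<alpha> i = quot_act M (ideal_smult A (ideal_pow A (max_ideal A) i) M) \<alpha>"

definition satisfies :: "nat \<Rightarrow> 'g monoid \<Rightarrow> 'g topology \<Rightarrow> 'g condition \<Rightarrow>
    (padic, 'a) module \<Rightarrow> ('a, 'm) module \<Rightarrow> ('g \<Rightarrow> 'm \<Rightarrow> 'm) \<Rightarrow> bool" where
  "satisfies p G T C A M \<alpha> \<longleftrightarrow> fg_module A M \<and>
     (\<forall>i\<ge>1. in_condition p G T C (red_mod A M i) (red_act A M \<alpha> i))"

definition left_act :: "('a, 'e) module \<Rightarrow> ('g \<Rightarrow> 'e) \<Rightarrow> 'g \<Rightarrow> 'e \<Rightarrow> 'e" where
  "left_act E \<rho> s x = \<rho> s \<otimes>\<^bsub>E\<^esub> x"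

definition CH_object_C :: "nat \<Rightarrow> 'g monoid \<Rightarrow> 'g topology \<Rightarrow> nat \<Rightarrow>
    (padic, 'r) module \<Rightarrow> ('r, 'g \<Rightarrow> 'r, 'u) law \<Rightarrow> 'g condition \<Rightarrow>
    (padic, 'a) module \<Rightarrow> ('a, 'e) module \<Rightarrow> ('g \<Rightarrow> 'e) \<Rightarrow> ('a, 'e, 'u) law \<Rightarrow> bool" where
  "CH_object_C p G T d R Du C A E \<rho> D \<longleftrightarrow>
     CH_object p G T d R Du A E \<rho> D \<and> satisfies p G T C A E (left_act E \<rho>)"


section \<open>The construction\<close>

text \<open>The intersection of the kernels of all surjections from \<open>(M, \<alpha>)\<close> onto members of \<open>C\<close>.\<close>

definition C_kernel :: "nat \<Rightarrow> 'g monoid \<Rightarrow> 'g condition \<Rightarrow> (padic, 'm) module \<Rightarrow>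
    ('g \<Rightarrow> 'm \<Rightarrow> 'm) \<Rightarrow> 'm set" where
  "C_kernel p G C M \<alpha> = {x \<in> carrier M. \<forall>(N, \<beta>)\<in>C. \<forall>\<phi>\<in>gmodule_hom p G M \<alpha> N \<beta>.
     \<phi> ` carrier M = carrier N \<longrightarrow> \<phi> x = \<zero>\<^bsub>N\<^esub>}"

definition EC_level :: "nat \<Rightarrow> 'g monoid \<Rightarrow> 'g condition \<Rightarrow> (padic, 'r) module \<Rightarrow> ('r, 'e) module \<Rightarrow>
    ('g \<Rightarrow> 'e) \<Rightarrow> nat \<Rightarrow> (padic, 'e set set) module" where
  "EC_level p G C R E \<rho> i = quot_module (red_mod R E i)
     (C_kernel p G C (red_mod R E i) (red_act R E (left_act E \<rho>) i))"

definition to_EC_level :: "nat \<Rightarrow> 'g monoid \<Rightarrow> 'g condition \<Rightarrow> (padic, 'r) module \<Rightarrow> ('r, 'e) module \<Rightarrow>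
    ('g \<Rightarrow> 'e) \<Rightarrow> nat \<Rightarrow> 'e \<Rightarrow> 'e set set" where
  "to_EC_level p G C R E \<rho> i x =
     C_kernel p G C (red_mod R E i) (red_act R E (left_act E \<rho>) i) +>\<^bsub>red_mod R E i\<^esub>
       (ideal_smult R (ideal_pow R (max_ideal R) i) E +>\<^bsub>E\<^esub> x)"

text \<open>The kernel of \<open>E \<rightarrow> lim\<^sub>i E\<^sup>C(i)\<close>: the elements whose component at every \<open>i\<close> vanishes.\<close>

definition KC :: "nat \<Rightarrow> 'g monoid \<Rightarrow> 'g condition \<Rightarrow> (padic, 'r) module \<Rightarrow> ('r, 'e) module \<Rightarrow>
    ('g \<Rightarrow> 'e) \<Rightarrow> 'e set" where
  "KC p G C R E \<rho> = {x \<in> carrier E. \<forall>i\<ge>1.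
     to_EC_level p G C R E \<rho> i x = \<zero>\<^bsub>EC_level p G C R E \<rho> i\<^esub>}"

definition aC :: "nat \<Rightarrow> 'g monoid \<Rightarrow> 'g condition \<Rightarrow> (padic, 'r) module \<Rightarrow> ('r, 'e) module \<Rightarrow>
    ('g \<Rightarrow> 'e) \<Rightarrow> ('r, 'e, 'u) law \<Rightarrow> 'r set" where
  "aC p G C R E \<rho> D = genideal R
     {up_ring.coeff (UP (self_alg R)) (rev_char_poly R E D x) i | x i. x \<in> KC p G C R E \<rho> \<and> i \<ge> 1}"

definition JC :: "nat \<Rightarrow> 'g monoid \<Rightarrow> 'g condition \<Rightarrow> (padic, 'r) module \<Rightarrow> ('r, 'e) module \<Rightarrow>
    ('g \<Rightarrow> 'e) \<Rightarrow> ('r, 'e, 'u) law \<Rightarrow> 'e set" where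
  "JC p G C R E \<rho> D = KC p G C R E \<rho> <+>\<^bsub>E\<^esub> ideal_smult R (aC p G C R E \<rho> D) E"

definition RC :: "nat \<Rightarrow> 'g monoid \<Rightarrow> 'g condition \<Rightarrow> (padic, 'r) module \<Rightarrow> ('r, 'e) module \<Rightarrow>
    ('g \<Rightarrow> 'e) \<Rightarrow> ('r, 'e, 'u) law \<Rightarrow> (padic, 'r set) module" where
  "RC p G C R E \<rho> D = quot_module R (aC p G C R E \<rho> D)"

definition EC :: "nat \<Rightarrow> 'g monoid \<Rightarrow> 'g condition \<Rightarrow> (padic, 'r) module \<Rightarrow> ('r, 'e) module \<Rightarrow>
    ('g \<Rightarrow> 'e) \<Rightarrow> ('r, 'e, 'u) law \<Rightarrow> ('r set, 'e set) module" where
  "EC p G C R E \<rho> D = quot_alg E (JC p G C R E \<rho> D)"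

definition rhoC :: "nat \<Rightarrow> 'g monoid \<Rightarrow> 'g condition \<Rightarrow> (padic, 'r) module \<Rightarrow> ('r, 'e) module \<Rightarrow>
    ('g \<Rightarrow> 'e) \<Rightarrow> ('r, 'e, 'u) law \<Rightarrow> 'g \<Rightarrow> 'e set" where
  "rhoC p G C R E \<rho> D s = JC p G C R E \<rho> D +>\<^bsub>E\<^esub> \<rho> s"

definition is_DC :: "nat \<Rightarrow> 'g monoid \<Rightarrow> nat \<Rightarrow> 'g condition \<Rightarrow> (padic, 'r) module \<Rightarrow> ('r, 'e) module \<Rightarrow>
    ('g \<Rightarrow> 'e) \<Rightarrow> ('r, 'e, 'u) law \<Rightarrow> ('r set, 'e set, 'u) law \<Rightarrow> bool" where
  "is_DC p G d C R E \<rho> D DC \<longleftrightarrow>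
     pseudorep (RC p G C R E \<rho> D) (EC p G C R E \<rho> D) d DC \<and>
     pseudo_morphism R E D (RC p G C R E \<rho> D) (EC p G C R E \<rho> D) DC
       (\<lambda>r. aC p G C R E \<rho> D +>\<^bsub>R\<^esub> r)
       (lin_ext (EC p G C R E \<rho> D) (\<lambda>x. JC p G C R E \<rho> D +>\<^bsub>E\<^esub> x))"

end

theory Submission
  imports Defs
begin

text \<open>
  A morphism of Cayley--Hamilton representations \<open>(E, D) \<rightarrow> (E', D')\<close> over \<open>f : R \<rightarrow> R'\<close> is the same as an
  \<open>f\<close>-semilinear ring homomorphism \<open>E \<rightarrow> E'\<close> compatible with the laws and with \<open>\<rho>\<close>. The
  initial morphism from \<open>E\<close> therefore has to be factored through the quotient maps, and uniqueness is clear as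
  these are surjective.

  Let \<open>K\<^sub>i\<close> be the smallest \<open>G\<close>-stable additive subgroup of \<open>E\<close> that contains \<open>m\<^sup>iE\<close> and has quotient in
  \<open>C\<close>. Since \<open>K\<^sub>i = K\<^sub>j + m\<^sup>iE\<close> for \<open>j \<ge> i\<close>, completeness gives \<open>K + m\<^sup>iE = K\<^sub>i\<close> for the intersection \<open>K\<close> of
  all \<open>K\<^sub>i\<close>, so the quotient algebra satisfies \<open>C\<close>. Conversely, if \<open>E'\<close> satisfies \<open>C\<close>, each \<open>E'/m'\<^sup>iE'\<close> is finite,
  hence killed by a power of \<open>m\<close>, and \<open>K\<close> dies in it; Krull's intersection theorem shows that \<open>K\<close> maps
  to \<open>0\<close> in \<open>E'\<close>. For \<open>x \<in> K\<close> the element \<open>1 - x t\<close> then maps to \<open>1\<close>, so the non-constant coefficients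
  of its law, which generate the ideal of \<open>R\<close> divided out, map to \<open>0\<close> as well.
\<close>

section \<open>Additive and semilinear maps\<close>

text \<open>The ring map of a morphism is not assumed local, so nothing says in advance that m^j E
  lands in m'^i E'. Finiteness replaces locality: on a finite quotient of E' two powers a^k and a^l
  of an element a of m act alike, and the unit 1 - a^(l-k) then forces a^k to act as 0.

  Closure of C under finite sums controls finite intersections of kernels, whereas K is an infinite
  one. As the residue field is finite, every E/m^i E is finite and each K_i is a finite
  intersection; only the passage from the K_i to K needs a limit.

  A law is a function of the whole test algebra, including its scalar multiplication off the
  carrier. Ring maps that agree on the carrier thus give different test algebras, and naturality
  along the identity has to mediate between them. A law also sees only test algebras in one type, so
  a usable copy of A[t] there depends on an injective coding of finitely supported sequences.

  If the coefficients generate the unit ideal, the quotient ring is zero and hence not local. No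
  object satisfies C then, because its ring map would send 1 to 0.\<close>

definition addhom :: "('a, 'x) ring_scheme \<Rightarrow> ('b, 'y) ring_scheme \<Rightarrow> ('a \<Rightarrow> 'b) \<Rightarrow> bool" where
  "addhom M N h \<longleftrightarrow> h \<in> carrier M \<rightarrow> carrier N \<and>
     (\<forall>x\<in>carrier M. \<forall>y\<in>carrier M. h (x \<oplus>\<^bsub>M\<^esub> y) = h x \<oplus>\<^bsub>N\<^esub> h y)"

lemma addhomI:
  "\<lbrakk>\<And>x. x \<in> carrier M \<Longrightarrow> h x \<in> carrier N;
    \<And>x y. \<lbrakk>x \<in> carrier M; y \<in> carrier M\<rbrakk> \<Longrightarrow> h (x \<oplus>\<^bsub>M\<^esub> y) = h x \<oplus>\<^bsub>N\<^esub> h y\<rbrakk> \<Longrightarrow> addhom M N h"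
  by (auto simp: addhom_def)

lemma addhom_closed: "addhom M N h \<Longrightarrow> x \<in> carrier M \<Longrightarrow> h x \<in> carrier N"
  by (auto simp: addhom_def)

lemma addhom_add: "\<lbrakk>addhom M N h; x \<in> carrier M; y \<in> carrier M\<rbrakk> \<Longrightarrow> h (x \<oplus>\<^bsub>M\<^esub> y) = h x \<oplus>\<^bsub>N\<^esub> h y"
  by (auto simp: addhom_def)

lemma addhom_comp: "addhom M N h \<Longrightarrow> addhom N P k \<Longrightarrow> addhom M P (\<lambda>x. k (h x))"
  by (auto simp: addhom_def Pi_iff)

lemma addhom_zero:
  assumes "addhom M N h" "abelian_group M" "abelian_group N"
  shows "h \<zero>\<^bsub>M\<^esub> = \<zero>\<^bsub>N\<^esub>"
proof -
  interpret M: abelian_group M by fact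
  interpret N: abelian_group N by fact
  have "h \<zero>\<^bsub>M\<^esub> \<oplus>\<^bsub>N\<^esub> h \<zero>\<^bsub>M\<^esub> = h \<zero>\<^bsub>M\<^esub> \<oplus>\<^bsub>N\<^esub> \<zero>\<^bsub>N\<^esub>"
    using addhom_add[OF assms(1), of "\<zero>\<^bsub>M\<^esub>" "\<zero>\<^bsub>M\<^esub>"] addhom_closed[OF assms(1), of "\<zero>\<^bsub>M\<^esub>"] by simp
  then show ?thesis using addhom_closed[OF assms(1), of "\<zero>\<^bsub>M\<^esub>"] by (metis M.zero_closed N.add.l_cancel N.zero_closed)
qed

lemma addhom_a_inv:
  assumes "addhom M N h" "abelian_group M" "abelian_group N" "x \<in> carrier M"
  shows "h (\<ominus>\<^bsub>M\<^esub> x) = \<ominus>\<^bsub>N\<^esub> h x"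
proof -
  interpret M: abelian_group M by fact
  interpret N: abelian_group N by fact
  have "h (\<ominus>\<^bsub>M\<^esub> x) \<oplus>\<^bsub>N\<^esub> h x = \<zero>\<^bsub>N\<^esub>"
    using addhom_add[OF assms(1), of "\<ominus>\<^bsub>M\<^esub> x" x] addhom_zero[OF assms(1-3)] assms(4) by (simp add: M.l_neg)
  then show ?thesis using assms addhom_closed[OF assms(1)] by (simp add: N.minus_equality)
qed

lemma addhom_minus:
  assumes "addhom M N h" "abelian_group M" "abelian_group N" "x \<in> carrier M" "y \<in> carrier M"
  shows "h (x \<ominus>\<^bsub>M\<^esub> y) = h x \<ominus>\<^bsub>N\<^esub> h y"
proof -
  interpret M: abelian_group M by fact
  show ?thesis using assms by (simp add: a_minus_def addhom_add addhom_a_inv)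
qed

lemma addhom_finsum:
  assumes "addhom M N h" "abelian_group M" "abelian_group N" "f \<in> S \<rightarrow> carrier M"
  shows "h (finsum M f S) = finsum N (\<lambda>s. h (f s)) S"
proof -
  interpret M: abelian_group M by fact
  interpret N: abelian_group N by fact
  show ?thesis using assms(4)
  proof (induct S rule: infinite_finite_induct)
    case (infinite S)
    then show ?case using addhom_zero[OF assms(1-3)] by simp
  next
    case empty
    then show ?case using addhom_zero[OF assms(1-3)] by simp
  next
    case (insert s S)
    have 1: "f \<in> S \<rightarrow> carrier M" "f s \<in> carrier M" using insert by auto
    have 2: "(\<lambda>s. h (f s)) \<in> S \<rightarrow> carrier N" "h (f s) \<in> carrier N"
      using 1 addhom_closed[OF assms(1)] by auto
    show ?case using insert 1 2 by (simp add: addhom_add[OF assms(1)])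
  qed
qed

text \<open>The ring map is a parameter and the scalars of N are reached only through it. With the
  identity for \<open>f\<close> this is linearity; with a quotient map or a change of base it is the
  component \<open>E -> E'\<close> of a morphism.\<close>

definition slin :: "('r, 'x) ring_scheme \<Rightarrow> ('r \<Rightarrow> 's) \<Rightarrow> ('r, 'a) module \<Rightarrow> ('s, 'b) module \<Rightarrow> ('a \<Rightarrow> 'b) \<Rightarrow> bool" where
  "slin R f M N h \<longleftrightarrow> addhom M N h \<and> (\<forall>r\<in>carrier R. \<forall>x\<in>carrier M. h (r \<odot>\<^bsub>M\<^esub> x) = f r \<odot>\<^bsub>N\<^esub> h x)"

lemma slin_addhom: "slin R f M N h \<Longrightarrow> addhom M N h" by (simp add: slin_def)

lemma slin_smult: "\<lbrakk>slin R f M N h; r \<in> carrier R; x \<in> carrier M\<rbrakk> \<Longrightarrow> h (r \<odot>\<^bsub>M\<^esub> x) = f r \<odot>\<^bsub>N\<^esub> h x"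
  by (simp add: slin_def)

lemma slinI: "\<lbrakk>addhom M N h; \<And>r x. \<lbrakk>r \<in> carrier R; x \<in> carrier M\<rbrakk> \<Longrightarrow> h (r \<odot>\<^bsub>M\<^esub> x) = f r \<odot>\<^bsub>N\<^esub> h x\<rbrakk> \<Longrightarrow> slin R f M N h"
  by (simp add: slin_def)

lemma ring_hom_addhom: "h \<in> ring_hom A B \<Longrightarrow> addhom A B h"
  by (auto simp: addhom_def ring_hom_def)

lemma assoc_algebraD:
  assumes "assoc_algebra R E" shows "Module.module R E" "ring E" "abelian_group E" "cring R"
  using assms by (auto simp: assoc_algebra_def Module.module_def ring_def)

section \<open>Tensor products\<close>

locale tensor_alg =
  fixes R :: "('r,'x) ring_scheme" and E :: "('r,'e) module" and A :: "('r,'a) module"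
  assumes assE: "assoc_algebra R E" and algA: "algebra R A"
begin

sublocale E: ring E using assE by (simp add: assoc_algebra_def)
sublocale EM: Module.module R E using assE by (simp add: assoc_algebra_def)
sublocale A: cring A using algA by (simp add: algebra_def)
sublocale AM: algebra R A by (rule algA)

lemma smult_mult_l: "\<lbrakk>r \<in> carrier R; x \<in> carrier E; y \<in> carrier E\<rbrakk> \<Longrightarrow> (r \<odot>\<^bsub>E\<^esub> x) \<otimes>\<^bsub>E\<^esub> y = r \<odot>\<^bsub>E\<^esub> (x \<otimes>\<^bsub>E\<^esub> y)"
  and smult_mult_r: "\<lbrakk>r \<in> carrier R; x \<in> carrier E; y \<in> carrier E\<rbrakk> \<Longrightarrow> x \<otimes>\<^bsub>E\<^esub> (r \<odot>\<^bsub>E\<^esub> y) = r \<odot>\<^bsub>E\<^esub> (x \<otimes>\<^bsub>E\<^esub> y)"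
  using assE by (auto simp: assoc_algebra_def)

lemma A_smult_mult_r: "\<lbrakk>r \<in> carrier R; x \<in> carrier A; y \<in> carrier A\<rbrakk> \<Longrightarrow> x \<otimes>\<^bsub>A\<^esub> (r \<odot>\<^bsub>A\<^esub> y) = r \<odot>\<^bsub>A\<^esub> (x \<otimes>\<^bsub>A\<^esub> y)"
  by (metis A.m_comm AM.smult_assoc2 AM.smult_closed)

abbreviation "T \<equiv> tensor R E A"
abbreviation "tq \<equiv> teq R E A"
abbreviation "tc \<equiv> tclass R E A"
abbreviation "pr \<equiv> pure R E A"
abbreviation "C2 \<equiv> carrier E \<times> carrier A"

lemma teq_carrier: "tq l k \<Longrightarrow> set l \<subseteq> C2 \<and> set k \<subseteq> C2"
  by (induct rule: teq.induct) auto

lemma tclass_eq: "tq l k \<Longrightarrow> tc l = tc k"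
  unfolding tclass_def by (auto intro: teq_sym teq_trans)

lemma tclass_self: "set l \<subseteq> C2 \<Longrightarrow> l \<in> tc l"
  by (simp add: tclass_def teq_refl)

lemma tclass_mem: "k \<in> tc l \<Longrightarrow> tc k = tc l \<and> set k \<subseteq> C2"
  using tclass_eq teq_carrier by (auto simp: tclass_def)

text \<open>The generating relation swaps two single pairs only. Moving one pair past a list, and
  then inducting on the other list, is what makes addition commutative.\<close>

lemma teq_Cons_move: "u \<in> C2 \<Longrightarrow> set k \<subseteq> C2 \<Longrightarrow> tq (u # k) (k @ [u])"
proof (induct k)
  case Nil
  then show ?case by (simp add: teq_refl)
next
  case (Cons v k)
  have "tq ([u, v] @ k) ([v, u] @ k)"
    using Cons by (intro teq_append teq_swap teq_refl) auto
  moreover have "tq ([v] @ (u # k)) ([v] @ (k @ [u]))"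
    using Cons by (intro teq_append teq_refl Cons(1)) auto
  ultimately show ?case using teq_trans by fastforce
qed

lemma teq_comm: "set l \<subseteq> C2 \<Longrightarrow> set k \<subseteq> C2 \<Longrightarrow> tq (l @ k) (k @ l)"
proof (induct l arbitrary: k)
  case Nil
  then show ?case by (simp add: teq_refl)
next
  case (Cons u l)
  have "tq ([u] @ (l @ k)) ([u] @ (k @ l))"
    using Cons by (intro teq_append teq_refl Cons(1)) auto
  moreover have "tq ((u # k) @ l) ((k @ [u]) @ l)"
    using Cons by (intro teq_append teq_refl teq_Cons_move) auto
  ultimately show ?case using teq_trans by fastforce
qed

text \<open>The sum is a union over all representatives of both classes. The relation is a
  congruence, so all members of that union are one class, and the union over a nonempty index set is
  this class.\<close>

lemma add_tclass:
  assumes "set l \<subseteq> C2" "set k \<subseteq> C2" shows "tc l \<oplus>\<^bsub>T\<^esub> tc k = tc (l @ k)"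
proof -
  have *: "tc (l' @ k') = tc (l @ k)" if "l' \<in> tc l" "k' \<in> tc k" for l' k'
    using that tclass_eq[OF teq_sym[OF teq_append]] by (auto simp: tclass_def)
  have ne: "l \<in> tc l" "k \<in> tc k" using assms by (auto intro: tclass_self)
  have "tc l \<oplus>\<^bsub>T\<^esub> tc k = (\<Union>l'\<in>tc l. \<Union>k'\<in>tc k. tc (l' @ k'))" by (simp add: tensor_def)
  also have "\<dots> = (\<Union>l'\<in>tc l. \<Union>k'\<in>tc k. tc (l @ k))" using * by (intro SUP_cong refl) blast
  also have "\<dots> = tc (l @ k)" using ne by blast
  finally show ?thesis .
qed

lemma T_carrier: "carrier T = {tc l | l. set l \<subseteq> C2}" by (simp add: tensor_def)
lemma T_elem: "X \<in> carrier T \<Longrightarrow> \<exists>l. X = tc l \<and> set l \<subseteq> C2" unfolding T_carrier by blast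
lemma T_zero: "\<zero>\<^bsub>T\<^esub> = tc []" by (simp add: tensor_def)
lemma T_one: "\<one>\<^bsub>T\<^esub> = pr \<one>\<^bsub>E\<^esub> \<one>\<^bsub>A\<^esub>" by (simp add: tensor_def)

lemma tclass_closed: "set l \<subseteq> C2 \<Longrightarrow> tc l \<in> carrier T" by (auto simp: T_carrier)
lemma pure_closed: "x \<in> carrier E \<Longrightarrow> a \<in> carrier A \<Longrightarrow> pr x a \<in> carrier T"
  by (rule tclass_closed) auto

lemma tclass_Cons: "x \<in> carrier E \<Longrightarrow> a \<in> carrier A \<Longrightarrow> set l \<subseteq> C2 \<Longrightarrow> tc ((x,a) # l) = pr x a \<oplus>\<^bsub>T\<^esub> tc l"
  by (subst add_tclass) auto

lemma tensor_induct [consumes 1, case_names zero add]: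
  assumes "X \<in> carrier T" "P \<zero>\<^bsub>T\<^esub>"
    "\<And>x a X. \<lbrakk>x \<in> carrier E; a \<in> carrier A; X \<in> carrier T; P X\<rbrakk> \<Longrightarrow> P (pr x a \<oplus>\<^bsub>T\<^esub> X)"
  shows "P X"
proof -
  obtain l where l: "set l \<subseteq> C2" "X = tc l" using T_elem[OF assms(1)] by blast
  have "P (tc l)" using l(1)
  proof (induct l)
    case Nil
    then show ?case using assms(2) by (simp add: T_zero)
  next
    case (Cons u l)
    obtain x a where u: "u = (x,a)" by (cases u)
    have c: "x \<in> carrier E" "a \<in> carrier A" "set l \<subseteq> C2" using Cons u by auto
    show ?case unfolding u using assms(3)[OF c(1,2) tclass_closed[OF c(3)] Cons(1)[OF c(3)]] tclass_Cons[OF c] by metis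
  qed
  then show ?thesis using l by simp
qed

lemma T_abelian_monoid: "abelian_monoid T"
proof (rule abelian_monoidI)
  show "x \<oplus>\<^bsub>T\<^esub> y \<in> carrier T" if "x \<in> carrier T" "y \<in> carrier T" for x y
  proof -
    note xyz = that
    obtain l where l: "x = tc l" "set l \<subseteq> C2" using T_elem[OF xyz(1)] by blast
    obtain k where k: "y = tc k" "set k \<subseteq> C2" using T_elem[OF xyz(2)] by blast
    show ?thesis using l k by (simp add: add_tclass tclass_closed)
  qed
  show "\<zero>\<^bsub>T\<^esub> \<in> carrier T" by (simp add: T_zero tclass_closed)
  show "(x \<oplus>\<^bsub>T\<^esub> y) \<oplus>\<^bsub>T\<^esub> z = x \<oplus>\<^bsub>T\<^esub> (y \<oplus>\<^bsub>T\<^esub> z)" if "x \<in> carrier T" "y \<in> carrier T" "z \<in> carrier T" for x y z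
  proof -
    note xyz = that
    obtain l where l: "x = tc l" "set l \<subseteq> C2" using T_elem[OF xyz(1)] by blast
    obtain k where k: "y = tc k" "set k \<subseteq> C2" using T_elem[OF xyz(2)] by blast
    obtain m where m: "z = tc m" "set m \<subseteq> C2" using T_elem[OF xyz(3)] by blast
    show ?thesis using l k m by (simp add: add_tclass)
  qed
  show "\<zero>\<^bsub>T\<^esub> \<oplus>\<^bsub>T\<^esub> x = x" if "x \<in> carrier T" for x
  proof -
    note xyz = that
    obtain l where l: "x = tc l" "set l \<subseteq> C2" using T_elem[OF xyz(1)] by blast
    then show ?thesis by (simp add: add_tclass T_zero)
  qed
  show "x \<oplus>\<^bsub>T\<^esub> y = y \<oplus>\<^bsub>T\<^esub> x" if "x \<in> carrier T" "y \<in> carrier T" for x y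
  proof -
    note xyz = that
    obtain l where l: "x = tc l" "set l \<subseteq> C2" using T_elem[OF xyz(1)] by blast
    obtain k where k: "y = tc k" "set k \<subseteq> C2" using T_elem[OF xyz(2)] by blast
    show ?thesis using l k by (simp add: add_tclass tclass_eq[OF teq_comm])
  qed
qed

lemma pure_add_left: "\<lbrakk>x \<in> carrier E; y \<in> carrier E; a \<in> carrier A\<rbrakk> \<Longrightarrow> pr (x \<oplus>\<^bsub>E\<^esub> y) a = pr x a \<oplus>\<^bsub>T\<^esub> pr y a"
  by (subst add_tclass) (auto intro!: tclass_eq teq_add_left)
lemma pure_add_right: "\<lbrakk>x \<in> carrier E; a \<in> carrier A; b \<in> carrier A\<rbrakk> \<Longrightarrow> pr x (a \<oplus>\<^bsub>A\<^esub> b) = pr x a \<oplus>\<^bsub>T\<^esub> pr x b"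
  by (subst add_tclass) (auto intro!: tclass_eq teq_add_right)
lemma pure_smult: "\<lbrakk>r \<in> carrier R; x \<in> carrier E; a \<in> carrier A\<rbrakk> \<Longrightarrow> pr (r \<odot>\<^bsub>E\<^esub> x) a = pr x (r \<odot>\<^bsub>A\<^esub> a)"
  by (intro tclass_eq teq_smult)
lemma pure_zero_left: "a \<in> carrier A \<Longrightarrow> pr \<zero>\<^bsub>E\<^esub> a = \<zero>\<^bsub>T\<^esub>"
  unfolding T_zero by (intro tclass_eq teq_zero)

text \<open>Formal sums contain no negatives. The negative of x (x) a is (-x) (x) a, because their
  sum is 0 (x) a, and an induction over the summands does the rest.\<close>

lemma T_abelian_group: "abelian_group T"
proof -
  interpret T: abelian_monoid T by (rule T_abelian_monoid)
  have inv: "\<exists>y\<in>carrier T. y \<oplus>\<^bsub>T\<^esub> x = \<zero>\<^bsub>T\<^esub>" if "x \<in> carrier T" for x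
    using that
  proof (induct x rule: tensor_induct)
    case zero
    then show ?case by auto
  next
    case (add x a X)
    then obtain Y where Y: "Y \<in> carrier T" "Y \<oplus>\<^bsub>T\<^esub> X = \<zero>\<^bsub>T\<^esub>" by auto
    have p: "pr x a \<in> carrier T" "pr (\<ominus>\<^bsub>E\<^esub> x) a \<in> carrier T" using add by (simp_all add: pure_closed)
    have z: "pr (\<ominus>\<^bsub>E\<^esub> x) a \<oplus>\<^bsub>T\<^esub> pr x a = \<zero>\<^bsub>T\<^esub>"
      using add by (simp add: pure_add_left[symmetric] E.l_neg pure_zero_left)
    have "(Y \<oplus>\<^bsub>T\<^esub> pr (\<ominus>\<^bsub>E\<^esub> x) a) \<oplus>\<^bsub>T\<^esub> (pr x a \<oplus>\<^bsub>T\<^esub> X) = Y \<oplus>\<^bsub>T\<^esub> (pr (\<ominus>\<^bsub>E\<^esub> x) a \<oplus>\<^bsub>T\<^esub> pr x a) \<oplus>\<^bsub>T\<^esub> X"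
      using p Y add by (simp add: T.a_assoc)
    also have "\<dots> = \<zero>\<^bsub>T\<^esub>" using Y z by simp
    finally show ?case using p Y by (intro bexI[of _ "Y \<oplus>\<^bsub>T\<^esub> pr (\<ominus>\<^bsub>E\<^esub> x) a"]) auto
  qed
  show ?thesis
    by (rule abelian_groupI) (use inv in \<open>simp_all add: T.a_assoc\<close>, simp add: T.a_comm)
qed

sublocale T: abelian_group T by (rule T_abelian_group)

text \<open>The workhorse of the tensor calculus: nearly every later identity between maps on a
  tensor product is obtained by exhibiting both sides as additive and comparing them on pure
  tensors.\<close>

lemma tensor_ext:
  assumes "addhom T M h" "addhom T M k" "abelian_group M" "X \<in> carrier T"
    "\<And>x a. \<lbrakk>x \<in> carrier E; a \<in> carrier A\<rbrakk> \<Longrightarrow> h (pr x a) = k (pr x a)"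
  shows "h X = k X"
  using assms(4)
proof (induct X rule: tensor_induct)
  case zero
  then show ?case using addhom_zero[OF _ T_abelian_group assms(3)] assms(1,2) by metis
next
  case (add x a X)
  then show ?case using assms(5)[of x a] by (simp add: addhom_add[OF assms(1)] addhom_add[OF assms(2)] pure_closed)
qed

definition balanced :: "('b,'z) ring_scheme \<Rightarrow> ('e \<Rightarrow> 'a \<Rightarrow> 'b) \<Rightarrow> bool" where
  "balanced M h \<longleftrightarrow> (\<forall>x\<in>carrier E. \<forall>a\<in>carrier A. h x a \<in> carrier M) \<and>
    (\<forall>x\<in>carrier E. \<forall>y\<in>carrier E. \<forall>a\<in>carrier A. h (x \<oplus>\<^bsub>E\<^esub> y) a = h x a \<oplus>\<^bsub>M\<^esub> h y a) \<and>
    (\<forall>x\<in>carrier E. \<forall>a\<in>carrier A. \<forall>b\<in>carrier A. h x (a \<oplus>\<^bsub>A\<^esub> b) = h x a \<oplus>\<^bsub>M\<^esub> h x b) \<and>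
    (\<forall>r\<in>carrier R. \<forall>x\<in>carrier E. \<forall>a\<in>carrier A. h (r \<odot>\<^bsub>E\<^esub> x) a = h x (r \<odot>\<^bsub>A\<^esub> a))"

lemma balancedI:
  assumes "\<And>x a. \<lbrakk>x \<in> carrier E; a \<in> carrier A\<rbrakk> \<Longrightarrow> h x a \<in> carrier M"
    "\<And>x y a. \<lbrakk>x \<in> carrier E; y \<in> carrier E; a \<in> carrier A\<rbrakk> \<Longrightarrow> h (x \<oplus>\<^bsub>E\<^esub> y) a = h x a \<oplus>\<^bsub>M\<^esub> h y a"
    "\<And>x a b. \<lbrakk>x \<in> carrier E; a \<in> carrier A; b \<in> carrier A\<rbrakk> \<Longrightarrow> h x (a \<oplus>\<^bsub>A\<^esub> b) = h x a \<oplus>\<^bsub>M\<^esub> h x b"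
    "\<And>r x a. \<lbrakk>r \<in> carrier R; x \<in> carrier E; a \<in> carrier A\<rbrakk> \<Longrightarrow> h (r \<odot>\<^bsub>E\<^esub> x) a = h x (r \<odot>\<^bsub>A\<^esub> a)"
  shows "balanced M h"
  unfolding balanced_def by (intro conjI ballI assms)

abbreviation "fr M h l \<equiv> foldr (\<lambda>(x, a) s. h x a \<oplus>\<^bsub>M\<^esub> s) l \<zero>\<^bsub>M\<^esub>"

lemma fr_closed: "abelian_group M \<Longrightarrow> balanced M h \<Longrightarrow> set l \<subseteq> C2 \<Longrightarrow> fr M h l \<in> carrier M"
proof (induct l)
  case Nil
  then show ?case by (simp add: abelian_groupE)
next
  case (Cons u l)
  interpret M: abelian_group M by fact
  show ?case using Cons by (cases u) (auto simp: balanced_def)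
qed

lemma fr_append:
  assumes "abelian_group M" "balanced M h" "set l \<subseteq> C2" "set k \<subseteq> C2"
  shows "fr M h (l @ k) = fr M h l \<oplus>\<^bsub>M\<^esub> fr M h k"
  using assms(3)
proof (induct l)
  interpret M: abelian_group M by fact
  case Nil
  then show ?case using fr_closed[OF assms(1,2,4)] by simp
next
  interpret M: abelian_group M by fact
  case (Cons u l)
  obtain x a where u: "u = (x,a)" by (cases u)
  have "h x a \<in> carrier M" using Cons assms(2) by (auto simp: balanced_def u)
  then show ?case using Cons fr_closed[OF assms(1,2,4)] fr_closed[OF assms(1,2), of l] by (simp add: u M.a_assoc)
qed

lemma fr_teq:
  assumes "abelian_group M" "balanced M h" "tq l k"
  shows "fr M h l = fr M h k"
  using assms(3)
proof (induct rule: teq.induct)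
  interpret M: abelian_group M by fact
  note b = assms(2)[unfolded balanced_def]
  {
    case (teq_append l l' k k')
    then show ?case using fr_append[OF assms(1,2)] teq_carrier by metis
  next
    case (teq_swap u v)
    obtain x a y c where u: "u = (x,a)" "v = (y,c)" by (cases u; cases v)
    have "h x a \<in> carrier M" "h y c \<in> carrier M" using teq_swap u b by auto
    then show ?case by (simp add: u M.a_comm)
  next
    \<comment> \<open>Additivity in the first argument gives \<open>h 0 a + h 0 a = h 0 a\<close>,
      and cancellation in the group \<open>M\<close> turns this into the relation for zero.\<close>
    case (teq_zero a)
    have h: "h \<zero>\<^bsub>E\<^esub> a \<in> carrier M" using b teq_zero by auto
    have "h (\<zero>\<^bsub>E\<^esub> \<oplus>\<^bsub>E\<^esub> \<zero>\<^bsub>E\<^esub>) a = h \<zero>\<^bsub>E\<^esub> a \<oplus>\<^bsub>M\<^esub> h \<zero>\<^bsub>E\<^esub> a" using b teq_zero by blast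
    then have "h \<zero>\<^bsub>E\<^esub> a \<oplus>\<^bsub>M\<^esub> h \<zero>\<^bsub>E\<^esub> a = h \<zero>\<^bsub>E\<^esub> a \<oplus>\<^bsub>M\<^esub> \<zero>\<^bsub>M\<^esub>" using h by simp
    then have "h \<zero>\<^bsub>E\<^esub> a = \<zero>\<^bsub>M\<^esub>" using h by (metis M.add.l_cancel M.zero_closed)
    then show ?case by simp
  next
    case (teq_add_left x y a)
    then show ?case using b by (simp add: M.a_assoc)
  next
    case (teq_add_right x a b)
    then show ?case using b by (simp add: M.a_assoc)
  next
    case (teq_smult r x a)
    then show ?case using b by simp
  }
qed auto

lemma tensor_lift_tclass:
  assumes "abelian_group M" "balanced M h" "set l \<subseteq> C2"
  shows "tensor_lift M h (tc l) = fr M h l"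
proof -
  have "fr M h k = fr M h l" if "k \<in> tc l" for k
    using that fr_teq[OF assms(1,2)] unfolding tclass_def by (metis mem_Collect_eq)
  then have "(\<lambda>l. fr M h l) ` tc l = {fr M h l}"
    using tclass_self[OF assms(3)] by (metis (no_types, lifting) image_cong image_constant)
  then show ?thesis by (simp add: tensor_lift_def)
qed

lemma tensor_lift_addhom:
  assumes "abelian_group M" "balanced M h" shows "addhom T M (tensor_lift M h)"
proof (rule addhomI)
  fix X Y assume X: "X \<in> carrier T"
  then obtain l where l: "X = tc l" "set l \<subseteq> C2" using T_elem by blast
  show "tensor_lift M h X \<in> carrier M" using l by (simp add: tensor_lift_tclass[OF assms] fr_closed[OF assms])
  assume "Y \<in> carrier T"
  then obtain k where k: "Y = tc k" "set k \<subseteq> C2" using T_elem by blast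
  show "tensor_lift M h (X \<oplus>\<^bsub>T\<^esub> Y) = tensor_lift M h X \<oplus>\<^bsub>M\<^esub> tensor_lift M h Y"
    using l k by (simp add: add_tclass tensor_lift_tclass[OF assms] fr_append[OF assms] del: foldr_append)
qed

lemma tensor_lift_pure:
  assumes "abelian_group M" "balanced M h" "x \<in> carrier E" "a \<in> carrier A"
  shows "tensor_lift M h (pr x a) = h x a"
proof -
  interpret M: abelian_group M by fact
  show ?thesis using assms(2-) by (subst tensor_lift_tclass[OF assms(1,2)]) (auto simp: balanced_def)
qed

text \<open>The product of the tensor algebra comes from applying the universal property twice.
  Multiplication by one pure tensor from the left is a lift; as a function of that pure tensor it is
  balanced again, so it lifts once more.\<close>

definition Lmul :: "'e \<Rightarrow> 'a \<Rightarrow> ('e \<times> 'a) list set \<Rightarrow> ('e \<times> 'a) list set" where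
  "Lmul x a = tensor_lift T (\<lambda>y b. pr (x \<otimes>\<^bsub>E\<^esub> y) (a \<otimes>\<^bsub>A\<^esub> b))"

lemma Lmul_balanced: "x \<in> carrier E \<Longrightarrow> a \<in> carrier A \<Longrightarrow> balanced T (\<lambda>y b. pr (x \<otimes>\<^bsub>E\<^esub> y) (a \<otimes>\<^bsub>A\<^esub> b))"
  by (rule balancedI) (simp_all add: pure_closed E.r_distr A.r_distr pure_add_left pure_add_right smult_mult_r A_smult_mult_r pure_smult)

lemmas Lmul_addhom = tensor_lift_addhom[OF T_abelian_group Lmul_balanced, folded Lmul_def]
lemmas Lmul_pure = tensor_lift_pure[OF T_abelian_group Lmul_balanced, folded Lmul_def]

lemma Lmul_closed: "\<lbrakk>x \<in> carrier E; a \<in> carrier A; Y \<in> carrier T\<rbrakk> \<Longrightarrow> Lmul x a Y \<in> carrier T"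
  by (rule addhom_closed[OF Lmul_addhom])

lemma Lmul_tclass:
  assumes "x \<in> carrier E" "a \<in> carrier A" "set k \<subseteq> C2"
  shows "tc (map (\<lambda>(y, b). (x \<otimes>\<^bsub>E\<^esub> y, a \<otimes>\<^bsub>A\<^esub> b)) k) = Lmul x a (tc k)"
  using assms(3)
proof (induct k)
  case Nil
  then show ?case using addhom_zero[OF Lmul_addhom[OF assms(1,2)]] T_abelian_group by (simp add: T_zero)
next
  case (Cons u k)
  obtain y b where u: "u = (y,b)" by (cases u)
  have s: "set (map (\<lambda>(y, b). (x \<otimes>\<^bsub>E\<^esub> y, a \<otimes>\<^bsub>A\<^esub> b)) k) \<subseteq> C2" using Cons assms by auto
  then show ?case using Cons assms
    by (simp add: u tclass_Cons[where l=k] tclass_Cons[OF _ _ s] addhom_add[OF Lmul_addhom] Lmul_pure pure_closed tclass_closed)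
qed

lemma addhom_addI:
  assumes "addhom T T h" "addhom T T k" shows "addhom T T (\<lambda>X. h X \<oplus>\<^bsub>T\<^esub> k X)"
  using assms by (auto simp: addhom_def Pi_iff T.add.m_ac)

lemma Lmul_balanced2:
  assumes Y: "Y \<in> carrier T" shows "balanced T (\<lambda>x a. Lmul x a Y)"
proof (rule balancedI)
  show "Lmul x a Y \<in> carrier T" if "x \<in> carrier E" "a \<in> carrier A" for x a
    using that Y by (rule Lmul_closed)
  show "Lmul (x \<oplus>\<^bsub>E\<^esub> y) a Y = Lmul x a Y \<oplus>\<^bsub>T\<^esub> Lmul y a Y" if "x \<in> carrier E" "y \<in> carrier E" "a \<in> carrier A" for x y a
    by (rule tensor_ext[OF _ addhom_addI T_abelian_group Y])
       (use that in \<open>simp_all add: Lmul_pure E.l_distr pure_add_left Lmul_addhom\<close>)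
  show "Lmul x (a \<oplus>\<^bsub>A\<^esub> b) Y = Lmul x a Y \<oplus>\<^bsub>T\<^esub> Lmul x b Y" if "x \<in> carrier E" "a \<in> carrier A" "b \<in> carrier A" for x a b
    by (rule tensor_ext[OF _ addhom_addI T_abelian_group Y])
       (use that in \<open>simp_all add: Lmul_pure A.l_distr pure_add_right Lmul_addhom\<close>)
  show "Lmul (r \<odot>\<^bsub>E\<^esub> x) a Y = Lmul x (r \<odot>\<^bsub>A\<^esub> a) Y" if "r \<in> carrier R" "x \<in> carrier E" "a \<in> carrier A" for r x a
    by (rule tensor_ext[OF _ _ T_abelian_group Y])
       (use that in \<open>simp_all add: Lmul_pure smult_mult_l AM.smult_assoc2 pure_smult Lmul_addhom\<close>)
qed

text \<open>Replaces the union over representatives in the definition of the product by a lift. From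
  here on additivity in the left factor is automatic and the ring axioms reduce to pure
  tensors.\<close>

lemma mult_eq:
  assumes "X \<in> carrier T" "Y \<in> carrier T"
  shows "X \<otimes>\<^bsub>T\<^esub> Y = tensor_lift T (\<lambda>x a. Lmul x a Y) X"
proof -
  let ?p = "\<lambda>l k. concat (map (\<lambda>(x, a). map (\<lambda>(y, b). (x \<otimes>\<^bsub>E\<^esub> y, a \<otimes>\<^bsub>A\<^esub> b)) k) l)"
  have *: "tc (?p l k) = tensor_lift T (\<lambda>x a. Lmul x a (tc k)) (tc l)" if "set l \<subseteq> C2" "set k \<subseteq> C2" for l k
    using that(1)
  proof (induct l)
    case Nil
    then show ?case using addhom_zero[OF tensor_lift_addhom[OF T_abelian_group Lmul_balanced2]] T_abelian_group that
      by (simp add: T_zero tclass_closed)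
  next
    case (Cons u l)
    obtain x a where u: "u = (x,a)" by (cases u)
    have s: "set (?p l k) \<subseteq> C2" "set (map (\<lambda>(y, b). (x \<otimes>\<^bsub>E\<^esub> y, a \<otimes>\<^bsub>A\<^esub> b)) k) \<subseteq> C2"
      using Cons that u by fastforce+
    have kk: "tc k \<in> carrier T" using that by (simp add: tclass_closed)
    show ?case using Cons u that s
      by (simp add: add_tclass[symmetric] tclass_Cons[where l=l] tclass_closed pure_closed Lmul_tclass
          addhom_add[OF tensor_lift_addhom[OF T_abelian_group Lmul_balanced2[OF kk]]]
          tensor_lift_pure[OF T_abelian_group Lmul_balanced2[OF kk]])
  qed
  obtain l where l: "X = tc l" "set l \<subseteq> C2" using T_elem[OF assms(1)] by blast
  obtain k where k: "Y = tc k" "set k \<subseteq> C2" using T_elem[OF assms(2)] by blast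
  note lk = l k
  have **: "tc (?p l' k') = tensor_lift T (\<lambda>x a. Lmul x a Y) X" if "l' \<in> X" "k' \<in> Y" for l' k'
  proof -
    have "tc l' = tc l" "set l' \<subseteq> C2" "tc k' = tc k" "set k' \<subseteq> C2"
      using that tclass_mem[of l' l] tclass_mem[of k' k] lk by blast+
    then show ?thesis using *[of l' k'] lk by simp
  qed
  have "l \<in> X" "k \<in> Y" using lk by (auto intro: tclass_self)
  have "X \<otimes>\<^bsub>T\<^esub> Y = (\<Union>l\<in>X. \<Union>k\<in>Y. tc (?p l k))" by (simp add: tensor_def)
  also have "\<dots> = (\<Union>l\<in>X. \<Union>k\<in>Y. tensor_lift T (\<lambda>x a. Lmul x a Y) X)" using ** by (intro SUP_cong refl) blast
  also have "\<dots> = tensor_lift T (\<lambda>x a. Lmul x a Y) X" using \<open>l \<in> X\<close> \<open>k \<in> Y\<close> by auto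
  finally show ?thesis .
qed

lemma mult_closed: "\<lbrakk>X \<in> carrier T; Y \<in> carrier T\<rbrakk> \<Longrightarrow> X \<otimes>\<^bsub>T\<^esub> Y \<in> carrier T"
  using addhom_closed[OF tensor_lift_addhom[OF T_abelian_group Lmul_balanced2]] by (simp add: mult_eq)

lemma addhom_cong: "addhom M N h \<Longrightarrow> abelian_group M \<Longrightarrow> (\<And>x. x \<in> carrier M \<Longrightarrow> h x = k x) \<Longrightarrow> addhom M N k"
  unfolding addhom_def by (simp add: Pi_iff abelian_groupE)

lemma mult_addhom_l: "Y \<in> carrier T \<Longrightarrow> addhom T T (\<lambda>X. X \<otimes>\<^bsub>T\<^esub> Y)"
  by (rule addhom_cong[OF tensor_lift_addhom[OF T_abelian_group Lmul_balanced2] T_abelian_group]) (simp_all add: mult_eq)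

lemma pure_mult_Lmul: "\<lbrakk>x \<in> carrier E; a \<in> carrier A; Y \<in> carrier T\<rbrakk> \<Longrightarrow> pr x a \<otimes>\<^bsub>T\<^esub> Y = Lmul x a Y"
  by (simp add: mult_eq pure_closed tensor_lift_pure[OF T_abelian_group Lmul_balanced2])

lemma pure_mult: "\<lbrakk>x \<in> carrier E; a \<in> carrier A; y \<in> carrier E; b \<in> carrier A\<rbrakk> \<Longrightarrow>
    pr x a \<otimes>\<^bsub>T\<^esub> pr y b = pr (x \<otimes>\<^bsub>E\<^esub> y) (a \<otimes>\<^bsub>A\<^esub> b)"
  by (simp add: pure_mult_Lmul pure_closed Lmul_pure)

lemma mult_l_distr: "\<lbrakk>X \<in> carrier T; Y \<in> carrier T; Z \<in> carrier T\<rbrakk> \<Longrightarrow> (X \<oplus>\<^bsub>T\<^esub> Y) \<otimes>\<^bsub>T\<^esub> Z = X \<otimes>\<^bsub>T\<^esub> Z \<oplus>\<^bsub>T\<^esub> Y \<otimes>\<^bsub>T\<^esub> Z"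
  using addhom_add[OF mult_addhom_l] by blast

lemma mult_r_distr:
  assumes "X \<in> carrier T" "Y \<in> carrier T" "Z \<in> carrier T"
  shows "X \<otimes>\<^bsub>T\<^esub> (Y \<oplus>\<^bsub>T\<^esub> Z) = X \<otimes>\<^bsub>T\<^esub> Y \<oplus>\<^bsub>T\<^esub> X \<otimes>\<^bsub>T\<^esub> Z"
  by (rule tensor_ext[OF mult_addhom_l addhom_addI T_abelian_group assms(1)])
     (use assms in \<open>simp_all add: mult_addhom_l pure_mult_Lmul addhom_add[OF Lmul_addhom]\<close>)

lemma mult_addhom_r: "X \<in> carrier T \<Longrightarrow> addhom T T (\<lambda>Y. X \<otimes>\<^bsub>T\<^esub> Y)"
  by (rule addhomI) (simp_all add: mult_closed mult_r_distr)

text \<open>Both sides are additive in each argument, so the arguments are replaced by pure tensors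
  one at a time, from left to right.\<close>

lemma mult_assoc:
  assumes "X \<in> carrier T" "Y \<in> carrier T" "Z \<in> carrier T"
  shows "(X \<otimes>\<^bsub>T\<^esub> Y) \<otimes>\<^bsub>T\<^esub> Z = X \<otimes>\<^bsub>T\<^esub> (Y \<otimes>\<^bsub>T\<^esub> Z)"
proof (rule tensor_ext[OF addhom_comp[OF mult_addhom_l mult_addhom_l] mult_addhom_l T_abelian_group assms(1)])
  show "Y \<otimes>\<^bsub>T\<^esub> Z \<in> carrier T" "Y \<in> carrier T" "Z \<in> carrier T" using assms by (simp_all add: mult_closed)
  fix x a assume xa: "x \<in> carrier E" "a \<in> carrier A"
  show "pr x a \<otimes>\<^bsub>T\<^esub> Y \<otimes>\<^bsub>T\<^esub> Z = pr x a \<otimes>\<^bsub>T\<^esub> (Y \<otimes>\<^bsub>T\<^esub> Z)"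
  proof (rule tensor_ext[OF addhom_comp[OF mult_addhom_r mult_addhom_l] addhom_comp[OF mult_addhom_l mult_addhom_r] T_abelian_group assms(2)])
    show "pr x a \<in> carrier T" "pr x a \<in> carrier T" "Z \<in> carrier T" "Z \<in> carrier T" using assms xa by (simp_all add: pure_closed)
    fix y b assume yb: "y \<in> carrier E" "b \<in> carrier A"
    show "pr x a \<otimes>\<^bsub>T\<^esub> pr y b \<otimes>\<^bsub>T\<^esub> Z = pr x a \<otimes>\<^bsub>T\<^esub> (pr y b \<otimes>\<^bsub>T\<^esub> Z)"
    proof (rule tensor_ext[OF mult_addhom_r addhom_comp[OF mult_addhom_r mult_addhom_r] T_abelian_group assms(3)])
      show "pr x a \<otimes>\<^bsub>T\<^esub> pr y b \<in> carrier T" "pr x a \<in> carrier T" "pr y b \<in> carrier T"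
        using xa yb by (simp_all add: pure_closed mult_closed)
      fix z c assume zc: "z \<in> carrier E" "c \<in> carrier A"
      show "pr x a \<otimes>\<^bsub>T\<^esub> pr y b \<otimes>\<^bsub>T\<^esub> pr z c = pr x a \<otimes>\<^bsub>T\<^esub> (pr y b \<otimes>\<^bsub>T\<^esub> pr z c)"
        using xa yb zc by (simp add: pure_mult E.m_assoc A.m_assoc)
    qed
  qed
qed

lemma addhom_id: "addhom M M (\<lambda>X. X)" by (auto simp: addhom_def)

lemma T_ring: "ring T"
proof (rule ringI)
  show "abelian_group T" by (rule T_abelian_group)
  have one: "\<one>\<^bsub>T\<^esub> \<in> carrier T" by (simp add: T_one pure_closed)
  show "Group.monoid T"
  proof (rule monoidI)
    show "\<one>\<^bsub>T\<^esub> \<otimes>\<^bsub>T\<^esub> x = x" if "x \<in> carrier T" for x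
      by (rule tensor_ext[OF mult_addhom_r addhom_id T_abelian_group that]) (simp_all add: one mult_addhom_l mult_addhom_r, simp_all add: T_one pure_mult)
    show "x \<otimes>\<^bsub>T\<^esub> \<one>\<^bsub>T\<^esub> = x" if "x \<in> carrier T" for x
      by (rule tensor_ext[OF mult_addhom_l addhom_id T_abelian_group that]) (simp_all add: one mult_addhom_l mult_addhom_r, simp_all add: T_one pure_mult)
  qed (simp_all add: one mult_closed mult_assoc)
qed (simp_all add: mult_l_distr mult_r_distr)

lemma smult_balanced: "b \<in> carrier A \<Longrightarrow> balanced T (\<lambda>x a. pr x (b \<otimes>\<^bsub>A\<^esub> a))"
  by (rule balancedI) (simp_all add: pure_closed A.r_distr pure_add_left pure_add_right pure_smult A_smult_mult_r)

lemma smult_eq: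
  assumes "b \<in> carrier A" "X \<in> carrier T"
  shows "b \<odot>\<^bsub>T\<^esub> X = tensor_lift T (\<lambda>x a. pr x (b \<otimes>\<^bsub>A\<^esub> a)) X"
proof -
  let ?p = "\<lambda>l. map (\<lambda>(x, a). (x, b \<otimes>\<^bsub>A\<^esub> a)) l"
  have *: "tc (?p l) = tensor_lift T (\<lambda>x a. pr x (b \<otimes>\<^bsub>A\<^esub> a)) (tc l)" if "set l \<subseteq> C2" for l
    using that
  proof (induct l)
    case Nil
    then show ?case using addhom_zero[OF tensor_lift_addhom[OF T_abelian_group smult_balanced]] T_abelian_group assms
      by (simp add: T_zero)
  next
    case (Cons u l)
    obtain x a where u: "u = (x,a)" by (cases u)
    have s: "set (?p l) \<subseteq> C2" using Cons assms by auto
    show ?case using Cons u assms s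
      by (simp add: tclass_Cons[where l=l] tclass_Cons[OF _ _ s] tclass_closed pure_closed
          addhom_add[OF tensor_lift_addhom[OF T_abelian_group smult_balanced]]
          tensor_lift_pure[OF T_abelian_group smult_balanced])
  qed
  obtain l where l: "X = tc l" "set l \<subseteq> C2" using T_elem[OF assms(2)] by blast
  have **: "tc (?p l') = tensor_lift T (\<lambda>x a. pr x (b \<otimes>\<^bsub>A\<^esub> a)) X" if "l' \<in> X" for l'
  proof -
    have "tc l' = tc l" "set l' \<subseteq> C2" using that tclass_mem[of l' l] l by blast+
    then show ?thesis using *[of l'] l by simp
  qed
  have "l \<in> X" using l by (auto intro: tclass_self)
  have "b \<odot>\<^bsub>T\<^esub> X = (\<Union>l\<in>X. tc (?p l))" by (simp add: tensor_def)
  also have "\<dots> = (\<Union>l\<in>X. tensor_lift T (\<lambda>x a. pr x (b \<otimes>\<^bsub>A\<^esub> a)) X)" using ** by (intro SUP_cong refl) blast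
  also have "\<dots> = tensor_lift T (\<lambda>x a. pr x (b \<otimes>\<^bsub>A\<^esub> a)) X" using \<open>l \<in> X\<close> by auto
  finally show ?thesis .
qed

lemma smult_addhom: "b \<in> carrier A \<Longrightarrow> addhom T T (\<lambda>X. b \<odot>\<^bsub>T\<^esub> X)"
  by (rule addhom_cong[OF tensor_lift_addhom[OF T_abelian_group smult_balanced] T_abelian_group]) (simp_all add: smult_eq)

lemma smult_pure: "\<lbrakk>b \<in> carrier A; x \<in> carrier E; a \<in> carrier A\<rbrakk> \<Longrightarrow> b \<odot>\<^bsub>T\<^esub> pr x a = pr x (b \<otimes>\<^bsub>A\<^esub> a)"
  by (simp add: smult_eq pure_closed tensor_lift_pure[OF T_abelian_group smult_balanced])

lemma T_smult_closed: "b \<in> carrier A \<Longrightarrow> X \<in> carrier T \<Longrightarrow> b \<odot>\<^bsub>T\<^esub> X \<in> carrier T"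
  using addhom_closed[OF smult_addhom] by blast

lemma T_module: "Module.module A T"
proof (rule moduleI)
  show "cring A" by (rule A.is_cring)
  show "abelian_group T" by (rule T_abelian_group)
  show "a \<odot>\<^bsub>T\<^esub> x \<in> carrier T" if "a \<in> carrier A" "x \<in> carrier T" for a x using that by (rule T_smult_closed)
  show "a \<odot>\<^bsub>T\<^esub> (x \<oplus>\<^bsub>T\<^esub> y) = a \<odot>\<^bsub>T\<^esub> x \<oplus>\<^bsub>T\<^esub> a \<odot>\<^bsub>T\<^esub> y" if "a \<in> carrier A" "x \<in> carrier T" "y \<in> carrier T" for a x y
    using that addhom_add[OF smult_addhom] by blast
  show "(a \<oplus>\<^bsub>A\<^esub> b) \<odot>\<^bsub>T\<^esub> x = a \<odot>\<^bsub>T\<^esub> x \<oplus>\<^bsub>T\<^esub> b \<odot>\<^bsub>T\<^esub> x" if "a \<in> carrier A" "b \<in> carrier A" "x \<in> carrier T" for a b x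
    by (rule tensor_ext[OF smult_addhom addhom_addI T_abelian_group that(3)])
       (use that in \<open>simp_all add: smult_addhom smult_pure A.l_distr pure_add_right\<close>)
  show "(a \<otimes>\<^bsub>A\<^esub> b) \<odot>\<^bsub>T\<^esub> x = a \<odot>\<^bsub>T\<^esub> (b \<odot>\<^bsub>T\<^esub> x)" if "a \<in> carrier A" "b \<in> carrier A" "x \<in> carrier T" for a b x
    by (rule tensor_ext[OF smult_addhom addhom_comp[OF smult_addhom smult_addhom] T_abelian_group that(3)])
       (use that in \<open>simp_all add: smult_pure A.m_assoc\<close>)
  show "\<one>\<^bsub>A\<^esub> \<odot>\<^bsub>T\<^esub> x = x" if "x \<in> carrier T" for x
    by (rule tensor_ext[OF smult_addhom addhom_id T_abelian_group that]) (simp_all add: smult_pure)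
qed

lemma T_assoc_algebra: "assoc_algebra A T"
  unfolding assoc_algebra_def
proof (intro conjI ballI)
  show "Module.module A T" by (rule T_module)
  show "ring T" by (rule T_ring)
  fix r x y assume r: "r \<in> carrier A" and x: "x \<in> carrier T" and y: "y \<in> carrier T"
  show "(r \<odot>\<^bsub>T\<^esub> x) \<otimes>\<^bsub>T\<^esub> y = r \<odot>\<^bsub>T\<^esub> (x \<otimes>\<^bsub>T\<^esub> y)"
  proof (rule tensor_ext[OF addhom_comp[OF smult_addhom mult_addhom_l] addhom_comp[OF mult_addhom_l smult_addhom] T_abelian_group x])
    fix x a assume xa: "x \<in> carrier E" "a \<in> carrier A"
    show "r \<odot>\<^bsub>T\<^esub> pr x a \<otimes>\<^bsub>T\<^esub> y = r \<odot>\<^bsub>T\<^esub> (pr x a \<otimes>\<^bsub>T\<^esub> y)"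
      by (rule tensor_ext[OF mult_addhom_r addhom_comp[OF mult_addhom_r smult_addhom] T_abelian_group y])
         (use r xa in \<open>simp_all add: smult_pure pure_mult pure_closed T_smult_closed A.m_assoc\<close>)
  qed (use r y in auto)
  show "x \<otimes>\<^bsub>T\<^esub> (r \<odot>\<^bsub>T\<^esub> y) = r \<odot>\<^bsub>T\<^esub> (x \<otimes>\<^bsub>T\<^esub> y)"
  proof (rule tensor_ext[OF mult_addhom_l addhom_comp[OF mult_addhom_l smult_addhom] T_abelian_group x])
    fix x a assume xa: "x \<in> carrier E" "a \<in> carrier A"
    show "pr x a \<otimes>\<^bsub>T\<^esub> (r \<odot>\<^bsub>T\<^esub> y) = r \<odot>\<^bsub>T\<^esub> (pr x a \<otimes>\<^bsub>T\<^esub> y)"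
      by (rule tensor_ext[OF addhom_comp[OF smult_addhom mult_addhom_r] addhom_comp[OF mult_addhom_r smult_addhom] T_abelian_group y])
         (use r xa in \<open>simp_all add: smult_pure pure_mult pure_closed T_smult_closed A.m_lcomm\<close>)
  qed (use r y in \<open>simp_all add: T_smult_closed\<close>)
qed

end

section \<open>Maps between tensor products\<close>

locale tensor_map = S: tensor_alg R E A + T': tensor_alg R' E' A'
  for R :: "('r,'x) ring_scheme" and E :: "('r,'e) module" and A :: "('r,'a) module"
    and R' :: "('s,'y) ring_scheme" and E' :: "('s,'f) module" and A' :: "('s,'b) module" +
  fixes f :: "'r \<Rightarrow> 's" and g :: "'e \<Rightarrow> 'f" and h :: "'a \<Rightarrow> 'b"
  assumes f: "f \<in> carrier R \<rightarrow> carrier R'" and g: "slin R f E E' g" and h: "slin R f A A' h"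
begin

lemma tmap_balanced: "S.balanced (tensor R' E' A') (\<lambda>x a. pure R' E' A' (g x) (h a))"
proof -
  note a = addhom_closed[OF slin_addhom[OF g]] addhom_closed[OF slin_addhom[OF h]]
  have fr: "r \<in> carrier R \<Longrightarrow> f r \<in> carrier R'" for r using f by auto
  show ?thesis
    by (rule S.balancedI) (simp_all add: a fr T'.pure_closed addhom_add[OF slin_addhom[OF g]] addhom_add[OF slin_addhom[OF h]]
      T'.pure_add_left T'.pure_add_right slin_smult[OF g] slin_smult[OF h] T'.pure_smult)
qed

lemmas tmap_addhom = S.tensor_lift_addhom[OF T'.T_abelian_group tmap_balanced, folded tmap_def]
lemmas tmap_pure = S.tensor_lift_pure[OF T'.T_abelian_group tmap_balanced, folded tmap_def]
lemmas tmap_closed = addhom_closed[OF tmap_addhom]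

lemma tmap_surj:
  assumes "g ` carrier E = carrier E'" "h ` carrier A = carrier A'" "Y \<in> carrier (tensor R' E' A')"
  shows "\<exists>X\<in>carrier (tensor R E A). tmap R' E' A' g h X = Y"
  using assms(3)
proof (induct Y rule: T'.tensor_induct)
  case zero
  show ?case using addhom_zero[OF tmap_addhom S.T_abelian_group T'.T_abelian_group] by auto
next
  case (add y b Y)
  have "y \<in> g ` carrier E" "b \<in> h ` carrier A" using add(1,2) assms(1,2) by simp_all
  then obtain x a where xa: "x \<in> carrier E" "g x = y" "a \<in> carrier A" "h a = b" by (elim imageE) metis
  obtain X where "X \<in> carrier (tensor R E A)" "tmap R' E' A' g h X = Y" using add by blast
  then show ?case using xa
    by (intro bexI[of _ "pure R E A x a \<oplus>\<^bsub>tensor R E A\<^esub> X"]) (simp_all add: addhom_add[OF tmap_addhom] tmap_pure S.pure_closed)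
qed

lemma tmap_ring_hom:
  assumes "g \<in> ring_hom E E'" "h \<in> ring_hom A A'"
  shows "tmap R' E' A' g h \<in> ring_hom (tensor R E A) (tensor R' E' A')"
proof (rule ring_hom_memI)
  have c: "x \<in> carrier E \<Longrightarrow> g x \<in> carrier E'" "a \<in> carrier A \<Longrightarrow> h a \<in> carrier A'" for x a
    using assms by (auto simp: ring_hom_def)
  fix X assume X: "X \<in> carrier (tensor R E A)"
  show "tmap R' E' A' g h X \<in> carrier (tensor R' E' A')" using X by (rule tmap_closed)
  fix Y assume Y: "Y \<in> carrier (tensor R E A)"
  show "tmap R' E' A' g h (X \<oplus>\<^bsub>tensor R E A\<^esub> Y) = tmap R' E' A' g h X \<oplus>\<^bsub>tensor R' E' A'\<^esub> tmap R' E' A' g h Y"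
    using X Y addhom_add[OF tmap_addhom] by blast
  show "tmap R' E' A' g h (X \<otimes>\<^bsub>tensor R E A\<^esub> Y) = tmap R' E' A' g h X \<otimes>\<^bsub>tensor R' E' A'\<^esub> tmap R' E' A' g h Y"
  proof (rule S.tensor_ext[OF addhom_comp[OF S.mult_addhom_l tmap_addhom] addhom_comp[OF tmap_addhom T'.mult_addhom_l] T'.T_abelian_group X])
    fix x a assume xa: "x \<in> carrier E" "a \<in> carrier A"
    show "tmap R' E' A' g h (pure R E A x a \<otimes>\<^bsub>tensor R E A\<^esub> Y) = tmap R' E' A' g h (pure R E A x a) \<otimes>\<^bsub>tensor R' E' A'\<^esub> tmap R' E' A' g h Y"
      by (rule S.tensor_ext[OF addhom_comp[OF S.mult_addhom_r tmap_addhom] addhom_comp[OF tmap_addhom T'.mult_addhom_r] T'.T_abelian_group Y])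
         (use xa in \<open>simp_all add: S.pure_closed T'.pure_closed tmap_closed S.pure_mult tmap_pure T'.pure_mult c ring_hom_mult[OF assms(1)] ring_hom_mult[OF assms(2)]\<close>)
  qed (use Y tmap_closed in simp_all)
next
  show "tmap R' E' A' g h \<one>\<^bsub>tensor R E A\<^esub> = \<one>\<^bsub>tensor R' E' A'\<^esub>"
    by (simp add: S.T_one T'.T_one tmap_pure ring_hom_one[OF assms(1)] ring_hom_one[OF assms(2)])
qed

lemma tmap_smult:
  assumes "h \<in> ring_hom A A'" "b \<in> carrier A" "X \<in> carrier (tensor R E A)"
  shows "tmap R' E' A' g h (b \<odot>\<^bsub>tensor R E A\<^esub> X) = h b \<odot>\<^bsub>tensor R' E' A'\<^esub> tmap R' E' A' g h X"
proof (rule S.tensor_ext[OF addhom_comp[OF S.smult_addhom tmap_addhom] addhom_comp[OF tmap_addhom T'.smult_addhom] T'.T_abelian_group assms(3)])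
  show "b \<in> carrier A" "h b \<in> carrier A'" using assms(2) addhom_closed[OF slin_addhom[OF h]] by simp_all
  fix x a assume xa: "x \<in> carrier E" "a \<in> carrier A"
  then have c: "g x \<in> carrier E'" "h a \<in> carrier A'" "h b \<in> carrier A'"
    using assms(2) by (simp_all add: addhom_closed[OF slin_addhom[OF g]] addhom_closed[OF slin_addhom[OF h]])
  show "tmap R' E' A' g h (b \<odot>\<^bsub>tensor R E A\<^esub> pure R E A x a) = h b \<odot>\<^bsub>tensor R' E' A'\<^esub> tmap R' E' A' g h (pure R E A x a)"
    using xa assms(2) c by (simp add: S.smult_pure tmap_pure T'.smult_pure ring_hom_mult[OF assms(1)])
qed

end

section \<open>Restriction of scalars\<close>

text \<open>\<open>restr\<close> and \<open>self_alg\<close> alter the record and its type but keep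
  the listed fields, so structure is carried over field by field.\<close>

lemma abelian_group_cong:
  assumes "abelian_group A" "carrier B = carrier A" "add B = add A" "zero B = zero A"
  shows "abelian_group B"
proof -
  interpret A: abelian_group A by fact
  show ?thesis
  proof (rule abelian_groupI)
    show "\<exists>y\<in>carrier B. y \<oplus>\<^bsub>B\<^esub> x = \<zero>\<^bsub>B\<^esub>" if "x \<in> carrier B" for x
      using that by (intro bexI[of _ "\<ominus>\<^bsub>A\<^esub> x"]) (simp_all add: assms A.l_neg)
    show "x \<oplus>\<^bsub>B\<^esub> y = y \<oplus>\<^bsub>B\<^esub> x" if "x \<in> carrier B" "y \<in> carrier B" for x y
      using that by (simp add: assms A.a_comm)
  qed (simp_all add: assms A.a_assoc)
qed

lemma ring_cong:
  assumes "ring A" "carrier B = carrier A" "add B = add A" "zero B = zero A" "monoid.mult B = monoid.mult A" "one B = one A"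
  shows "ring B"
proof -
  interpret A: ring A by fact
  have "Group.monoid B" by (rule monoidI) (simp_all add: assms A.m_assoc)
  then show ?thesis
    by (intro ringI abelian_group_cong[OF A.abelian_group_axioms]) (simp_all add: assms A.l_distr A.r_distr)
qed

lemma cring_cong:
  assumes "cring A" "carrier B = carrier A" "add B = add A" "zero B = zero A" "monoid.mult B = monoid.mult A" "one B = one A"
  shows "cring B"
proof -
  interpret A: cring A by fact
  interpret B: ring B by (rule ring_cong[OF A.ring_axioms]) (simp_all add: assms)
  show ?thesis
  proof (rule cringI[OF B.abelian_group_axioms comm_monoidI])
    show "x \<otimes>\<^bsub>B\<^esub> y = y \<otimes>\<^bsub>B\<^esub> x" if "x \<in> carrier B" "y \<in> carrier B" for x y
      using that by (simp add: assms A.m_comm)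
  qed (simp_all add: assms A.m_assoc A.l_distr)
qed

lemma module_cong:
  assumes "Module.module R M" "carrier S = carrier R" "add S = add R" "zero S = zero R" "monoid.mult S = monoid.mult R" "one S = one R"
  shows "Module.module S M"
proof -
  interpret M: Module.module R M by fact
  show ?thesis
    by (rule moduleI[OF cring_cong[OF M.is_cring] M.abelian_group_axioms])
      (simp_all add: assms M.smult_l_distr M.smult_r_distr M.smult_assoc1)
qed

lemma assoc_algebra_cong:
  assumes "assoc_algebra R M" "carrier S = carrier R" "add S = add R" "zero S = zero R" "monoid.mult S = monoid.mult R" "one S = one R"
  shows "assoc_algebra S M"
  using assms(1) module_cong[OF _ assms(2-), of M] unfolding assoc_algebra_def assms(2) by blast

lemma restr_simps [simp]:
  "carrier (restr f M) = carrier M" "monoid.mult (restr f M) = monoid.mult M" "one (restr f M) = one M"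
  "zero (restr f M) = zero M" "add (restr f M) = add M" "smult (restr f M) s x = smult M (f s) x"
  by (simp_all add: restr_def)

lemma self_alg_simps [simp]:
  "carrier (self_alg R) = carrier R" "monoid.mult (self_alg R) = monoid.mult R" "one (self_alg R) = one R"
  "zero (self_alg R) = zero R" "add (self_alg R) = add R" "smult (self_alg R) = monoid.mult R"
  by (simp_all add: self_alg_def)

lemma restr_restr: "restr q (restr f M) = restr (\<lambda>x. f (q x)) M"
  by (simp add: restr_def)

lemma restr_ring: "ring A \<Longrightarrow> ring (restr f A)" by (erule ring_cong) simp_all
lemma restr_cring: "cring A \<Longrightarrow> cring (restr f A)" by (erule cring_cong) simp_all
lemma restr_abelian_group: "abelian_group A \<Longrightarrow> abelian_group (restr f A)" by (erule abelian_group_cong) simp_all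

lemma module_restr:
  assumes "Module.module R' M" "f \<in> ring_hom R R'" "cring R"
  shows "Module.module R (restr f M)"
proof -
  interpret M: Module.module R' M by fact
  have c: "r \<in> carrier R \<Longrightarrow> f r \<in> carrier R'" for r using assms(2) by (rule ring_hom_closed)
  show ?thesis
    by (rule moduleI[OF assms(3) restr_abelian_group[OF M.abelian_group_axioms]])
      (simp_all add: c ring_hom_add[OF assms(2)] ring_hom_mult[OF assms(2)] ring_hom_one[OF assms(2)]
        M.smult_l_distr M.smult_r_distr M.smult_assoc1)
qed

lemma algebra_restr:
  assumes "algebra R' B" "f \<in> ring_hom R R'" "cring R"
  shows "algebra R (restr f B)"
proof -
  interpret B: algebra R' B by fact
  have c: "r \<in> carrier R \<Longrightarrow> f r \<in> carrier R'" for r using assms(2) by (rule ring_hom_closed)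
  have m: "Module.module R (restr f B)" by (rule module_restr[OF B.module_axioms assms(2,3)])
  have "cring B" using assms(1) by (simp add: algebra_def)
  then show ?thesis
    using m restr_cring unfolding algebra_def algebra_axioms_def
    by (simp add: c B.smult_assoc2)
qed

lemma self_alg_algebra:
  assumes "cring R" shows "algebra R (self_alg R)"
proof -
  interpret cring R by fact
  have c: "cring (self_alg R)" by (rule cring_cong[OF assms]) simp_all
  have "Module.module R (self_alg R)"
    by (rule moduleI[OF assms]) (use c in \<open>simp_all add: cring_def ring_def l_distr r_distr m_assoc\<close>)
  then show ?thesis using c unfolding algebra_def algebra_axioms_def by (simp add: m_assoc)
qed

lemma algebraD:
  assumes "algebra R A" shows "cring A" "ring A" "abelian_group A" "cring R" "Module.module R A"
proof -
  show "cring A" using assms by (simp add: algebra_def)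
  then show "ring A" "abelian_group A" by (simp_all add: cring_def ring_def)
  show "Module.module R A" using assms by (simp add: algebra_def)
  then show "cring R" by (simp add: Module.module_def)
qed

lemma str_map_closed: "algebra R A \<Longrightarrow> r \<in> carrier R \<Longrightarrow> str_map A r \<in> carrier A"
  unfolding str_map_def by (meson algebraD(2,5) module.smult_closed ring.ring_simprules(6))

lemma str_map_mult:
  assumes "algebra R A" "r \<in> carrier R" "a \<in> carrier A" shows "str_map A r \<otimes>\<^bsub>A\<^esub> a = r \<odot>\<^bsub>A\<^esub> a"
proof -
  interpret A: cring A using algebraD(1)[OF assms(1)] .
  interpret AM: algebra R A by fact
  show ?thesis using assms by (simp add: str_map_def AM.smult_assoc2)
qed

lemma str_map_ring_hom:
  assumes "algebra R A" shows "str_map A \<in> ring_hom R A"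
proof -
  interpret A: cring A using algebraD(1)[OF assms(1)] .
  interpret AM: algebra R A by fact
  show ?thesis
    by (rule ring_hom_memI) (simp_all add: str_map_closed[OF assms] str_map_mult[OF assms], simp_all add: str_map_def AM.smult_l_distr AM.smult_assoc1)
qed

lemma slin_id: "slin R f (restr f B) B (\<lambda>b. b)"
  by (rule slinI[OF addhomI]) simp_all

section \<open>Pseudorepresentations and semilinear maps\<close>

text \<open>The content of \<open>f o D = D' o g\<close> without the base changed algebra: both laws
  are compared directly on E (x)_R B for an R'-algebra B, instead of on the iterated product (E
  (x)_R R') (x)_R' B used by \<open>bc_law\<close>.\<close>

definition law_compat :: "('r, 'x) ring_scheme \<Rightarrow> ('r, 'e) module \<Rightarrow> ('r, 'e, 'u) law \<Rightarrow>
    ('s, 'y) ring_scheme \<Rightarrow> ('s, 'f) module \<Rightarrow> ('s, 'f, 'u) law \<Rightarrow> ('r \<Rightarrow> 's) \<Rightarrow> ('e \<Rightarrow> 'f) \<Rightarrow> bool" where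
  "law_compat R E D R' E' D' f g \<longleftrightarrow> (\<forall>B :: ('s,'u) module. algebra R' B \<longrightarrow>
     (\<forall>x\<in>carrier (tensor R E (restr f B)). D (restr f B) x = D' B (tmap R' E' B g (\<lambda>b. b) x)))"

lemma tensor_mapI:
  assumes "tensor_alg R E A" "tensor_alg R' E' A'" "f \<in> carrier R \<rightarrow> carrier R'" "slin R f E E' g" "slin R f A A' h"
  shows "tensor_map R E A R' E' A' f g h"
  using assms by (simp add: tensor_map_def tensor_map_axioms_def)

locale base_change =
  fixes R :: "('r,'x) ring_scheme" and E :: "('r,'e) module"
    and R' :: "('s,'y) ring_scheme" and E' :: "('s,'f) module" and f :: "'r \<Rightarrow> 's"
  assumes E: "assoc_algebra R E" and E': "assoc_algebra R' E'" and f: "f \<in> ring_hom R R'"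
begin

lemma R: "cring R" and R': "cring R'" using assoc_algebraD(4)[OF E] assoc_algebraD(4)[OF E'] .
sublocale R': cring R' by (rule R')
sublocale E': ring E' using assoc_algebraD(2)[OF E'] .
sublocale EM': Module.module R' E' using assoc_algebraD(1)[OF E'] .
sublocale E: ring E using assoc_algebraD(2)[OF E] .

abbreviation "S \<equiv> restr f (self_alg R')"
abbreviation "BC \<equiv> bc_alg R E f R'"

sublocale S: tensor_alg R E S
  by (rule tensor_alg.intro[OF E algebra_restr[OF self_alg_algebra[OF R'] f R]])

lemma bc_eq: "BC = tensor R E S" by (simp add: bc_alg_def)

lemma bc_assoc: "assoc_algebra R' BC"
  unfolding bc_eq by (rule assoc_algebra_cong[OF S.T_assoc_algebra]) simp_all

lemma fc: "r \<in> carrier R \<Longrightarrow> f r \<in> carrier R'" using f by (rule ring_hom_closed)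
lemma fPi: "f \<in> carrier R \<rightarrow> carrier R'" using fc by simp

lemma bc_pure_smult: "x \<in> carrier E \<Longrightarrow> a \<in> carrier R' \<Longrightarrow> b \<in> carrier R' \<Longrightarrow> a \<odot>\<^bsub>BC\<^esub> pure R E S x b = pure R E S x (a \<otimes>\<^bsub>R'\<^esub> b)"
  using S.smult_pure[of a x b] by (simp add: bc_eq)

lemma lin_ext_balanced:
  assumes "slin R f E E' g" shows "S.balanced E' (\<lambda>x r. r \<odot>\<^bsub>E'\<^esub> g x)"
  by (rule S.balancedI)
    (use assms in \<open>simp_all add: addhom_closed[OF slin_addhom] addhom_add[OF slin_addhom] slin_smult fc
      EM'.smult_l_distr EM'.smult_r_distr EM'.smult_assoc1[symmetric] R'.m_comm\<close>)

lemmas lin_ext_addhom = S.tensor_lift_addhom[OF assoc_algebraD(3)[OF E'] lin_ext_balanced, folded lin_ext_def bc_eq]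
lemmas lin_ext_pure = S.tensor_lift_pure[OF assoc_algebraD(3)[OF E'] lin_ext_balanced, folded lin_ext_def, simplified]

lemma E'_ab: "abelian_group E'" using assoc_algebraD(3)[OF E'] .

lemmas bc_ext = S.tensor_ext[folded bc_eq]

lemma lin_ext_smult:
  assumes g: "slin R f E E' g" and a: "a \<in> carrier R'" and X: "X \<in> carrier BC"
  shows "lin_ext E' g (a \<odot>\<^bsub>BC\<^esub> X) = a \<odot>\<^bsub>E'\<^esub> lin_ext E' g X"
proof (rule bc_ext[OF addhom_comp[OF _ lin_ext_addhom[OF g]] addhom_comp[OF lin_ext_addhom[OF g], of _ "\<lambda>y. a \<odot>\<^bsub>E'\<^esub> y"] E'_ab X])
  show "addhom BC BC (\<lambda>X. a \<odot>\<^bsub>BC\<^esub> X)" using S.smult_addhom[of a] a by (simp add: bc_eq)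
  show "addhom E' E' (\<lambda>y. a \<odot>\<^bsub>E'\<^esub> y)" by (rule addhomI) (simp_all add: a EM'.smult_r_distr)
  fix x b assume xb: "x \<in> carrier E" "b \<in> carrier S"
  then show "lin_ext E' g (a \<odot>\<^bsub>BC\<^esub> pure R E S x b) = a \<odot>\<^bsub>E'\<^esub> lin_ext E' g (pure R E S x b)"
    using a addhom_closed[OF slin_addhom[OF g]] by (simp add: bc_pure_smult lin_ext_pure[OF g] EM'.smult_assoc1)
qed

lemma lin_ext_alg_hom:
  assumes g: "slin R f E E' g" and gr: "g \<in> ring_hom E E'"
  shows "lin_ext E' g \<in> alg_hom R' BC E'"
proof -
  have gc: "x \<in> carrier E \<Longrightarrow> g x \<in> carrier E'" for x using gr by (rule ring_hom_closed)
  note sm = E'[unfolded assoc_algebra_def, THEN conjunct2, THEN conjunct2, rule_format]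
  have "lin_ext E' g \<in> ring_hom BC E'"
  proof (rule ring_hom_memI)
    fix X assume X: "X \<in> carrier BC"
    show "lin_ext E' g X \<in> carrier E'" using addhom_closed[OF lin_ext_addhom[OF g] X] .
    fix Y assume Y: "Y \<in> carrier BC"
    show "lin_ext E' g (X \<oplus>\<^bsub>BC\<^esub> Y) = lin_ext E' g X \<oplus>\<^bsub>E'\<^esub> lin_ext E' g Y"
      using addhom_add[OF lin_ext_addhom[OF g] X Y] .
    have ml: "addhom E' E' (\<lambda>y. y \<otimes>\<^bsub>E'\<^esub> z)" and mr: "addhom E' E' (\<lambda>y. z \<otimes>\<^bsub>E'\<^esub> y)" if "z \<in> carrier E'" for z
      by (rule addhomI, simp_all add: that E'.l_distr E'.r_distr)+
    show "lin_ext E' g (X \<otimes>\<^bsub>BC\<^esub> Y) = lin_ext E' g X \<otimes>\<^bsub>E'\<^esub> lin_ext E' g Y"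
    proof (rule bc_ext[OF addhom_comp[OF S.mult_addhom_l[folded bc_eq] lin_ext_addhom[OF g]] addhom_comp[OF lin_ext_addhom[OF g] ml] E'_ab X])
      show "Y \<in> carrier BC" "lin_ext E' g Y \<in> carrier E'" using Y addhom_closed[OF lin_ext_addhom[OF g] Y] by simp_all
      fix x a assume xa: "x \<in> carrier E" "a \<in> carrier S"
      show "lin_ext E' g (pure R E S x a \<otimes>\<^bsub>BC\<^esub> Y) = lin_ext E' g (pure R E S x a) \<otimes>\<^bsub>E'\<^esub> lin_ext E' g Y"
      proof (rule bc_ext[OF addhom_comp[OF S.mult_addhom_r[folded bc_eq] lin_ext_addhom[OF g]] addhom_comp[OF lin_ext_addhom[OF g] mr] E'_ab Y])
        show "pure R E S x a \<in> carrier BC" "lin_ext E' g (pure R E S x a) \<in> carrier E'"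
          using xa addhom_closed[OF lin_ext_addhom[OF g]] S.pure_closed[folded bc_eq] by simp_all
        fix y b assume yb: "y \<in> carrier E" "b \<in> carrier S"
        have "a \<odot>\<^bsub>E'\<^esub> g x \<otimes>\<^bsub>E'\<^esub> (b \<odot>\<^bsub>E'\<^esub> g y) = (a \<otimes>\<^bsub>R'\<^esub> b) \<odot>\<^bsub>E'\<^esub> (g x \<otimes>\<^bsub>E'\<^esub> g y)"
          using xa yb gc by (simp add: sm EM'.smult_assoc1[symmetric] R'.m_comm)
        then show "lin_ext E' g (pure R E S x a \<otimes>\<^bsub>BC\<^esub> pure R E S y b) = lin_ext E' g (pure R E S x a) \<otimes>\<^bsub>E'\<^esub> lin_ext E' g (pure R E S y b)"
          using xa yb by (simp add: S.pure_mult[folded bc_eq] lin_ext_pure[OF g] ring_hom_mult[OF gr])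
      qed
    qed
  next
    show "lin_ext E' g \<one>\<^bsub>BC\<^esub> = \<one>\<^bsub>E'\<^esub>"
      by (simp add: S.T_one[folded bc_eq] lin_ext_pure[OF g] ring_hom_one[OF gr])
  qed
  then show ?thesis using lin_ext_smult[OF g] by (simp add: alg_hom_def)
qed

text \<open>Adjunction between extension and restriction of scalars: since x (x) a = a (x (x) 1), an
  R'-algebra map on E (x)_R R' is determined by its values on the elements x (x) 1.\<close>

lemma alg_hom_bcD:
  fixes g defines "g1 \<equiv> \<lambda>x. g (pure R E S x \<one>\<^bsub>R'\<^esub>)"
  assumes g: "g \<in> alg_hom R' BC E'"
  shows "g1 \<in> ring_hom E E'" and "slin R f E E' g1"
    and "X \<in> carrier BC \<Longrightarrow> g X = lin_ext E' g1 X"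
proof -
  have gr: "g \<in> ring_hom BC E'" using g by (simp add: alg_hom_def)
  have gs: "\<And>r x. r \<in> carrier R' \<Longrightarrow> x \<in> carrier BC \<Longrightarrow> g (r \<odot>\<^bsub>BC\<^esub> x) = r \<odot>\<^bsub>E'\<^esub> g x" using g by (simp add: alg_hom_def)
  note pc = S.pure_closed[folded bc_eq, simplified]
  show 1: "g1 \<in> ring_hom E E'" unfolding g1_def
  proof (rule ring_hom_memI)
    fix x assume x: "x \<in> carrier E"
    show "g (pure R E S x \<one>\<^bsub>R'\<^esub>) \<in> carrier E'" using x by (simp add: ring_hom_closed[OF gr] pc)
    fix y assume y: "y \<in> carrier E"
    show "g (pure R E S (x \<otimes>\<^bsub>E\<^esub> y) \<one>\<^bsub>R'\<^esub>) = g (pure R E S x \<one>\<^bsub>R'\<^esub>) \<otimes>\<^bsub>E'\<^esub> g (pure R E S y \<one>\<^bsub>R'\<^esub>)"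
      using x y by (simp add: ring_hom_mult[OF gr, symmetric] pc S.pure_mult[folded bc_eq])
    show "g (pure R E S (x \<oplus>\<^bsub>E\<^esub> y) \<one>\<^bsub>R'\<^esub>) = g (pure R E S x \<one>\<^bsub>R'\<^esub>) \<oplus>\<^bsub>E'\<^esub> g (pure R E S y \<one>\<^bsub>R'\<^esub>)"
      using x y by (simp add: ring_hom_add[OF gr, symmetric] pc S.pure_add_left[folded bc_eq])
  next
    show "g (pure R E S \<one>\<^bsub>E\<^esub> \<one>\<^bsub>R'\<^esub>) = \<one>\<^bsub>E'\<^esub>" using ring_hom_one[OF gr] by (simp add: S.T_one[folded bc_eq])
  qed
  show 2: "slin R f E E' g1"
  proof (rule slinI[OF ring_hom_addhom[OF 1]])
    fix r x assume rx: "r \<in> carrier R" "x \<in> carrier E"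
    have "pure R E S (r \<odot>\<^bsub>E\<^esub> x) \<one>\<^bsub>R'\<^esub> = f r \<odot>\<^bsub>BC\<^esub> pure R E S x \<one>\<^bsub>R'\<^esub>"
      using rx S.pure_smult[of r x "\<one>\<^bsub>R'\<^esub>"] by (simp add: bc_pure_smult fc)
    then show "g1 (r \<odot>\<^bsub>E\<^esub> x) = f r \<odot>\<^bsub>E'\<^esub> g1 x" using rx by (simp add: g1_def gs fc pc)
  qed
  show "g X = lin_ext E' g1 X" if X: "X \<in> carrier BC"
  proof (rule bc_ext[OF ring_hom_addhom[OF gr] lin_ext_addhom[OF 2] E'_ab X])
    fix x a assume xa: "x \<in> carrier E" "a \<in> carrier S"
    have "pure R E S x a = a \<odot>\<^bsub>BC\<^esub> pure R E S x \<one>\<^bsub>R'\<^esub>" using xa by (simp add: bc_pure_smult)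
    then have "g (pure R E S x a) = a \<odot>\<^bsub>E'\<^esub> g1 x" using xa by (simp add: gs pc g1_def)
    then show "g (pure R E S x a) = lin_ext E' g1 (pure R E S x a)"
      using xa lin_ext_pure[OF 2, of x a] by simp
  qed
qed

text \<open>The canonical map (E (x)_R R') (x)_R' B -> E (x)_R B that is hidden in
  \<open>bc_law\<close>; on generators it sends (x (x) r) (x) b to x (x) rb.\<close>

definition contr :: "('s, 'b) module \<Rightarrow> (('e \<times> 's) list set \<times> 'b) list set \<Rightarrow> ('e \<times> 'b) list set" where
  "contr B = tensor_lift (tensor R E (restr f B))
        (\<lambda>X b. b \<odot>\<^bsub>tensor R E (restr f B)\<^esub> tmap R E (restr f B) (\<lambda>e. e) (str_map B) X)"

lemma bc_law_contr: "bc_law R E D f B Y = D (restr f B) (contr B Y)"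
  by (simp add: bc_law_def contr_def)

context
  fixes B :: "('s, 'b) module" assumes B: "algebra R' B"
begin

interpretation B: cring B using algebraD(1)[OF B] .
interpretation BM: algebra R' B by (rule B)
interpretation TB: tensor_alg R E "restr f B"
  by (rule tensor_alg.intro[OF E algebra_restr[OF B f R]])
interpretation TBC: tensor_alg R' BC B
  by (rule tensor_alg.intro[OF bc_assoc B])
interpretation tm: tensor_map R E S R E "restr f B" "\<lambda>r. r" "\<lambda>e. e" "str_map B"
proof (rule tensor_mapI[OF S.tensor_alg_axioms TB.tensor_alg_axioms])
  show "(\<lambda>r. r) \<in> carrier R \<rightarrow> carrier R" by simp
  show "slin R (\<lambda>r. r) E E (\<lambda>e. e)" by (rule slinI[OF addhomI]) simp_all
  show "slin R (\<lambda>r. r) S (restr f B) (str_map B)"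
    by (rule slinI[OF addhomI]) (simp_all add: str_map_closed[OF B] ring_hom_add[OF str_map_ring_hom[OF B]]
      ring_hom_mult[OF str_map_ring_hom[OF B]] fc str_map_mult[OF B])
qed

lemma slin_pure: "slin R f E BC (\<lambda>e. pure R E S e \<one>\<^bsub>R'\<^esub>)"
proof (rule slinI[OF addhomI])
  note pc = S.pure_closed[folded bc_eq, simplified]
  fix x assume x: "x \<in> carrier E"
  then show "pure R E S x \<one>\<^bsub>R'\<^esub> \<in> carrier BC" by (simp add: pc)
  show "pure R E S (x \<oplus>\<^bsub>E\<^esub> y) \<one>\<^bsub>R'\<^esub> = pure R E S x \<one>\<^bsub>R'\<^esub> \<oplus>\<^bsub>BC\<^esub> pure R E S y \<one>\<^bsub>R'\<^esub>" if "y \<in> carrier E" for y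
    using x that by (simp add: S.pure_add_left[folded bc_eq])
  show "pure R E S (r \<odot>\<^bsub>E\<^esub> x) \<one>\<^bsub>R'\<^esub> = f r \<odot>\<^bsub>BC\<^esub> pure R E S x \<one>\<^bsub>R'\<^esub>" if "r \<in> carrier R" for r
    using x that S.pure_smult[of r x "\<one>\<^bsub>R'\<^esub>"] by (simp add: bc_pure_smult fc)
qed

interpretation io: tensor_map R E "restr f B" R' BC B f "\<lambda>e. pure R E S e \<one>\<^bsub>R'\<^esub>" "\<lambda>b. b"
  by (rule tensor_mapI[OF TB.tensor_alg_axioms TBC.tensor_alg_axioms fPi slin_pure slin_id])

abbreviation "TB \<equiv> tensor R E (restr f B)"
abbreviation "tmB \<equiv> tmap R E (restr f B) (\<lambda>e. e) (str_map B)"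

lemma tm_smult: "r \<in> carrier R' \<Longrightarrow> X \<in> carrier BC \<Longrightarrow> tmB (r \<odot>\<^bsub>BC\<^esub> X) = str_map B r \<odot>\<^bsub>TB\<^esub> tmB X"
proof -
  have "str_map B \<in> ring_hom S (restr f B)" using str_map_ring_hom[OF B] by (simp add: ring_hom_def)
  then show "r \<in> carrier R' \<Longrightarrow> X \<in> carrier BC \<Longrightarrow> ?thesis" using tm.tmap_smult[of r X] by (simp add: bc_eq)
qed

lemma contr_balanced: "TBC.balanced TB (\<lambda>X b. b \<odot>\<^bsub>TB\<^esub> tmB X)"
proof (rule TBC.balancedI)
  note cl = tm.tmap_closed[folded bc_eq]
  note ad = addhom_add[OF tm.tmap_addhom, folded bc_eq]
  fix X a assume X: "X \<in> carrier BC" and a: "a \<in> carrier B"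
  show "a \<odot>\<^bsub>TB\<^esub> tmB X \<in> carrier TB" using X a by (simp add: cl TB.T_smult_closed)
  show "a \<odot>\<^bsub>TB\<^esub> tmB (X \<oplus>\<^bsub>BC\<^esub> Y) = a \<odot>\<^bsub>TB\<^esub> tmB X \<oplus>\<^bsub>TB\<^esub> a \<odot>\<^bsub>TB\<^esub> tmB Y" if "Y \<in> carrier BC" for Y
    using X a that by (simp add: ad cl addhom_add[OF TB.smult_addhom])
  show "(a \<oplus>\<^bsub>B\<^esub> b) \<odot>\<^bsub>TB\<^esub> tmB X = a \<odot>\<^bsub>TB\<^esub> tmB X \<oplus>\<^bsub>TB\<^esub> b \<odot>\<^bsub>TB\<^esub> tmB X" if "b \<in> carrier B" for b
    using X a that module.smult_l_distr[OF TB.T_module, of a b] by (simp add: cl)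
  show "a \<odot>\<^bsub>TB\<^esub> tmB (r \<odot>\<^bsub>BC\<^esub> X) = (r \<odot>\<^bsub>B\<^esub> a) \<odot>\<^bsub>TB\<^esub> tmB X" if "r \<in> carrier R'" for r
    using X a that module.smult_assoc1[OF TB.T_module, of a "str_map B r" "tmB X"] str_map_mult[OF B that a] B.m_comm[OF a str_map_closed[OF B that]]
    by (simp add: tm_smult cl str_map_closed[OF B])
qed

lemmas contr_addhom = TBC.tensor_lift_addhom[OF TB.T_abelian_group contr_balanced, folded contr_def]
lemmas contr_pure = TBC.tensor_lift_pure[OF TB.T_abelian_group contr_balanced, folded contr_def]

lemma contr_pure_pure:
  assumes "x \<in> carrier E" "r \<in> carrier R'" "b \<in> carrier B"
  shows "contr B (pure R' BC B (pure R E S x r) b) = pure R E (restr f B) x (r \<odot>\<^bsub>B\<^esub> b)"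
proof -
  have "b \<otimes>\<^bsub>B\<^esub> str_map B r = r \<odot>\<^bsub>B\<^esub> b" using assms str_map_mult[OF B assms(2,3)] B.m_comm[OF assms(3) str_map_closed[OF B assms(2)]] by simp
  then show ?thesis using assms TB.smult_pure[of b x "str_map B r"]
    by (simp add: contr_pure S.pure_closed[folded bc_eq] tm.tmap_pure str_map_closed[OF B])
qed

text \<open>The map x (x) b |-> (x (x) 1) (x) b is a right inverse of \<open>contr\<close>. Every
  element of E (x)_R B is therefore reached, and an equality of laws on the iterated product
  descends.\<close>

lemma contr_surj:
  assumes x: "x \<in> carrier TB"
  defines "Y \<equiv> tmap R' BC B (\<lambda>e. pure R E S e \<one>\<^bsub>R'\<^esub>) (\<lambda>b. b) x"
  shows "Y \<in> carrier (tensor R' BC B)" "contr B Y = x"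
    "slin R f E E' (\<lambda>x. g (pure R E S x \<one>\<^bsub>R'\<^esub>)) \<Longrightarrow> slin R' (\<lambda>r. r) BC E' g \<Longrightarrow>
       tmap R' E' B g (\<lambda>b. b) Y = tmap R' E' B (\<lambda>x. g (pure R E S x \<one>\<^bsub>R'\<^esub>)) (\<lambda>b. b) x"
proof -
  show "Y \<in> carrier (tensor R' BC B)" unfolding Y_def by (rule io.tmap_closed[OF x])
  show "contr B Y = x" unfolding Y_def
    by (rule TB.tensor_ext[OF addhom_comp[OF io.tmap_addhom contr_addhom] TB.addhom_id TB.T_abelian_group x])
      (simp add: io.tmap_pure contr_pure_pure)
  assume g1: "slin R f E E' (\<lambda>x. g (pure R E S x \<one>\<^bsub>R'\<^esub>))" and g: "slin R' (\<lambda>r. r) BC E' g"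
  interpret m1: tensor_map R E "restr f B" R' E' B f "\<lambda>x. g (pure R E S x \<one>\<^bsub>R'\<^esub>)" "\<lambda>b. b"
    by (rule tensor_mapI[OF TB.tensor_alg_axioms tensor_alg.intro[OF E' B] fPi g1 slin_id])
  interpret m2: tensor_map R' BC B R' E' B "\<lambda>r. r" g "\<lambda>b. b"
    by (rule tensor_mapI[OF TBC.tensor_alg_axioms tensor_alg.intro[OF E' B] _ g slinI[OF addhomI]]) simp_all
  show "tmap R' E' B g (\<lambda>b. b) Y = tmap R' E' B (\<lambda>x. g (pure R E S x \<one>\<^bsub>R'\<^esub>)) (\<lambda>b. b) x" unfolding Y_def
    by (rule TB.tensor_ext[OF addhom_comp[OF io.tmap_addhom m2.tmap_addhom] m1.tmap_addhom m1.T'.T_abelian_group x])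
      (simp add: io.tmap_pure m1.tmap_pure m2.tmap_pure S.pure_closed[folded bc_eq])
qed

text \<open>For the way back from E (x)_R B to the iterated product. Equality is tested on X (x) b,
  and then, with b fixed, on X = x (x) a inside E (x)_R R'.\<close>

lemma contr_tmap:
  assumes g1: "slin R f E E' g1" and g: "slin R' (\<lambda>r. r) BC E' g" and Y: "Y \<in> carrier (tensor R' BC B)"
    and gg1: "\<And>X. X \<in> carrier BC \<Longrightarrow> g X = lin_ext E' g1 X"
  shows "tmap R' E' B g1 (\<lambda>b. b) (contr B Y) = tmap R' E' B g (\<lambda>b. b) Y"
proof -
  interpret m1: tensor_map R E "restr f B" R' E' B f g1 "\<lambda>b. b"
    by (rule tensor_mapI[OF TB.tensor_alg_axioms tensor_alg.intro[OF E' B] fPi g1 slin_id])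
  interpret m2: tensor_map R' BC B R' E' B "\<lambda>r. r" g "\<lambda>b. b"
    by (rule tensor_mapI[OF TBC.tensor_alg_axioms tensor_alg.intro[OF E' B] _ g slinI[OF addhomI]]) simp_all
  show ?thesis
  proof (rule TBC.tensor_ext[OF addhom_comp[OF contr_addhom m1.tmap_addhom] m2.tmap_addhom m1.T'.T_abelian_group Y])
    fix X b assume X: "X \<in> carrier BC" and b: "b \<in> carrier B"
    have 1: "addhom BC (tensor R' BC B) (\<lambda>X. pure R' BC B X b)"
      by (rule addhomI) (simp_all add: b TBC.pure_closed TBC.pure_add_left)
    have 2: "addhom BC (tensor R' E' B) (\<lambda>X. tmap R' E' B g1 (\<lambda>b. b) (contr B (pure R' BC B X b)))"
      by (rule addhom_comp[OF addhom_comp[OF 1 contr_addhom] m1.tmap_addhom])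
    show "tmap R' E' B g1 (\<lambda>b. b) (contr B (pure R' BC B X b)) = tmap R' E' B g (\<lambda>b. b) (pure R' BC B X b)"
    proof (rule bc_ext[OF 2 addhom_comp[OF 1 m2.tmap_addhom] m1.T'.T_abelian_group X])
      fix x a assume xa: "x \<in> carrier E" "a \<in> carrier S"
      have "g (pure R E S x a) = a \<odot>\<^bsub>E'\<^esub> g1 x" using gg1[of "pure R E S x a"] xa S.pure_closed[folded bc_eq, of x a]
        by (simp add: lin_ext_pure[OF g1])
      then show "tmap R' E' B g1 (\<lambda>b. b) (contr B (pure R' BC B (pure R E S x a) b)) = tmap R' E' B g (\<lambda>b. b) (pure R' BC B (pure R E S x a) b)"
        using xa b addhom_closed[OF slin_addhom[OF g1]]
        by (simp add: contr_pure_pure m1.tmap_pure m2.tmap_pure S.pure_closed[folded bc_eq] m1.T'.pure_smult)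
    qed
  qed
qed

end

lemma slin_alg_hom: "g \<in> alg_hom R' BC E' \<Longrightarrow> slin R' (\<lambda>r. r) BC E' g"
  unfolding alg_hom_def by (auto intro!: slinI ring_hom_addhom)

text \<open>With its converse \<open>pseudo_morphismI\<close> this is the dictionary between
  morphisms of pseudorepresentations and semilinear ring maps compatible with the laws; the later
  arguments are carried out on the second side.\<close>

lemma pseudo_morphismD:
  fixes D :: "('r,'e,'u) law" and D' :: "('s,'f,'u) law"
  fixes g defines "g1 \<equiv> \<lambda>x. g (pure R E S x \<one>\<^bsub>R'\<^esub>)"
  assumes pm: "pseudo_morphism R E D R' E' D' f g"
  shows "g1 \<in> ring_hom E E'" "slin R f E E' g1" "law_compat R E D R' E' D' f g1"
    "X \<in> carrier BC \<Longrightarrow> g X = lin_ext E' g1 X"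
proof -
  have g: "g \<in> alg_hom R' BC E'" using pm by (simp add: pseudo_morphism_def)
  show "g1 \<in> ring_hom E E'" "X \<in> carrier BC \<Longrightarrow> g X = lin_ext E' g1 X" unfolding g1_def using alg_hom_bcD[OF g] by blast+
  show s: "slin R f E E' g1" unfolding g1_def using alg_hom_bcD[OF g] by blast
  show "law_compat R E D R' E' D' f g1" unfolding law_compat_def
  proof (intro allI impI ballI)
    fix B :: "('s,'u) module" and x assume B: "algebra R' B" and x: "x \<in> carrier (tensor R E (restr f B))"
    let ?Y = "tmap R' BC B (\<lambda>e. pure R E S e \<one>\<^bsub>R'\<^esub>) (\<lambda>b. b) x"
    note c = contr_surj[OF B x]
    have "bc_law R E D f B ?Y = D' B (tmap R' E' B g (\<lambda>b. b) ?Y)"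
      using pm B c(1) unfolding pseudo_morphism_def law_eq_def by blast
    then show "D (restr f B) x = D' B (tmap R' E' B g1 (\<lambda>b. b) x)"
      using c(2) c(3)[OF s[unfolded g1_def] slin_alg_hom[OF g]] by (simp add: bc_law_contr g1_def)
  qed
qed

lemma pseudo_morphismI:
  fixes D :: "('r,'e,'u) law" and D' :: "('s,'f,'u) law"
  assumes g1: "g1 \<in> ring_hom E E'" "slin R f E E' g1" and lc: "law_compat R E D R' E' D' f g1"
    and gg1: "\<And>X. X \<in> carrier BC \<Longrightarrow> g X = lin_ext E' g1 X"
  shows "pseudo_morphism R E D R' E' D' f g"
proof -
  interpret BC: ring BC using assoc_algebraD(2)[OF bc_assoc] .
  interpret BCM: Module.module R' BC using assoc_algebraD(1)[OF bc_assoc] .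
  note l = lin_ext_alg_hom[OF g1(2,1)]
  have lr: "lin_ext E' g1 \<in> ring_hom BC E'" using l by (simp add: alg_hom_def)
  have "g \<in> ring_hom BC E'"
    by (rule ring_hom_memI) (simp_all add: gg1 ring_hom_closed[OF lr] ring_hom_mult[OF lr] ring_hom_add[OF lr] ring_hom_one[OF lr])
  then have g: "g \<in> alg_hom R' BC E'" using l by (simp add: alg_hom_def gg1)
  have "D (restr f B) (contr B Y) = D' B (tmap R' E' B g (\<lambda>b. b) Y)"
    if B: "algebra R' B" and Y: "Y \<in> carrier (tensor R' BC B)" for B Y
    using lc B addhom_closed[OF contr_addhom[OF B] Y] contr_tmap[OF B g1(2) slin_alg_hom[OF g] Y gg1]
    unfolding law_compat_def by simp
  then show ?thesis unfolding pseudo_morphism_def law_eq_def using f g by (simp add: bc_law_contr)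
qed

end

section \<open>Submodules, spans and noetherian modules\<close>

text \<open>The ring is explicit because the same subset of E is regarded as a submodule over R and
  over the p-adic integers. Closure under negatives follows by multiplying with -1.\<close>

definition rsub :: "('r, 'x) ring_scheme \<Rightarrow> ('r, 'm) module \<Rightarrow> 'm set \<Rightarrow> bool" where
  "rsub R M N \<longleftrightarrow> N \<subseteq> carrier M \<and> \<zero>\<^bsub>M\<^esub> \<in> N \<and> (\<forall>x\<in>N. \<forall>y\<in>N. x \<oplus>\<^bsub>M\<^esub> y \<in> N) \<and>
     (\<forall>r\<in>carrier R. \<forall>x\<in>N. r \<odot>\<^bsub>M\<^esub> x \<in> N)"

lemma rsubD:
  assumes "rsub R M N"
  shows "N \<subseteq> carrier M" "\<zero>\<^bsub>M\<^esub> \<in> N" "\<And>x y. x \<in> N \<Longrightarrow> y \<in> N \<Longrightarrow> x \<oplus>\<^bsub>M\<^esub> y \<in> N"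
    "\<And>r x. r \<in> carrier R \<Longrightarrow> x \<in> N \<Longrightarrow> r \<odot>\<^bsub>M\<^esub> x \<in> N" "\<And>x. x \<in> N \<Longrightarrow> x \<in> carrier M"
  using assms by (auto simp: rsub_def)

lemma rsubI:
  assumes "\<And>x. x \<in> N \<Longrightarrow> x \<in> carrier M" "\<zero>\<^bsub>M\<^esub> \<in> N" "\<And>x y. x \<in> N \<Longrightarrow> y \<in> N \<Longrightarrow> x \<oplus>\<^bsub>M\<^esub> y \<in> N"
    "\<And>r x. r \<in> carrier R \<Longrightarrow> x \<in> N \<Longrightarrow> r \<odot>\<^bsub>M\<^esub> x \<in> N"
  shows "rsub R M N"
  using assms by (auto simp: rsub_def)

text \<open>Coefficient set and generating set vary independently: \<open>I = carrier R\<close>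
  gives the span of S, \<open>S = carrier M\<close> gives the submodule I M, and the mixed case is
  the I S of Nakayama's lemma.\<close>

inductive_set ispan :: "('r, 'm) module \<Rightarrow> 'r set \<Rightarrow> 'm set \<Rightarrow> 'm set" for M I S where
  zero: "\<zero>\<^bsub>M\<^esub> \<in> ispan M I S"
| add: "\<lbrakk>a \<in> I; s \<in> S; y \<in> ispan M I S\<rbrakk> \<Longrightarrow> a \<odot>\<^bsub>M\<^esub> s \<oplus>\<^bsub>M\<^esub> y \<in> ispan M I S"

lemma ispan_mono:
  assumes "I \<subseteq> J" "S \<subseteq> S'" shows "ispan M I S \<subseteq> ispan M J S'"
proof
  show "x \<in> ispan M J S'" if "x \<in> ispan M I S" for x
    using that by (induct rule: ispan.induct) (use assms in \<open>auto intro: ispan.intros\<close>)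
qed

locale pmodule = Module.module R M for R :: "('r, 'x) ring_scheme" and M :: "('r, 'm) module"
begin

lemma rsub_neg: "rsub R M N \<Longrightarrow> x \<in> N \<Longrightarrow> \<ominus>\<^bsub>M\<^esub> x \<in> N"
  using rsubD(4)[of R M N "\<ominus>\<^bsub>R\<^esub> \<one>\<^bsub>R\<^esub>" x] rsubD(5)[of R M N x] by (simp add: smult_l_minus)

lemma rsub_minus: "rsub R M N \<Longrightarrow> x \<in> N \<Longrightarrow> y \<in> N \<Longrightarrow> x \<ominus>\<^bsub>M\<^esub> y \<in> N"
  unfolding a_minus_def using rsub_neg rsubD(3) by metis

lemma rsub_carrier: "rsub R M (carrier M)"
  by (rule rsubI) auto

lemma rsub_subgroup: "rsub R M N \<Longrightarrow> subgroup N (add_monoid M)"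
  by (rule M.add.subgroupI) (use rsubD[of R M N] rsub_neg[of N] in \<open>auto simp: a_inv_def\<close>)

lemma ispan_minimal:
  assumes "\<zero>\<^bsub>M\<^esub> \<in> N" "\<And>x y. x \<in> N \<Longrightarrow> y \<in> N \<Longrightarrow> x \<oplus>\<^bsub>M\<^esub> y \<in> N" "\<And>a s. a \<in> I \<Longrightarrow> s \<in> S \<Longrightarrow> a \<odot>\<^bsub>M\<^esub> s \<in> N"
  shows "ispan M I S \<subseteq> N"
proof
  show "x \<in> N" if "x \<in> ispan M I S" for x
    using that by (induct rule: ispan.induct) (use assms in auto)
qed

lemma ispan_closed: "I \<subseteq> carrier R \<Longrightarrow> S \<subseteq> carrier M \<Longrightarrow> ispan M I S \<subseteq> carrier M"
  by (rule ispan_minimal) auto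

lemma ispan_add:
  assumes "I \<subseteq> carrier R" "S \<subseteq> carrier M" "x \<in> ispan M I S" "y \<in> ispan M I S"
  shows "x \<oplus>\<^bsub>M\<^esub> y \<in> ispan M I S"
  using assms(3)
proof (induct rule: ispan.induct)
  case zero
  then show ?case using assms(4) ispan_closed[OF assms(1,2)] by (simp add: subset_iff)
next
  case (add a s z)
  have c: "a \<odot>\<^bsub>M\<^esub> s \<in> carrier M" "z \<in> carrier M" "y \<in> carrier M"
    using assms add ispan_closed[OF assms(1,2)] by auto
  show ?case using ispan.add[OF add(1,2,4)] c by (simp add: M.a_assoc)
qed

lemma ispan_base: "a \<in> I \<Longrightarrow> s \<in> S \<Longrightarrow> I \<subseteq> carrier R \<Longrightarrow> S \<subseteq> carrier M \<Longrightarrow> a \<odot>\<^bsub>M\<^esub> s \<in> ispan M I S"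
  using ispan.add[OF _ _ ispan.zero, of a I s S M] by (metis M.r_zero smult_closed subsetD)

lemma ispan_rsub:
  assumes "ideal I R" "S \<subseteq> carrier M" shows "rsub R M (ispan M I S)"
proof -
  interpret I: ideal I R by fact
  have I: "I \<subseteq> carrier R" using I.Icarr by auto
  show ?thesis
  proof (rule rsubI)
    show "x \<in> carrier M" if "x \<in> ispan M I S" for x using that ispan_closed[OF I assms(2)] by auto
    show "\<zero>\<^bsub>M\<^esub> \<in> ispan M I S" by (rule ispan.zero)
    show "x \<oplus>\<^bsub>M\<^esub> y \<in> ispan M I S" if "x \<in> ispan M I S" "y \<in> ispan M I S" for x y
      using ispan_add[OF I assms(2) that] .
    fix r x assume r: "r \<in> carrier R" and x: "x \<in> ispan M I S"
    show "r \<odot>\<^bsub>M\<^esub> x \<in> ispan M I S" using x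
    proof (induct rule: ispan.induct)
      case zero
      then show ?case using r by (simp add: ispan.zero)
    next
      case (add a s y)
      have c: "a \<in> carrier R" "s \<in> carrier M" "y \<in> carrier M" using add assms I ispan_closed[OF I assms(2)] by auto
      have "(r \<otimes>\<^bsub>R\<^esub> a) \<odot>\<^bsub>M\<^esub> s \<oplus>\<^bsub>M\<^esub> r \<odot>\<^bsub>M\<^esub> y \<in> ispan M I S"
        using add r by (intro ispan.add I.I_l_closed)
      then show ?case using r c by (simp add: smult_r_distr smult_assoc1)
    qed
  qed
qed

lemma span_rsub: "S \<subseteq> carrier M \<Longrightarrow> rsub R M (ispan M (carrier R) S)"
  by (rule ispan_rsub[OF R.oneideal])

lemma span_base: "s \<in> S \<Longrightarrow> S \<subseteq> carrier M \<Longrightarrow> s \<in> ispan M (carrier R) S"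
  using ispan_base[of "\<one>\<^bsub>R\<^esub>" "carrier R" s S] by (auto simp: subset_iff)

lemma span_minimal: "rsub R M N \<Longrightarrow> S \<subseteq> N \<Longrightarrow> ispan M (carrier R) S \<subseteq> N"
  by (rule ispan_minimal) (auto dest: rsubD)

text \<open>Collects all multiples of one generator. Inductions on the number of generators, in
  Nakayama's lemma, the noetherian property, completeness and finiteness of quotients, rest on this
  normal form.\<close>

lemma ispan_insert:
  assumes "ideal I R" "insert s S \<subseteq> carrier M" "x \<in> ispan M I (insert s S)"
  shows "\<exists>a\<in>I. \<exists>y\<in>ispan M I S. x = a \<odot>\<^bsub>M\<^esub> s \<oplus>\<^bsub>M\<^esub> y"
  using assms(3)
proof (induct rule: ispan.induct)
  interpret I: ideal I R by fact
  case zero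
  show ?case using assms(2) by (intro bexI[of _ "\<zero>\<^bsub>R\<^esub>"] bexI[of _ "\<zero>\<^bsub>M\<^esub>"]) (auto intro: ispan.zero)
next
  interpret I: ideal I R by fact
  have S: "S \<subseteq> carrier M" "s \<in> carrier M" using assms by auto
  note sub = ispan_rsub[OF assms(1) S(1)]
  case (add b t z)
  then obtain a y where ay: "a \<in> I" "y \<in> ispan M I S" "z = a \<odot>\<^bsub>M\<^esub> s \<oplus>\<^bsub>M\<^esub> y" by blast
  have c: "a \<in> carrier R" "b \<in> carrier R" "y \<in> carrier M" "t \<in> carrier M"
    using ay add assms I.Icarr rsubD(5)[OF sub] by auto
  show ?case
  proof (cases "t = s")
    case True
    then show ?thesis using ay c S add
      by (intro bexI[of _ "b \<oplus>\<^bsub>R\<^esub> a"] bexI[of _ y]) (auto simp: smult_l_distr M.a_assoc)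
  next
    case False
    then have "b \<odot>\<^bsub>M\<^esub> t \<oplus>\<^bsub>M\<^esub> y \<in> ispan M I S" using add ay by (intro ispan.add) auto
    then show ?thesis using ay c S
      by (intro bexI[of _ a] bexI[of _ "b \<odot>\<^bsub>M\<^esub> t \<oplus>\<^bsub>M\<^esub> y"]) (auto simp: M.a_lcomm)
  qed
qed

lemma ispan_empty: "ispan M I {} = {\<zero>\<^bsub>M\<^esub>}"
  by (auto intro: ispan.zero elim: ispan.cases)

lemma ispan_ispan_le:
  assumes I: "ideal I R" and J: "ideal J R" and S: "S \<subseteq> carrier M" and K: "K \<subseteq> carrier R"
    and IJ: "\<And>a b. a \<in> I \<Longrightarrow> b \<in> J \<Longrightarrow> a \<otimes>\<^bsub>R\<^esub> b \<in> K"
  shows "ispan M I (ispan M J S) \<subseteq> ispan M K S"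
proof (rule ispan_minimal)
  note add = ispan_add[OF K S]
  show "\<zero>\<^bsub>M\<^esub> \<in> ispan M K S" by (rule ispan.zero)
  show "x \<oplus>\<^bsub>M\<^esub> y \<in> ispan M K S" if "x \<in> ispan M K S" "y \<in> ispan M K S" for x y using add that .
  fix a s assume a: "a \<in> I" and s: "s \<in> ispan M J S"
  have ac: "a \<in> carrier R" using a I ideal.Icarr by metis
  show "a \<odot>\<^bsub>M\<^esub> s \<in> ispan M K S" using s
  proof (induct rule: ispan.induct)
    case zero
    then show ?case using ac by (simp add: ispan.zero)
  next
    case (add b t y)
    have c: "b \<in> carrier R" "t \<in> carrier M" "y \<in> carrier M"
      using add S ideal.Icarr[OF J] rsubD(5)[OF ispan_rsub[OF J S]] by auto
    have "(a \<otimes>\<^bsub>R\<^esub> b) \<odot>\<^bsub>M\<^esub> t \<oplus>\<^bsub>M\<^esub> a \<odot>\<^bsub>M\<^esub> y \<in> ispan M K S"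
      using add a by (intro ispan.add IJ)
    then show ?case using c ac by (simp add: smult_r_distr smult_assoc1)
  qed
qed

lemma ispan_span:
  assumes I: "ideal I R" and S: "S \<subseteq> carrier M"
  shows "ispan M I (ispan M (carrier R) S) = ispan M I S"
proof (rule equalityI)
  interpret I: ideal I R by fact
  show "ispan M I (ispan M (carrier R) S) \<subseteq> ispan M I S"
    by (rule ispan_ispan_le[OF I R.oneideal S]) (auto intro: I.I_r_closed)
  show "ispan M I S \<subseteq> ispan M I (ispan M (carrier R) S)"
    using S by (intro ispan_mono) (auto intro: span_base)
qed

lemma ideal_smult_eq:
  assumes "ideal I R" shows "ideal_smult R I M = ispan M I (carrier M)"
proof (rule equalityI)
  note sub = ispan_rsub[OF assms order_refl]
  have I: "I \<subseteq> carrier R" using ideal.Icarr[OF assms] by auto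
  show "ideal_smult R I M \<subseteq> ispan M I (carrier M)" unfolding ideal_smult_def
    by (rule group.generate_subgroup_incl[OF M.a_group _ rsub_subgroup[OF sub]])
      (use I in \<open>auto intro: ispan_base\<close>)
  have H: "{a \<odot>\<^bsub>M\<^esub> x | a x. a \<in> I \<and> x \<in> carrier M} \<subseteq> carrier (add_monoid M)" using I by auto
  interpret G: subgroup "ideal_smult R I M" "add_monoid M"
    unfolding ideal_smult_def by (rule group.generate_is_subgroup[OF M.a_group H])
  show "ispan M I (carrier M) \<subseteq> ideal_smult R I M"
    by (rule ispan_minimal) (use G.one_closed G.m_closed in \<open>auto simp: ideal_smult_def intro: generate.incl\<close>)
qed

lemma ispan_finsum:
  assumes "finite S" "S \<subseteq> carrier M" "x \<in> ispan M (carrier R) S"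
  shows "\<exists>c\<in>S \<rightarrow> carrier R. x = finsum M (\<lambda>s. c s \<odot>\<^bsub>M\<^esub> s) S"
  using assms
proof (induct S arbitrary: x rule: finite_induct)
  case empty
  then show ?case by (simp add: ispan_empty)
next
  case (insert s S)
  obtain a y where ay: "a \<in> carrier R" "y \<in> ispan M (carrier R) S" "x = a \<odot>\<^bsub>M\<^esub> s \<oplus>\<^bsub>M\<^esub> y"
    using ispan_insert[OF R.oneideal insert(4,5)] by blast
  obtain c where c: "c \<in> S \<rightarrow> carrier R" "y = finsum M (\<lambda>s. c s \<odot>\<^bsub>M\<^esub> s) S" using insert ay by blast
  let ?c = "c(s := a)"
  have "finsum M (\<lambda>s. ?c s \<odot>\<^bsub>M\<^esub> s) S = finsum M (\<lambda>s. c s \<odot>\<^bsub>M\<^esub> s) S"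
    using insert c by (intro M.finsum_cong') (auto simp: Pi_iff)
  then have "finsum M (\<lambda>s. ?c s \<odot>\<^bsub>M\<^esub> s) (insert s S) = x"
    using insert(1,2,4) ay c by (subst M.finsum_insert) (auto simp: Pi_iff subset_iff)
  then show ?case using ay c by (intro bexI[of _ ?c]) auto
qed

lemma finsum_span:
  assumes "S \<subseteq> carrier M" "c \<in> S \<rightarrow> carrier R"
  shows "finsum M (\<lambda>s. c s \<odot>\<^bsub>M\<^esub> s) S \<in> ispan M (carrier R) S"
proof -
  note sub = span_rsub[OF assms(1)]
  have "finsum M (\<lambda>s. c s \<odot>\<^bsub>M\<^esub> s) S' \<in> ispan M (carrier R) S" if "S' \<subseteq> S" for S'
    using that
  proof (induct S' rule: infinite_finite_induct)
    case (insert s F)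
    have 1: "(\<lambda>s. c s \<odot>\<^bsub>M\<^esub> s) \<in> F \<rightarrow> carrier M" "c s \<odot>\<^bsub>M\<^esub> s \<in> carrier M" using insert assms by auto
    have "c s \<odot>\<^bsub>M\<^esub> s \<oplus>\<^bsub>M\<^esub> finsum M (\<lambda>s. c s \<odot>\<^bsub>M\<^esub> s) F \<in> ispan M (carrier R) S"
      using insert assms by (intro ispan.add) auto
    then show ?case using insert(1,2) 1 by simp
  qed (simp_all add: ispan.zero)
  then show ?thesis by blast
qed

lemma fg_module_iff: "fg_module R M \<longleftrightarrow> (\<exists>S. finite S \<and> S \<subseteq> carrier M \<and> carrier M = ispan M (carrier R) S)"
proof -
  have "carrier M = {finsum M (\<lambda>s. c s \<odot>\<^bsub>M\<^esub> s) S | c. c \<in> S \<rightarrow> carrier R} \<longleftrightarrow> carrier M = ispan M (carrier R) S"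
    if "finite S" "S \<subseteq> carrier M" for S
  proof -
    have "{finsum M (\<lambda>s. c s \<odot>\<^bsub>M\<^esub> s) S | c. c \<in> S \<rightarrow> carrier R} = ispan M (carrier R) S"
      using ispan_finsum[OF that] finsum_span[OF that(2)] by blast
    then show ?thesis by simp
  qed
  then show ?thesis unfolding fg_module_def by blast
qed

text \<open>Generators are eliminated one by one. From s = a s + y with a in I the unit 1 - a
  expresses s through the others, so I S loses nothing when s is dropped. The hypothesis on 1 - a
  says that I lies in the Jacobson radical.\<close>

lemma nakayama:
  assumes I: "ideal I R" and u: "\<And>a. a \<in> I \<Longrightarrow> \<one>\<^bsub>R\<^esub> \<ominus>\<^bsub>R\<^esub> a \<in> Units R"
  shows "finite S \<Longrightarrow> S \<subseteq> carrier M \<Longrightarrow> S \<subseteq> ispan M I S \<Longrightarrow> S \<subseteq> {\<zero>\<^bsub>M\<^esub>}"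
proof (induct S rule: finite_induct)
  case empty
  then show ?case by simp
next
  case (insert s S)
  have S: "S \<subseteq> carrier M" "s \<in> carrier M" using insert by auto
  note sub = ispan_rsub[OF I S(1)]
  obtain a y where ay: "a \<in> I" "y \<in> ispan M I S" "s = a \<odot>\<^bsub>M\<^esub> s \<oplus>\<^bsub>M\<^esub> y"
    using ispan_insert[OF I insert(4), of s] insert(5) by blast
  have c: "a \<in> carrier R" "y \<in> carrier M" using ay I ideal.Icarr rsubD(5)[OF sub] by metis+
  have "(\<one>\<^bsub>R\<^esub> \<ominus>\<^bsub>R\<^esub> a) \<odot>\<^bsub>M\<^esub> s = s \<oplus>\<^bsub>M\<^esub> \<ominus>\<^bsub>M\<^esub> (a \<odot>\<^bsub>M\<^esub> s)"
    using c S by (simp add: R.minus_eq smult_l_distr smult_l_minus)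
  also have "\<dots> = (a \<odot>\<^bsub>M\<^esub> s \<oplus>\<^bsub>M\<^esub> y) \<oplus>\<^bsub>M\<^esub> \<ominus>\<^bsub>M\<^esub> (a \<odot>\<^bsub>M\<^esub> s)" using ay(3) by simp
  also have "\<dots> = y" using c S by (simp add: M.a_comm[of "a \<odot>\<^bsub>M\<^esub> s"] M.a_assoc M.r_neg)
  finally have e: "(\<one>\<^bsub>R\<^esub> \<ominus>\<^bsub>R\<^esub> a) \<odot>\<^bsub>M\<^esub> s = y" .
  let ?v = "inv\<^bsub>R\<^esub> (\<one>\<^bsub>R\<^esub> \<ominus>\<^bsub>R\<^esub> a)"
  have v: "?v \<in> carrier R" "?v \<otimes>\<^bsub>R\<^esub> (\<one>\<^bsub>R\<^esub> \<ominus>\<^bsub>R\<^esub> a) = \<one>\<^bsub>R\<^esub>" using u[OF ay(1)] by auto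
  have "s = ?v \<odot>\<^bsub>M\<^esub> y" using e[symmetric] v S c by (simp add: smult_assoc1[symmetric])
  then have s: "s \<in> ispan M I S" using rsubD(4)[OF sub v(1) ay(2)] by simp
  have "ispan M I (insert s S) \<subseteq> ispan M I S"
  proof
    fix x assume "x \<in> ispan M I (insert s S)"
    then obtain b z where "b \<in> I" "z \<in> ispan M I S" "x = b \<odot>\<^bsub>M\<^esub> s \<oplus>\<^bsub>M\<^esub> z"
      using ispan_insert[OF I insert(4)] by blast
    then show "x \<in> ispan M I S" using rsubD(3)[OF sub] rsubD(4)[OF sub] s ideal.Icarr[OF I] by metis
  qed
  then have S0: "S \<subseteq> {\<zero>\<^bsub>M\<^esub>}" using insert by auto
  have "s = \<zero>\<^bsub>M\<^esub>"
  proof -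
    have "ispan M I S \<subseteq> {\<zero>\<^bsub>M\<^esub>}" by (rule ispan_minimal) (use S0 ideal.Icarr[OF I] in auto)
    then show ?thesis using s by auto
  qed
  then show ?case using S0 by simp
qed

end

lemma (in abelian_group) add_minus_cancel:
  assumes "p \<in> carrier G" "z \<in> carrier G" "w \<in> carrier G"
  shows "(p \<oplus> z) \<ominus> (p \<oplus> w) = z \<ominus> w" "(z \<ominus> w) \<oplus> (p \<oplus> w) = p \<oplus> z"
proof -
  have "(p \<oplus> z) \<ominus> (p \<oplus> w) = (p \<oplus> \<ominus> p) \<oplus> (z \<oplus> \<ominus> w)"
    using assms by (simp add: minus_eq minus_add a_ac)
  then show "(p \<oplus> z) \<ominus> (p \<oplus> w) = z \<ominus> w" using assms by (simp add: r_neg minus_eq)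
  have "(z \<ominus> w) \<oplus> (p \<oplus> w) = (p \<oplus> z) \<oplus> (w \<oplus> \<ominus> w)"
    using assms by (simp add: minus_eq a_ac)
  then show "(z \<ominus> w) \<oplus> (p \<oplus> w) = p \<oplus> z" using assms by (simp add: r_neg)
qed

lemma (in cring) rsub_self_ideal:
  assumes "rsub R (self_alg R) I" shows "ideal I R"
proof (rule idealI[OF ring_axioms])
  have sm: "a \<in> I \<Longrightarrow> x \<in> carrier R \<Longrightarrow> x \<otimes> a \<in> I" for a x using rsubD(4)[OF assms] by simp
  have c: "a \<in> I \<Longrightarrow> a \<in> carrier R" for a using rsubD(5)[OF assms] by simp
  show "a \<in> I \<Longrightarrow> x \<in> carrier R \<Longrightarrow> x \<otimes> a \<in> I" for a x by (rule sm)
  show "a \<in> I \<Longrightarrow> x \<in> carrier R \<Longrightarrow> a \<otimes> x \<in> I" for a x using sm m_comm c by metis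
  have neg: "a \<in> I \<Longrightarrow> \<ominus> a \<in> I" for a using sm[of a "\<ominus> \<one>"] c[of a] by (simp add: l_minus)
  show "subgroup I (add_monoid R)"
    by (rule add.subgroupI) (use c neg rsubD(2,3)[OF assms] in \<open>auto simp: a_inv_def\<close>)
qed

lemma (in cring) ideal_rsub_self:
  assumes "ideal I R" shows "rsub R (self_alg R) I"
proof -
  interpret ideal I R by fact
  show ?thesis by (rule rsubI) (auto simp: I_l_closed)
qed

lemma (in cring) idealI':
  assumes "\<And>x. x \<in> I \<Longrightarrow> x \<in> carrier R" "\<zero> \<in> I" "\<And>x y. x \<in> I \<Longrightarrow> y \<in> I \<Longrightarrow> x \<oplus> y \<in> I"
    "\<And>r x. r \<in> carrier R \<Longrightarrow> x \<in> I \<Longrightarrow> r \<otimes> x \<in> I"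
  shows "ideal I R"
  by (rule rsub_self_ideal, rule rsubI) (use assms in simp_all)

section \<open>Finitely generated modules over a noetherian ring\<close>

locale noeth_module = pmodule R M + noetherian_ring R for R :: "('r, 'x) ring_scheme" and M :: "('r, 'm) module"
begin

text \<open>Induction on the generators of the ambient span: N is generated by elements realizing
  generators of the ideal of leading coefficients at s, together with generators of the part of N in
  the span of the rest.\<close>

lemma noeth_fg:
  "finite S \<Longrightarrow> S \<subseteq> carrier M \<Longrightarrow> rsub R M N \<Longrightarrow> N \<subseteq> ispan M (carrier R) S \<Longrightarrow>
    \<exists>T. finite T \<and> T \<subseteq> N \<and> N = ispan M (carrier R) T"
proof (induct S arbitrary: N rule: finite_induct)
  case empty
  then have "N = {\<zero>\<^bsub>M\<^esub>}" using rsubD(2)[OF empty(2)] by (auto simp: ispan_empty)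
  then show ?case by (intro exI[of _ "{}"]) (simp add: ispan_empty)
next
  case (insert s S)
  have S: "S \<subseteq> carrier M" "s \<in> carrier M" using insert by auto
  note sub = span_rsub[OF S(1)] and N = insert(5)
  \<comment> \<open>The ideal of leading coefficients at s of the elements of
    \<open>N\<close>.\<close>
  define I where "I = {r \<in> carrier R. \<exists>y\<in>ispan M (carrier R) S. r \<odot>\<^bsub>M\<^esub> s \<oplus>\<^bsub>M\<^esub> y \<in> N}"
  have "ideal I R"
  proof (rule R.idealI')
    show "x \<in> carrier R" if "x \<in> I" for x using that by (simp add: I_def)
    show "\<zero>\<^bsub>R\<^esub> \<in> I" unfolding I_def using S rsubD(2)[OF N] by (auto intro!: bexI[of _ "\<zero>\<^bsub>M\<^esub>"] ispan.zero)
    fix x assume "x \<in> I"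
    then obtain a where a: "x \<in> carrier R" "a \<in> ispan M (carrier R) S" "x \<odot>\<^bsub>M\<^esub> s \<oplus>\<^bsub>M\<^esub> a \<in> N" by (auto simp: I_def)
    have ac: "a \<in> carrier M" using a rsubD(5)[OF sub] by auto
    show "r \<otimes>\<^bsub>R\<^esub> x \<in> I" if r: "r \<in> carrier R" for r
      unfolding I_def using r a ac S rsubD(4)[OF N r a(3)] rsubD(4)[OF sub r a(2)]
      by (auto intro!: bexI[of _ "r \<odot>\<^bsub>M\<^esub> a"] simp: smult_r_distr smult_assoc1)
    fix y assume "y \<in> I"
    then obtain b where b: "y \<in> carrier R" "b \<in> ispan M (carrier R) S" "y \<odot>\<^bsub>M\<^esub> s \<oplus>\<^bsub>M\<^esub> b \<in> N" by (auto simp: I_def)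
    have bc: "b \<in> carrier M" using b rsubD(5)[OF sub] by auto
    have "(x \<odot>\<^bsub>M\<^esub> s \<oplus>\<^bsub>M\<^esub> a) \<oplus>\<^bsub>M\<^esub> (y \<odot>\<^bsub>M\<^esub> s \<oplus>\<^bsub>M\<^esub> b) = (x \<oplus>\<^bsub>R\<^esub> y) \<odot>\<^bsub>M\<^esub> s \<oplus>\<^bsub>M\<^esub> (a \<oplus>\<^bsub>M\<^esub> b)"
      using a b ac bc S by (simp add: smult_l_distr M.a_ac)
    then show "x \<oplus>\<^bsub>R\<^esub> y \<in> I"
      unfolding I_def using a b ac bc rsubD(3)[OF N a(3) b(3)] rsubD(3)[OF sub a(2) b(2)] by auto
  qed
  then obtain A where A: "A \<subseteq> carrier R" "finite A" "I = genideal R A" using finetely_gen by blast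
  have AI: "A \<subseteq> I" using A R.genideal_self by simp
  then have "\<forall>a\<in>A. \<exists>y\<in>ispan M (carrier R) S. a \<odot>\<^bsub>M\<^esub> s \<oplus>\<^bsub>M\<^esub> y \<in> N" by (auto simp: I_def)
  then obtain y where y: "\<And>a. a \<in> A \<Longrightarrow> y a \<in> ispan M (carrier R) S \<and> a \<odot>\<^bsub>M\<^esub> s \<oplus>\<^bsub>M\<^esub> y a \<in> N" by metis
  let ?n = "\<lambda>a. a \<odot>\<^bsub>M\<^esub> s \<oplus>\<^bsub>M\<^esub> y a"
  have NS: "rsub R M (N \<inter> ispan M (carrier R) S)"
    using N sub unfolding rsub_def by auto
  obtain T' where T': "finite T'" "T' \<subseteq> N \<inter> ispan M (carrier R) S" "N \<inter> ispan M (carrier R) S = ispan M (carrier R) T'"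
    using insert(3)[OF S(1) NS] by blast
  let ?T = "?n ` A \<union> T'"
  have TN: "?T \<subseteq> N" using y T' by auto
  then have TM: "?T \<subseteq> carrier M" using rsubD(1)[OF N] by auto
  note Tsub = span_rsub[OF TM]
  \<comment> \<open>Leading coefficients attained inside the span of the chosen elements. This is an
    ideal containing the generators A of I, hence contains I; no element of I has to be written out
    in terms of A.\<close>
  define J where "J = {r \<in> carrier R. \<exists>z\<in>ispan M (carrier R) S. r \<odot>\<^bsub>M\<^esub> s \<oplus>\<^bsub>M\<^esub> z \<in> ispan M (carrier R) ?T}"
  have "ideal J R"
  proof (rule R.idealI')
    show "x \<in> carrier R" if "x \<in> J" for x using that by (simp add: J_def)
    show "\<zero>\<^bsub>R\<^esub> \<in> J" unfolding J_def using S by (auto intro!: bexI[of _ "\<zero>\<^bsub>M\<^esub>"] ispan.zero)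
    fix x assume "x \<in> J"
    then obtain a where a: "x \<in> carrier R" "a \<in> ispan M (carrier R) S" "x \<odot>\<^bsub>M\<^esub> s \<oplus>\<^bsub>M\<^esub> a \<in> ispan M (carrier R) ?T" by (auto simp: J_def)
    have ac: "a \<in> carrier M" using a rsubD(5)[OF sub] by auto
    show "r \<otimes>\<^bsub>R\<^esub> x \<in> J" if r: "r \<in> carrier R" for r
      unfolding J_def using r a ac S rsubD(4)[OF Tsub r a(3)] rsubD(4)[OF sub r a(2)]
      by (auto intro!: bexI[of _ "r \<odot>\<^bsub>M\<^esub> a"] simp: smult_r_distr smult_assoc1)
    fix y assume "y \<in> J"
    then obtain b where b: "y \<in> carrier R" "b \<in> ispan M (carrier R) S" "y \<odot>\<^bsub>M\<^esub> s \<oplus>\<^bsub>M\<^esub> b \<in> ispan M (carrier R) ?T" by (auto simp: J_def)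
    have bc: "b \<in> carrier M" using b rsubD(5)[OF sub] by auto
    have "(x \<odot>\<^bsub>M\<^esub> s \<oplus>\<^bsub>M\<^esub> a) \<oplus>\<^bsub>M\<^esub> (y \<odot>\<^bsub>M\<^esub> s \<oplus>\<^bsub>M\<^esub> b) = (x \<oplus>\<^bsub>R\<^esub> y) \<odot>\<^bsub>M\<^esub> s \<oplus>\<^bsub>M\<^esub> (a \<oplus>\<^bsub>M\<^esub> b)"
      using a b ac bc S by (simp add: smult_l_distr M.a_ac)
    then show "x \<oplus>\<^bsub>R\<^esub> y \<in> J"
      unfolding J_def using a b ac bc rsubD(3)[OF Tsub a(3) b(3)] rsubD(3)[OF sub a(2) b(2)] by auto
  qed
  moreover have "A \<subseteq> J"
  proof
    fix a assume a: "a \<in> A"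
    then have "?n a \<in> ispan M (carrier R) ?T" by (intro span_base[OF _ TM]) auto
    then show "a \<in> J" unfolding J_def using y[OF a] A(1) a by blast
  qed
  ultimately have IJ: "I \<subseteq> J" unfolding A(3) by (rule R.genideal_minimal)
  have "N \<subseteq> ispan M (carrier R) ?T"
  proof
    fix x assume x: "x \<in> N"
    then obtain r z where rz: "r \<in> carrier R" "z \<in> ispan M (carrier R) S" "x = r \<odot>\<^bsub>M\<^esub> s \<oplus>\<^bsub>M\<^esub> z"
      using ispan_insert[OF R.oneideal insert(4), of x] insert(6) by blast
    then have "r \<in> J" using IJ x by (auto simp: I_def)
    then obtain w where w: "w \<in> ispan M (carrier R) S" "r \<odot>\<^bsub>M\<^esub> s \<oplus>\<^bsub>M\<^esub> w \<in> ispan M (carrier R) ?T" by (auto simp: J_def)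
    have c: "z \<in> carrier M" "w \<in> carrier M" using rz w rsubD(5)[OF sub] by auto
    \<comment> \<open>Subtracting a spanned element with the same leading coefficient leaves the
      span of \<open>S\<close> and stays in N, where the induction hypothesis applies.\<close>
    have e: "x \<ominus>\<^bsub>M\<^esub> (r \<odot>\<^bsub>M\<^esub> s \<oplus>\<^bsub>M\<^esub> w) = z \<ominus>\<^bsub>M\<^esub> w"
      using rz c S by (simp add: M.add_minus_cancel)
    have "r \<odot>\<^bsub>M\<^esub> s \<oplus>\<^bsub>M\<^esub> w \<in> N" using w span_minimal[OF N TN] by auto
    then have "x \<ominus>\<^bsub>M\<^esub> (r \<odot>\<^bsub>M\<^esub> s \<oplus>\<^bsub>M\<^esub> w) \<in> N \<inter> ispan M (carrier R) S"
      using rsub_minus[OF N x, of "r \<odot>\<^bsub>M\<^esub> s \<oplus>\<^bsub>M\<^esub> w"] rsub_minus[OF sub rz(2) w(1)] unfolding e by simp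
    then have "z \<ominus>\<^bsub>M\<^esub> w \<in> ispan M (carrier R) ?T" using T'(3) ispan_mono[of "carrier R" "carrier R" T' ?T M] e by auto
    then have "(z \<ominus>\<^bsub>M\<^esub> w) \<oplus>\<^bsub>M\<^esub> (r \<odot>\<^bsub>M\<^esub> s \<oplus>\<^bsub>M\<^esub> w) \<in> ispan M (carrier R) ?T" using w rsubD(3)[OF Tsub] by blast
    moreover have "(z \<ominus>\<^bsub>M\<^esub> w) \<oplus>\<^bsub>M\<^esub> (r \<odot>\<^bsub>M\<^esub> s \<oplus>\<^bsub>M\<^esub> w) = x"
      using rz c S by (simp add: M.add_minus_cancel)
    ultimately show "x \<in> ispan M (carrier R) ?T" by simp
  qed
  moreover have "ispan M (carrier R) ?T \<subseteq> N" by (rule span_minimal[OF N TN])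
  moreover have "finite ?T" using A T' by simp
  ultimately show ?case using TN by (intro exI[of _ ?T]) blast
qed

text \<open>The union of a chain is finitely generated, and its finitely many generators lie in a
  single member, which is then the whole union. Zorn's lemma finishes.\<close>

lemma noeth_max:
  assumes fg: "fg_module R M" and ne: "\<F> \<noteq> {}" and sub: "\<And>N. N \<in> \<F> \<Longrightarrow> rsub R M N"
  shows "\<exists>L\<in>\<F>. \<forall>X\<in>\<F>. L \<subseteq> X \<longrightarrow> X = L"
proof (rule subset_Zorn_nonempty[OF ne])
  fix C assume C: "C \<noteq> {}" "subset.chain \<F> C"
  then have CF: "C \<subseteq> \<F>" and ch: "\<And>X Y. X \<in> C \<Longrightarrow> Y \<in> C \<Longrightarrow> X \<subseteq> Y \<or> Y \<subseteq> X"
    by (auto simp: subset_chain_def)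
  have U: "rsub R M (\<Union>C)"
  proof (rule rsubI)
    show "x \<in> carrier M" if "x \<in> \<Union>C" for x using that CF rsubD(5)[OF sub] by blast
    show "\<zero>\<^bsub>M\<^esub> \<in> \<Union>C" using C(1) CF rsubD(2)[OF sub] by blast
    show "r \<odot>\<^bsub>M\<^esub> x \<in> \<Union>C" if "r \<in> carrier R" "x \<in> \<Union>C" for r x using that CF rsubD(4)[OF sub] by blast
    fix x y assume "x \<in> \<Union>C" "y \<in> \<Union>C"
    then obtain X Y where XY: "X \<in> C" "Y \<in> C" "x \<in> X" "y \<in> Y" by blast
    then have "\<exists>Z\<in>C. x \<in> Z \<and> y \<in> Z" using ch by blast
    then show "x \<oplus>\<^bsub>M\<^esub> y \<in> \<Union>C" using CF rsubD(3)[OF sub] by blast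
  qed
  obtain S where S: "finite S" "S \<subseteq> carrier M" "carrier M = ispan M (carrier R) S" using fg by (auto simp: fg_module_iff)
  obtain T where T: "finite T" "T \<subseteq> \<Union>C" "\<Union>C = ispan M (carrier R) T"
    using noeth_fg[OF S(1,2) U] rsubD(1)[OF U] S(3) by auto
  obtain B where B: "B \<in> C" "T \<subseteq> B" using finite_subset_Union_chain[OF T(1,2) C] .
  have "\<Union>C \<subseteq> B" unfolding T(3) by (rule span_minimal[OF sub B(2)]) (use B CF in auto)
  then have "\<Union>C = B" using B by auto
  then show "\<Union>C \<in> \<F>" using B CF by auto
qed

end

section \<open>Powers of ideals and noetherian local rings\<close>

context cring
begin

lemma ideal_pow_ideal: "ideal I R \<Longrightarrow> ideal (ideal_pow R I n) R"
  by (induct n) (simp_all add: oneideal ideal_prod_is_ideal)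

lemma ideal_pow_Suc_subset: "ideal I R \<Longrightarrow> ideal_pow R I (Suc n) \<subseteq> ideal_pow R I n"
  using ideal_prod_inter[of I "ideal_pow R I n"] ideal_pow_ideal[of I n] by auto

lemma ideal_pow_antimono:
  assumes "ideal I R" "m \<le> n" shows "ideal_pow R I n \<subseteq> ideal_pow R I m"
  using assms(2) by (induct n rule: dec_induct) (use ideal_pow_Suc_subset[OF assms(1)] in blast)+

lemma ideal_prod_carrier_l: "ideal I R \<Longrightarrow> carrier R \<cdot> I = I"
  using ideal_prod_one[of I] ideal_prod_commute[OF oneideal, of I] by simp

lemma ideal_pow_add: "ideal I R \<Longrightarrow> ideal_pow R I (k + l) = ideal_pow R I k \<cdot> ideal_pow R I l"
  by (induct k) (simp_all add: ideal_prod_carrier_l ideal_pow_ideal ideal_prod_assoc)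

lemma ideal_pow_1: "ideal I R \<Longrightarrow> ideal_pow R I (Suc 0) = I"
  by (simp add: ideal_prod_one)

lemma noeth_self:
  assumes "noetherian_ring R" shows "noeth_module R (self_alg R)" "fg_module R (self_alg R)"
proof -
  have m: "Module.module R (self_alg R)" using algebraD(5)[OF self_alg_algebra[OF is_cring]] .
  then show "noeth_module R (self_alg R)" using assms by (simp add: noeth_module_def pmodule_def)
  interpret M: pmodule R "self_alg R" using m by (simp add: pmodule_def)
  have "x \<in> ispan (self_alg R) (carrier R) {\<one>}" if "x \<in> carrier R" for x
    using M.ispan_base[of x "carrier R" \<one> "{\<one>}"] that by simp
  then have "carrier (self_alg R) = ispan (self_alg R) (carrier R) {\<one>}"
    using M.ispan_closed[of "carrier R" "{\<one>}"] by auto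
  then show "fg_module R (self_alg R)" unfolding M.fg_module_iff by (intro exI[of _ "{\<one>}"]) simp
qed

lemma noeth_ideal_max:
  assumes "noetherian_ring R" "\<F> \<noteq> {}" "\<And>J. J \<in> \<F> \<Longrightarrow> ideal J R"
  shows "\<exists>L\<in>\<F>. \<forall>X\<in>\<F>. L \<subseteq> X \<longrightarrow> X = L"
  using noeth_module.noeth_max[OF noeth_self[OF assms(1)] assms(2)] ideal_rsub_self assms(3) by blast

text \<open>Noetherian induction in place of a multinomial expansion. If c is maximal among the
  counterexamples above b and a lies in I but not in c, then c : a and c + (a) are strictly larger
  than c, so they contain powers I^l and I^m; the product I^(m+l) then lies in c.\<close>

lemma pow_subset_of_radical:
  assumes noeth: "noetherian_ring R" and b: "ideal b R" and I: "ideal I R"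
    and rad: "\<And>a. a \<in> I \<Longrightarrow> \<exists>n::nat. a [^] n \<in> b"
  shows "\<exists>k. ideal_pow R I k \<subseteq> b"
proof (rule ccontr)
  assume contra: "\<not> ?thesis"
  let ?F = "{c. ideal c R \<and> b \<subseteq> c \<and> \<not> (\<exists>k. ideal_pow R I k \<subseteq> c)}"
  have "b \<in> ?F" using contra b by simp
  then have ne: "?F \<noteq> {}" by (metis empty_iff)
  obtain c where c: "c \<in> ?F" and max: "\<And>X. X \<in> ?F \<Longrightarrow> c \<subseteq> X \<Longrightarrow> X = c"
    using noeth_ideal_max[OF noeth ne] by auto
  have ci: "ideal c R" and cb: "b \<subseteq> c" and cn: "\<And>k. \<not> ideal_pow R I k \<subseteq> c" using c by auto
  interpret c: ideal c R by (rule ci)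
  have big: "\<exists>k. ideal_pow R I k \<subseteq> X" if "ideal X R" "c \<subseteq> X" "X \<noteq> c" for X
    using max[of X] that cb by blast
  obtain a where a: "a \<in> I" "a \<notin> c" using cn[of "Suc 0"] ideal_pow_1[OF I] by auto
  have ac: "a \<in> carrier R" using ideal.Icarr[OF I a(1)] .
  \<comment> \<open>The least exponent is positive, since exponent 0 would put 1 into c and make c
    contain I^0. Its predecessor k gives an element a^k of c : a outside c.\<close>
  define n where "n = (LEAST n::nat. a [^] n \<in> c)"
  have ex: "\<exists>n::nat. a [^] n \<in> c" using rad[OF a(1)] cb by blast
  have n: "a [^] n \<in> c" unfolding n_def using ex by (rule LeastI_ex)
  have "n \<noteq> 0"
  proof
    assume "n = 0"
    then have "\<one> \<in> c" using n by simp
    then have "c = carrier R" by (rule c.one_imp_carrier)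
    then show False using cn[of 0] by simp
  qed
  then obtain k where k: "n = Suc k" by (cases n) auto
  let ?e = "a [^] k"
  have e: "?e \<notin> c" using not_less_Least[of k "\<lambda>n. a [^] n \<in> c"] k n_def by simp
  have ea: "?e \<otimes> a \<in> c" using n k by simp
  \<comment> \<open>The colon ideal c : a and the sum c + (a).\<close>
  let ?q = "{r \<in> carrier R. r \<otimes> a \<in> c}" and ?s = "{x \<oplus> r \<otimes> a | x r. x \<in> c \<and> r \<in> carrier R}"
  have q: "ideal ?q R" by (rule idealI') (use ac in \<open>auto simp: l_distr m_assoc c.I_l_closed\<close>)
  obtain l where l: "ideal_pow R I l \<subseteq> ?q"
  proof -
    have "c \<subseteq> ?q" using ac c.I_r_closed c.Icarr by auto
    moreover have "?e \<in> ?q" using ea ac by simp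
    ultimately show ?thesis using big[OF q] e that by metis
  qed
  have s: "ideal ?s R"
  proof (rule idealI')
    show "x \<in> carrier R" if "x \<in> ?s" for x using that ac c.Icarr by auto
    show "\<zero> \<in> ?s" using ac by (auto intro!: exI[of _ \<zero>] c.zero_closed)
    fix x assume "x \<in> ?s"
    then obtain u r where x: "x = u \<oplus> r \<otimes> a" "u \<in> c" "r \<in> carrier R" by blast
    show "t \<otimes> x \<in> ?s" if t: "t \<in> carrier R" for t
    proof -
      have "t \<otimes> x = t \<otimes> u \<oplus> (t \<otimes> r) \<otimes> a" using x t ac c.Icarr[OF x(2)] by (simp add: r_distr m_assoc)
      then show ?thesis using x t c.I_l_closed by blast
    qed
    fix y assume "y \<in> ?s"
    then obtain v r' where y: "y = v \<oplus> r' \<otimes> a" "v \<in> c" "r' \<in> carrier R" by blast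
    have "x \<oplus> y = (u \<oplus> v) \<oplus> (r \<oplus> r') \<otimes> a"
      using x y ac c.Icarr[OF x(2)] c.Icarr[OF y(2)] by (simp add: l_distr a_ac)
    then show "x \<oplus> y \<in> ?s" using x y c.a_closed by blast
  qed
  have cs: "c \<subseteq> ?s"
  proof
    fix x assume x: "x \<in> c"
    have "x = x \<oplus> \<zero> \<otimes> a" using c.Icarr[OF x] ac by simp
    then show "x \<in> ?s" using x by blast
  qed
  have "a = \<zero> \<oplus> \<one> \<otimes> a" using ac by simp
  then have "a \<in> ?s" using c.zero_closed by blast
  then obtain m where m: "ideal_pow R I m \<subseteq> ?s" using big[OF s cs] a by blast
  have "ideal_pow R I (m + l) \<subseteq> c"
  proof
    fix z assume "z \<in> ideal_pow R I (m + l)"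
    then have "z \<in> ideal_pow R I m \<cdot> ideal_pow R I l" by (simp add: ideal_pow_add[OF I])
    then show "z \<in> c"
    proof (induct rule: ideal_prod.induct)
      case (prod x y)
      then obtain u r where x: "x = u \<oplus> r \<otimes> a" "u \<in> c" "r \<in> carrier R" using m by blast
      have y: "y \<in> carrier R" "y \<otimes> a \<in> c" using prod l by auto
      have "x \<otimes> y = u \<otimes> y \<oplus> r \<otimes> (y \<otimes> a)"
        using x y ac c.Icarr[OF x(2)] by (simp add: l_distr m_assoc m_comm[of a y])
      then show ?case using x y c.I_l_closed c.I_r_closed c.a_closed by simp
    next
      case (sum x y)
      then show ?case by (simp add: c.a_closed)
    qed
  qed
  then show False using cn by blast
qed

text \<open>A maximal element among the proper ideals containing u is a maximal ideal; the principal
  ideal of a non-unit starts the family.\<close>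

lemma maximal_over:
  assumes noeth: "noetherian_ring R" and u: "u \<in> carrier R" "u \<notin> Units R"
  shows "\<exists>J. maximalideal J R \<and> u \<in> J"
proof -
  let ?F = "{J. ideal J R \<and> J \<noteq> carrier R \<and> u \<in> J}"
  have "PIdl u \<noteq> carrier R"
  proof
    assume "PIdl u = carrier R"
    then have "\<one> \<in> PIdl u" by simp
    then obtain x where "x \<in> carrier R" "\<one> = x \<otimes> u" by (auto simp: cgenideal_def)
    then have "u \<in> Units R" using u(1) m_comm[of x u] unfolding Units_def by force
    then show False using u(2) by simp
  qed
  then have "PIdl u \<in> ?F" using cgenideal_ideal[OF u(1)] cgenideal_self[OF u(1)] by simp
  then have ne: "?F \<noteq> {}" by (metis empty_iff)
  obtain J where J: "J \<in> ?F" "\<And>X. X \<in> ?F \<Longrightarrow> J \<subseteq> X \<Longrightarrow> X = J"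
    using noeth_ideal_max[OF noeth ne] by auto
  have "maximalideal J R" by (rule maximalidealI) (use J in auto)
  then show ?thesis using J by blast
qed

end

lemma complete_noetherian_localD:
  assumes "complete_noetherian_local R"
  shows "cring R" "noetherian_ring R" "maximalideal (max_ideal R) R" "ideal (max_ideal R) R"
    "\<And>J. maximalideal J R \<Longrightarrow> J = max_ideal R" "adically_complete R (max_ideal R)"
proof -
  have u: "\<exists>!m. maximalideal m R" using assms by (simp add: complete_noetherian_local_def)
  show m: "maximalideal (max_ideal R) R" unfolding max_ideal_def using u by (rule theI')
  then show "ideal (max_ideal R) R" by (rule maximalideal.axioms(1))
  show "\<And>J. maximalideal J R \<Longrightarrow> J = max_ideal R" using u m by blast
qed (use assms in \<open>simp_all add: complete_noetherian_local_def\<close>)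

text \<open>The form in which locality is used: it supplies the unit hypothesis of
  \<open>nakayama\<close>, \<open>krull\<close> and \<open>finite_target_nilpotent\<close>.\<close>

lemma local_one_minus_unit:
  assumes "cring R" "noetherian_ring R" "maximalideal m R" "\<And>J. maximalideal J R \<Longrightarrow> J = m" "a \<in> m"
  shows "\<one>\<^bsub>R\<^esub> \<ominus>\<^bsub>R\<^esub> a \<in> Units R"
proof (rule ccontr)
  interpret R: cring R by fact
  interpret m: maximalideal m R by fact
  have a: "a \<in> carrier R" using m.Icarr[OF assms(5)] .
  assume "\<not> ?thesis"
  then obtain J where "maximalideal J R" "\<one>\<^bsub>R\<^esub> \<ominus>\<^bsub>R\<^esub> a \<in> J"
    using R.maximal_over[OF assms(2), of "\<one>\<^bsub>R\<^esub> \<ominus>\<^bsub>R\<^esub> a"] a by auto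
  then have "\<one>\<^bsub>R\<^esub> \<ominus>\<^bsub>R\<^esub> a \<in> m" using assms(4) by blast
  then have "(\<one>\<^bsub>R\<^esub> \<ominus>\<^bsub>R\<^esub> a) \<oplus>\<^bsub>R\<^esub> a \<in> m" using assms(5) by (rule m.a_closed)
  then have "\<one>\<^bsub>R\<^esub> \<in> m" using a by (simp add: R.minus_eq R.a_assoc R.l_neg)
  then show False using m.one_imp_carrier m.I_notcarr by auto
qed

section \<open>Krull's intersection theorem\<close>

context noeth_module
begin

text \<open>A proof without the Artin-Rees lemma. Let N be the intersection of all I^n M and take L
  maximal with L meeting N in I N. Some power of I maps M into L, so N lies in L, whence N = I N,
  and Nakayama's lemma gives N = 0.\<close>

lemma krull:
  assumes fg: "fg_module R M" and I: "ideal I R" and u: "\<And>a. a \<in> I \<Longrightarrow> \<one>\<^bsub>R\<^esub> \<ominus>\<^bsub>R\<^esub> a \<in> Units R"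
    and x: "\<And>n. x \<in> ispan M (ideal_pow R I n) (carrier M)"
  shows "x = \<zero>\<^bsub>M\<^esub>"
proof -
  interpret I: ideal I R by (rule I)
  have Ic: "I \<subseteq> carrier R" using I.Icarr by auto
  note pi = R.ideal_pow_ideal[OF I]
  define N where "N = (\<Inter>n. ispan M (ideal_pow R I n) (carrier M))"
  have N: "rsub R M N"
  proof -
    have n: "rsub R M (ispan M (ideal_pow R I n) (carrier M))" for n by (rule ispan_rsub[OF pi order_refl])
    show ?thesis unfolding N_def
      by (rule rsubI) (auto intro: rsubD(2)[OF n] rsubD(3)[OF n] rsubD(4)[OF n] rsubD(5)[OF n])
  qed
  define IN where "IN = ispan M I N"
  have INs: "rsub R M IN" unfolding IN_def by (rule ispan_rsub[OF I rsubD(1)[OF N]])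
  have INN: "IN \<subseteq> N" unfolding IN_def by (rule ispan_minimal) (use Ic in \<open>auto intro: rsubD(2,3,4)[OF N]\<close>)
  \<comment> \<open>The family contains I N itself, so a maximal L exists.\<close>
  let ?F = "{L. rsub R M L \<and> L \<inter> N = IN}"
  have "IN \<in> ?F" using INs INN by auto
  then have ne: "?F \<noteq> {}" by (metis empty_iff)
  then obtain L where L: "rsub R M L" "L \<inter> N = IN" and Lmax: "\<And>X. rsub R M X \<Longrightarrow> X \<inter> N = IN \<Longrightarrow> L \<subseteq> X \<Longrightarrow> X = L"
    using noeth_max[OF fg ne] by auto
  define b where "b = {r \<in> carrier R. \<forall>x\<in>carrier M. r \<odot>\<^bsub>M\<^esub> x \<in> L}"
  have b: "ideal b R"
    by (rule R.idealI') (auto simp: b_def smult_l_distr smult_assoc1 intro: rsubD(2,3,4)[OF L(1)])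
  have "\<exists>n::nat. a [^]\<^bsub>R\<^esub> n \<in> b" if a: "a \<in> I" for a
  proof -
    have ac: "a \<in> carrier R" using a Ic by auto
    \<comment> \<open>The chain of submodules L : a^n ascends, so it becomes stationary; one
      repetition at n and n + 1 is all that is used.\<close>
    define Ln where "Ln n = {x \<in> carrier M. a [^]\<^bsub>R\<^esub> (n::nat) \<odot>\<^bsub>M\<^esub> x \<in> L}" for n
    have Lns: "rsub R M (Ln n)" for n
    proof (rule rsubI)
      show "r \<odot>\<^bsub>M\<^esub> x \<in> Ln n" if "r \<in> carrier R" "x \<in> Ln n" for r x
      proof -
        have "a [^]\<^bsub>R\<^esub> n \<odot>\<^bsub>M\<^esub> (r \<odot>\<^bsub>M\<^esub> x) = r \<odot>\<^bsub>M\<^esub> (a [^]\<^bsub>R\<^esub> n \<odot>\<^bsub>M\<^esub> x)"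
          using that ac by (simp add: Ln_def smult_assoc1[symmetric] R.m_comm)
        then show ?thesis using that ac rsubD(4)[OF L(1)] by (simp add: Ln_def)
      qed
    qed (use ac rsubD(2,3)[OF L(1)] in \<open>auto simp: Ln_def smult_r_distr\<close>)
    have Lnm: "Ln n \<subseteq> Ln (Suc n)" for n
    proof
      fix x assume x: "x \<in> Ln n"
      then have "a [^]\<^bsub>R\<^esub> Suc n \<odot>\<^bsub>M\<^esub> x = a \<odot>\<^bsub>M\<^esub> (a [^]\<^bsub>R\<^esub> n \<odot>\<^bsub>M\<^esub> x)"
        using ac by (simp add: Ln_def smult_assoc1[symmetric] R.m_comm)
      then show "x \<in> Ln (Suc n)" using x ac rsubD(4)[OF L(1) ac] by (simp add: Ln_def del: R.nat_pow_Suc)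
    qed
    have "\<exists>L\<in>range Ln. \<forall>X\<in>range Ln. L \<subseteq> X \<longrightarrow> X = L"
      by (rule noeth_max[OF fg]) (auto simp: Lns)
    then obtain n where "\<And>k. Ln n \<subseteq> Ln k \<Longrightarrow> Ln k = Ln n" by auto
    then have n: "Ln n = Ln (Suc n)" using Lnm by blast
    \<comment> \<open>P = L + a^n M. It will be shown to meet N in I N as well; by maximality P = L,
      which means that a^n M lies in L.\<close>
    define P where "P = {l \<oplus>\<^bsub>M\<^esub> a [^]\<^bsub>R\<^esub> n \<odot>\<^bsub>M\<^esub> x | l x. l \<in> L \<and> x \<in> carrier M}"
    have PI: "l \<oplus>\<^bsub>M\<^esub> a [^]\<^bsub>R\<^esub> n \<odot>\<^bsub>M\<^esub> x \<in> P" if "l \<in> L" "x \<in> carrier M" for l x using that P_def by blast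
    have Lc: "l \<in> L \<Longrightarrow> l \<in> carrier M" for l using rsubD(5)[OF L(1)] .
    have P: "rsub R M P"
    proof (rule rsubI)
      show "x \<in> carrier M" if "x \<in> P" for x using that ac Lc by (auto simp: P_def)
      show "\<zero>\<^bsub>M\<^esub> \<in> P" using PI[OF rsubD(2)[OF L(1)] M.zero_closed] ac by simp
      fix x assume "x \<in> P"
      then obtain l z where x: "x = l \<oplus>\<^bsub>M\<^esub> a [^]\<^bsub>R\<^esub> n \<odot>\<^bsub>M\<^esub> z" "l \<in> L" "z \<in> carrier M" by (auto simp: P_def)
      show "r \<odot>\<^bsub>M\<^esub> x \<in> P" if "r \<in> carrier R" for r
      proof -
        have "r \<odot>\<^bsub>M\<^esub> x = r \<odot>\<^bsub>M\<^esub> l \<oplus>\<^bsub>M\<^esub> a [^]\<^bsub>R\<^esub> n \<odot>\<^bsub>M\<^esub> (r \<odot>\<^bsub>M\<^esub> z)"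
          using x that ac Lc[OF x(2)] by (simp add: smult_r_distr smult_assoc1[symmetric] R.m_comm)
        then show ?thesis using PI rsubD(4)[OF L(1) that x(2)] x that by simp
      qed
      fix y assume "y \<in> P"
      then obtain l' z' where y: "y = l' \<oplus>\<^bsub>M\<^esub> a [^]\<^bsub>R\<^esub> n \<odot>\<^bsub>M\<^esub> z'" "l' \<in> L" "z' \<in> carrier M" by (auto simp: P_def)
      have "x \<oplus>\<^bsub>M\<^esub> y = (l \<oplus>\<^bsub>M\<^esub> l') \<oplus>\<^bsub>M\<^esub> a [^]\<^bsub>R\<^esub> n \<odot>\<^bsub>M\<^esub> (z \<oplus>\<^bsub>M\<^esub> z')"
        using x y ac Lc by (simp add: smult_r_distr M.a_ac)
      then show "x \<oplus>\<^bsub>M\<^esub> y \<in> P" using PI rsubD(3)[OF L(1) x(2) y(2)] x y by simp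
    qed
    have LP: "L \<subseteq> P"
    proof
      fix l assume l: "l \<in> L"
      show "l \<in> P" using PI[OF l M.zero_closed] ac Lc[OF l] by simp
    qed
    have "P \<inter> N = IN"
    proof (rule equalityI)
      show "IN \<subseteq> P \<inter> N" using L(2) LP by auto
      show "P \<inter> N \<subseteq> IN"
      proof
        \<comment> \<open>For y = l + a^n z in N, the element a y lies in I N and so in L. Hence
          a^(n+1) z is in L, the stationary chain gives a^n z in L, and y belongs to L and
          N.\<close>
        fix y assume y: "y \<in> P \<inter> N"
        then obtain l z where lz: "y = l \<oplus>\<^bsub>M\<^esub> a [^]\<^bsub>R\<^esub> n \<odot>\<^bsub>M\<^esub> z" "l \<in> L" "z \<in> carrier M" by (auto simp: P_def)
        have yc: "y \<in> carrier M" using y rsubD(5)[OF N] by auto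
        have "a \<odot>\<^bsub>M\<^esub> y \<in> IN" unfolding IN_def using y a by (intro ispan_base Ic rsubD(1)[OF N]) auto
        then have ay: "a \<odot>\<^bsub>M\<^esub> y \<in> L" using L(2) by auto
        have "a [^]\<^bsub>R\<^esub> Suc n \<odot>\<^bsub>M\<^esub> z = a \<odot>\<^bsub>M\<^esub> (a [^]\<^bsub>R\<^esub> n \<odot>\<^bsub>M\<^esub> z)"
          using lz ac by (simp add: smult_assoc1[symmetric] R.m_comm)
        also have "a [^]\<^bsub>R\<^esub> n \<odot>\<^bsub>M\<^esub> z = y \<ominus>\<^bsub>M\<^esub> l"
          using lz ac Lc[OF lz(2)] by (simp add: M.minus_eq M.a_ac M.r_neg1 M.r_neg2)
        also have "a \<odot>\<^bsub>M\<^esub> (y \<ominus>\<^bsub>M\<^esub> l) \<in> L"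
          using rsub_minus[OF L(1) ay rsubD(4)[OF L(1) ac lz(2)]] ac yc Lc[OF lz(2)]
          by (simp add: M.minus_eq smult_r_distr smult_r_minus)
        finally have "z \<in> Ln (Suc n)" using lz by (simp add: Ln_def)
        then have "z \<in> Ln n" using n by simp
        then have "y \<in> L" using lz rsubD(3)[OF L(1)] by (simp add: Ln_def)
        then show "y \<in> IN" using y L(2) by auto
      qed
    qed
    then have PL: "P = L" using Lmax P LP by blast
    have "a [^]\<^bsub>R\<^esub> n \<odot>\<^bsub>M\<^esub> z \<in> L" if "z \<in> carrier M" for z
      using PI[OF rsubD(2)[OF L(1)] that] ac that PL by simp
    then show ?thesis using ac by (auto simp: b_def)
  qed
  then obtain k where k: "ideal_pow R I k \<subseteq> b"
    using R.pow_subset_of_radical[OF noetherian_ring_axioms b I] by blast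
  have "ispan M (ideal_pow R I k) (carrier M) \<subseteq> L"
    by (rule ispan_minimal) (use k in \<open>auto simp: b_def intro: rsubD(2,3)[OF L(1)]\<close>)
  then have "N \<subseteq> L" unfolding N_def by blast
  then have NIN: "N = IN" using L(2) by auto
  obtain S where S: "finite S" "S \<subseteq> carrier M" "carrier M = ispan M (carrier R) S" using fg by (auto simp: fg_module_iff)
  obtain T where T: "finite T" "T \<subseteq> N" "N = ispan M (carrier R) T"
    using noeth_fg[OF S(1,2) N] rsubD(1)[OF N] S(3) by auto
  have TM: "T \<subseteq> carrier M" using T(2) rsubD(1)[OF N] by auto
  have "N = ispan M I T" using NIN ispan_span[OF I TM] T(3) unfolding IN_def by simp
  then have "T \<subseteq> {\<zero>\<^bsub>M\<^esub>}" using nakayama[OF I u T(1) TM] T(2) by simp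
  then have "N \<subseteq> {\<zero>\<^bsub>M\<^esub>}" unfolding T(3) by (intro ispan_minimal) auto
  then show ?thesis using x unfolding N_def by blast
qed

end

section \<open>Completeness\<close>

text \<open>The sum stops before z n. When z k lies in I^k M for all k, what is missing from
  \<open>psum M z n\<close> then lies in I^n M, with no shift of the index.\<close>

primrec psum :: "('m, 'x) ring_scheme \<Rightarrow> (nat \<Rightarrow> 'm) \<Rightarrow> nat \<Rightarrow> 'm" where
  "psum M z 0 = \<zero>\<^bsub>M\<^esub>"
| "psum M z (Suc n) = psum M z n \<oplus>\<^bsub>M\<^esub> z n"

lemma (in abelian_group) psum_closed: "(\<And>n. z n \<in> carrier G) \<Longrightarrow> psum G z n \<in> carrier G"
  by (induct n) simp_all

lemma (in cring) rcos_eq_iff: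
  assumes "ideal I R" "x \<in> carrier R" "y \<in> carrier R"
  shows "I +> x = I +> y \<longleftrightarrow> x \<ominus> y \<in> I"
proof -
  interpret ideal I R by fact
  show ?thesis using assms quotient_eq_iff_same_a_r_cos[OF assms(1,2,3)] by simp
qed

text \<open>The cosets of the partial sums modulo I^n form a compatible sequence, since the next
  summand a n already lies in I^n; surjectivity onto the inverse limit provides the sum.\<close>

lemma adic_sum:
  assumes "cring R" "ideal I R" "adically_complete R I" "\<And>n. a n \<in> ideal_pow R I n"
  shows "\<exists>x\<in>carrier R. \<forall>n. x \<ominus>\<^bsub>R\<^esub> psum R a n \<in> ideal_pow R I n"
proof -
  interpret R: cring R by fact
  note pi = R.ideal_pow_ideal[OF assms(2)]
  have ac: "a n \<in> carrier R" for n using ideal.Icarr[OF pi assms(4)] .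
  have pc: "psum R a n \<in> carrier R" for n using ac by (rule R.psum_closed)
  let ?s = "\<lambda>n. ideal_pow R I n +>\<^bsub>R\<^esub> psum R a n"
  have "?s (Suc n) \<subseteq> ?s n" for n
  proof -
    interpret P: ideal "ideal_pow R I n" R by (rule pi)
    have "?s n = ideal_pow R I n +>\<^bsub>R\<^esub> psum R a (Suc n)"
      using R.rcos_eq_iff[OF pi, of "psum R a (Suc n)" "psum R a n" n] ac pc assms(4)
      by (simp add: R.minus_eq R.a_ac R.r_neg)
    then show ?thesis using R.ideal_pow_Suc_subset[OF assms(2), of n]
      by (auto simp: a_r_coset_def r_coset_def)
  qed
  moreover have "?s n \<in> a_rcosets\<^bsub>R\<^esub> (ideal_pow R I n)" for n
    using pc unfolding A_RCOSETS_def' by blast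
  ultimately have "?s \<in> {s. \<forall>n. s n \<in> a_rcosets\<^bsub>R\<^esub> (ideal_pow R I n) \<and> s (Suc n) \<subseteq> s n}" by simp
  then obtain x where x: "x \<in> carrier R" "(\<lambda>n. ideal_pow R I n +>\<^bsub>R\<^esub> x) = ?s"
    using assms(3) unfolding adically_complete_def bij_betw_def by (metis (no_types, lifting) imageE)
  then have "x \<ominus>\<^bsub>R\<^esub> psum R a n \<in> ideal_pow R I n" for n
    using R.rcos_eq_iff[OF pi x(1) pc, of n n] by metis
  then show ?thesis using x(1) by blast
qed

context pmodule
begin

text \<open>Completeness is applied to each coefficient separately. The generators may satisfy
  relations: any choice of coefficients for the summands will do, as only existence of a limit is
  claimed.\<close>

lemma span_complete:
  assumes I: "ideal I R" and ac: "adically_complete R I"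
  shows "finite S \<Longrightarrow> S \<subseteq> carrier M \<Longrightarrow> (\<And>n. z n \<in> ispan M (ideal_pow R I n) S) \<Longrightarrow>
    \<exists>y\<in>ispan M (carrier R) S. \<forall>n. y \<ominus>\<^bsub>M\<^esub> psum M z n \<in> ispan M (ideal_pow R I n) S"
proof (induct S arbitrary: z rule: finite_induct)
  case empty
  have "psum M z n = \<zero>\<^bsub>M\<^esub>" for n using empty(2) by (induct n) (auto simp: ispan_empty)
  then show ?case by (simp add: ispan_empty M.minus_eq)
next
  case (insert s S)
  have S: "S \<subseteq> carrier M" "s \<in> carrier M" using insert by auto
  note pi = R.ideal_pow_ideal[OF I]
  have "\<forall>n. \<exists>a w. a \<in> ideal_pow R I n \<and> w \<in> ispan M (ideal_pow R I n) S \<and> z n = a \<odot>\<^bsub>M\<^esub> s \<oplus>\<^bsub>M\<^esub> w"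
    using ispan_insert[OF pi insert(4)] insert(5) by blast
  then obtain a w where aw: "\<And>n. a n \<in> ideal_pow R I n" "\<And>n. w n \<in> ispan M (ideal_pow R I n) S"
    "\<And>n. z n = a n \<odot>\<^bsub>M\<^esub> s \<oplus>\<^bsub>M\<^esub> w n" by metis
  obtain b where b: "b \<in> carrier R" "\<And>n. b \<ominus>\<^bsub>R\<^esub> psum R a n \<in> ideal_pow R I n"
    using adic_sum[OF R.is_cring I ac aw(1)] by blast
  obtain v where v: "v \<in> ispan M (carrier R) S" "\<And>n. v \<ominus>\<^bsub>M\<^esub> psum M w n \<in> ispan M (ideal_pow R I n) S"
    using insert(3)[OF S(1) aw(2)] by blast
  have acc: "a n \<in> carrier R" and wc: "w n \<in> carrier M" for n
    using ideal.Icarr[OF pi aw(1)] rsubD(5)[OF ispan_rsub[OF pi S(1)] aw(2)] by auto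
  have pac: "psum R a n \<in> carrier R" and pwc: "psum M w n \<in> carrier M" for n
    using acc wc by (simp_all add: R.psum_closed M.psum_closed)
  have vc: "v \<in> carrier M" using v rsubD(5)[OF span_rsub[OF S(1)]] by auto
  have pz: "psum M z n = psum R a n \<odot>\<^bsub>M\<^esub> s \<oplus>\<^bsub>M\<^esub> psum M w n" for n
    by (induct n) (use S acc wc pac pwc in \<open>simp_all add: aw(3) smult_l_distr M.a_ac\<close>)
  have "(b \<odot>\<^bsub>M\<^esub> s \<oplus>\<^bsub>M\<^esub> v) \<ominus>\<^bsub>M\<^esub> psum M z n = (b \<ominus>\<^bsub>R\<^esub> psum R a n) \<odot>\<^bsub>M\<^esub> s \<oplus>\<^bsub>M\<^esub> (v \<ominus>\<^bsub>M\<^esub> psum M w n)" for n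
    using S b pac[of n] pwc[of n] vc
    by (simp add: pz M.minus_eq R.minus_eq smult_l_distr smult_l_minus M.minus_add M.a_ac)
  moreover have "(b \<ominus>\<^bsub>R\<^esub> psum R a n) \<odot>\<^bsub>M\<^esub> s \<oplus>\<^bsub>M\<^esub> (v \<ominus>\<^bsub>M\<^esub> psum M w n) \<in> ispan M (ideal_pow R I n) (insert s S)" for n
    using b(2)[of n] v(2)[of n] ispan_mono[of "ideal_pow R I n" "ideal_pow R I n" S "insert s S" M]
    by (intro ispan.add) auto
  moreover have "b \<odot>\<^bsub>M\<^esub> s \<oplus>\<^bsub>M\<^esub> v \<in> ispan M (carrier R) (insert s S)"
    using b(1) v(1) ispan_mono[of "carrier R" "carrier R" S "insert s S" M] by (intro ispan.add) auto
  ultimately show ?case by (intro bexI[of _ "b \<odot>\<^bsub>M\<^esub> s \<oplus>\<^bsub>M\<^esub> v"]) auto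
qed

lemma fg_complete:
  assumes I: "ideal I R" and ac: "adically_complete R I" and fg: "fg_module R M"
    and z: "\<And>n. z n \<in> ispan M (ideal_pow R I n) (carrier M)"
  shows "\<exists>y\<in>carrier M. \<forall>n. y \<ominus>\<^bsub>M\<^esub> psum M z n \<in> ispan M (ideal_pow R I n) (carrier M)"
proof -
  obtain S where S: "finite S" "S \<subseteq> carrier M" "carrier M = ispan M (carrier R) S" using fg by (auto simp: fg_module_iff)
  have "ispan M (ideal_pow R I n) (carrier M) = ispan M (ideal_pow R I n) S" for n
    using ispan_span[OF R.ideal_pow_ideal[OF I] S(2)] S(3) by simp
  then show ?thesis using span_complete[OF I ac S(1,2), of z] z S(3) by simp
qed

end

section \<open>Quotients of complete local rings\<close>

text \<open>The quotient of R by an ideal is handled as the target of a surjection, so that in this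
  part its elements never have to be opened as cosets.\<close>

locale surj_cring_hom =
  fixes R :: "('r,'x) ring_scheme" and R' :: "('s,'y) ring_scheme" and q :: "'r \<Rightarrow> 's"
  assumes cR: "cring R" and cR': "cring R'" and q: "q \<in> ring_hom R R'" and surj: "q ` carrier R = carrier R'"
begin

sublocale R: cring R by (rule cR)
sublocale R': cring R' by (rule cR')

lemma q_closed: "x \<in> carrier R \<Longrightarrow> q x \<in> carrier R'" using q by (rule ring_hom_closed)
lemmas q_mult = ring_hom_mult[OF q] and q_add = ring_hom_add[OF q] and q_one = ring_hom_one[OF q]
lemma q_zero: "q \<zero>\<^bsub>R\<^esub> = \<zero>\<^bsub>R'\<^esub>"
  using addhom_zero[OF ring_hom_addhom[OF q]] R.abelian_group_axioms R'.abelian_group_axioms by blast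
lemma q_minus: "x \<in> carrier R \<Longrightarrow> y \<in> carrier R \<Longrightarrow> q (x \<ominus>\<^bsub>R\<^esub> y) = q x \<ominus>\<^bsub>R'\<^esub> q y"
  using addhom_minus[OF ring_hom_addhom[OF q]] R.abelian_group_axioms R'.abelian_group_axioms by blast
lemma q_ex: "y \<in> carrier R' \<Longrightarrow> \<exists>x\<in>carrier R. q x = y" using surj by (metis imageE)

lemma im_ideal: assumes "ideal I R" shows "ideal (q ` I) R'"
proof (rule R'.idealI')
  interpret I: ideal I R by fact
  show "x \<in> carrier R'" if "x \<in> q ` I" for x using that I.Icarr q_closed by auto
  show "\<zero>\<^bsub>R'\<^esub> \<in> q ` I" using q_zero I.zero_closed by (metis imageI)
  show "x \<oplus>\<^bsub>R'\<^esub> y \<in> q ` I" if xy: "x \<in> q ` I" "y \<in> q ` I" for x y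
  proof -
    obtain a b where ab: "x = q a" "a \<in> I" "y = q b" "b \<in> I" using xy by auto
    then have "x \<oplus>\<^bsub>R'\<^esub> y = q (a \<oplus>\<^bsub>R\<^esub> b)" using I.Icarr by (simp add: q_add)
    then show ?thesis using ab I.a_closed by simp
  qed
  show "r \<otimes>\<^bsub>R'\<^esub> x \<in> q ` I" if rx: "r \<in> carrier R'" "x \<in> q ` I" for r x
  proof -
    obtain a where a: "x = q a" "a \<in> I" using rx by auto
    obtain t where t: "t \<in> carrier R" "q t = r" using q_ex[OF rx(1)] by blast
    then have "r \<otimes>\<^bsub>R'\<^esub> x = q (t \<otimes>\<^bsub>R\<^esub> a)" using a I.Icarr by (simp add: q_mult)
    then show ?thesis using a t I.I_l_closed by simp
  qed
qed

lemma pre_ideal: assumes "ideal J R'" shows "ideal {r \<in> carrier R. q r \<in> J} R"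
proof (rule R.idealI')
  interpret J: ideal J R' by fact
  show "\<zero>\<^bsub>R\<^esub> \<in> {r \<in> carrier R. q r \<in> J}" by (simp add: q_zero J.zero_closed)
  show "r \<otimes>\<^bsub>R\<^esub> x \<in> {r \<in> carrier R. q r \<in> J}" if "r \<in> carrier R" "x \<in> {r \<in> carrier R. q r \<in> J}" for r x
    using that by (simp add: q_mult q_closed J.I_l_closed)
qed (simp_all add: q_add additive_subgroup.a_closed[OF ideal.axioms(1)[OF assms]])

lemma im_prod:
  assumes "ideal I R" "ideal J R"
  shows "ideal_prod R' (q ` I) (q ` J) = q ` ideal_prod R I J"
proof (rule equalityI)
  note IJ = im_ideal[OF R.ideal_prod_is_ideal[OF assms]]
  show "ideal_prod R' (q ` I) (q ` J) \<subseteq> q ` ideal_prod R I J"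
  proof
    fix z assume "z \<in> ideal_prod R' (q ` I) (q ` J)"
    then show "z \<in> q ` ideal_prod R I J"
    proof (induct rule: ideal_prod.induct)
      case (prod x y)
      then obtain a b where "x = q a" "a \<in> I" "y = q b" "b \<in> J" by auto
      then have "x \<otimes>\<^bsub>R'\<^esub> y = q (a \<otimes>\<^bsub>R\<^esub> b)" "a \<otimes>\<^bsub>R\<^esub> b \<in> ideal_prod R I J"
        using ideal.Icarr[OF assms(1)] ideal.Icarr[OF assms(2)] by (auto simp: q_mult intro: ideal_prod.prod)
      then show ?case by simp
    next
      case (sum x y)
      then show ?case using additive_subgroup.a_closed[OF ideal.axioms(1)[OF IJ]] by simp
    qed
  qed
  show "q ` ideal_prod R I J \<subseteq> ideal_prod R' (q ` I) (q ` J)"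
  proof
    fix z assume "z \<in> q ` ideal_prod R I J"
    then obtain w where w: "w \<in> ideal_prod R I J" "z = q w" by auto
    have "q w \<in> ideal_prod R' (q ` I) (q ` J)" using w(1)
    proof (induct rule: ideal_prod.induct)
      case (prod x y)
      then show ?case using assms ideal.Icarr by (metis q_mult ideal_prod.prod imageI)
    next
      case (sum x y)
      have c: "x \<in> carrier R" "y \<in> carrier R" using sum(1,3) R.ideal_prod_in_carrier[OF assms] by blast+
      show ?case unfolding q_add[OF c] by (rule ideal_prod.sum[OF sum(2,4)])
    qed
    then show "z \<in> ideal_prod R' (q ` I) (q ` J)" using w by simp
  qed
qed

lemma im_pow: "ideal I R \<Longrightarrow> ideal_pow R' (q ` I) n = q ` ideal_pow R I n"
  by (induct n) (simp_all add: surj im_prod R.ideal_pow_ideal)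

lemma surj_noetherian:
  assumes "noetherian_ring R" shows "noetherian_ring R'"
proof (intro noetherian_ring.intro noetherian_ring_axioms.intro)
  show "ring R'" by (rule R'.ring_axioms)
  fix J assume J: "ideal J R'"
  interpret J: ideal J R' by (rule J)
  obtain A where A: "A \<subseteq> carrier R" "finite A" "{r \<in> carrier R. q r \<in> J} = genideal R A"
    using noetherian_ring.finetely_gen[OF assms pre_ideal[OF J]] by blast
  have AJ: "q ` A \<subseteq> J" using A R.genideal_self[OF A(1)] by blast
  have qA: "q ` A \<subseteq> carrier R'" using A(1) q_closed by auto
  have "genideal R A \<subseteq> {r \<in> carrier R. q r \<in> genideal R' (q ` A)}"
    by (rule R.genideal_minimal[OF pre_ideal[OF R'.genideal_ideal[OF qA]]])
      (use A(1) R'.genideal_self[OF qA] in auto)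
  then have "J \<subseteq> genideal R' (q ` A)" using A(3) q_ex J.Icarr by blast
  moreover have "genideal R' (q ` A) \<subseteq> J" by (rule R'.genideal_minimal[OF J AJ])
  ultimately show "\<exists>A\<subseteq>carrier R'. finite A \<and> J = genideal R' A" using A(2) qA by blast
qed

text \<open>A preimage outside m is a unit of R, so a proper ideal of R' lies in q(m). And q(m) is
  proper: if q a = 1 with a in m, the unit 1 - a would map to 0.\<close>

lemma surj_local:
  assumes c: "complete_noetherian_local R" and ne: "\<one>\<^bsub>R'\<^esub> \<noteq> \<zero>\<^bsub>R'\<^esub>"
  shows "maximalideal (q ` max_ideal R) R'" "maximalideal J R' \<Longrightarrow> J = q ` max_ideal R"
proof -
  note d = complete_noetherian_localD[OF c]
  interpret m: maximalideal "max_ideal R" R by (rule d(3))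
  have u: "a \<in> max_ideal R \<Longrightarrow> \<one>\<^bsub>R\<^esub> \<ominus>\<^bsub>R\<^esub> a \<in> Units R" for a
    using local_one_minus_unit[OF d(1-3) d(5)] .
  have prp: "\<one>\<^bsub>R'\<^esub> \<notin> q ` max_ideal R"
  proof
    assume "\<one>\<^bsub>R'\<^esub> \<in> q ` max_ideal R"
    then obtain a where a: "a \<in> max_ideal R" "q a = \<one>\<^bsub>R'\<^esub>" by auto
    have ac: "a \<in> carrier R" using a m.Icarr by auto
    let ?u = "\<one>\<^bsub>R\<^esub> \<ominus>\<^bsub>R\<^esub> a"
    have "q ?u = \<zero>\<^bsub>R'\<^esub>" using a ac by (simp add: q_minus q_one R'.r_neg R'.minus_eq)
    moreover have "?u \<otimes>\<^bsub>R\<^esub> inv\<^bsub>R\<^esub> ?u = \<one>\<^bsub>R\<^esub>" "inv\<^bsub>R\<^esub> ?u \<in> carrier R" "?u \<in> carrier R" using u[OF a(1)] by auto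
    ultimately have "\<one>\<^bsub>R'\<^esub> = \<zero>\<^bsub>R'\<^esub>" using q_mult[of ?u "inv\<^bsub>R\<^esub> ?u"] q_one q_closed by simp
    then show False using ne by simp
  qed
  have sub: "J \<subseteq> q ` max_ideal R" if J: "ideal J R'" "J \<noteq> carrier R'" for J
  proof
    interpret J: ideal J R' by (rule J)
    let ?P = "{r \<in> carrier R. q r \<in> J}"
    fix y assume y: "y \<in> J"
    obtain x where x: "x \<in> carrier R" "q x = y" using q_ex J.Icarr[OF y] by blast
    have "x \<in> max_ideal R"
    proof (rule ccontr)
      assume nx: "x \<notin> max_ideal R"
      have "\<exists>a. a \<in> max_ideal R \<and> (\<exists>r\<in>carrier R. \<one>\<^bsub>R\<^esub> = a \<oplus>\<^bsub>R\<^esub> r \<otimes>\<^bsub>R\<^esub> x)"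
      proof -
        have "x \<in> Units R"
        proof (rule ccontr)
          assume "x \<notin> Units R"
          then obtain K where "maximalideal K R" "x \<in> K" using R.maximal_over[OF d(2) x(1)] by blast
          then show False using d(5) nx by blast
        qed
        then show ?thesis using x(1) m.zero_closed by (intro exI[of _ "\<zero>\<^bsub>R\<^esub>"]) (auto intro!: bexI[of _ "inv\<^bsub>R\<^esub> x"])
      qed
      then obtain a r where ar: "a \<in> max_ideal R" "r \<in> carrier R" "\<one>\<^bsub>R\<^esub> = a \<oplus>\<^bsub>R\<^esub> r \<otimes>\<^bsub>R\<^esub> x" by blast
      have ac: "a \<in> carrier R" using ar m.Icarr by auto
      have "\<one>\<^bsub>R\<^esub> \<ominus>\<^bsub>R\<^esub> a = r \<otimes>\<^bsub>R\<^esub> x" unfolding ar(3) using ac ar(2) x(1) by (simp add: R.minus_eq R.a_ac R.r_neg1 R.r_neg2 R.r_neg)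
      then have "r \<otimes>\<^bsub>R\<^esub> x \<in> Units R" using u[OF ar(1)] by simp
      then obtain v where v: "v \<in> carrier R" "v \<otimes>\<^bsub>R\<^esub> (r \<otimes>\<^bsub>R\<^esub> x) = \<one>\<^bsub>R\<^esub>" by (meson R.Units_l_inv_ex)
      have "q v \<otimes>\<^bsub>R'\<^esub> (q r \<otimes>\<^bsub>R'\<^esub> y) = \<one>\<^bsub>R'\<^esub>" using v x ar(2) q_mult q_one by (metis R.m_closed)
      moreover have "q v \<otimes>\<^bsub>R'\<^esub> (q r \<otimes>\<^bsub>R'\<^esub> y) \<in> J" using y v ar(2) by (simp add: J.I_l_closed q_closed)
      ultimately show False using J.one_imp_carrier J(2) by simp
    qed
    then show "y \<in> q ` max_ideal R" using x by auto
  qed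
  have ii: "ideal (q ` max_ideal R) R'" by (rule im_ideal[OF d(4)])
  have nc: "carrier R' \<noteq> q ` max_ideal R" using prp by auto
  show "maximalideal (q ` max_ideal R) R'"
    by (rule maximalidealI[OF ii nc]) (use sub in blast)
  show "J = q ` max_ideal R" if J: "maximalideal J R'"
  proof -
    interpret J: maximalideal J R' by (rule J)
    have "J \<subseteq> q ` max_ideal R" using sub[OF J.is_ideal] J.I_notcarr by blast
    then show ?thesis using J.I_maximal[OF ii] nc ideal.Icarr[OF ii] by blast
  qed
qed

lemma surj_max_ideal:
  assumes c: "complete_noetherian_local R" and ne: "\<one>\<^bsub>R'\<^esub> \<noteq> \<zero>\<^bsub>R'\<^esub>"
  shows "max_ideal R' = q ` max_ideal R"
  unfolding max_ideal_def[of R'] using surj_local[OF assms] by (rule the_equality)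

text \<open>Separatedness of R' is Krull's theorem for R' as a module over itself. A compatible
  sequence is lifted to a Cauchy sequence in R, summed there and mapped back.\<close>

lemma surj_adically_complete:
  assumes c: "complete_noetherian_local R" and ne: "\<one>\<^bsub>R'\<^esub> \<noteq> \<zero>\<^bsub>R'\<^esub>"
  shows "adically_complete R' (q ` max_ideal R)"
proof -
  note d = complete_noetherian_localD[OF c]
  let ?m = "max_ideal R" and ?m' = "q ` max_ideal R"
  note mi = d(4) and mi' = im_ideal[OF d(4)]
  note pi = R.ideal_pow_ideal[OF mi] and pi' = R'.ideal_pow_ideal[OF mi']
  have nn: "noetherian_ring R'" by (rule surj_noetherian[OF d(2)])
  interpret S: noeth_module R' "self_alg R'" by (rule R'.noeth_self[OF nn])
  have kr: "x = \<zero>\<^bsub>R'\<^esub>" if x: "\<And>n. x \<in> ideal_pow R' ?m' n" for x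
  proof -
    have "x \<in> ispan (self_alg R') (ideal_pow R' ?m' n) (carrier (self_alg R'))" for n
      using S.ispan_base[of x "ideal_pow R' ?m' n" "\<one>\<^bsub>R'\<^esub>" "carrier R'"] x[of n] ideal.Icarr[OF pi'] by (simp add: subset_iff)
    moreover have "\<one>\<^bsub>R'\<^esub> \<ominus>\<^bsub>R'\<^esub> a \<in> Units R'" if "a \<in> ?m'" for a
      using local_one_minus_unit[OF cR' nn surj_local(1)[OF assms] surj_local(2)[OF assms] that] .
    ultimately show ?thesis using S.krull[OF R'.noeth_self(2)[OF nn] mi', of x] by simp
  qed
  let ?F = "\<lambda>x n. ideal_pow R' ?m' n +>\<^bsub>R'\<^esub> x"
  have inj: "inj_on ?F (carrier R')"
  proof (rule inj_onI)
    fix x y assume x: "x \<in> carrier R'" and y: "y \<in> carrier R'" and e: "?F x = ?F y"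
    have "x \<ominus>\<^bsub>R'\<^esub> y \<in> ideal_pow R' ?m' n" for n
      using R'.rcos_eq_iff[OF pi' x y, of n] fun_cong[OF e, of n] by simp
    then have "x \<ominus>\<^bsub>R'\<^esub> y = \<zero>\<^bsub>R'\<^esub>" by (rule kr)
    then show "x = y" using x y by simp
  qed
  let ?S = "{s. \<forall>n. s n \<in> a_rcosets\<^bsub>R'\<^esub> (ideal_pow R' ?m' n) \<and> s (Suc n) \<subseteq> s n}"
  have sub: "?F x \<in> ?S" if "x \<in> carrier R'" for x
    using that R'.ideal_pow_Suc_subset[OF mi']
    by (auto simp: A_RCOSETS_def' a_r_coset_def r_coset_def simp del: ideal_pow.simps)
  have sup: "\<exists>x\<in>carrier R'. s = ?F x" if s: "s \<in> ?S" for s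
  proof -
    have sc: "s n \<in> a_rcosets\<^bsub>R'\<^esub> (ideal_pow R' ?m' n)" "s (Suc n) \<subseteq> s n" for n using s by auto
    have sn: "s n = ideal_pow R' ?m' n +>\<^bsub>R'\<^esub> w" and sw: "w \<in> carrier R'" if ws: "w \<in> s n" for n w
    proof -
      interpret P: ideal "ideal_pow R' ?m' n" R' by (rule pi')
      obtain v where v: "v \<in> carrier R'" "s n = ideal_pow R' ?m' n +>\<^bsub>R'\<^esub> v"
        using sc(1)[of n] unfolding A_RCOSETS_def' by blast
      then obtain h where h: "h \<in> ideal_pow R' ?m' n" "w = h \<oplus>\<^bsub>R'\<^esub> v" using ws by (auto simp: a_r_coset_def r_coset_def)
      then show wc: "w \<in> carrier R'" using v P.Icarr by simp
      have "w \<ominus>\<^bsub>R'\<^esub> v = h" using h v P.Icarr[OF h(1)] by (simp add: R'.minus_eq R'.a_assoc R'.r_neg)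
      then show "s n = ideal_pow R' ?m' n +>\<^bsub>R'\<^esub> w" using R'.rcos_eq_iff[OF pi' wc v(1), of n] h v by simp
    qed
    have ne_s: "\<exists>w. w \<in> s n" for n
    proof -
      interpret P: ideal "ideal_pow R' ?m' n" R' by (rule pi')
      show ?thesis using sc(1)[of n] P.a_rcos_self unfolding A_RCOSETS_def' by blast
    qed
    \<comment> \<open>The lifts are chosen one after another so that consecutive ones differ by an
      element of m^n; such a correction exists because the n-th power of q(m) is q(m^n).\<close>
    have "\<exists>f. \<forall>n. (f n \<in> carrier R \<and> q (f n) \<in> s n) \<and> f (Suc n) \<ominus>\<^bsub>R\<^esub> f n \<in> ideal_pow R ?m n"
    proof (rule dependent_nat_choice)
      show "\<exists>x. x \<in> carrier R \<and> q x \<in> s 0" using ne_s[of 0] sw[of _ 0] q_ex by blast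
      fix x n assume x: "x \<in> carrier R \<and> q x \<in> s n"
      obtain w where w: "w \<in> s (Suc n)" using ne_s by blast
      have wc: "w \<in> carrier R'" using sw[OF w] .
      have "w \<in> s n" using w sc(2) by blast
      then have "w \<ominus>\<^bsub>R'\<^esub> q x \<in> ideal_pow R' ?m' n"
        using R'.rcos_eq_iff[OF pi' wc, of "q x" n] sn x q_closed by metis
      then obtain \<mu> where mu: "\<mu> \<in> ideal_pow R ?m n" "q \<mu> = w \<ominus>\<^bsub>R'\<^esub> q x" using im_pow[OF mi, of n] by (metis imageE)
      have muc: "\<mu> \<in> carrier R" using mu ideal.Icarr[OF pi] by blast
      have "q (x \<oplus>\<^bsub>R\<^esub> \<mu>) = w" using x muc mu wc q_closed[of x] by (simp add: q_add R'.minus_eq R'.a_ac R'.r_neg)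
      moreover have "(x \<oplus>\<^bsub>R\<^esub> \<mu>) \<ominus>\<^bsub>R\<^esub> x = \<mu>" using x muc by (simp add: R.minus_eq R.a_ac R.r_neg)
      ultimately show "\<exists>y. (y \<in> carrier R \<and> q y \<in> s (Suc n)) \<and> y \<ominus>\<^bsub>R\<^esub> x \<in> ideal_pow R ?m n"
        using x muc mu w by (intro exI[of _ "x \<oplus>\<^bsub>R\<^esub> \<mu>"]) simp
    qed
    then obtain f where f: "\<And>n. f n \<in> carrier R" "\<And>n. q (f n) \<in> s n" "\<And>n. f (Suc n) \<ominus>\<^bsub>R\<^esub> f n \<in> ideal_pow R ?m n" by blast
    obtain x where x: "x \<in> carrier R" "\<And>n. x \<ominus>\<^bsub>R\<^esub> psum R (\<lambda>n. f (Suc n) \<ominus>\<^bsub>R\<^esub> f n) n \<in> ideal_pow R ?m n"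
      using adic_sum[OF cR mi d(6) f(3)] by blast
    have ps: "psum R (\<lambda>n. f (Suc n) \<ominus>\<^bsub>R\<^esub> f n) n = f n \<ominus>\<^bsub>R\<^esub> f 0" for n
      by (induct n) (simp_all add: f(1) R.r_neg R.minus_eq R.a_ac R.r_neg1 R.r_neg2)
    \<comment> \<open>The differences telescope to f n - f 0, so the limit of the sequence itself is
      the sum plus f 0.\<close>
    let ?X = "x \<oplus>\<^bsub>R\<^esub> f 0"
    have "s n = ?F (q ?X) n" for n
    proof -
      have "?X \<ominus>\<^bsub>R\<^esub> f n = x \<ominus>\<^bsub>R\<^esub> (f n \<ominus>\<^bsub>R\<^esub> f 0)" using x(1) f(1) by (simp add: R.minus_eq R.minus_add R.a_ac)
      then have "?X \<ominus>\<^bsub>R\<^esub> f n \<in> ideal_pow R ?m n" using x(2)[of n] ps[of n] by simp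
      then have "q (?X \<ominus>\<^bsub>R\<^esub> f n) \<in> ideal_pow R' ?m' n" using im_pow[OF mi, of n] by simp
      then have "q ?X \<ominus>\<^bsub>R'\<^esub> q (f n) \<in> ideal_pow R' ?m' n" using x(1) f(1) by (simp add: q_minus)
      then have "?F (q ?X) n = ?F (q (f n)) n" using R'.rcos_eq_iff[OF pi', of "q ?X" "q (f n)" n] x(1) f(1) q_closed by simp
      then show ?thesis using sn[OF f(2)[of n]] by simp
    qed
    then show ?thesis using x(1) f(1) q_closed by (intro bexI[of _ "q ?X"]) auto
  qed
  have "?F ` carrier R' = ?S"
  proof (intro equalityI subsetI)
    show "s \<in> ?S" if "s \<in> ?F ` carrier R'" for s using that by (elim imageE) (simp only: sub)
    show "s \<in> ?F ` carrier R'" if "s \<in> ?S" for s using sup[OF that] by (elim bexE) (rule image_eqI)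
  qed
  then show ?thesis unfolding adically_complete_def bij_betw_def using inj by simp
qed

lemma surj_complete_noetherian_local:
  assumes c: "complete_noetherian_local R" and ne: "\<one>\<^bsub>R'\<^esub> \<noteq> \<zero>\<^bsub>R'\<^esub>"
  shows "complete_noetherian_local R'"
  using surj_local[OF assms] surj_adically_complete[OF assms] surj_noetherian[OF complete_noetherian_localD(2)[OF c]] cR'
  unfolding complete_noetherian_local_def surj_max_ideal[OF assms] by blast

end

section \<open>Finiteness\<close>

context noeth_module
begin

lemma finite_reps_span:
  assumes I: "ideal I R" and T: "finite T" "T \<subseteq> carrier R" "\<And>r. r \<in> carrier R \<Longrightarrow> \<exists>t\<in>T. r \<ominus>\<^bsub>R\<^esub> t \<in> I"
  shows "finite S \<Longrightarrow> S \<subseteq> carrier M \<Longrightarrow>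
    \<exists>X. finite X \<and> X \<subseteq> ispan M (carrier R) S \<and> (\<forall>x\<in>ispan M (carrier R) S. \<exists>t\<in>X. x \<ominus>\<^bsub>M\<^esub> t \<in> ispan M I S)"
proof (induct S rule: finite_induct)
  case empty
  then show ?case by (intro exI[of _ "{\<zero>\<^bsub>M\<^esub>}"]) (simp add: ispan_empty M.minus_eq)
next
  case (insert s S)
  have S: "S \<subseteq> carrier M" "s \<in> carrier M" using insert by auto
  obtain X where X: "finite X" "X \<subseteq> ispan M (carrier R) S" "\<And>x. x \<in> ispan M (carrier R) S \<Longrightarrow> \<exists>t\<in>X. x \<ominus>\<^bsub>M\<^esub> t \<in> ispan M I S"
    using insert(3)[OF S(1)] by blast
  let ?X = "(\<lambda>(t, x). t \<odot>\<^bsub>M\<^esub> s \<oplus>\<^bsub>M\<^esub> x) ` (T \<times> X)"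
  have mono: "ispan M J S \<subseteq> ispan M J (insert s S)" for J by (rule ispan_mono) auto
  have XM: "x \<in> X \<Longrightarrow> x \<in> carrier M" for x using X(2) ispan_closed[OF order_refl S(1)] by auto
  have "?X \<subseteq> ispan M (carrier R) (insert s S)"
    using T(2) X(2) mono[of "carrier R"] by (auto intro!: ispan.add)
  moreover have "\<exists>t\<in>?X. x \<ominus>\<^bsub>M\<^esub> t \<in> ispan M I (insert s S)" if x: "x \<in> ispan M (carrier R) (insert s S)" for x
  proof -
    obtain r y where ry: "r \<in> carrier R" "y \<in> ispan M (carrier R) S" "x = r \<odot>\<^bsub>M\<^esub> s \<oplus>\<^bsub>M\<^esub> y"
      using ispan_insert[OF R.oneideal insert(4) x] by blast
    have yc: "y \<in> carrier M" using ry ispan_closed[OF order_refl S(1)] by auto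
    obtain t where t: "t \<in> T" "r \<ominus>\<^bsub>R\<^esub> t \<in> I" using T(3)[OF ry(1)] by blast
    obtain u where u: "u \<in> X" "y \<ominus>\<^bsub>M\<^esub> u \<in> ispan M I S" using X(3)[OF ry(2)] by blast
    have tc: "t \<in> carrier R" using t T by auto
    have "x \<ominus>\<^bsub>M\<^esub> (t \<odot>\<^bsub>M\<^esub> s \<oplus>\<^bsub>M\<^esub> u) = (r \<ominus>\<^bsub>R\<^esub> t) \<odot>\<^bsub>M\<^esub> s \<oplus>\<^bsub>M\<^esub> (y \<ominus>\<^bsub>M\<^esub> u)"
      using ry(1,3) yc tc XM[OF u(1)] S
      by (simp add: M.minus_eq R.minus_eq smult_l_distr smult_l_minus M.minus_add M.a_ac)
    moreover have "(r \<ominus>\<^bsub>R\<^esub> t) \<odot>\<^bsub>M\<^esub> s \<oplus>\<^bsub>M\<^esub> (y \<ominus>\<^bsub>M\<^esub> u) \<in> ispan M I (insert s S)"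
      using t u mono[of I] by (intro ispan.add) auto
    ultimately show ?thesis using t u by (intro bexI[of _ "t \<odot>\<^bsub>M\<^esub> s \<oplus>\<^bsub>M\<^esub> u"]) auto
  qed
  ultimately show ?case using T(1) X(1) by (intro exI[of _ ?X]) auto
qed

text \<open>Finiteness of M/I^n M from finiteness of R/I, expressed by finite sets of
  representatives. Each layer is handled through generators of I^n M, which exist because R is
  noetherian.\<close>

lemma finite_reps:
  assumes fg: "fg_module R M" and I: "ideal I R"
    and T: "finite T" "T \<subseteq> carrier R" "\<And>r. r \<in> carrier R \<Longrightarrow> \<exists>t\<in>T. r \<ominus>\<^bsub>R\<^esub> t \<in> I"
  shows "\<exists>X. finite X \<and> X \<subseteq> carrier M \<and> (\<forall>x\<in>carrier M. \<exists>t\<in>X. x \<ominus>\<^bsub>M\<^esub> t \<in> ispan M (ideal_pow R I n) (carrier M))"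
proof (induct n)
  case 0
  have "x \<ominus>\<^bsub>M\<^esub> \<zero>\<^bsub>M\<^esub> \<in> ispan M (carrier R) (carrier M)" if "x \<in> carrier M" for x
    using rsub_minus[OF span_rsub[OF order_refl] span_base[OF that order_refl] ispan.zero] .
  then show ?case by (intro exI[of _ "{\<zero>\<^bsub>M\<^esub>}"]) simp
next
  case (Suc n)
  let ?N = "ispan M (ideal_pow R I n) (carrier M)" and ?N' = "ispan M (ideal_pow R I (Suc n)) (carrier M)"
  note pi = R.ideal_pow_ideal[OF I]
  note N = ispan_rsub[OF pi order_refl, of n] and N' = ispan_rsub[OF pi order_refl, of "Suc n"]
  obtain X where X: "finite X" "X \<subseteq> carrier M" "\<And>x. x \<in> carrier M \<Longrightarrow> \<exists>t\<in>X. x \<ominus>\<^bsub>M\<^esub> t \<in> ?N" using Suc by blast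
  obtain S where S: "finite S" "S \<subseteq> carrier M" "carrier M = ispan M (carrier R) S" using fg by (auto simp: fg_module_iff)
  \<comment> \<open>Modulo I G finitely many representatives suffice for I^n M, and I G lies in
    I^(n+1) M; sums of old and new representatives serve for the next level.\<close>
  obtain G where G: "finite G" "G \<subseteq> ?N" "?N = ispan M (carrier R) G"
    using noeth_fg[OF S(1,2) N] rsubD(1)[OF N] S(3) by auto
  have GM: "G \<subseteq> carrier M" using G(2) rsubD(1)[OF N] by auto
  obtain Y where Y: "finite Y" "Y \<subseteq> ?N" "\<And>x. x \<in> ?N \<Longrightarrow> \<exists>t\<in>Y. x \<ominus>\<^bsub>M\<^esub> t \<in> ispan M I G"
    using finite_reps_span[OF I T G(1) GM] G(3) by auto
  have "ispan M I G \<subseteq> ispan M I ?N" by (rule ispan_mono[OF order_refl G(2)])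
  also have "\<dots> \<subseteq> ?N'"
    by (rule ispan_ispan_le[OF I pi order_refl]) (use ideal.Icarr[OF pi, of _ "Suc n"] in \<open>auto intro: ideal_prod.prod\<close>)
  finally have GN: "ispan M I G \<subseteq> ?N'" .
  let ?X = "(\<lambda>(x, y). x \<oplus>\<^bsub>M\<^esub> y) ` (X \<times> Y)"
  have YM: "Y \<subseteq> carrier M" using Y(2) rsubD(1)[OF N] by auto
  have "\<exists>t\<in>?X. x \<ominus>\<^bsub>M\<^esub> t \<in> ?N'" if x: "x \<in> carrier M" for x
  proof -
    obtain t where t: "t \<in> X" "x \<ominus>\<^bsub>M\<^esub> t \<in> ?N" using X(3)[OF x] by blast
    obtain u where u: "u \<in> Y" "(x \<ominus>\<^bsub>M\<^esub> t) \<ominus>\<^bsub>M\<^esub> u \<in> ispan M I G" using Y(3)[OF t(2)] by blast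
    have "t \<in> carrier M" "u \<in> carrier M" using t u X(2) YM by auto
    then have "x \<ominus>\<^bsub>M\<^esub> (t \<oplus>\<^bsub>M\<^esub> u) = (x \<ominus>\<^bsub>M\<^esub> t) \<ominus>\<^bsub>M\<^esub> u" using x by (simp add: M.minus_eq M.minus_add M.a_ac)
    then show ?thesis using t u GN by (intro bexI[of _ "t \<oplus>\<^bsub>M\<^esub> u"]) auto
  qed
  then show ?case using X Y YM by (intro exI[of _ ?X]) auto
qed

end

text \<open>Here the finiteness of the target does what locality of \<open>f\<close> would do. Each
  a in m has a power in the annihilator of the image, and a noetherian ring turns this into one
  power of m.\<close>

lemma finite_target_nilpotent:
  fixes R :: "('r,'x) ring_scheme" and E :: "('r,'e) module" and N :: "('s,'n) module" and A :: "('s,'y) ring_scheme"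
  assumes R: "cring R" "noetherian_ring R" and m: "ideal m R" and u: "\<And>a. a \<in> m \<Longrightarrow> \<one>\<^bsub>R\<^esub> \<ominus>\<^bsub>R\<^esub> a \<in> Units R"
    and E: "Module.module R E" and N: "Module.module A N" "finite (carrier N)"
    and f: "f \<in> ring_hom R A" and h: "slin R f E N h"
  shows "\<exists>j. \<forall>x\<in>ispan E (ideal_pow R m j) (carrier E). h x = \<zero>\<^bsub>N\<^esub>"
proof -
  interpret R: cring R by fact
  interpret m: ideal m R by fact
  interpret E: pmodule R E using E by (simp add: pmodule_def)
  interpret N: Module.module A N by fact
  note hc = addhom_closed[OF slin_addhom[OF h]] and hs = slin_smult[OF h]
  have h0: "h \<zero>\<^bsub>E\<^esub> = \<zero>\<^bsub>N\<^esub>" using addhom_zero[OF slin_addhom[OF h] E.M.abelian_group_axioms N.abelian_group_axioms] .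
  have fc: "r \<in> carrier R \<Longrightarrow> f r \<in> carrier A" for r using ring_hom_closed[OF f] .
  define b where "b = {r \<in> carrier R. \<forall>x\<in>carrier E. h (r \<odot>\<^bsub>E\<^esub> x) = \<zero>\<^bsub>N\<^esub>}"
  have b: "ideal b R"
    by (rule R.idealI') (auto simp: b_def E.smult_l_distr E.smult_assoc1 addhom_add[OF slin_addhom[OF h]] h0 hs fc)
  have "\<exists>n::nat. a [^]\<^bsub>R\<^esub> n \<in> b" if a: "a \<in> m" for a
  proof -
    have ac: "a \<in> carrier R" using a by (rule m.Icarr)
    \<comment> \<open>Powers of a act on the finite set N, so two exponents k < l act equally by the
      pigeonhole principle. Restricting to the carrier makes the space of such functions
      finite.\<close>
    let ?g = "\<lambda>k::nat. restrict (\<lambda>n. f (a [^]\<^bsub>R\<^esub> k) \<odot>\<^bsub>N\<^esub> n) (carrier N)"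
    have "range ?g \<subseteq> carrier N \<rightarrow>\<^sub>E carrier N" using ac fc by auto
    then have "finite (range ?g)" by (rule finite_subset) (intro finite_PiE N(2))
    then have "\<not> inj ?g" using finite_imageD[of ?g UNIV] by auto
    then obtain k l where kl: "k < l" "?g k = ?g l" unfolding inj_def by (metis (no_types, lifting) linorder_neqE_nat)
    let ?d = "l - k"
    let ?w = "\<one>\<^bsub>R\<^esub> \<ominus>\<^bsub>R\<^esub> a [^]\<^bsub>R\<^esub> ?d"
    have "a [^]\<^bsub>R\<^esub> ?d \<in> m"
    proof -
      have "?d = Suc (?d - 1)" using kl by simp
      then have "a [^]\<^bsub>R\<^esub> ?d = a [^]\<^bsub>R\<^esub> (?d - 1) \<otimes>\<^bsub>R\<^esub> a" by (metis R.nat_pow_Suc)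
      then show ?thesis using a ac m.I_l_closed by simp
    qed
    then have wu: "?w \<in> Units R" by (rule u)
    have e: "f (a [^]\<^bsub>R\<^esub> k) \<odot>\<^bsub>N\<^esub> h x = f (a [^]\<^bsub>R\<^esub> l) \<odot>\<^bsub>N\<^esub> h x" if "x \<in> carrier E" for x
      using fun_cong[OF kl(2), of "h x"] hc[OF that] by simp
    have "a [^]\<^bsub>R\<^esub> k \<in> b"
    proof -
      have "h (a [^]\<^bsub>R\<^esub> k \<odot>\<^bsub>E\<^esub> x) = \<zero>\<^bsub>N\<^esub>" if x: "x \<in> carrier E" for x
      proof -
        \<comment> \<open>With y = w^-1 x the element a^k x is (a^k - a^l) y, and the image of y
          sees no difference between a^k and a^l.\<close>
        let ?v = "inv\<^bsub>R\<^esub> ?w" and ?y = "inv\<^bsub>R\<^esub> ?w \<odot>\<^bsub>E\<^esub> x"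
        have v: "?v \<in> carrier R" "?w \<otimes>\<^bsub>R\<^esub> ?v = \<one>\<^bsub>R\<^esub>" using wu by auto
        have y: "?y \<in> carrier E" using v x by simp
        have "a [^]\<^bsub>R\<^esub> k \<odot>\<^bsub>E\<^esub> x = a [^]\<^bsub>R\<^esub> k \<odot>\<^bsub>E\<^esub> (?w \<odot>\<^bsub>E\<^esub> ?y)"
          using v x ac by (simp add: E.smult_assoc1[symmetric])
        also have "\<dots> = (a [^]\<^bsub>R\<^esub> k \<otimes>\<^bsub>R\<^esub> ?w) \<odot>\<^bsub>E\<^esub> ?y" using y ac by (simp add: E.smult_assoc1)
        also have "a [^]\<^bsub>R\<^esub> k \<otimes>\<^bsub>R\<^esub> ?w = a [^]\<^bsub>R\<^esub> k \<ominus>\<^bsub>R\<^esub> a [^]\<^bsub>R\<^esub> l"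
          using ac kl(1) by (simp add: R.minus_eq R.r_distr R.r_minus R.nat_pow_mult)
        finally have "h (a [^]\<^bsub>R\<^esub> k \<odot>\<^bsub>E\<^esub> x) = h ((a [^]\<^bsub>R\<^esub> k \<ominus>\<^bsub>R\<^esub> a [^]\<^bsub>R\<^esub> l) \<odot>\<^bsub>E\<^esub> ?y)" by simp
        also have "(a [^]\<^bsub>R\<^esub> k \<ominus>\<^bsub>R\<^esub> a [^]\<^bsub>R\<^esub> l) \<odot>\<^bsub>E\<^esub> ?y = a [^]\<^bsub>R\<^esub> k \<odot>\<^bsub>E\<^esub> ?y \<ominus>\<^bsub>E\<^esub> a [^]\<^bsub>R\<^esub> l \<odot>\<^bsub>E\<^esub> ?y"
          using ac y by (simp add: R.minus_eq E.M.minus_eq E.smult_l_distr E.smult_l_minus)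
        also have "h \<dots> = \<zero>\<^bsub>N\<^esub>"
          using ac y e[OF y] hc[OF y] fc addhom_minus[OF slin_addhom[OF h] E.M.abelian_group_axioms N.abelian_group_axioms, of "a [^]\<^bsub>R\<^esub> k \<odot>\<^bsub>E\<^esub> ?y" "a [^]\<^bsub>R\<^esub> l \<odot>\<^bsub>E\<^esub> ?y"]
          by (simp add: hs N.minus_eq N.r_neg)
        finally show ?thesis .
      qed
      then show ?thesis using ac by (simp add: b_def)
    qed
    then show ?thesis by blast
  qed
  then obtain j where j: "ideal_pow R m j \<subseteq> b" using R.pow_subset_of_radical[OF R(2) b m] by blast
  have jc: "ideal_pow R m j \<subseteq> carrier R" using ideal.Icarr[OF R.ideal_pow_ideal[OF m]] by blast
  have "ispan E (ideal_pow R m j) (carrier E) \<subseteq> {x \<in> carrier E. h x = \<zero>\<^bsub>N\<^esub>}"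
    by (rule E.ispan_minimal) (use j jc in \<open>auto simp: b_def h0 addhom_add[OF slin_addhom[OF h]]\<close>)
  then show ?thesis by blast
qed

section \<open>Quotients of abelian groups and modules\<close>

text \<open>The axioms are inherited along a surjection compatible with the operations. The variants
  for modules, rings and algebras let every quotient be treated through its projection.\<close>

lemma abelian_group_surj:
  assumes "abelian_group M" "h ` carrier M = carrier N"
    "\<And>x y. \<lbrakk>x \<in> carrier M; y \<in> carrier M\<rbrakk> \<Longrightarrow> h (x \<oplus>\<^bsub>M\<^esub> y) = h x \<oplus>\<^bsub>N\<^esub> h y" "h \<zero>\<^bsub>M\<^esub> = \<zero>\<^bsub>N\<^esub>"
  shows "abelian_group N"
proof -
  interpret M: abelian_group M by fact
  have ex: "\<exists>x\<in>carrier M. y = h x" if "y \<in> carrier N" for y using that assms(2) by (metis imageE)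
  have cl: "x \<in> carrier M \<Longrightarrow> h x \<in> carrier N" for x using assms(2) by (metis imageI)
  show ?thesis
  proof (rule abelian_groupI)
    fix x assume x: "x \<in> carrier N"
    then obtain a where a: "a \<in> carrier M" "x = h a" using ex by blast
    show "\<zero>\<^bsub>N\<^esub> \<oplus>\<^bsub>N\<^esub> x = x" using a by (simp add: assms(3,4)[symmetric])
    show "\<exists>y\<in>carrier N. y \<oplus>\<^bsub>N\<^esub> x = \<zero>\<^bsub>N\<^esub>"
      using a cl by (intro bexI[of _ "h (\<ominus>\<^bsub>M\<^esub> a)"]) (simp_all add: assms(3,4)[symmetric] M.l_neg)
    fix y assume y: "y \<in> carrier N"
    then obtain b where b: "b \<in> carrier M" "y = h b" using ex by blast
    show "x \<oplus>\<^bsub>N\<^esub> y \<in> carrier N" using a b cl by (simp add: assms(3)[symmetric])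
    show "x \<oplus>\<^bsub>N\<^esub> y = y \<oplus>\<^bsub>N\<^esub> x" using a b by (simp add: assms(3)[symmetric] M.a_comm)
    fix z assume z: "z \<in> carrier N"
    then obtain c where c: "c \<in> carrier M" "z = h c" using ex by blast
    show "x \<oplus>\<^bsub>N\<^esub> y \<oplus>\<^bsub>N\<^esub> z = x \<oplus>\<^bsub>N\<^esub> (y \<oplus>\<^bsub>N\<^esub> z)" using a b c by (simp add: assms(3)[symmetric] M.a_assoc)
  next
    show "\<zero>\<^bsub>N\<^esub> \<in> carrier N" using cl[OF M.zero_closed] assms(4) by simp
  qed
qed

lemma module_surj:
  assumes "Module.module R M" "h ` carrier M = carrier N"
    "\<And>x y. \<lbrakk>x \<in> carrier M; y \<in> carrier M\<rbrakk> \<Longrightarrow> h (x \<oplus>\<^bsub>M\<^esub> y) = h x \<oplus>\<^bsub>N\<^esub> h y" "h \<zero>\<^bsub>M\<^esub> = \<zero>\<^bsub>N\<^esub>"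
    "\<And>r x. \<lbrakk>r \<in> carrier R; x \<in> carrier M\<rbrakk> \<Longrightarrow> h (r \<odot>\<^bsub>M\<^esub> x) = r \<odot>\<^bsub>N\<^esub> h x"
  shows "Module.module R N"
proof -
  interpret M: Module.module R M by fact
  have ex: "\<exists>x\<in>carrier M. y = h x" if "y \<in> carrier N" for y using that assms(2) by (metis imageE)
  have cl: "x \<in> carrier M \<Longrightarrow> h x \<in> carrier N" for x using assms(2) by (metis imageI)
  have ab: "abelian_group N" by (rule abelian_group_surj[OF M.abelian_group_axioms assms(2-4)])
  show ?thesis
  proof (rule moduleI[OF M.is_cring ab])
    fix r x assume r: "r \<in> carrier R" and x: "x \<in> carrier N"
    then obtain a where a: "a \<in> carrier M" "x = h a" using ex by blast
    show "r \<odot>\<^bsub>N\<^esub> x \<in> carrier N" using a r cl by (simp add: assms(5)[symmetric])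
    show "(r \<oplus>\<^bsub>R\<^esub> s) \<odot>\<^bsub>N\<^esub> x = r \<odot>\<^bsub>N\<^esub> x \<oplus>\<^bsub>N\<^esub> s \<odot>\<^bsub>N\<^esub> x" if "s \<in> carrier R" for s
      using a r that by (simp add: assms(3,5)[symmetric] M.smult_l_distr)
    show "(r \<otimes>\<^bsub>R\<^esub> s) \<odot>\<^bsub>N\<^esub> x = r \<odot>\<^bsub>N\<^esub> (s \<odot>\<^bsub>N\<^esub> x)" if "s \<in> carrier R" for s
      using a r that by (simp add: assms(3,5)[symmetric] M.smult_assoc1)
    fix y assume "y \<in> carrier N"
    then obtain b where b: "b \<in> carrier M" "y = h b" using ex by blast
    show "r \<odot>\<^bsub>N\<^esub> (x \<oplus>\<^bsub>N\<^esub> y) = r \<odot>\<^bsub>N\<^esub> x \<oplus>\<^bsub>N\<^esub> r \<odot>\<^bsub>N\<^esub> y" using a b r by (simp add: assms(3,5)[symmetric] M.smult_r_distr)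
  next
    fix x assume "x \<in> carrier N"
    then obtain a where a: "a \<in> carrier M" "x = h a" using ex by blast
    then show "\<one>\<^bsub>R\<^esub> \<odot>\<^bsub>N\<^esub> x = x" using assms(5)[of "\<one>\<^bsub>R\<^esub>" a] by simp
  qed
qed

section \<open>Cosets in abelian groups\<close>

context abelian_group
begin

lemma rcos_mem: "w \<in> H +> x \<longleftrightarrow> (\<exists>h\<in>H. w = h \<oplus> x)"
  by (auto simp: a_r_coset_def r_coset_def)

lemma rcosets_mem: "X \<in> a_rcosets H \<longleftrightarrow> (\<exists>x\<in>carrier G. X = H +> x)"
  unfolding A_RCOSETS_def' by blast

lemma subgroupD:
  assumes "subgroup H (add_monoid G)"
  shows "x \<in> H \<Longrightarrow> x \<in> carrier G" "\<zero> \<in> H" "x \<in> H \<Longrightarrow> y \<in> H \<Longrightarrow> x \<oplus> y \<in> H" "x \<in> H \<Longrightarrow> \<ominus> x \<in> H"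
    "x \<in> H \<Longrightarrow> y \<in> H \<Longrightarrow> x \<ominus> y \<in> H"
proof -
  interpret H: additive_subgroup H G using assms by (rule additive_subgroupI)
  show "x \<in> H \<Longrightarrow> x \<in> carrier G" "\<zero> \<in> H" "x \<in> H \<Longrightarrow> y \<in> H \<Longrightarrow> x \<oplus> y \<in> H" "x \<in> H \<Longrightarrow> \<ominus> x \<in> H"
    "x \<in> H \<Longrightarrow> y \<in> H \<Longrightarrow> x \<ominus> y \<in> H" using H.a_subset by (auto simp: minus_eq)
qed

lemma rcos_iff:
  assumes H: "subgroup H (add_monoid G)" and x: "x \<in> carrier G" and y: "y \<in> carrier G"
  shows "H +> x = H +> y \<longleftrightarrow> x \<ominus> y \<in> H"
proof
  assume e: "H +> x = H +> y"
  have "x \<in> H +> x" using subgroupD(2)[OF H] x by (force simp: rcos_mem)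
  then obtain h where h: "h \<in> H" "x = h \<oplus> y" using e by (auto simp: rcos_mem)
  then show "x \<ominus> y \<in> H" using y subgroupD(1)[OF H] by (simp add: minus_eq a_assoc r_neg)
next
  assume "x \<ominus> y \<in> H"
  moreover have "x = (x \<ominus> y) \<oplus> y" using x y by (simp add: minus_eq a_assoc l_neg)
  ultimately have "x \<in> H +> y" by (auto simp: rcos_mem)
  then show "H +> x = H +> y" using a_repr_independence[OF _ y H] by simp
qed

lemma rcos_zero_iff:
  assumes "subgroup H (add_monoid G)" "x \<in> carrier G" shows "H +> x = H \<longleftrightarrow> x \<in> H"
proof -
  have "\<ominus> \<zero> = \<zero>" by (metis l_neg r_zero zero_closed a_inv_closed)
  then have "x \<ominus> \<zero> = x" using assms(2) by (metis minus_eq r_zero)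
  then show ?thesis
    using rcos_iff[OF assms zero_closed] a_coset_join2[OF zero_closed assms(1) subgroupD(2)[OF assms(1)]] by metis
qed

lemma rcos_zero: "subgroup H (add_monoid G) \<Longrightarrow> H +> \<zero> = H"
  using a_coset_join2[of \<zero> H] subgroupD(2)[of H] by simp

lemma rcos_add:
  assumes H: "subgroup H (add_monoid G)" and x: "x \<in> carrier G" and y: "y \<in> carrier G"
  shows "(H +> x) <+> (H +> y) = H +> (x \<oplus> y)"
  using abelian_subgroup.a_rcos_sum[OF abelian_subgroupI3[OF additive_subgroupI[OF H] abelian_group_axioms] x y] .

text \<open>Operations on quotients are given as unions over the representatives of a coset; for a
  map preserving H all these cosets coincide.\<close>

lemma rcos_UN:
  assumes H: "subgroup H (add_monoid G)" and x: "x \<in> carrier G" and t: "addhom G G t" "\<And>h. h \<in> H \<Longrightarrow> t h \<in> H"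
  shows "(\<Union>y\<in>H +> x. H +> t y) = H +> t x"
proof -
  have "H +> t y = H +> t x" if yx: "y \<in> H +> x" for y
  proof -
    obtain h where h: "h \<in> H" "y = h \<oplus> x" using yx by (auto simp: rcos_mem)
    have hc: "h \<in> carrier G" using h subgroupD(1)[OF H] by blast
    have "t y = t h \<oplus> t x" using h hc x addhom_add[OF t(1)] by simp
    then have "t y \<ominus> t x \<in> H" using t(2)[OF h(1)] addhom_closed[OF t(1)] hc x by (simp add: minus_eq a_assoc r_neg)
    then show ?thesis using rcos_iff[OF H, of "t y" "t x"] addhom_closed[OF t(1)] h hc x by simp
  qed
  moreover have "x \<in> H +> x" using subgroupD(2)[OF H] x by (force simp: rcos_mem)
  ultimately show ?thesis by blast
qed

end

lemma quot_module_simps [simp]: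
  "carrier (quot_module M N) = a_rcosets\<^bsub>M\<^esub> N" "zero (quot_module M N) = N" "add (quot_module M N) = set_add M"
  "one (quot_module M N) = N +>\<^bsub>M\<^esub> \<one>\<^bsub>M\<^esub>" "monoid.mult (quot_module M N) = rcoset_mult M N"
  by (simp_all add: quot_module_def)

context pmodule
begin

lemma quot_surj: "(\<lambda>x. N +>\<^bsub>M\<^esub> x) ` carrier M = a_rcosets\<^bsub>M\<^esub> N"
  unfolding A_RCOSETS_def' by blast

lemma smult_addhom: "r \<in> carrier R \<Longrightarrow> addhom M M (\<lambda>x. r \<odot>\<^bsub>M\<^esub> x)"
  by (rule addhomI) (simp_all add: smult_r_distr)

lemma quot_smult: "rsub R M N \<Longrightarrow> r \<in> carrier R \<Longrightarrow> x \<in> carrier M \<Longrightarrow>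
    r \<odot>\<^bsub>quot_module M N\<^esub> (N +>\<^bsub>M\<^esub> x) = N +>\<^bsub>M\<^esub> (r \<odot>\<^bsub>M\<^esub> x)"
  by (simp add: quot_module_def M.rcos_UN[OF rsub_subgroup _ smult_addhom] rsubD(4))

lemma quot_is_module: "rsub R M N \<Longrightarrow> Module.module R (quot_module M N)"
  by (rule module_surj[OF module_axioms, where h = "\<lambda>x. N +>\<^bsub>M\<^esub> x"])
    (simp_all add: quot_surj M.rcos_add[OF rsub_subgroup] M.rcos_zero[OF rsub_subgroup] quot_smult)

lemma quot_proj: "rsub R M N \<Longrightarrow> slin R (\<lambda>r. r) M (quot_module M N) (\<lambda>x. N +>\<^bsub>M\<^esub> x)"
  by (rule slinI[OF addhomI]) (simp_all add: M.rcos_add[OF rsub_subgroup] quot_smult M.rcosets_mem, blast)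

lemma rsub_submodule: "rsub R M N \<Longrightarrow> submodule N R M"
  using rsub_subgroup[of N] rsubD(4)[of R M N] by (simp add: submodule_def submodule_axioms_def)

end

section \<open>Modules over the \<open>p\<close>-adic integers\<close>

lemma Zp_simps: "carrier (Zp p) = {x. \<forall>n. x n \<in> {0..<int p ^ n} \<and> x (Suc n) mod int p ^ n = x n}"
  "x \<otimes>\<^bsub>Zp p\<^esub> y = (\<lambda>n. (x n * y n) mod int p ^ n)" "\<one>\<^bsub>Zp p\<^esub> = (\<lambda>n. 1 mod int p ^ n)" "\<zero>\<^bsub>Zp p\<^esub> = (\<lambda>n. 0)"
  "x \<oplus>\<^bsub>Zp p\<^esub> y = (\<lambda>n. (x n + y n) mod int p ^ n)"
  by (simp_all add: Zp_def)

lemma Zp_mod: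
  assumes "z \<in> carrier (Zp p)" "n \<le> m" shows "z m mod int p ^ n = z n"
  using assms(2)
proof (induct m rule: dec_induct)
  case base
  then show ?case using assms(1) by (simp add: Zp_simps)
next
  case (step m)
  have "z (Suc m) mod int p ^ m mod int p ^ n = z (Suc m) mod int p ^ n"
    using step(1) by (simp add: mod_mod_cancel le_imp_power_dvd)
  then show ?case using step assms(1) by (simp add: Zp_simps)
qed

definition Zp_int :: "nat \<Rightarrow> int \<Rightarrow> padic" where
  "Zp_int p a = (\<lambda>n. a mod int p ^ n)"

lemma Zp_int_closed: "p > 0 \<Longrightarrow> Zp_int p a \<in> carrier (Zp p)"
  by (simp add: Zp_simps Zp_int_def mod_mod_cancel)

lemma Zp_int_add: "Zp_int p a \<oplus>\<^bsub>Zp p\<^esub> Zp_int p b = Zp_int p (a + b)"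
  and Zp_int_mult: "Zp_int p a \<otimes>\<^bsub>Zp p\<^esub> Zp_int p b = Zp_int p (a * b)"
  and Zp_int_0: "Zp_int p 0 = \<zero>\<^bsub>Zp p\<^esub>" and Zp_int_1: "Zp_int p 1 = \<one>\<^bsub>Zp p\<^esub>"
  by (simp_all add: Zp_simps Zp_int_def mod_add_eq mod_mult_eq fun_eq_iff)

text \<open>Division by p^k costs k digits, so the quotient z' at level n is read off from the
  residue of z at level n + k.\<close>

lemma Zp_split:
  assumes p: "p > 0" and z: "z \<in> carrier (Zp p)"
  shows "\<exists>z'\<in>carrier (Zp p). z = Zp_int p (z k) \<oplus>\<^bsub>Zp p\<^esub> (Zp_int p (int p ^ k) \<otimes>\<^bsub>Zp p\<^esub> z')"
proof -
  define z' where "z' = (\<lambda>n. z (n + k) div int p ^ k)"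
  have pk: "int p ^ k > 0" using p by simp
  have z0: "0 \<le> z n" "z n < int p ^ n" for n using z by (auto simp: Zp_simps)
  have zc: "z' \<in> carrier (Zp p)"
  proof -
    have "0 \<le> z' n" "z' n < int p ^ n" for n
    proof -
      show "0 \<le> z' n" using z0 pk by (simp add: z'_def pos_imp_zdiv_nonneg_iff)
      have "z (n + k) < int p ^ k * int p ^ n" using z0(2)[of "n + k"] by (simp add: power_add mult.commute)
      then show "z' n < int p ^ n" unfolding z'_def using pk
        by (smt (verit) div_pos_geq mult.commute nonzero_mult_div_cancel_left zdiv_mono1 minus_mult_div_eq_mod pos_mod_sign mult_less_cancel_left_pos)
    qed
    moreover have "z' (Suc n) mod int p ^ n = z' n" for n
    proof -
      have "z (n + k) = z (Suc n + k) mod (int p ^ k * int p ^ n)"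
        using Zp_mod[OF z, of "n + k" "Suc n + k"] by (simp add: power_add mult.commute)
      also have "\<dots> div int p ^ k = z (Suc n + k) div int p ^ k mod int p ^ n"
        using pk by (simp add: zmod_zmult2_eq)
      finally show ?thesis by (simp add: z'_def)
    qed
    ultimately show ?thesis by (simp add: Zp_simps)
  qed
  have zn: "z n = (z k mod int p ^ n + ((int p ^ k mod int p ^ n) * z' n) mod int p ^ n) mod int p ^ n" for n
  proof -
    have "z (n + k) = z k + int p ^ k * z' n" using Zp_mod[OF z, of k "n + k"] by (simp add: z'_def)
       (metis mod_mult_div_eq)
    then have "z n = (z k + int p ^ k * z' n) mod int p ^ n" using Zp_mod[OF z, of n "n + k"] by simp
    then show ?thesis by (simp add: mod_simps)
  qed
  show ?thesis
  proof (rule bexI[OF _ zc], rule ext)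
    show "z n = (Zp_int p (z k) \<oplus>\<^bsub>Zp p\<^esub> (Zp_int p (int p ^ k) \<otimes>\<^bsub>Zp p\<^esub> z')) n" for n
      unfolding Zp_simps Zp_int_def by (rule zn)
  qed
qed

text \<open>v is the inverse of 1 - p^d, that is, the geometric series in p^d. At level n the first
  n terms suffice, because p^n divides (p^d)^n for positive d.\<close>

lemma Zp_geometric:
  assumes p: "p > 0" and d: "d > 0"
  shows "\<exists>v\<in>carrier (Zp p). (v \<otimes>\<^bsub>Zp p\<^esub> Zp_int p (int p ^ d)) \<oplus>\<^bsub>Zp p\<^esub> \<one>\<^bsub>Zp p\<^esub> = v"
proof -
  let ?s = "\<lambda>n. \<Sum>j<n. (int p ^ d) ^ j"
  define v where "v = (\<lambda>n. ?s n mod int p ^ n)"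
  have dv: "int p ^ n dvd (int p ^ d) ^ n" for n using d by (simp add: power_mult[symmetric] le_imp_power_dvd)
  have z: "(int p ^ d) ^ n mod int p ^ n = 0" for n using dv[of n] by simp
  have sS: "?s (Suc n) mod int p ^ n = ?s n mod int p ^ n" for n using z[of n] by (simp add: mod_add_right_eq[symmetric])
  have "v \<in> carrier (Zp p)"
    using p by (simp add: Zp_simps v_def mod_mod_cancel le_imp_power_dvd sS del: sum.lessThan_Suc)
  moreover have "(v n * (int p ^ d mod int p ^ n) mod int p ^ n + 1 mod int p ^ n) mod int p ^ n = v n" for n
  proof -
    have "?s n * int p ^ d + 1 = ?s (Suc n)"
      by (simp add: sum.lessThan_Suc_shift sum_distrib_left mult.commute del: sum.lessThan_Suc)
    then have "(?s n * int p ^ d + 1) mod int p ^ n = v n" using sS[of n] by (simp add: v_def)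
    then show ?thesis by (simp add: v_def mod_simps)
  qed
  ultimately show ?thesis by (intro bexI[of _ v]) (simp_all add: Zp_simps Zp_int_def fun_eq_iff)
qed

text \<open>Among the multiples p^k x two coincide, so w = p^k x satisfies p^d w = w for some d > 0.
  As 1 - p^d is invertible, w = 0. The maximum of the exponents over the finite carrier works for
  all x.\<close>

lemma Zp_finite_killed:
  assumes p: "p > 0" and M: "Module.module (Zp p) M" "finite (carrier M)"
  shows "\<exists>k. \<forall>x\<in>carrier M. Zp_int p (int p ^ k) \<odot>\<^bsub>M\<^esub> x = \<zero>\<^bsub>M\<^esub>"
proof -
  interpret M: Module.module "Zp p" M by fact
  let ?P = "\<lambda>k. Zp_int p (int p ^ k)"
  have Pc: "?P k \<in> carrier (Zp p)" for k by (rule Zp_int_closed[OF p])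
  have Padd: "?P (k + l) \<odot>\<^bsub>M\<^esub> x = ?P k \<odot>\<^bsub>M\<^esub> (?P l \<odot>\<^bsub>M\<^esub> x)" if "x \<in> carrier M" for k l x
    using that Pc by (simp add: M.smult_assoc1[symmetric] Zp_int_mult power_add)
  have one: "\<exists>k. ?P k \<odot>\<^bsub>M\<^esub> x = \<zero>\<^bsub>M\<^esub>" if x: "x \<in> carrier M" for x
  proof -
    have "finite (range (\<lambda>k. ?P k \<odot>\<^bsub>M\<^esub> x))" by (rule finite_subset[OF _ M(2)]) (use x Pc in auto)
    then have "\<not> inj (\<lambda>k. ?P k \<odot>\<^bsub>M\<^esub> x)" using finite_imageD[of "\<lambda>k. ?P k \<odot>\<^bsub>M\<^esub> x" UNIV] by auto
    then obtain k l where kl: "k < l" "?P k \<odot>\<^bsub>M\<^esub> x = ?P l \<odot>\<^bsub>M\<^esub> x" unfolding inj_def by (metis linorder_neqE_nat)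
    let ?w = "?P k \<odot>\<^bsub>M\<^esub> x" and ?d = "l - k"
    have wc: "?w \<in> carrier M" using x Pc by simp
    have ww: "?P ?d \<odot>\<^bsub>M\<^esub> ?w = ?w" using Padd[OF x, of ?d k] kl by simp
    obtain v where v: "v \<in> carrier (Zp p)" "(v \<otimes>\<^bsub>Zp p\<^esub> ?P ?d) \<oplus>\<^bsub>Zp p\<^esub> \<one>\<^bsub>Zp p\<^esub> = v"
      using Zp_geometric[OF p, of ?d] kl by auto
    have "v \<odot>\<^bsub>M\<^esub> ?w = ((v \<otimes>\<^bsub>Zp p\<^esub> ?P ?d) \<oplus>\<^bsub>Zp p\<^esub> \<one>\<^bsub>Zp p\<^esub>) \<odot>\<^bsub>M\<^esub> ?w" using v(2) by simp
    also have "\<dots> = v \<odot>\<^bsub>M\<^esub> (?P ?d \<odot>\<^bsub>M\<^esub> ?w) \<oplus>\<^bsub>M\<^esub> ?w"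
      using v(1) wc Pc by (simp only: M.smult_l_distr M.smult_assoc1 M.smult_one M.m_closed M.one_closed)
    finally have "v \<odot>\<^bsub>M\<^esub> ?w \<oplus>\<^bsub>M\<^esub> \<zero>\<^bsub>M\<^esub> = v \<odot>\<^bsub>M\<^esub> ?w \<oplus>\<^bsub>M\<^esub> ?w" using ww v(1) wc by simp
    then have "?w = \<zero>\<^bsub>M\<^esub>" using v(1) wc by (metis M.smult_closed M.M.add.l_cancel M.M.zero_closed)
    then show ?thesis by blast
  qed
  then obtain k where k: "\<And>x. x \<in> carrier M \<Longrightarrow> ?P (k x) \<odot>\<^bsub>M\<^esub> x = \<zero>\<^bsub>M\<^esub>" by metis
  have "?P (Max (k ` carrier M)) \<odot>\<^bsub>M\<^esub> x = \<zero>\<^bsub>M\<^esub>" if x: "x \<in> carrier M" for x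
  proof -
    have "k x \<le> Max (k ` carrier M)" using x M(2) by simp
    then obtain j where "Max (k ` carrier M) = j + k x" using le_Suc_ex by (metis add.commute)
    then show ?thesis using Padd[OF x, of j "k x"] k[OF x] Pc by simp
  qed
  then show ?thesis by blast
qed

lemma addhom_Zp_int:
  assumes p: "p > 0" and M: "Module.module (Zp p) M" and N: "Module.module (Zp p) N" and h: "addhom M N h"
    and x: "x \<in> carrier M"
  shows "h (Zp_int p (int a) \<odot>\<^bsub>M\<^esub> x) = Zp_int p (int a) \<odot>\<^bsub>N\<^esub> h x"
proof -
  interpret M: Module.module "Zp p" M by fact
  interpret N: Module.module "Zp p" N by fact
  have hx: "h x \<in> carrier N" using addhom_closed[OF h x] .
  note c = Zp_int_closed[OF p]
  show ?thesis
  proof (induct a)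
    case 0
    then show ?case using x hx addhom_zero[OF h M.abelian_group_axioms N.abelian_group_axioms] by (simp add: Zp_int_0)
  next
    case (Suc a)
    have e: "Zp_int p (int (Suc a)) = Zp_int p (int a) \<oplus>\<^bsub>Zp p\<^esub> \<one>\<^bsub>Zp p\<^esub>"
      by (simp add: Zp_int_1[symmetric] Zp_int_add add.commute)
    show ?case unfolding e using x hx c Suc by (simp add: M.smult_l_distr N.smult_l_distr addhom_add[OF h])
  qed
qed

text \<open>Additivity implies p-adic linearity when the target is finite: a power p^k kills the
  target, and modulo p^k a p-adic integer is a natural number. This is why maps and actions may be
  treated as merely additive below.\<close>

lemma addhom_Zp_linear:
  assumes p: "p > 0" and M: "Module.module (Zp p) M" and N: "Module.module (Zp p) N" "finite (carrier N)" and h: "addhom M N h"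
    and z: "z \<in> carrier (Zp p)" and x: "x \<in> carrier M"
  shows "h (z \<odot>\<^bsub>M\<^esub> x) = z \<odot>\<^bsub>N\<^esub> h x"
proof -
  interpret M: Module.module "Zp p" M by fact
  interpret N: Module.module "Zp p" N by fact
  have hx: "h x \<in> carrier N" using addhom_closed[OF h x] .
  obtain k where k: "\<And>y. y \<in> carrier N \<Longrightarrow> Zp_int p (int p ^ k) \<odot>\<^bsub>N\<^esub> y = \<zero>\<^bsub>N\<^esub>"
    using Zp_finite_killed[OF p N] by blast
  obtain z' where z': "z' \<in> carrier (Zp p)" "z = Zp_int p (z k) \<oplus>\<^bsub>Zp p\<^esub> (Zp_int p (int p ^ k) \<otimes>\<^bsub>Zp p\<^esub> z')"
    using Zp_split[OF p z] by blast
  note c = Zp_int_closed[OF p]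
  have "0 \<le> z k" using z by (simp add: Zp_simps)
  then obtain a where a: "z k = int a" by (rule nonneg_int_cases)
  have zz: "z = Zp_int p (int a) \<oplus>\<^bsub>Zp p\<^esub> (Zp_int p (int p ^ k) \<otimes>\<^bsub>Zp p\<^esub> z')" using z'(2) a by simp
  have i: "int p ^ k = int (p ^ k)" by simp
  have "h (z \<odot>\<^bsub>M\<^esub> x) = h (Zp_int p (int a) \<odot>\<^bsub>M\<^esub> x) \<oplus>\<^bsub>N\<^esub> h (Zp_int p (int p ^ k) \<odot>\<^bsub>M\<^esub> (z' \<odot>\<^bsub>M\<^esub> x))"
    using x z' c by (subst zz) (simp add: M.smult_l_distr M.smult_assoc1 addhom_add[OF h])
  also have "\<dots> = Zp_int p (int a) \<odot>\<^bsub>N\<^esub> h x \<oplus>\<^bsub>N\<^esub> Zp_int p (int p ^ k) \<odot>\<^bsub>N\<^esub> h (z' \<odot>\<^bsub>M\<^esub> x)"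
    using x z' unfolding i by (simp only: addhom_Zp_int[OF p M N(1) h] M.smult_closed)
  also have "\<dots> = Zp_int p (int a) \<odot>\<^bsub>N\<^esub> h x \<oplus>\<^bsub>N\<^esub> Zp_int p (int p ^ k) \<odot>\<^bsub>N\<^esub> (z' \<odot>\<^bsub>N\<^esub> h x)"
    using x z' hx addhom_closed[OF h] by (simp add: k)
  also have "\<dots> = z \<odot>\<^bsub>N\<^esub> h x" using hx z' c by (subst zz) (simp add: N.smult_l_distr N.smult_assoc1)
  finally show ?thesis .
qed

lemma (in abelian_group) minus_zero_iff:
  assumes "x \<in> carrier G" "y \<in> carrier G" shows "x \<ominus> y = \<zero> \<longleftrightarrow> x = y"
proof
  assume "x \<ominus> y = \<zero>"
  then have "(x \<ominus> y) \<oplus> y = y" using assms by simp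
  then show "x = y" using assms by (simp add: minus_eq a_assoc l_neg)
qed (use assms in \<open>simp add: minus_eq r_neg\<close>)

section \<open>Finite modules with a group action, and stable conditions\<close>

text \<open>Neither finiteness nor continuity is included, so that E itself qualifies. Linearity of
  the action over the p-adic integers is recovered from \<open>addhom_Zp_linear\<close> as soon as
  the module is finite.\<close>

definition gmod :: "nat \<Rightarrow> 'g monoid \<Rightarrow> (padic, 'm) module \<Rightarrow> ('g \<Rightarrow> 'm \<Rightarrow> 'm) \<Rightarrow> bool" where
  "gmod p G M \<alpha> \<longleftrightarrow> Module.module (Zp p) M \<and> (\<forall>s\<in>carrier G. addhom M M (\<alpha> s)) \<and>
     (\<forall>x\<in>carrier M. \<alpha> \<one>\<^bsub>G\<^esub> x = x) \<and>
     (\<forall>s\<in>carrier G. \<forall>t\<in>carrier G. \<forall>x\<in>carrier M. \<alpha> (s \<otimes>\<^bsub>G\<^esub> t) x = \<alpha> s (\<alpha> t x))"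

definition ghom :: "'g monoid \<Rightarrow> ('a, 'x) ring_scheme \<Rightarrow> ('g \<Rightarrow> 'a \<Rightarrow> 'a) \<Rightarrow> ('b, 'y) ring_scheme \<Rightarrow> ('g \<Rightarrow> 'b \<Rightarrow> 'b) \<Rightarrow> ('a \<Rightarrow> 'b) \<Rightarrow> bool" where
  "ghom G M \<alpha> N \<beta> \<phi> \<longleftrightarrow> addhom M N \<phi> \<and> (\<forall>s\<in>carrier G. \<forall>x\<in>carrier M. \<phi> (\<alpha> s x) = \<beta> s (\<phi> x))"

definition gsub :: "nat \<Rightarrow> 'g monoid \<Rightarrow> (padic, 'm) module \<Rightarrow> ('g \<Rightarrow> 'm \<Rightarrow> 'm) \<Rightarrow> 'm set \<Rightarrow> bool" where
  "gsub p G M \<alpha> H \<longleftrightarrow> rsub (Zp p) M H \<and> (\<forall>s\<in>carrier G. \<forall>x\<in>H. \<alpha> s x \<in> H)"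

lemma gmodD:
  assumes "gmod p G M \<alpha>"
  shows "Module.module (Zp p) M" "pmodule (Zp p) M" "abelian_group M" "\<And>s. s \<in> carrier G \<Longrightarrow> addhom M M (\<alpha> s)"
    "\<And>s x. s \<in> carrier G \<Longrightarrow> x \<in> carrier M \<Longrightarrow> \<alpha> s x \<in> carrier M"
    "\<And>x. x \<in> carrier M \<Longrightarrow> \<alpha> \<one>\<^bsub>G\<^esub> x = x"
    "\<And>s t x. s \<in> carrier G \<Longrightarrow> t \<in> carrier G \<Longrightarrow> x \<in> carrier M \<Longrightarrow> \<alpha> (s \<otimes>\<^bsub>G\<^esub> t) x = \<alpha> s (\<alpha> t x)"
  using assms by (auto simp: gmod_def pmodule_def Module.module_def addhom_def)

lemma ghomD:
  assumes "ghom G M \<alpha> N \<beta> \<phi>"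
  shows "addhom M N \<phi>" "\<And>s x. s \<in> carrier G \<Longrightarrow> x \<in> carrier M \<Longrightarrow> \<phi> (\<alpha> s x) = \<beta> s (\<phi> x)"
    "\<And>x. x \<in> carrier M \<Longrightarrow> \<phi> x \<in> carrier N"
    "\<And>x y. x \<in> carrier M \<Longrightarrow> y \<in> carrier M \<Longrightarrow> \<phi> (x \<oplus>\<^bsub>M\<^esub> y) = \<phi> x \<oplus>\<^bsub>N\<^esub> \<phi> y"
  using assms by (auto simp: ghom_def addhom_def)

lemma ghomI: "addhom M N \<phi> \<Longrightarrow> (\<And>s x. s \<in> carrier G \<Longrightarrow> x \<in> carrier M \<Longrightarrow> \<phi> (\<alpha> s x) = \<beta> s (\<phi> x)) \<Longrightarrow> ghom G M \<alpha> N \<beta> \<phi>"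
  by (simp add: ghom_def)

lemma ghom_comp: "ghom G M \<alpha> N \<beta> \<phi> \<Longrightarrow> ghom G N \<beta> P \<gamma> \<psi> \<Longrightarrow> ghom G M \<alpha> P \<gamma> (\<lambda>x. \<psi> (\<phi> x))"
  by (rule ghomI[OF addhom_comp[OF ghomD(1) ghomD(1)]]) (auto simp: ghomD)

text \<open>The induced map is defined through an arbitrary preimage; two preimages differ by an
  element of the kernel, which h also kills.\<close>

lemma addhom_factor:
  assumes M: "abelian_group M" and N: "abelian_group N" and P: "abelian_group P"
    and pi: "addhom M N \<pi>" "\<pi> ` carrier M = carrier N" and h: "addhom M P h"
    and ker: "\<And>x. x \<in> carrier M \<Longrightarrow> \<pi> x = \<zero>\<^bsub>N\<^esub> \<Longrightarrow> h x = \<zero>\<^bsub>P\<^esub>"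
  shows "\<exists>k. addhom N P k \<and> (\<forall>x\<in>carrier M. k (\<pi> x) = h x)"
proof -
  interpret M: abelian_group M by fact
  interpret N: abelian_group N by fact
  interpret P: abelian_group P by fact
  define k where "k y = h (inv_into (carrier M) \<pi> y)" for y
  have k: "k (\<pi> x) = h x" if x: "x \<in> carrier M" for x
  proof -
    let ?x = "inv_into (carrier M) \<pi> (\<pi> x)"
    have c: "?x \<in> carrier M" "\<pi> ?x = \<pi> x" using x by (auto intro: inv_into_into f_inv_into_f)
    have "\<pi> (?x \<ominus>\<^bsub>M\<^esub> x) = \<zero>\<^bsub>N\<^esub>" using c x addhom_closed[OF pi(1)] by (simp add: addhom_minus[OF pi(1) M N] N.minus_eq N.r_neg)
    then have "h ?x \<ominus>\<^bsub>P\<^esub> h x = \<zero>\<^bsub>P\<^esub>" using ker[of "?x \<ominus>\<^bsub>M\<^esub> x"] c x by (simp add: addhom_minus[OF h M P])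
    then show ?thesis using c x addhom_closed[OF h] by (simp add: k_def P.minus_zero_iff)
  qed
  have ex: "\<exists>x\<in>carrier M. y = \<pi> x" if "y \<in> carrier N" for y using that pi(2) by (metis imageE)
  have "addhom N P k"
  proof (rule addhomI)
    fix y assume "y \<in> carrier N"
    then obtain x where x: "x \<in> carrier M" "y = \<pi> x" using ex by blast
    show "k y \<in> carrier P" using x k addhom_closed[OF h] by simp
    fix y' assume "y' \<in> carrier N"
    then obtain x' where x': "x' \<in> carrier M" "y' = \<pi> x'" using ex by blast
    have "k (y \<oplus>\<^bsub>N\<^esub> y') = k (\<pi> (x \<oplus>\<^bsub>M\<^esub> x'))" using x x' addhom_add[OF pi(1)] by simp
    also have "\<dots> = k y \<oplus>\<^bsub>P\<^esub> k y'" using x x' k addhom_add[OF h] by simp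
    finally show "k (y \<oplus>\<^bsub>N\<^esub> y') = k y \<oplus>\<^bsub>P\<^esub> k y'" .
  qed
  then show ?thesis using k by blast
qed

lemma ghom_factor:
  assumes M: "abelian_group M" and N: "abelian_group N" and P: "abelian_group P"
    and pi: "ghom G M \<alpha> N \<beta> \<pi>" "\<pi> ` carrier M = carrier N" and h: "ghom G M \<alpha> P \<gamma> h"
    and a: "\<And>s x. s \<in> carrier G \<Longrightarrow> x \<in> carrier M \<Longrightarrow> \<alpha> s x \<in> carrier M"
    and ker: "\<And>x. x \<in> carrier M \<Longrightarrow> \<pi> x = \<zero>\<^bsub>N\<^esub> \<Longrightarrow> h x = \<zero>\<^bsub>P\<^esub>"
  shows "\<exists>k. ghom G N \<beta> P \<gamma> k \<and> (\<forall>x\<in>carrier M. k (\<pi> x) = h x)"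
proof -
  obtain k where k: "addhom N P k" "\<And>x. x \<in> carrier M \<Longrightarrow> k (\<pi> x) = h x"
    using addhom_factor[OF M N P ghomD(1)[OF pi(1)] pi(2) ghomD(1)[OF h] ker] by blast
  have "k (\<beta> s y) = \<gamma> s (k y)" if s: "s \<in> carrier G" and y: "y \<in> carrier N" for s y
  proof -
    obtain x where x: "x \<in> carrier M" "y = \<pi> x" using y pi(2) by (metis imageE)
    have "\<beta> s y = \<pi> (\<alpha> s x)" using x s ghomD(2)[OF pi(1)] by simp
    then show ?thesis using x s k a ghomD(2)[OF h] by simp
  qed
  then show ?thesis using k by (intro exI[of _ k]) (simp add: ghom_def)
qed

lemma quot_act_rcos:
  assumes M: "gmod p G M \<alpha>" and H: "gsub p G M \<alpha> H" and s: "s \<in> carrier G" and x: "x \<in> carrier M"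
  shows "quot_act M H \<alpha> s (H +>\<^bsub>M\<^esub> x) = H +>\<^bsub>M\<^esub> \<alpha> s x"
proof -
  interpret M: pmodule "Zp p" M using gmodD[OF M] by simp
  show ?thesis unfolding quot_act_def
    using H s by (intro M.M.rcos_UN[OF M.rsub_subgroup x gmodD(4)[OF M]]) (simp_all add: gsub_def)
qed

lemma quot_gmod:
  fixes G :: "'g monoid"
  assumes G: "group G" and M: "gmod p G M \<alpha>" and H: "gsub p G M \<alpha> H"
  shows "gmod p G (quot_module M H) (quot_act M H \<alpha>)" "ghom G M \<alpha> (quot_module M H) (quot_act M H \<alpha>) (\<lambda>x. H +>\<^bsub>M\<^esub> x)"
    "(\<lambda>x. H +>\<^bsub>M\<^esub> x) ` carrier M = carrier (quot_module M H)"
    "x \<in> carrier M \<Longrightarrow> H +>\<^bsub>M\<^esub> x = \<zero>\<^bsub>quot_module M H\<^esub> \<longleftrightarrow> x \<in> H"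
proof -
  interpret G: group G by fact
  interpret M: pmodule "Zp p" M using gmodD[OF M] by simp
  have rs: "rsub (Zp p) M H" using H by (simp add: gsub_def)
  note sg = M.rsub_subgroup[OF rs]
  let ?Q = "quot_module M H"
  have add: "(H +>\<^bsub>M\<^esub> x) \<oplus>\<^bsub>?Q\<^esub> (H +>\<^bsub>M\<^esub> y) = H +>\<^bsub>M\<^esub> (x \<oplus>\<^bsub>M\<^esub> y)" if "x \<in> carrier M" "y \<in> carrier M" for x y
    using that M.M.rcos_add[OF sg] by simp
  show surj: "(\<lambda>x. H +>\<^bsub>M\<^esub> x) ` carrier M = carrier ?Q" using M.quot_surj by simp
  have ex: "\<exists>x\<in>carrier M. y = H +>\<^bsub>M\<^esub> x" if "y \<in> carrier ?Q" for y using that surj by (metis imageE)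
  have cl: "x \<in> carrier M \<Longrightarrow> H +>\<^bsub>M\<^esub> x \<in> carrier ?Q" for x using surj by (metis imageI)
  show "ghom G M \<alpha> ?Q (quot_act M H \<alpha>) (\<lambda>x. H +>\<^bsub>M\<^esub> x)"
    by (rule ghomI[OF addhomI]) (simp_all only: cl add quot_act_rcos[OF M H])
  show "gmod p G ?Q (quot_act M H \<alpha>)" unfolding gmod_def
  proof (intro conjI ballI)
    show "Module.module (Zp p) ?Q" by (rule M.quot_is_module[OF rs])
  next
    fix s assume s: "s \<in> carrier G"
    show "addhom ?Q ?Q (quot_act M H \<alpha> s)"
    proof (rule addhomI)
      fix y assume "y \<in> carrier ?Q"
      then obtain x where x: "x \<in> carrier M" "y = H +>\<^bsub>M\<^esub> x" using ex by blast
      show "quot_act M H \<alpha> s y \<in> carrier ?Q" unfolding x(2) quot_act_rcos[OF M H s x(1)] using cl gmodD(5)[OF M s x(1)] by blast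
      fix y' assume "y' \<in> carrier ?Q"
      then obtain x' where x': "x' \<in> carrier M" "y' = H +>\<^bsub>M\<^esub> x'" using ex by blast
      show "quot_act M H \<alpha> s (y \<oplus>\<^bsub>?Q\<^esub> y') = quot_act M H \<alpha> s y \<oplus>\<^bsub>?Q\<^esub> quot_act M H \<alpha> s y'"
        unfolding x(2) x'(2) using x(1) x'(1) gmodD(5)[OF M s]
        by (simp only: add quot_act_rcos[OF M H s] M.M.add.m_closed addhom_add[OF gmodD(4)[OF M s]])
    qed
  next
    fix y assume "y \<in> carrier ?Q"
    then obtain x where x: "x \<in> carrier M" "y = H +>\<^bsub>M\<^esub> x" using ex by blast
    show "quot_act M H \<alpha> \<one>\<^bsub>G\<^esub> y = y"
      unfolding x(2) quot_act_rcos[OF M H G.one_closed x(1)] gmodD(6)[OF M x(1)] ..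
    fix s t assume s: "s \<in> carrier G" and t: "t \<in> carrier G"
    show "quot_act M H \<alpha> (s \<otimes>\<^bsub>G\<^esub> t) y = quot_act M H \<alpha> s (quot_act M H \<alpha> t y)"
      unfolding x(2) using s t x(1) gmodD(5)[OF M] by (simp only: quot_act_rcos[OF M H] G.m_closed gmodD(7)[OF M])
  qed
  show "x \<in> carrier M \<Longrightarrow> H +>\<^bsub>M\<^esub> x = \<zero>\<^bsub>?Q\<^esub> \<longleftrightarrow> x \<in> H" using M.M.rcos_zero_iff[OF sg] by simp
qed

section \<open>Stable conditions up to isomorphism\<close>

locale stab_cond =
  fixes p :: nat and G :: "'g monoid" and T :: "'g topology" and C :: "'g condition"
  assumes p: "p > 0" and prof: "profinite_group G T" and stab: "stable_condition p G T C"
begin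

sublocale G: group G using prof by (simp add: profinite_group_def)

lemma topT: "topspace T = carrier G" using prof by (simp add: profinite_group_def)

abbreviation "fing M \<alpha> \<equiv> fin_gmodule p G T M \<alpha>"
abbreviation "inC M \<alpha> \<equiv> in_condition p G T C M \<alpha>"

text \<open>For a finite discrete module, continuity of the action amounts to openness of the sets
  of group elements carrying one given point to another. \<open>fin_gmodI\<close> is the converse,
  and all continuity checks for finite modules go through these sets.\<close>

lemma fin_gmodD:
  assumes "fing M \<alpha>"
  shows "gmod p G M \<alpha>" "finite (carrier M)"
    "x \<in> carrier M \<Longrightarrow> y \<in> carrier M \<Longrightarrow> openin T {s \<in> carrier G. \<alpha> s x = y}"
proof -
  show "gmod p G M \<alpha>" "finite (carrier M)" using assms by (auto simp: fin_gmodule_def gmod_def addhom_def)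
  assume x: "x \<in> carrier M" and y: "y \<in> carrier M"
  have "continuous_map (prod_topology T (discrete_topology (carrier M))) (discrete_topology (carrier M)) (\<lambda>(s, x). \<alpha> s x)"
    using assms by (simp add: fin_gmodule_def)
  moreover have "continuous_map T (prod_topology T (discrete_topology (carrier M))) (\<lambda>s. (s, x))"
    using x by (intro continuous_map_pairedI) auto
  ultimately have "continuous_map T (discrete_topology (carrier M)) ((\<lambda>(s, x). \<alpha> s x) \<circ> (\<lambda>s. (s, x)))"
    using continuous_map_compose by blast
  then have "openin T {s \<in> topspace T. ((\<lambda>(s, x). \<alpha> s x) \<circ> (\<lambda>s. (s, x))) s \<in> {y}}"
    by (rule openin_continuous_map_preimage) (use y in simp)
  then show "openin T {s \<in> carrier G. \<alpha> s x = y}" by (simp add: topT)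
qed

lemma fin_gmodI:
  assumes M: "gmod p G M \<alpha>" and fin: "finite (carrier M)"
    and op: "\<And>x y. x \<in> carrier M \<Longrightarrow> y \<in> carrier M \<Longrightarrow> openin T {s \<in> carrier G. \<alpha> s x = y}"
  shows "fing M \<alpha>"
  unfolding fin_gmodule_def
proof (intro conjI ballI)
  show "Module.module (Zp p) M" "finite (carrier M)" using gmodD[OF M] fin by auto
  show "\<alpha> s \<in> carrier M \<rightarrow> carrier M" if "s \<in> carrier G" for s using gmodD(5)[OF M that] by auto
  show "\<alpha> s (z \<odot>\<^bsub>M\<^esub> x) = z \<odot>\<^bsub>M\<^esub> \<alpha> s x" if "s \<in> carrier G" "z \<in> carrier (Zp p)" "x \<in> carrier M" for s z x
    using addhom_Zp_linear[OF p gmodD(1)[OF M] gmodD(1)[OF M] fin gmodD(4)[OF M that(1)] that(2,3)] .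
  let ?d = "discrete_topology (carrier M)"
  show "continuous_map (prod_topology T ?d) ?d (\<lambda>(s, x). \<alpha> s x)"
    unfolding continuous_map_def
  proof (intro conjI allI impI)
    show "(\<lambda>(s, x). \<alpha> s x) \<in> topspace (prod_topology T ?d) \<rightarrow> topspace ?d" using gmodD(5)[OF M] by (auto simp: topT)
    fix U assume "openin ?d U"
    then have U: "U \<subseteq> carrier M" by simp
    have "{u \<in> topspace (prod_topology T ?d). (case u of (s, x) \<Rightarrow> \<alpha> s x) \<in> U} =
      (\<Union>(x, y)\<in>carrier M \<times> U. {s \<in> carrier G. \<alpha> s x = y} \<times> {x})" (is "?L = ?R") by (auto simp: topT)
    moreover have "openin (prod_topology T ?d) ?R"
      using U op by (intro openin_Union) (auto simp: openin_prod_Times_iff)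
    ultimately show "openin (prod_topology T ?d) ?L" by simp
  qed
qed (use gmodD[OF M] in \<open>auto simp: addhom_add\<close>)

lemma gmodule_homI: "fing N \<beta> \<Longrightarrow> gmod p G M \<alpha> \<Longrightarrow> ghom G M \<alpha> N \<beta> \<phi> \<Longrightarrow> \<phi> \<in> gmodule_hom p G M \<alpha> N \<beta>"
  unfolding gmodule_hom_def
  using addhom_Zp_linear[OF p gmodD(1) gmodD(1)[OF fin_gmodD(1)] fin_gmodD(2) ghomD(1)] by (auto simp: ghomD)

lemma gmodule_homD: "\<phi> \<in> gmodule_hom p G M \<alpha> N \<beta> \<Longrightarrow> ghom G M \<alpha> N \<beta> \<phi>"
  unfolding gmodule_hom_def ghom_def addhom_def by blast

lemma inC_fing: "inC M \<alpha> \<Longrightarrow> fing M \<alpha>" by (simp add: in_condition_def)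

lemma inC_E:
  assumes "inC M \<alpha>"
  obtains N \<beta> \<phi> where "(N, \<beta>) \<in> C" "fing N \<beta>" "ghom G M \<alpha> N \<beta> \<phi>" "bij_betw \<phi> (carrier M) (carrier N)"
proof -
  obtain N \<beta> \<phi> where *: "(N, \<beta>) \<in> C" "\<phi> \<in> gmodule_hom p G M \<alpha> N \<beta>" "bij_betw \<phi> (carrier M) (carrier N)"
    using assms by (auto simp: in_condition_def)
  moreover have "fing N \<beta>" using *(1) stab unfolding stable_condition_def by blast
  ultimately show thesis using that gmodule_homD by blast
qed

lemma inC_I: "(N, \<beta>) \<in> C \<Longrightarrow> fing M \<alpha> \<Longrightarrow> ghom G M \<alpha> N \<beta> \<phi> \<Longrightarrow> bij_betw \<phi> (carrier M) (carrier N) \<Longrightarrow> inC M \<alpha>"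
proof -
  assume *: "(N, \<beta>) \<in> C" "fing M \<alpha>" "ghom G M \<alpha> N \<beta> \<phi>" "bij_betw \<phi> (carrier M) (carrier N)"
  have "fing N \<beta>" using *(1) stab unfolding stable_condition_def by blast
  then have "\<phi> \<in> gmodule_hom p G M \<alpha> N \<beta>" using gmodule_homI fin_gmodD(1) * by blast
  then show ?thesis using * unfolding in_condition_def by blast
qed

lemma C_closed:
  assumes "(M, \<alpha>) \<in> C" "gsub p G M \<alpha> H"
  shows "inC (M\<lparr>carrier := H\<rparr>) \<alpha>" "inC (quot_module M H) (quot_act M H \<alpha>)"
proof -
  have f: "fing M \<alpha>" using assms(1) stab unfolding stable_condition_def by blast
  have "submodule H (Zp p) M" using assms(2) pmodule.rsub_submodule[OF gmodD(2)[OF fin_gmodD(1)[OF f]]] by (simp add: gsub_def)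
  moreover have "\<forall>s\<in>carrier G. \<alpha> s \<in> H \<rightarrow> H" using assms(2) by (auto simp: gsub_def)
  ultimately show "inC (M\<lparr>carrier := H\<rparr>) \<alpha>" "inC (quot_module M H) (quot_act M H \<alpha>)"
    using assms(1) stab unfolding stable_condition_def by blast+
qed

lemma kernel_gsub:
  assumes M: "gmod p G M \<alpha>" and N: "fing N \<beta>" and h: "ghom G M \<alpha> N \<beta> \<phi>"
  shows "gsub p G M \<alpha> {x \<in> carrier M. \<phi> x = \<zero>\<^bsub>N\<^esub>}"
proof -
  note N' = fin_gmodD(1)[OF N]
  interpret M: Module.module "Zp p" M using gmodD[OF M] by simp
  interpret N: Module.module "Zp p" N using gmodD[OF N'] by simp
  have z: "\<phi> \<zero>\<^bsub>M\<^esub> = \<zero>\<^bsub>N\<^esub>" using addhom_zero[OF ghomD(1)[OF h]] M.abelian_group_axioms N.abelian_group_axioms by blast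
  have l: "\<phi> (z \<odot>\<^bsub>M\<^esub> x) = z \<odot>\<^bsub>N\<^esub> \<phi> x" if "z \<in> carrier (Zp p)" "x \<in> carrier M" for z x
    using addhom_Zp_linear[OF p gmodD(1)[OF M] gmodD(1)[OF N'] fin_gmodD(2)[OF N] ghomD(1)[OF h] that] .
  have a0: "\<beta> s \<zero>\<^bsub>N\<^esub> = \<zero>\<^bsub>N\<^esub>" if "s \<in> carrier G" for s
    using addhom_zero[OF gmodD(4)[OF N' that]] N.abelian_group_axioms by blast
  show ?thesis unfolding gsub_def
  proof (intro conjI ballI rsubI)
    show "\<alpha> s x \<in> {x \<in> carrier M. \<phi> x = \<zero>\<^bsub>N\<^esub>}" if "s \<in> carrier G" "x \<in> {x \<in> carrier M. \<phi> x = \<zero>\<^bsub>N\<^esub>}" for s x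
      using that a0 gmodD(5)[OF M] ghomD(2)[OF h] by simp
  qed (simp_all add: z l ghomD(4)[OF h])
qed

text \<open>Stability speaks about members of C, whose carriers are sets of natural numbers. So the
  surjection is moved to an isomorphic member M0, the quotient by its kernel is in C, and N is
  identified with that quotient.\<close>

lemma inC_surj:
  assumes M: "inC M \<alpha>" and N: "gmod p G N \<beta>" and h: "ghom G M \<alpha> N \<beta> \<phi>" and surj: "\<phi> ` carrier M = carrier N"
  shows "inC N \<beta>"
proof -
  note Mf = inC_fing[OF M]
  note M' = fin_gmodD(1)[OF Mf] and Mfin = fin_gmodD(2)[OF Mf]
  note ab = gmodD(3)[OF M'] gmodD(3)[OF N]
  interpret M: abelian_group M by (rule ab(1))
  interpret N: abelian_group N by (rule ab(2))
  have Nf: "fing N \<beta>"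
  proof (rule fin_gmodI[OF N])
    show "finite (carrier N)" using surj Mfin finite_imageI by metis
    fix y y' assume y: "y \<in> carrier N" "y' \<in> carrier N"
    then obtain x where x: "x \<in> carrier M" "y = \<phi> x" using surj by (metis imageE)
    \<comment> \<open>The action on N is continuous because each such set is a union of the
      corresponding sets for M, over all preimages of y'.\<close>
    have "{s \<in> carrier G. \<beta> s y = y'} = (\<Union>x'\<in>{x'\<in>carrier M. \<phi> x' = y'}. {s \<in> carrier G. \<alpha> s x = x'})"
      using x ghomD(2)[OF h, symmetric] gmodD(5)[OF M'] by auto
    moreover have "openin T (\<Union>x'\<in>{x'\<in>carrier M. \<phi> x' = y'}. {s \<in> carrier G. \<alpha> s x = x'})"
      by (rule openin_Union) (use fin_gmodD(3)[OF Mf x(1)] in auto)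
    ultimately show "openin T {s \<in> carrier G. \<beta> s y = y'}" by simp
  qed
  obtain M0 \<alpha>0 \<psi> where M0: "(M0, \<alpha>0) \<in> C" "fing M0 \<alpha>0" "ghom G M \<alpha> M0 \<alpha>0 \<psi>" "bij_betw \<psi> (carrier M) (carrier M0)"
    using inC_E[OF M] .
  note M0' = fin_gmodD(1)[OF M0(2)]
  interpret M0: abelian_group M0 by (rule gmodD(3)[OF M0'])
  have psi: "\<psi> ` carrier M = carrier M0" "inj_on \<psi> (carrier M)" using M0(4) by (auto simp: bij_betw_def)
  have z: "\<psi> \<zero>\<^bsub>M\<^esub> = \<zero>\<^bsub>M0\<^esub>" using addhom_zero[OF ghomD(1)[OF M0(3)]] ab M0.abelian_group_axioms by blast
  have ker: "\<phi> x = \<zero>\<^bsub>N\<^esub>" if "x \<in> carrier M" "\<psi> x = \<zero>\<^bsub>M0\<^esub>" for x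
  proof -
    have "x = \<zero>\<^bsub>M\<^esub>" using inj_onD[OF psi(2), of x "\<zero>\<^bsub>M\<^esub>"] that z by simp
    then show ?thesis using addhom_zero[OF ghomD(1)[OF h] ab] by simp
  qed
  obtain k where k: "ghom G M0 \<alpha>0 N \<beta> k" "\<And>x. x \<in> carrier M \<Longrightarrow> k (\<psi> x) = \<phi> x"
    using ghom_factor[OF ab(1) M0.abelian_group_axioms ab(2) M0(3) psi(1) h gmodD(5)[OF M'] ker] by blast
  have ksurj: "k ` carrier M0 = carrier N" unfolding psi(1)[symmetric] surj[symmetric] image_image using k(2) by (rule image_cong[OF refl])
  define H where "H = {x \<in> carrier M0. k x = \<zero>\<^bsub>N\<^esub>}"
  have H: "gsub p G M0 \<alpha>0 H" unfolding H_def by (rule kernel_gsub[OF M0' Nf k(1)])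
  note Q = quot_gmod[OF G.group_axioms M0' H]
  obtain N1 \<beta>1 \<chi> where N1: "(N1, \<beta>1) \<in> C" "fing N1 \<beta>1" "ghom G (quot_module M0 H) (quot_act M0 H \<alpha>0) N1 \<beta>1 \<chi>"
    "bij_betw \<chi> (carrier (quot_module M0 H)) (carrier N1)"
    using inC_E[OF C_closed(2)[OF M0(1) H]] .
  note QN1 = ghom_comp[OF Q(2) N1(3)]
  have z1: "\<chi> \<zero>\<^bsub>quot_module M0 H\<^esub> = \<zero>\<^bsub>N1\<^esub>"
    using addhom_zero[OF ghomD(1)[OF N1(3)] gmodD(3)[OF Q(1)] gmodD(3)[OF fin_gmodD(1)[OF N1(2)]]] .
  have "\<exists>l. ghom G N \<beta> N1 \<beta>1 l \<and> (\<forall>x\<in>carrier M0. l (k x) = \<chi> (H +>\<^bsub>M0\<^esub> x))"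
  proof (rule ghom_factor[OF M0.abelian_group_axioms ab(2) gmodD(3)[OF fin_gmodD(1)[OF N1(2)]] k(1) ksurj QN1 gmodD(5)[OF M0']])
    fix x assume x: "x \<in> carrier M0" "k x = \<zero>\<^bsub>N\<^esub>"
    then have "H +>\<^bsub>M0\<^esub> x = \<zero>\<^bsub>quot_module M0 H\<^esub>" using Q(4)[OF x(1)] by (simp add: H_def)
    then show "\<chi> (H +>\<^bsub>M0\<^esub> x) = \<zero>\<^bsub>N1\<^esub>" using z1 by simp
  qed
  then obtain l where l: "ghom G N \<beta> N1 \<beta>1 l" "\<And>x. x \<in> carrier M0 \<Longrightarrow> l (k x) = \<chi> (H +>\<^bsub>M0\<^esub> x)" by blast
  have Hc: "x \<in> carrier M0 \<Longrightarrow> H +>\<^bsub>M0\<^esub> x \<in> carrier (quot_module M0 H)" for x using Q(3) by (metis imageI)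
  have "l ` carrier N = \<chi> ` ((\<lambda>x. H +>\<^bsub>M0\<^esub> x) ` carrier M0)"
    unfolding ksurj[symmetric] image_image using l(2) by (rule image_cong[OF refl])
  also have "\<dots> = carrier N1" using N1(4) unfolding Q(3) bij_betw_def by simp
  finally have ls: "l ` carrier N = carrier N1" .
  have "inj_on l (carrier N)"
  proof (rule inj_onI)
    fix y y' assume y: "y \<in> carrier N" "y' \<in> carrier N" "l y = l y'"
    obtain x where x: "x \<in> carrier M0" "y = k x" using y(1) ksurj by (metis imageE)
    obtain x' where x': "x' \<in> carrier M0" "y' = k x'" using y(2) ksurj by (metis imageE)
    have "\<chi> (H +>\<^bsub>M0\<^esub> x) = \<chi> (H +>\<^bsub>M0\<^esub> x')" using y(3) x x' l(2) by simp
    then have "H +>\<^bsub>M0\<^esub> x = H +>\<^bsub>M0\<^esub> x'" using N1(4) Hc[OF x(1)] Hc[OF x'(1)] unfolding bij_betw_def inj_on_def by blast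
    then have "x \<ominus>\<^bsub>M0\<^esub> x' \<in> H"
      using M0.rcos_iff[OF pmodule.rsub_subgroup[OF gmodD(2)[OF M0']], of H x x'] H x(1) x'(1) by (simp add: gsub_def)
    then have "k x \<ominus>\<^bsub>N\<^esub> k x' = \<zero>\<^bsub>N\<^esub>"
      using addhom_minus[OF ghomD(1)[OF k(1)] M0.abelian_group_axioms ab(2) x(1) x'(1)] by (simp add: H_def)
    then show "y = y'" using x(2) x'(2) y(1,2) N.minus_zero_iff by simp
  qed
  then show ?thesis using inC_I[OF N1(1) Nf l(1)] ls by (simp add: bij_betw_def)
qed

text \<open>As for surjections, N is replaced by its image in an isomorphic member of C, where
  stability under submodules applies.\<close>

lemma inC_inj:
  assumes M: "inC M \<alpha>" and N: "gmod p G N \<beta>" and h: "ghom G N \<beta> M \<alpha> \<phi>" and inj: "inj_on \<phi> (carrier N)"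
  shows "inC N \<beta>"
proof -
  note Mf = inC_fing[OF M]
  note M' = fin_gmodD(1)[OF Mf] and Mfin = fin_gmodD(2)[OF Mf]
  have Nf: "fing N \<beta>"
  proof (rule fin_gmodI[OF N])
    show "finite (carrier N)" using inj_on_finite[OF inj _ Mfin] ghomD(3)[OF h] by blast
    fix y y' assume y: "y \<in> carrier N" "y' \<in> carrier N"
    have "{s \<in> carrier G. \<beta> s y = y'} = {s \<in> carrier G. \<alpha> s (\<phi> y) = \<phi> y'}"
      using y ghomD(2)[OF h, symmetric] gmodD(5)[OF N] inj by (auto simp: inj_on_def)
    then show "openin T {s \<in> carrier G. \<beta> s y = y'}"
      using fin_gmodD(3)[OF Mf ghomD(3)[OF h y(1)] ghomD(3)[OF h y(2)]] by simp
  qed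
  obtain M0 \<alpha>0 \<psi> where M0: "(M0, \<alpha>0) \<in> C" "fing M0 \<alpha>0" "ghom G M \<alpha> M0 \<alpha>0 \<psi>" "bij_betw \<psi> (carrier M) (carrier M0)"
    using inC_E[OF M] .
  note M0' = fin_gmodD(1)[OF M0(2)]
  let ?f = "\<lambda>x. \<psi> (\<phi> x)"
  note f = ghom_comp[OF h M0(3)]
  have finj: "inj_on ?f (carrier N)"
    using inj M0(4) ghomD(3)[OF h] unfolding bij_betw_def inj_on_def by metis
  define H where "H = ?f ` carrier N"
  interpret N: Module.module "Zp p" N using gmodD[OF N] by simp
  have fl: "?f (z \<odot>\<^bsub>N\<^esub> x) = z \<odot>\<^bsub>M0\<^esub> ?f x" if "z \<in> carrier (Zp p)" "x \<in> carrier N" for z x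
    using addhom_Zp_linear[OF p gmodD(1)[OF N] gmodD(1)[OF M0'] fin_gmodD(2)[OF M0(2)] ghomD(1)[OF f] that] .
  have H: "gsub p G M0 \<alpha>0 H" unfolding gsub_def
  proof (intro conjI ballI rsubI)
    have HI: "x \<in> carrier N \<Longrightarrow> ?f x \<in> H" for x by (simp add: H_def)
    have HE: "\<exists>x\<in>carrier N. y = ?f x" if "y \<in> H" for y using that by (auto simp: H_def)
    show "x \<in> carrier M0" if "x \<in> H" for x using HE[OF that] ghomD(3)[OF f] by blast
    show "\<zero>\<^bsub>M0\<^esub> \<in> H" using HI[OF N.zero_closed] addhom_zero[OF ghomD(1)[OF f] N.abelian_group_axioms gmodD(3)[OF M0']] by simp
    show "x \<oplus>\<^bsub>M0\<^esub> y \<in> H" if "x \<in> H" "y \<in> H" for x y using HE[OF that(1)] HE[OF that(2)] ghomD(4)[OF f] HI by (metis N.add.m_closed)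
    show "z \<odot>\<^bsub>M0\<^esub> x \<in> H" if "z \<in> carrier (Zp p)" "x \<in> H" for z x using HE[OF that(2)] fl[OF that(1)] HI that(1) by (metis N.smult_closed)
    show "\<alpha>0 s x \<in> H" if "s \<in> carrier G" "x \<in> H" for s x using HE[OF that(2)] ghomD(2)[OF f that(1)] HI gmodD(5)[OF N that(1)] by metis
  qed
  obtain N1 \<beta>1 \<chi> where N1: "(N1, \<beta>1) \<in> C" "fing N1 \<beta>1" "ghom G (M0\<lparr>carrier := H\<rparr>) \<alpha>0 N1 \<beta>1 \<chi>"
    "bij_betw \<chi> (carrier (M0\<lparr>carrier := H\<rparr>)) (carrier N1)"
    using inC_E[OF C_closed(1)[OF M0(1) H]] .
  have "ghom G N \<beta> (M0\<lparr>carrier := H\<rparr>) \<alpha>0 ?f"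
    using f by (auto simp: ghom_def addhom_def H_def)
  note g = ghom_comp[OF this N1(3)]
  have "bij_betw ?f (carrier N) H" using finj by (simp add: H_def bij_betw_def)
  then have "bij_betw (\<lambda>x. \<chi> (?f x)) (carrier N) (carrier N1)"
    using bij_betw_trans[of ?f "carrier N" H \<chi> "carrier N1"] N1(4) by (simp add: comp_def)
  then show ?thesis using inC_I[OF N1(1) Nf g] by simp
qed

text \<open>Two maps that are jointly injective embed N into the direct sum of members of C; this is
  the step from sums to intersections of kernels.\<close>

lemma inC_joint_inj:
  assumes M: "inC M \<alpha>" and M': "inC M' \<alpha>'" and N: "gmod p G N \<beta>"
    and h: "ghom G N \<beta> M \<alpha> \<phi>" and h': "ghom G N \<beta> M' \<alpha>' \<phi>'"
    and inj: "\<And>x y. \<lbrakk>x \<in> carrier N; y \<in> carrier N; \<phi> x = \<phi> y; \<phi>' x = \<phi>' y\<rbrakk> \<Longrightarrow> x = y"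
  shows "inC N \<beta>"
proof -
  obtain M0 \<alpha>0 \<psi> where M0: "(M0, \<alpha>0) \<in> C" "fing M0 \<alpha>0" "ghom G M \<alpha> M0 \<alpha>0 \<psi>" "bij_betw \<psi> (carrier M) (carrier M0)"
    using inC_E[OF M] .
  obtain M1 \<alpha>1 \<psi>' where M1: "(M1, \<alpha>1) \<in> C" "fing M1 \<alpha>1" "ghom G M' \<alpha>' M1 \<alpha>1 \<psi>'" "bij_betw \<psi>' (carrier M') (carrier M1)"
    using inC_E[OF M'] .
  have D: "inC (dsum M0 M1) (\<lambda>s (x, y). (\<alpha>0 s x, \<alpha>1 s y))"
    using M0(1) M1(1) stab unfolding stable_condition_def by blast
  note f = ghom_comp[OF h M0(3)] and f' = ghom_comp[OF h' M1(3)]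
  have g: "ghom G N \<beta> (dsum M0 M1) (\<lambda>s (x, y). (\<alpha>0 s x, \<alpha>1 s y)) (\<lambda>x. (\<psi> (\<phi> x), \<psi>' (\<phi>' x)))"
    using f f' by (auto simp: ghom_def addhom_def dsum_def)
  have "inj_on (\<lambda>x. (\<psi> (\<phi> x), \<psi>' (\<phi>' x))) (carrier N)"
    using inj M0(4) M1(4) ghomD(3)[OF h] ghomD(3)[OF h'] unfolding bij_betw_def inj_on_def by (metis prod.inject)
  then show ?thesis by (rule inC_inj[OF D N g])
qed

text \<open>The empty direct sum. It makes the whole module a submodule with quotient in C, the
  starting point for finite intersections.\<close>

lemma inC_zero:
  assumes N: "gmod p G N \<beta>" and z: "carrier N = {\<zero>\<^bsub>N\<^esub>}"
  shows "inC N \<beta>"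
proof -
  interpret N: Module.module "Zp p" N using gmodD[OF N] by simp
  define Z :: "(padic, nat) module" where "Z = \<lparr>carrier = {0}, monoid.mult = (\<lambda>x y. 0), one = 0, zero = 0, add = (\<lambda>x y. 0), smult = (\<lambda>r x. 0)\<rparr>"
  have Zs: "carrier Z = {0}" "zero Z = 0" "add Z = (\<lambda>x y. 0)" "smult Z = (\<lambda>r x. 0)" by (simp_all add: Z_def)
  have "Module.module (Zp p) Z"
    by (rule moduleI[OF N.is_cring abelian_groupI]) (simp_all add: Zs)
  then have Zg: "gmod p G Z (\<lambda>s x. 0)" by (simp add: gmod_def Zs addhom_def)
  have op: "openin T (carrier G)" using topT openin_topspace by metis
  have Zf: "fing Z (\<lambda>s x. 0)" by (rule fin_gmodI[OF Zg]) (simp_all add: Zs op)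
  have "\<forall>M \<alpha>. fing M \<alpha> \<and> carrier M = {\<zero>\<^bsub>M\<^esub>} \<longrightarrow> (M, \<alpha>) \<in> C"
    using stab unfolding stable_condition_def by (elim conjE)
  then have "(Z, \<lambda>s x. 0) \<in> C" using Zf Zs(1,2) by simp
  moreover have "fing N \<beta>"
  proof (rule fin_gmodI[OF N])
    show "finite (carrier N)" using z by simp
    fix x y assume xy: "x \<in> carrier N" "y \<in> carrier N"
    have "{s \<in> carrier G. \<beta> s x = y} = carrier G" using xy gmodD(5)[OF N _ xy(1)] z by auto
    then show "openin T {s \<in> carrier G. \<beta> s x = y}" using op by simp
  qed
  moreover have "ghom G N \<beta> Z (\<lambda>s x. 0) (\<lambda>x. 0)" by (simp add: ghom_def addhom_def Zs)
  moreover have "bij_betw (\<lambda>x. 0) (carrier N) (carrier Z)" by (simp add: z Zs bij_betw_def)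
  ultimately show ?thesis by (rule inC_I)
qed

end

section \<open>Submodules whose quotient satisfies the condition\<close>

context stab_cond
begin

text \<open>The surjections onto objects of C are represented, up to isomorphism of the target, by
  their kernels; \<open>Ccl\<close> below is the intersection of those kernels that contain
  N.\<close>

definition Cq :: "(padic, 'm) module \<Rightarrow> ('g \<Rightarrow> 'm \<Rightarrow> 'm) \<Rightarrow> 'm set \<Rightarrow> bool" where
  "Cq M \<alpha> H \<longleftrightarrow> gsub p G M \<alpha> H \<and> inC (quot_module M H) (quot_act M H \<alpha>)"

definition Ccl :: "(padic, 'm) module \<Rightarrow> ('g \<Rightarrow> 'm \<Rightarrow> 'm) \<Rightarrow> 'm set \<Rightarrow> 'm set" where
  "Ccl M \<alpha> N = {x \<in> carrier M. \<forall>H. Cq M \<alpha> H \<and> N \<subseteq> H \<longrightarrow> x \<in> H}"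

lemma quot_map:
  assumes M: "gmod p G M \<alpha>" and H: "gsub p G M \<alpha> H" and H': "gsub p G M \<alpha> H'" and sub: "H \<subseteq> H'"
  shows "\<exists>k. ghom G (quot_module M H) (quot_act M H \<alpha>) (quot_module M H') (quot_act M H' \<alpha>) k \<and>
     (\<forall>x\<in>carrier M. k (H +>\<^bsub>M\<^esub> x) = H' +>\<^bsub>M\<^esub> x)"
proof -
  note Q = quot_gmod[OF G.group_axioms M H] and Q' = quot_gmod[OF G.group_axioms M H']
  show ?thesis
    by (rule ghom_factor[OF gmodD(3)[OF M] gmodD(3)[OF Q(1)] gmodD(3)[OF Q'(1)] Q(2,3) Q'(2) gmodD(5)[OF M]])
      (use Q(4) Q'(4) sub in blast)+
qed

text \<open>M/H' is a quotient of M/H.\<close>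

lemma Cq_mono:
  assumes M: "gmod p G M \<alpha>" and H: "Cq M \<alpha> H" and H': "gsub p G M \<alpha> H'" and sub: "H \<subseteq> H'"
  shows "Cq M \<alpha> H'"
proof -
  have Hg: "gsub p G M \<alpha> H" and Hc: "inC (quot_module M H) (quot_act M H \<alpha>)" using H by (auto simp: Cq_def)
  note Q = quot_gmod[OF G.group_axioms M Hg] and Q' = quot_gmod[OF G.group_axioms M H']
  obtain k where k: "ghom G (quot_module M H) (quot_act M H \<alpha>) (quot_module M H') (quot_act M H' \<alpha>) k"
     "\<And>x. x \<in> carrier M \<Longrightarrow> k (H +>\<^bsub>M\<^esub> x) = H' +>\<^bsub>M\<^esub> x" using quot_map[OF M Hg H' sub] by blast
  have "k ` carrier (quot_module M H) = carrier (quot_module M H')"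
    unfolding Q(3)[symmetric] Q'(3)[symmetric] image_image using k(2) by (rule image_cong[OF refl])
  then show ?thesis using inC_surj[OF Hc Q'(1) k(1)] H' by (simp add: Cq_def)
qed

text \<open>The quotient by the intersection embeds into the sum of the two quotients.\<close>

lemma Cq_Int:
  assumes M: "gmod p G M \<alpha>" and H: "Cq M \<alpha> H" and H': "Cq M \<alpha> H'"
  shows "Cq M \<alpha> (H \<inter> H')"
proof -
  have Hg: "gsub p G M \<alpha> H" and Hc: "inC (quot_module M H) (quot_act M H \<alpha>)" using H by (auto simp: Cq_def)
  have Hg': "gsub p G M \<alpha> H'" and Hc': "inC (quot_module M H') (quot_act M H' \<alpha>)" using H' by (auto simp: Cq_def)
  have I: "gsub p G M \<alpha> (H \<inter> H')" using Hg Hg' by (auto simp: gsub_def rsub_def)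
  interpret M: pmodule "Zp p" M using gmodD[OF M] by simp
  have sg: "subgroup H (add_monoid M)" "subgroup H' (add_monoid M)" "subgroup (H \<inter> H') (add_monoid M)"
    using Hg Hg' I M.rsub_subgroup by (auto simp: gsub_def)
  note Q = quot_gmod[OF G.group_axioms M I]
  obtain k where k: "ghom G (quot_module M (H \<inter> H')) (quot_act M (H \<inter> H') \<alpha>) (quot_module M H) (quot_act M H \<alpha>) k"
     "\<And>x. x \<in> carrier M \<Longrightarrow> k ((H \<inter> H') +>\<^bsub>M\<^esub> x) = H +>\<^bsub>M\<^esub> x" using quot_map[OF M I Hg] by blast
  obtain k' where k': "ghom G (quot_module M (H \<inter> H')) (quot_act M (H \<inter> H') \<alpha>) (quot_module M H') (quot_act M H' \<alpha>) k'"
     "\<And>x. x \<in> carrier M \<Longrightarrow> k' ((H \<inter> H') +>\<^bsub>M\<^esub> x) = H' +>\<^bsub>M\<^esub> x" using quot_map[OF M I Hg'] by blast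
  have "inC (quot_module M (H \<inter> H')) (quot_act M (H \<inter> H') \<alpha>)"
  proof (rule inC_joint_inj[OF Hc Hc' Q(1) k(1) k'(1)])
    fix X Y assume "X \<in> carrier (quot_module M (H \<inter> H'))" and "Y \<in> carrier (quot_module M (H \<inter> H'))"
      and e: "k X = k Y" "k' X = k' Y"
    then obtain x y where xy: "x \<in> carrier M" "X = (H \<inter> H') +>\<^bsub>M\<^esub> x" "y \<in> carrier M" "Y = (H \<inter> H') +>\<^bsub>M\<^esub> y"
      unfolding Q(3)[symmetric] by blast
    then have "x \<ominus>\<^bsub>M\<^esub> y \<in> H" "x \<ominus>\<^bsub>M\<^esub> y \<in> H'"
      using e k(2) k'(2) M.M.rcos_iff[OF sg(1)] M.M.rcos_iff[OF sg(2)] by simp_all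
    then show "X = Y" using xy M.M.rcos_iff[OF sg(3)] by simp
  qed
  then show ?thesis using I by (simp add: Cq_def)
qed

lemma Cq_carrier:
  assumes M: "gmod p G M \<alpha>" shows "Cq M \<alpha> (carrier M)"
proof -
  interpret M: pmodule "Zp p" M using gmodD[OF M] by simp
  have g: "gsub p G M \<alpha> (carrier M)" using M.rsub_carrier gmodD(5)[OF M] by (simp add: gsub_def)
  note Q = quot_gmod[OF G.group_axioms M g]
  have "carrier M +>\<^bsub>M\<^esub> x = \<zero>\<^bsub>quot_module M (carrier M)\<^esub>" if "x \<in> carrier M" for x using Q(4)[OF that] that by simp
  then have "carrier (quot_module M (carrier M)) = {\<zero>\<^bsub>quot_module M (carrier M)\<^esub>}"
    unfolding Q(3)[symmetric] using M.M.zero_closed by blast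
  then show ?thesis using inC_zero[OF Q(1)] g by (simp add: Cq_def)
qed

text \<open>The map may fail to be surjective: the quotient by its kernel embeds into the target,
  and C is closed under submodules.\<close>

lemma Cq_kernel:
  assumes M: "gmod p G M \<alpha>" and P: "inC P \<gamma>" and h: "ghom G M \<alpha> P \<gamma> \<theta>"
  shows "Cq M \<alpha> {x \<in> carrier M. \<theta> x = \<zero>\<^bsub>P\<^esub>}"
proof -
  let ?H = "{x \<in> carrier M. \<theta> x = \<zero>\<^bsub>P\<^esub>}"
  note Pf = inC_fing[OF P] note P' = fin_gmodD(1)[OF Pf]
  have H: "gsub p G M \<alpha> ?H" by (rule kernel_gsub[OF M Pf h])
  note Q = quot_gmod[OF G.group_axioms M H]
  interpret M: pmodule "Zp p" M using gmodD[OF M] by simp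
  interpret P: abelian_group P using gmodD[OF P'] by simp
  have sg: "subgroup ?H (add_monoid M)" using H M.rsub_subgroup by (auto simp: gsub_def)
  have "\<exists>k. ghom G (quot_module M ?H) (quot_act M ?H \<alpha>) P \<gamma> k \<and> (\<forall>x\<in>carrier M. k (?H +>\<^bsub>M\<^esub> x) = \<theta> x)"
    by (rule ghom_factor[OF gmodD(3)[OF M] gmodD(3)[OF Q(1)] gmodD(3)[OF P'] Q(2,3) h gmodD(5)[OF M]])
      (use Q(4) in blast)+
  then obtain k where k: "ghom G (quot_module M ?H) (quot_act M ?H \<alpha>) P \<gamma> k" "\<And>x. x \<in> carrier M \<Longrightarrow> k (?H +>\<^bsub>M\<^esub> x) = \<theta> x" by blast
  have "inj_on k (carrier (quot_module M ?H))"
  proof (rule inj_onI)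
    fix X Y assume "X \<in> carrier (quot_module M ?H)" and "Y \<in> carrier (quot_module M ?H)" and e: "k X = k Y"
    then obtain x y where xy: "x \<in> carrier M" "X = ?H +>\<^bsub>M\<^esub> x" "y \<in> carrier M" "Y = ?H +>\<^bsub>M\<^esub> y"
      unfolding Q(3)[symmetric] by blast
    then have "\<theta> x = \<theta> y" using e k(2) by simp
    then have "x \<ominus>\<^bsub>M\<^esub> y \<in> ?H" using xy addhom_minus[OF ghomD(1)[OF h] gmodD(3)[OF M] gmodD(3)[OF P']] ghomD(3)[OF h]
      by (simp add: P.minus_eq P.r_neg)
    then show "X = Y" using xy M.M.rcos_iff[OF sg] by simp
  qed
  then show ?thesis using inC_inj[OF P Q(1) k(1)] H by (simp add: Cq_def)
qed

text \<open>Connects the construction, which uses surjections from M/N onto members of C, with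
  submodules of M. A submodule H above N yields a surjection M/N -> M/H followed by an isomorphism
  with a member; conversely a map from M/N yields its kernel in M.\<close>

lemma C_kernel_iff:
  assumes M: "gmod p G M \<alpha>" and N: "gsub p G M \<alpha> N" and x: "x \<in> carrier M"
  shows "N +>\<^bsub>M\<^esub> x \<in> C_kernel p G C (quot_module M N) (quot_act M N \<alpha>) \<longleftrightarrow> x \<in> Ccl M \<alpha> N"
proof
  note Q = quot_gmod[OF G.group_axioms M N]
  assume a: "N +>\<^bsub>M\<^esub> x \<in> C_kernel p G C (quot_module M N) (quot_act M N \<alpha>)"
  have "x \<in> H" if H: "Cq M \<alpha> H" "N \<subseteq> H" for H
  proof -
    have Hg: "gsub p G M \<alpha> H" and Hc: "inC (quot_module M H) (quot_act M H \<alpha>)" using H by (auto simp: Cq_def)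
    note QH = quot_gmod[OF G.group_axioms M Hg]
    obtain k where k: "ghom G (quot_module M N) (quot_act M N \<alpha>) (quot_module M H) (quot_act M H \<alpha>) k"
       "\<And>x. x \<in> carrier M \<Longrightarrow> k (N +>\<^bsub>M\<^esub> x) = H +>\<^bsub>M\<^esub> x" using quot_map[OF M N Hg H(2)] by blast
    obtain P \<gamma> \<chi> where P: "(P, \<gamma>) \<in> C" "fing P \<gamma>" "ghom G (quot_module M H) (quot_act M H \<alpha>) P \<gamma> \<chi>"
      "bij_betw \<chi> (carrier (quot_module M H)) (carrier P)" using inC_E[OF Hc] .
    note g = ghom_comp[OF k(1) P(3)]
    have "(\<lambda>x. \<chi> (k x)) ` carrier (quot_module M N) = \<chi> ` ((\<lambda>x. H +>\<^bsub>M\<^esub> x) ` carrier M)"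
      unfolding Q(3)[symmetric] image_image using k(2) by (intro image_cong refl) simp
    also have "\<dots> = carrier P" using P(4) unfolding QH(3) bij_betw_def by simp
    finally have "\<chi> (k (N +>\<^bsub>M\<^esub> x)) = \<zero>\<^bsub>P\<^esub>"
      using a P(1) gmodule_homI[OF P(2) Q(1) g] unfolding C_kernel_def by blast
    then have "\<chi> (H +>\<^bsub>M\<^esub> x) = \<chi> \<zero>\<^bsub>quot_module M H\<^esub>"
      using k(2)[OF x] addhom_zero[OF ghomD(1)[OF P(3)] gmodD(3)[OF QH(1)] gmodD(3)[OF fin_gmodD(1)[OF P(2)]]] by simp
    moreover have "\<zero>\<^bsub>quot_module M H\<^esub> \<in> carrier (quot_module M H)" using gmodD(3)[OF QH(1)] by (rule abelian_groupE(2))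
    moreover have "H +>\<^bsub>M\<^esub> x \<in> carrier (quot_module M H)" using QH(3) x by (metis imageI)
    ultimately have "H +>\<^bsub>M\<^esub> x = \<zero>\<^bsub>quot_module M H\<^esub>" using P(4) unfolding bij_betw_def inj_on_def by blast
    then show "x \<in> H" using QH(4)[OF x] by simp
  qed
  then show "x \<in> Ccl M \<alpha> N" using x by (simp add: Ccl_def)
next
  note Q = quot_gmod[OF G.group_axioms M N]
  assume a: "x \<in> Ccl M \<alpha> N"
  show "N +>\<^bsub>M\<^esub> x \<in> C_kernel p G C (quot_module M N) (quot_act M N \<alpha>)"
    unfolding C_kernel_def
  proof (intro CollectI conjI)
    show "N +>\<^bsub>M\<^esub> x \<in> carrier (quot_module M N)" using Q(3) x by (metis imageI)
    show "\<forall>(P, \<gamma>)\<in>C. \<forall>\<phi>\<in>gmodule_hom p G (quot_module M N) (quot_act M N \<alpha>) P \<gamma>. \<phi> ` carrier (quot_module M N) = carrier P \<longrightarrow> \<phi> (N +>\<^bsub>M\<^esub> x) = \<zero>\<^bsub>P\<^esub>"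
    proof (clarify)
      fix P \<gamma> \<phi> assume P: "(P, \<gamma>) \<in> C" and phi: "\<phi> \<in> gmodule_hom p G (quot_module M N) (quot_act M N \<alpha>) P \<gamma>"
      have Pf: "fing P \<gamma>" using P stab unfolding stable_condition_def by blast
      have Pc: "inC P \<gamma>" by (rule inC_I[OF P Pf, of "\<lambda>x. x"]) (simp_all add: ghom_def addhom_def bij_betw_def)
      note h = ghom_comp[OF Q(2) gmodule_homD[OF phi]]
      have "N \<subseteq> {x \<in> carrier M. \<phi> (N +>\<^bsub>M\<^esub> x) = \<zero>\<^bsub>P\<^esub>}"
      proof
        fix n assume n: "n \<in> N"
        then have nc: "n \<in> carrier M" using N rsubD(5) by (auto simp: gsub_def)
        then have "N +>\<^bsub>M\<^esub> n = \<zero>\<^bsub>quot_module M N\<^esub>" using Q(4) n by blast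
        then show "n \<in> {x \<in> carrier M. \<phi> (N +>\<^bsub>M\<^esub> x) = \<zero>\<^bsub>P\<^esub>}"
          using nc addhom_zero[OF ghomD(1)[OF gmodule_homD[OF phi]] gmodD(3)[OF Q(1)] gmodD(3)[OF fin_gmodD(1)[OF Pf]]] by simp
      qed
      then show "\<phi> (N +>\<^bsub>M\<^esub> x) = \<zero>\<^bsub>P\<^esub>" using a Cq_kernel[OF M Pc h] unfolding Ccl_def by blast
    qed
  qed
qed

lemma Ccl_subset: "N \<subseteq> carrier M \<Longrightarrow> N \<subseteq> Ccl M \<alpha> N" by (auto simp: Ccl_def)

lemma Ccl_gsub:
  assumes M: "gmod p G M \<alpha>" shows "gsub p G M \<alpha> (Ccl M \<alpha> N)"
proof -
  interpret M: pmodule "Zp p" M using gmodD[OF M] by simp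
  have r: "Cq M \<alpha> H \<Longrightarrow> rsub (Zp p) M H" and s: "Cq M \<alpha> H \<Longrightarrow> \<forall>s\<in>carrier G. \<forall>x\<in>H. \<alpha> s x \<in> H" for H
    by (auto simp: Cq_def gsub_def)
  show ?thesis unfolding gsub_def
  proof (intro conjI rsubI ballI)
    show "x \<in> carrier M" if "x \<in> Ccl M \<alpha> N" for x using that by (simp add: Ccl_def)
    show "\<zero>\<^bsub>M\<^esub> \<in> Ccl M \<alpha> N" using rsubD(2)[OF r] by (simp add: Ccl_def)
    show "x \<oplus>\<^bsub>M\<^esub> y \<in> Ccl M \<alpha> N" if "x \<in> Ccl M \<alpha> N" "y \<in> Ccl M \<alpha> N" for x y
      using that rsubD(3)[OF r] by (simp add: Ccl_def)
    show "z \<odot>\<^bsub>M\<^esub> x \<in> Ccl M \<alpha> N" if "z \<in> carrier (Zp p)" "x \<in> Ccl M \<alpha> N" for z x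
      using that rsubD(4)[OF r] by (simp add: Ccl_def)
    show "\<alpha> t x \<in> Ccl M \<alpha> N" if "t \<in> carrier G" "x \<in> Ccl M \<alpha> N" for t x
      using that s gmodD(5)[OF M] by (simp add: Ccl_def)
  qed
qed

text \<open>Finiteness of M/N leaves only finitely many submodules above N, so the closure is a
  finite intersection and \<open>Cq_Int\<close> applies.\<close>

lemma Ccl_Cq:
  assumes M: "gmod p G M \<alpha>" and N: "gsub p G M \<alpha> N" and fin: "finite (carrier (quot_module M N))"
  shows "Cq M \<alpha> (Ccl M \<alpha> N)"
proof -
  interpret M: pmodule "Zp p" M using gmodD[OF M] by simp
  let ?F = "{H. Cq M \<alpha> H \<and> N \<subseteq> H}"
  have sg: "subgroup N (add_monoid M)" using N M.rsub_subgroup by (auto simp: gsub_def)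
  have Hc: "H \<subseteq> carrier M" if "Cq M \<alpha> H" for H using that rsubD(1) by (auto simp: Cq_def gsub_def)
  \<comment> \<open>A submodule containing N is determined by its image in M/N, and the finite set
    M/N has finitely many subsets.\<close>
  have "inj_on (\<lambda>H. (\<lambda>x. N +>\<^bsub>M\<^esub> x) ` H) ?F"
  proof (rule inj_onI)
    have le: "H \<subseteq> H'" if H: "H \<in> ?F" "H' \<in> ?F" and e: "(\<lambda>x. N +>\<^bsub>M\<^esub> x) ` H = (\<lambda>x. N +>\<^bsub>M\<^esub> x) ` H'" for H H'
    proof
      fix x assume x: "x \<in> H"
      then have "N +>\<^bsub>M\<^esub> x \<in> (\<lambda>x. N +>\<^bsub>M\<^esub> x) ` H'" using e by blast
      then obtain y where y: "y \<in> H'" "N +>\<^bsub>M\<^esub> x = N +>\<^bsub>M\<^esub> y" by blast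
      have c: "x \<in> carrier M" "y \<in> carrier M" using x y H Hc by blast+
      have "x \<ominus>\<^bsub>M\<^esub> y \<in> N" using M.M.rcos_iff[OF sg c] y(2) by simp
      then have "(x \<ominus>\<^bsub>M\<^esub> y) \<oplus>\<^bsub>M\<^esub> y \<in> H'" using H(2) y(1) rsubD(3)[of "Zp p" M H'] by (auto simp: Cq_def gsub_def)
      then show "x \<in> H'" using c by (simp add: M.M.minus_eq M.M.a_assoc M.M.l_neg)
    qed
    show "H = H'" if "H \<in> ?F" "H' \<in> ?F" "(\<lambda>x. N +>\<^bsub>M\<^esub> x) ` H = (\<lambda>x. N +>\<^bsub>M\<^esub> x) ` H'" for H H'
      using le[OF that] le[OF that(2,1) that(3)[symmetric]] by blast
  qed
  moreover have "(\<lambda>H. (\<lambda>x. N +>\<^bsub>M\<^esub> x) ` H) ` ?F \<subseteq> Pow (carrier (quot_module M N))"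
    using Hc unfolding quot_gmod(3)[OF G.group_axioms M N, symmetric] by blast
  ultimately have F: "finite ?F" using fin by (metis (no_types, lifting) finite_Pow_iff inj_on_finite)
  \<comment> \<open>The factor \<open>carrier M\<close> gives the empty intersection the right value
    and agrees with the carrier condition in \<open>Ccl\<close>.\<close>
  have "Cq M \<alpha> (carrier M \<inter> \<Inter>F)" if "finite F" "F \<subseteq> ?F" for F using that
  proof (induct F rule: finite_induct)
    case empty
    then show ?case using Cq_carrier[OF M] by simp
  next
    case (insert H F)
    then have "Cq M \<alpha> (H \<inter> (carrier M \<inter> \<Inter>F))" by (intro Cq_Int[OF M, of H "carrier M \<inter> \<Inter>F"]) simp_all
    moreover have "H \<inter> (carrier M \<inter> \<Inter>F) = carrier M \<inter> \<Inter>(insert H F)" by blast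
    ultimately show ?case by simp
  qed
  from this[OF F order_refl] show ?thesis by (simp add: Ccl_def Int_def)
qed

end

section \<open>The algebra E as a module with group action, and the ideal K\<close>

lemma quot_module_restr: "restr f (quot_module E N) = quot_module (restr f E) N"
  by (simp add: restr_def quot_module_def A_RCOSETS_def RCOSETS_def a_r_coset_def r_coset_def rcoset_mult_def set_add_def set_mult_def fun_eq_iff)

lemma quot_act_restr: "quot_act (restr f E) N \<alpha> = quot_act E N \<alpha>"
  by (simp add: restr_def quot_act_def a_r_coset_def r_coset_def fun_eq_iff)

lemma a_r_coset_restr [simp]: "N +>\<^bsub>restr f E\<^esub> x = N +>\<^bsub>E\<^esub> x"
  by (simp add: restr_def a_r_coset_def r_coset_def)

lemma a_minus_restr [simp]: "x \<ominus>\<^bsub>restr f E\<^esub> y = x \<ominus>\<^bsub>E\<^esub> y"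
  by (simp add: restr_def a_minus_def a_inv_def m_inv_def)

text \<open>The common part of three situations: the universal algebra, an arbitrary target of a
  morphism, and the quotient algebra. The last two enter as interpretations inside later
  proofs.\<close>

locale CH_data = stab_cond p G T C
  for p :: nat and G :: "'g monoid" and T :: "'g topology" and C :: "'g condition" +
  fixes R :: "(padic, 'r) module" and E :: "('r, 'e) module" and \<rho> :: "'g \<Rightarrow> 'e"
  assumes algR: "algebra (Zp p) R" and cnl: "complete_noetherian_local R" and assE: "assoc_algebra R E"
    and fgE: "fg_module R E" and rho: "\<rho> \<in> hom G (units_of E)"
begin

lemma cringR: "cring R" using algR by (simp add: algebra_def)
lemmas mD = complete_noetherian_localD[OF cnl]

sublocale R: cring R by (rule cringR)
sublocale E: ring E using assoc_algebraD[OF assE] by simp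
sublocale EM: noeth_module R E
  using assoc_algebraD(1)[OF assE] mD(2) by (simp add: noeth_module_def pmodule_def)

abbreviation "MM \<equiv> restr (str_map R) E"
abbreviation "al \<equiv> left_act E \<rho>"
abbreviation "mp n \<equiv> ideal_pow R (max_ideal R) n"
abbreviation "NN n \<equiv> ispan E (mp n) (carrier E)"

lemma mp_ideal: "ideal (mp n) R" by (rule R.ideal_pow_ideal[OF mD(4)])
lemma NN_rsub: "rsub R E (NN n)" by (rule EM.ispan_rsub[OF mp_ideal order_refl])
lemma NN_eq: "ideal_smult R (mp n) E = NN n" by (rule EM.ideal_smult_eq[OF mp_ideal])

lemma rho_closed: "s \<in> carrier G \<Longrightarrow> \<rho> s \<in> carrier E"
  using rho by (auto simp: hom_def units_of_def Units_def)
lemma rho_mult: "s \<in> carrier G \<Longrightarrow> t \<in> carrier G \<Longrightarrow> \<rho> (s \<otimes>\<^bsub>G\<^esub> t) = \<rho> s \<otimes>\<^bsub>E\<^esub> \<rho> t"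
  using rho by (auto simp: hom_def units_of_def)
lemma rho_one: "\<rho> \<one>\<^bsub>G\<^esub> = \<one>\<^bsub>E\<^esub>"
  using hom_one[OF rho G.group_axioms E.units_group] by (simp add: units_of_def)

lemma sm_l: "\<lbrakk>r \<in> carrier R; x \<in> carrier E; y \<in> carrier E\<rbrakk> \<Longrightarrow> (r \<odot>\<^bsub>E\<^esub> x) \<otimes>\<^bsub>E\<^esub> y = r \<odot>\<^bsub>E\<^esub> (x \<otimes>\<^bsub>E\<^esub> y)"
  and sm_r: "\<lbrakk>r \<in> carrier R; x \<in> carrier E; y \<in> carrier E\<rbrakk> \<Longrightarrow> x \<otimes>\<^bsub>E\<^esub> (r \<odot>\<^bsub>E\<^esub> y) = r \<odot>\<^bsub>E\<^esub> (x \<otimes>\<^bsub>E\<^esub> y)"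
  using assE by (auto simp: assoc_algebra_def)

lemma zpR: "str_map R \<in> ring_hom (Zp p) R" by (rule str_map_ring_hom[OF algR])

lemma MM_gmod: "gmod p G MM al"
  unfolding gmod_def
proof (intro conjI ballI)
  show "Module.module (Zp p) MM" by (rule module_restr[OF EM.module_axioms zpR algebraD(4)[OF algR]])
  show "addhom MM MM (al s)" if "s \<in> carrier G" for s
    by (rule addhomI) (simp_all add: left_act_def that rho_closed E.r_distr)
qed (simp_all add: left_act_def rho_one rho_mult rho_closed E.m_assoc)

lemma NN_mult:
  assumes x: "x \<in> NN n" and y: "y \<in> carrier E"
  shows "y \<otimes>\<^bsub>E\<^esub> x \<in> NN n" "x \<otimes>\<^bsub>E\<^esub> y \<in> NN n"
proof -
  have m: "a \<in> carrier R" if "a \<in> mp n" for a using that ideal.Icarr[OF mp_ideal] by blast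
  have c: "z \<in> carrier E" if "z \<in> NN n" for z using that rsubD(5)[OF NN_rsub] by blast
  show "y \<otimes>\<^bsub>E\<^esub> x \<in> NN n" using x
  proof (induct rule: ispan.induct)
    case zero then show ?case using y by (simp add: ispan.zero)
  next
    case (add a s z)
    have "a \<odot>\<^bsub>E\<^esub> (y \<otimes>\<^bsub>E\<^esub> s) \<oplus>\<^bsub>E\<^esub> y \<otimes>\<^bsub>E\<^esub> z \<in> NN n" using add y by (intro ispan.add) auto
    then show ?case using add y m c by (simp add: E.r_distr sm_r)
  qed
  show "x \<otimes>\<^bsub>E\<^esub> y \<in> NN n" using x
  proof (induct rule: ispan.induct)
    case zero then show ?case using y by (simp add: ispan.zero)
  next
    case (add a s z)
    have "a \<odot>\<^bsub>E\<^esub> (s \<otimes>\<^bsub>E\<^esub> y) \<oplus>\<^bsub>E\<^esub> z \<otimes>\<^bsub>E\<^esub> y \<in> NN n" using add y by (intro ispan.add) auto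
    then show ?case using add y m c by (simp add: E.l_distr sm_l)
  qed
qed

lemma rsub_restr: "rsub R E H \<Longrightarrow> rsub (Zp p) MM H"
  using ring_hom_closed[OF zpR] by (auto simp: rsub_def)

lemma NN_gsub: "gsub p G MM al (NN n)"
  using rsub_restr[OF NN_rsub] NN_mult rho_closed by (auto simp: gsub_def left_act_def)

lemma NN_antimono: "m \<le> n \<Longrightarrow> NN n \<subseteq> NN m"
  by (rule ispan_mono[OF R.ideal_pow_antimono[OF mD(4)] order_refl])

lemma red_mod_eq: "red_mod R E i = quot_module MM (NN i)"
  by (simp add: red_mod_def quot_module_restr NN_eq)

lemma red_act_eq: "red_act R E al i = quot_act MM (NN i) al"
  by (simp add: red_act_def quot_act_restr NN_eq)

abbreviation "KK \<equiv> KC p G C R E \<rho>"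
abbreviation "KI i \<equiv> Ccl MM al (NN i)"

text \<open>Replaces the cosets of cosets in the construction by an intersection of submodules of E;
  afterwards K is only used in this form.\<close>

lemma KC_iff: "x \<in> KK \<longleftrightarrow> x \<in> carrier E \<and> (\<forall>i\<ge>1. x \<in> KI i)"
proof -
  have "to_EC_level p G C R E \<rho> i x = \<zero>\<^bsub>EC_level p G C R E \<rho> i\<^esub> \<longleftrightarrow> x \<in> KI i" if x: "x \<in> carrier E" for i
  proof -
    let ?Q = "quot_module MM (NN i)" and ?a = "quot_act MM (NN i) al"
    let ?K = "C_kernel p G C ?Q ?a"
    have xM: "x \<in> carrier MM" using x by simp
    note Q = quot_gmod[OF G.group_axioms MM_gmod NN_gsub[of i]]
    interpret Q: abelian_group ?Q by (rule gmodD(3)[OF Q(1)])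
    have ck: "X \<in> ?K \<Longrightarrow> X \<in> carrier ?Q" for X by (simp add: C_kernel_def)
    \<comment> \<open>An element has trivial coset only if it lies in the set divided out, and this
      reading of the coset equation requires a subgroup.\<close>
    have sg: "subgroup ?K (add_monoid ?Q)"
    proof (rule Q.add.subgroupI)
      show "?K \<subseteq> carrier ?Q" using ck by blast
      have z: "\<phi> \<zero>\<^bsub>?Q\<^esub> = \<zero>\<^bsub>P\<^esub>" and ab: "abelian_group P" and ah: "addhom ?Q P \<phi>"
        if "(P, \<gamma>) \<in> C" "\<phi> \<in> gmodule_hom p G ?Q ?a P \<gamma>" for P \<gamma> \<phi>
      proof -
        have Pf: "fing P \<gamma>" using that stab unfolding stable_condition_def by blast
        show "addhom ?Q P \<phi>" by (rule ghomD(1)[OF gmodule_homD[OF that(2)]])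
        then show "\<phi> \<zero>\<^bsub>?Q\<^esub> = \<zero>\<^bsub>P\<^esub>" "abelian_group P"
          using addhom_zero Q.abelian_group_axioms gmodD(3)[OF fin_gmodD(1)[OF Pf]] by blast+
      qed
      have "\<zero>\<^bsub>?Q\<^esub> \<in> ?K" unfolding C_kernel_def using z Q.zero_closed by blast
      then show "?K \<noteq> {}" by blast
      fix X assume X: "X \<in> ?K"
      have n: "\<phi> (\<ominus>\<^bsub>?Q\<^esub> X) = \<zero>\<^bsub>P\<^esub>" if P: "(P, \<gamma>) \<in> C" "\<phi> \<in> gmodule_hom p G ?Q ?a P \<gamma>" "\<phi> ` carrier ?Q = carrier P" for P \<gamma> \<phi>
      proof -
        interpret P: abelian_group P by (rule ab[OF P(1,2)])
        have "\<phi> X = \<zero>\<^bsub>P\<^esub>" using X P unfolding C_kernel_def by blast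
        then show ?thesis using addhom_a_inv[OF ah[OF P(1,2)] Q.abelian_group_axioms P.abelian_group_axioms ck[OF X]]
          by (metis P.l_neg P.r_zero P.zero_closed P.a_inv_closed)
      qed
      show "\<ominus>\<^bsub>?Q\<^esub> X \<in> ?K" unfolding C_kernel_def using n Q.a_inv_closed[OF ck[OF X]] by blast
      fix Y assume Y: "Y \<in> ?K"
      have "\<phi> (X \<oplus>\<^bsub>?Q\<^esub> Y) = \<zero>\<^bsub>P\<^esub>" if P: "(P, \<gamma>) \<in> C" "\<phi> \<in> gmodule_hom p G ?Q ?a P \<gamma>" "\<phi> ` carrier ?Q = carrier P" for P \<gamma> \<phi>
      proof -
        interpret P: abelian_group P by (rule ab[OF P(1,2)])
        have "\<phi> X = \<zero>\<^bsub>P\<^esub>" "\<phi> Y = \<zero>\<^bsub>P\<^esub>" using X Y P unfolding C_kernel_def by blast+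
        then show ?thesis using addhom_add[OF ah[OF P(1,2)] ck[OF X] ck[OF Y]] by (metis P.r_zero P.zero_closed)
      qed
      then show "X \<oplus>\<^bsub>?Q\<^esub> Y \<in> ?K" unfolding C_kernel_def using Q.add.m_closed[OF ck[OF X] ck[OF Y]] by blast
    qed
    have "NN i +>\<^bsub>MM\<^esub> x \<in> carrier ?Q" using Q(3) xM by (metis imageI)
    then have "?K +>\<^bsub>?Q\<^esub> (NN i +>\<^bsub>MM\<^esub> x) = ?K \<longleftrightarrow> NN i +>\<^bsub>MM\<^esub> x \<in> ?K" by (rule Q.rcos_zero_iff[OF sg])
    then show ?thesis using C_kernel_iff[OF MM_gmod NN_gsub[of i] xM]
      unfolding to_EC_level_def EC_level_def red_mod_eq red_act_eq NN_eq by simp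
  qed
  then show ?thesis unfolding KC_def by blast
qed

lemma KK_gsub: "gsub p G MM al KK"
proof -
  have eq: "KK = {x \<in> carrier E. \<forall>i\<ge>1. x \<in> KI i}" using KC_iff by blast
  have g: "gsub p G MM al (KI i)" for i by (rule Ccl_gsub[OF MM_gmod])
  have r: "rsub (Zp p) MM (KI i)" and s: "\<And>s x. s \<in> carrier G \<Longrightarrow> x \<in> KI i \<Longrightarrow> al s x \<in> KI i" for i
    using g[of i] by (simp_all add: gsub_def)
  show ?thesis unfolding gsub_def
  proof (intro conjI ballI rsubI)
    show "x \<in> carrier MM" if "x \<in> KK" for x using that by (simp add: eq)
    show "\<zero>\<^bsub>MM\<^esub> \<in> KK" using rsubD(2)[OF r] by (simp add: eq)
    show "x \<oplus>\<^bsub>MM\<^esub> y \<in> KK" if "x \<in> KK" "y \<in> KK" for x y using that rsubD(3)[OF r] by (simp add: eq)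
    show "z \<odot>\<^bsub>MM\<^esub> x \<in> KK" if "z \<in> carrier (Zp p)" "x \<in> KK" for z x
      using that rsubD(4)[OF r that(1)] ring_hom_closed[OF zpR that(1)] by (simp add: eq)
    show "al t x \<in> KK" if "t \<in> carrier G" "x \<in> KK" for t x
      using that s gmodD(5)[OF MM_gmod that(1), of x] by (simp add: eq)
  qed
qed

text \<open>C sees only the action of G and of the p-adic integers, yet K must be stable under R. If
  H is one of the submodules intersected, so is its preimage under an equivariant map preserving all
  m^i E; hence K is mapped into H.\<close>

lemma KK_endo:
  assumes t: "addhom E E \<theta>" and e: "\<And>s x. s \<in> carrier G \<Longrightarrow> x \<in> carrier E \<Longrightarrow> \<theta> (al s x) = al s (\<theta> x)"
    and n: "\<And>i x. x \<in> NN i \<Longrightarrow> \<theta> x \<in> NN i" and x: "x \<in> KK"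
  shows "\<theta> x \<in> KK"
proof -
  have xc: "x \<in> carrier E" using x KC_iff by blast
  have tc: "\<theta> x \<in> carrier E" by (rule addhom_closed[OF t xc])
  have tg: "ghom G MM al MM al \<theta>" using t e by (simp add: ghom_def addhom_def)
  have "\<theta> x \<in> H" if i: "i \<ge> 1" and H: "Cq MM al H" "NN i \<subseteq> H" for i H
  proof -
    have Hg: "gsub p G MM al H" and Hc: "inC (quot_module MM H) (quot_act MM H al)" using H by (auto simp: Cq_def)
    note Q = quot_gmod[OF G.group_axioms MM_gmod Hg]
    \<comment> \<open>The preimage of H, written as the kernel of the composite into E/H so that
      \<open>Cq_kernel\<close> applies.\<close>
    let ?L = "{x \<in> carrier MM. H +>\<^bsub>MM\<^esub> \<theta> x = \<zero>\<^bsub>quot_module MM H\<^esub>}"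
    have "NN i \<subseteq> ?L"
    proof
      fix y assume y: "y \<in> NN i"
      then have yc: "y \<in> carrier MM" using rsubD(5)[OF NN_rsub] by auto
      have "\<theta> y \<in> carrier MM" using addhom_closed[OF t, of y] yc by simp
      then have "H +>\<^bsub>MM\<^esub> \<theta> y = \<zero>\<^bsub>quot_module MM H\<^esub>" using Q(4) n[OF y] H(2) by blast
      then show "y \<in> ?L" using yc by blast
    qed
    then have "x \<in> ?L" using x i Cq_kernel[OF MM_gmod Hc ghom_comp[OF tg Q(2)]] unfolding KC_iff Ccl_def by blast
    then show "\<theta> x \<in> H" using Q(4)[of "\<theta> x"] tc by simp
  qed
  then show ?thesis using tc unfolding KC_iff Ccl_def by simp
qed

lemma KK_rsub: "rsub R E KK"
proof (rule rsubI)
  have r: "rsub (Zp p) MM KK" using KK_gsub by (simp add: gsub_def)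
  show "x \<in> carrier E" if "x \<in> KK" for x using that KC_iff by blast
  show "x \<oplus>\<^bsub>E\<^esub> y \<in> KK" if "x \<in> KK" "y \<in> KK" for x y using rsubD(3)[OF r that] by simp
  show "\<zero>\<^bsub>E\<^esub> \<in> KK" using rsubD(2)[OF r] by simp
  show "r \<odot>\<^bsub>E\<^esub> x \<in> KK" if "r \<in> carrier R" "x \<in> KK" for r x
    by (rule KK_endo[OF EM.smult_addhom[OF that(1)] _ _ that(2)])
      (use that rsubD(4)[OF NN_rsub] in \<open>simp_all add: left_act_def sm_r rho_closed\<close>)
qed

text \<open>The kernel of such a map is among the submodules whose intersection is K. This is how K
  is shown to vanish in algebras that satisfy the condition.\<close>

lemma KK_killed:
  assumes P: "inC P \<gamma>" and h: "ghom G MM al P \<gamma> \<theta>" and j: "j \<ge> 1" "\<And>x. x \<in> NN j \<Longrightarrow> \<theta> x = \<zero>\<^bsub>P\<^esub>" and x: "x \<in> KK"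
  shows "\<theta> x = \<zero>\<^bsub>P\<^esub>"
proof -
  have "NN j \<subseteq> {x \<in> carrier MM. \<theta> x = \<zero>\<^bsub>P\<^esub>}" using j(2) rsubD(5)[OF NN_rsub] by auto
  then show ?thesis using x j(1) Cq_kernel[OF MM_gmod P h] unfolding KC_iff Ccl_def by blast
qed

section \<open>Lifting to K over a finite residue field\<close>

context
  assumes finR: "\<exists>X. finite X \<and> X \<subseteq> carrier R \<and> (\<forall>r\<in>carrier R. \<exists>t\<in>X. r \<ominus>\<^bsub>R\<^esub> t \<in> max_ideal R)"
begin

lemma KI_Cq: "Cq MM al (KI i)"
proof (rule Ccl_Cq[OF MM_gmod NN_gsub])
  obtain T where T: "finite T" "T \<subseteq> carrier R" "\<And>r. r \<in> carrier R \<Longrightarrow> \<exists>t\<in>T. r \<ominus>\<^bsub>R\<^esub> t \<in> max_ideal R" using finR by blast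
  obtain X where X: "finite X" "X \<subseteq> carrier E" "\<And>x. x \<in> carrier E \<Longrightarrow> \<exists>t\<in>X. x \<ominus>\<^bsub>E\<^esub> t \<in> NN i"
    using EM.finite_reps[OF fgE mD(4) T, of i] by blast
  note sg = EM.rsub_subgroup[OF NN_rsub]
  have "carrier (quot_module MM (NN i)) \<subseteq> (\<lambda>t. NN i +>\<^bsub>E\<^esub> t) ` X"
  proof
    fix Y assume "Y \<in> carrier (quot_module MM (NN i))"
    then have "Y \<in> (\<lambda>x. NN i +>\<^bsub>MM\<^esub> x) ` carrier MM" unfolding quot_gmod(3)[OF G.group_axioms MM_gmod NN_gsub] .
    then obtain x where x: "x \<in> carrier E" "Y = NN i +>\<^bsub>E\<^esub> x" by auto
    obtain t where t: "t \<in> X" "x \<ominus>\<^bsub>E\<^esub> t \<in> NN i" using X(3)[OF x(1)] by blast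
    have "t \<in> carrier E" using t X(2) by blast
    then have "Y = NN i +>\<^bsub>E\<^esub> t" unfolding x(2) using E.rcos_iff[OF sg x(1), of t] t(2) by simp
    then show "Y \<in> (\<lambda>t. NN i +>\<^bsub>E\<^esub> t) ` X" using t(1) by blast
  qed
  then show "finite (carrier (quot_module MM (NN i)))" using X(1) finite_surj by blast
qed

text \<open>K_(i+1) + m^i E contains K_(i+1), so its quotient is in C, and it contains m^i E.
  Minimality of K_i puts K_i inside it.\<close>

lemma KI_step:
  assumes y: "y \<in> KI i" shows "\<exists>k\<in>KI (Suc i). k \<ominus>\<^bsub>E\<^esub> y \<in> NN i"
proof -
  let ?S = "{k \<oplus>\<^bsub>E\<^esub> n | k n. k \<in> KI (Suc i) \<and> n \<in> NN i}"
  have gK: "gsub p G MM al (KI (Suc i))" by (rule Ccl_gsub[OF MM_gmod])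
  note rK = gK[unfolded gsub_def, THEN conjunct1] and rN = rsub_restr[OF NN_rsub, of i]
  have Kc: "k \<in> KI (Suc i) \<Longrightarrow> k \<in> carrier E" for k using rsubD(5)[OF rK] by simp
  have Nc: "k \<in> NN i \<Longrightarrow> k \<in> carrier E" for k using rsubD(5)[OF rN] by simp
  have SI: "k \<oplus>\<^bsub>E\<^esub> n \<in> ?S" if "k \<in> KI (Suc i)" "n \<in> NN i" for k n using that by blast
  have sr: "str_map R z \<in> carrier R" if "z \<in> carrier (Zp p)" for z using ring_hom_closed[OF zpR that] .
  have S: "gsub p G MM al ?S" unfolding gsub_def
  proof (intro conjI rsubI ballI)
    fix x assume "x \<in> ?S"
    then obtain k n where x: "x = k \<oplus>\<^bsub>E\<^esub> n" "k \<in> KI (Suc i)" "n \<in> NN i" by blast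
    show "x \<in> carrier MM" using x Kc Nc by simp
    show "z \<odot>\<^bsub>MM\<^esub> x \<in> ?S" if z: "z \<in> carrier (Zp p)" for z
    proof -
      have "z \<odot>\<^bsub>MM\<^esub> x = z \<odot>\<^bsub>MM\<^esub> k \<oplus>\<^bsub>E\<^esub> z \<odot>\<^bsub>MM\<^esub> n" using x Kc Nc sr[OF z] by (simp add: EM.smult_r_distr)
      then show ?thesis using SI[OF rsubD(4)[OF rK z x(2)] rsubD(4)[OF rN z x(3)]] by simp
    qed
    show "al s x \<in> ?S" if s: "s \<in> carrier G" for s
    proof -
      have "al s x = al s k \<oplus>\<^bsub>E\<^esub> al s n" using x Kc Nc rho_closed[OF s] by (simp add: left_act_def E.r_distr)
      moreover have "al s k \<in> KI (Suc i)" "al s n \<in> NN i" using gK NN_gsub[of i] s x unfolding gsub_def by blast+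
      ultimately show ?thesis using SI by simp
    qed
    fix x' assume "x' \<in> ?S"
    then obtain k' n' where x': "x' = k' \<oplus>\<^bsub>E\<^esub> n'" "k' \<in> KI (Suc i)" "n' \<in> NN i" by blast
    have "x \<oplus>\<^bsub>MM\<^esub> x' = (k \<oplus>\<^bsub>E\<^esub> k') \<oplus>\<^bsub>E\<^esub> (n \<oplus>\<^bsub>E\<^esub> n')" using x x' Kc Nc by (simp add: E.a_ac)
    then show "x \<oplus>\<^bsub>MM\<^esub> x' \<in> ?S" using SI rsubD(3)[OF rK x(2) x'(2)] rsubD(3)[OF rN x(3) x'(3)] by simp
  next
    show "\<zero>\<^bsub>MM\<^esub> \<in> ?S" using SI[OF rsubD(2)[OF rK] rsubD(2)[OF rN]] by simp
  qed
  have "KI (Suc i) \<subseteq> ?S"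
  proof
    fix k assume k: "k \<in> KI (Suc i)"
    show "k \<in> ?S" using SI[OF k rsubD(2)[OF rN]] Kc[OF k] by simp
  qed
  then have CS: "Cq MM al ?S" by (rule Cq_mono[OF MM_gmod KI_Cq S])
  have NS: "NN i \<subseteq> ?S"
  proof
    fix n assume n: "n \<in> NN i"
    show "n \<in> ?S" using SI[OF rsubD(2)[OF rK] n] Nc[OF n] by simp
  qed
  have "y \<in> ?S" using y CS NS unfolding Ccl_def by blast
  then obtain k n where kn: "y = k \<oplus>\<^bsub>E\<^esub> n" "k \<in> KI (Suc i)" "n \<in> NN i" by blast
  have "k \<ominus>\<^bsub>E\<^esub> y = \<ominus>\<^bsub>E\<^esub> n" using kn Kc Nc by (simp add: E.minus_eq E.minus_add E.r_neg1 E.r_neg2)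
  then show ?thesis using kn EM.rsub_neg[OF NN_rsub kn(3)] by (intro bexI[of _ k]) simp_all
qed

lemma KI_antimono: "i \<le> j \<Longrightarrow> KI j \<subseteq> KI i"
  using NN_antimono[of i j] unfolding Ccl_def by blast

text \<open>Successive approximation: an element of K_i is corrected by elements of m^i E, m^(i+1) E
  and so on, to lie in deeper and deeper K_j. The limit exists as E is complete and lies in all K_j
  as these are closed.\<close>

lemma KI_lift:
  assumes x: "x \<in> KI i" shows "\<exists>y\<in>KK. y \<ominus>\<^bsub>E\<^esub> x \<in> NN i"
proof -
  \<comment> \<open>The clause for index 0 pins the start of the sequence at x; the n-th term is
    taken in K_(i+n).\<close>
  have "\<exists>f. \<forall>n. (f n \<in> KI (i + n) \<and> (n = 0 \<longrightarrow> f n = x)) \<and> f (Suc n) \<ominus>\<^bsub>E\<^esub> f n \<in> NN (i + n)"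
  proof (rule dependent_nat_choice)
    show "\<exists>z. z \<in> KI (i + 0) \<and> (0 = (0::nat) \<longrightarrow> z = x)" using x by auto
    fix z n assume z: "z \<in> KI (i + n) \<and> (n = 0 \<longrightarrow> z = x)"
    then obtain k where "k \<in> KI (Suc (i + n))" "k \<ominus>\<^bsub>E\<^esub> z \<in> NN (i + n)" using KI_step by blast
    then show "\<exists>y. (y \<in> KI (i + Suc n) \<and> (Suc n = 0 \<longrightarrow> y = x)) \<and> y \<ominus>\<^bsub>E\<^esub> z \<in> NN (i + n)" by (intro exI[of _ k]) simp
  qed
  then obtain f where f: "\<And>n. f n \<in> KI (i + n)" "f 0 = x" "\<And>n. f (Suc n) \<ominus>\<^bsub>E\<^esub> f n \<in> NN (i + n)" by blast
  have fc: "f n \<in> carrier E" for n using f(1)[of n] by (simp add: Ccl_def)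
  have "f (Suc n) \<ominus>\<^bsub>E\<^esub> f n \<in> NN n" for n using f(3)[of n] NN_antimono[of n "i + n"] by auto
  then obtain y where y: "y \<in> carrier E" "\<And>n. y \<ominus>\<^bsub>E\<^esub> psum E (\<lambda>n. f (Suc n) \<ominus>\<^bsub>E\<^esub> f n) n \<in> NN n"
    using EM.fg_complete[OF mD(4) mD(6) fgE, of "\<lambda>n. f (Suc n) \<ominus>\<^bsub>E\<^esub> f n"] by blast
  have ps: "psum E (\<lambda>n. f (Suc n) \<ominus>\<^bsub>E\<^esub> f n) n = f n \<ominus>\<^bsub>E\<^esub> f 0" for n
    by (induct n) (simp_all add: fc E.r_neg E.minus_eq E.a_ac E.r_neg1 E.r_neg2)
  \<comment> \<open>The partial sums of the differences are f n - f 0, so the limit of f is the sum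
    plus f 0.\<close>
  let ?Y = "y \<oplus>\<^bsub>E\<^esub> f 0"
  have Yc: "?Y \<in> carrier E" using y fc by simp
  have Yn: "?Y \<ominus>\<^bsub>E\<^esub> f n \<in> NN n" for n
  proof -
    have "?Y \<ominus>\<^bsub>E\<^esub> f n = y \<ominus>\<^bsub>E\<^esub> (f n \<ominus>\<^bsub>E\<^esub> f 0)" using y(1) fc by (simp add: E.minus_eq E.minus_add E.a_ac)
    then show ?thesis using y(2)[of n] ps[of n] by simp
  qed
  \<comment> \<open>f j lies in K_j because K_(i+j) does so entirely, and the remaining error lies
    in m^j E, which is part of K_j.\<close>
  have "?Y \<in> KI j" for j
  proof -
    note rK = Ccl_gsub[OF MM_gmod, of "NN j", unfolded gsub_def, THEN conjunct1]
    have "f j \<in> KI j" using f(1)[of j] KI_antimono[of j "i + j"] by auto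
    moreover have "?Y \<ominus>\<^bsub>E\<^esub> f j \<in> KI j" using Yn[of j] Ccl_subset[of "NN j" MM al] rsubD(1)[OF NN_rsub] by auto
    ultimately have "(?Y \<ominus>\<^bsub>E\<^esub> f j) \<oplus>\<^bsub>E\<^esub> f j \<in> KI j" using rsubD(3)[OF rK] by simp
    moreover have "(?Y \<ominus>\<^bsub>E\<^esub> f j) \<oplus>\<^bsub>E\<^esub> f j = ?Y" using Yc fc[of j] by (simp add: E.minus_eq E.a_assoc E.l_neg)
    ultimately show ?thesis by simp
  qed
  then have "?Y \<in> KK" using Yc KC_iff by blast
  moreover have "?Y \<ominus>\<^bsub>E\<^esub> x \<in> NN i"
  proof -
    \<comment> \<open>All corrections lie in m^i E, so every f n stays congruent to x. The term with
      n = i is also congruent to the limit modulo m^i E, which closes the argument.\<close>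
    have "f n \<ominus>\<^bsub>E\<^esub> x \<in> NN i" for n
    proof (induct n)
      case 0
      then show ?case using f(2) fc[of 0] rsubD(2)[OF NN_rsub] by (simp add: E.minus_eq E.r_neg)
    next
      case (Suc n)
      have "f (Suc n) \<ominus>\<^bsub>E\<^esub> f n \<in> NN i" using f(3)[of n] NN_antimono[of i "i + n"] by auto
      then have "(f (Suc n) \<ominus>\<^bsub>E\<^esub> f n) \<oplus>\<^bsub>E\<^esub> (f n \<ominus>\<^bsub>E\<^esub> x) \<in> NN i" using Suc rsubD(3)[OF NN_rsub] by blast
      moreover have "(f (Suc n) \<ominus>\<^bsub>E\<^esub> f n) \<oplus>\<^bsub>E\<^esub> (f n \<ominus>\<^bsub>E\<^esub> x) = f (Suc n) \<ominus>\<^bsub>E\<^esub> x"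
        using fc f(2) by (metis E.add_minus_cancel(1) E.minus_closed E.r_zero E.zero_closed E.minus_eq E.a_assoc E.l_neg E.a_inv_closed)
      ultimately show ?case by simp
    qed
    from this[of i] Yn[of i] have "(?Y \<ominus>\<^bsub>E\<^esub> f i) \<oplus>\<^bsub>E\<^esub> (f i \<ominus>\<^bsub>E\<^esub> x) \<in> NN i" using rsubD(3)[OF NN_rsub] by blast
    moreover have "(?Y \<ominus>\<^bsub>E\<^esub> f i) \<oplus>\<^bsub>E\<^esub> (f i \<ominus>\<^bsub>E\<^esub> x) = ?Y \<ominus>\<^bsub>E\<^esub> x"
    proof -
      have xc: "x \<in> carrier E" using f(2) fc by metis
      show ?thesis using Yc fc[of i] xc by (simp only: E.minus_eq) (metis E.a_assoc E.a_inv_closed E.add.m_closed E.l_neg E.l_zero)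
    qed
    ultimately show ?thesis by simp
  qed
  ultimately show ?thesis by blast
qed

text \<open>A map killing K and m^i E kills K_i, because elements of K_i lift to K modulo m^i E. It
  therefore factors through E/K_i, which is in C.\<close>

lemma quotient_inC:
  assumes P: "gmod p G P \<gamma>" and h: "ghom G MM al P \<gamma> \<theta>" and surj: "\<theta> ` carrier E = carrier P"
    and k: "\<And>x. x \<in> KK \<Longrightarrow> \<theta> x = \<zero>\<^bsub>P\<^esub>" and n: "\<And>x. x \<in> NN i \<Longrightarrow> \<theta> x = \<zero>\<^bsub>P\<^esub>"
  shows "inC P \<gamma>"
proof -
  interpret P: abelian_group P by (rule gmodD(3)[OF P])
  have Kg: "gsub p G MM al (KI i)" and Kc: "inC (quot_module MM (KI i)) (quot_act MM (KI i) al)" using KI_Cq by (auto simp: Cq_def)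
  note Q = quot_gmod[OF G.group_axioms MM_gmod Kg]
  have "\<theta> x = \<zero>\<^bsub>P\<^esub>" if x: "x \<in> KI i" for x
  proof -
    obtain y where y: "y \<in> KK" "y \<ominus>\<^bsub>E\<^esub> x \<in> NN i" using KI_lift[OF x] by blast
    have c: "x \<in> carrier E" "y \<in> carrier E" using x y KC_iff by (auto simp: Ccl_def)
    have "\<theta> y \<ominus>\<^bsub>P\<^esub> \<theta> x = \<zero>\<^bsub>P\<^esub>" using n[OF y(2)] addhom_minus[OF ghomD(1)[OF h] gmodD(3)[OF MM_gmod] P.abelian_group_axioms, of y x] c by simp
    then show ?thesis using k[OF y(1)] c ghomD(3)[OF h] P.minus_zero_iff[of "\<theta> y" "\<theta> x"] by simp
  qed
  then have ker: "\<theta> x = \<zero>\<^bsub>P\<^esub>" if "x \<in> carrier MM" "KI i +>\<^bsub>MM\<^esub> x = \<zero>\<^bsub>quot_module MM (KI i)\<^esub>" for x using Q(4) that by blast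
  obtain l where l: "ghom G (quot_module MM (KI i)) (quot_act MM (KI i) al) P \<gamma> l" "\<And>x. x \<in> carrier MM \<Longrightarrow> l (KI i +>\<^bsub>MM\<^esub> x) = \<theta> x"
    using ghom_factor[OF gmodD(3)[OF MM_gmod] gmodD(3)[OF Q(1)] P.abelian_group_axioms Q(2,3) h gmodD(5)[OF MM_gmod] ker] by blast
  have "l ` carrier (quot_module MM (KI i)) = \<theta> ` carrier MM"
    unfolding Q(3)[symmetric] image_image using l(2) by (rule image_cong[OF refl])
  then show ?thesis using inC_surj[OF Kc P l(1)] surj by simp
qed

end

end

section \<open>Rings as surjective images\<close>

lemma ring_surj:
  assumes "ring M" "h ` carrier M = carrier N"
    "\<And>x y. \<lbrakk>x \<in> carrier M; y \<in> carrier M\<rbrakk> \<Longrightarrow> h (x \<oplus>\<^bsub>M\<^esub> y) = h x \<oplus>\<^bsub>N\<^esub> h y" "h \<zero>\<^bsub>M\<^esub> = \<zero>\<^bsub>N\<^esub>"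
    "\<And>x y. \<lbrakk>x \<in> carrier M; y \<in> carrier M\<rbrakk> \<Longrightarrow> h (x \<otimes>\<^bsub>M\<^esub> y) = h x \<otimes>\<^bsub>N\<^esub> h y" "h \<one>\<^bsub>M\<^esub> = \<one>\<^bsub>N\<^esub>"
  shows "ring N"
proof -
  interpret M: ring M by fact
  have ex: "\<exists>x\<in>carrier M. y = h x" if "y \<in> carrier N" for y using that assms(2) by (metis imageE)
  have cl: "x \<in> carrier M \<Longrightarrow> h x \<in> carrier N" for x using assms(2) by (metis imageI)
  show ?thesis
  proof (rule ringI[OF abelian_group_surj[OF M.abelian_group_axioms assms(2-4)] monoidI])
    show "\<one>\<^bsub>N\<^esub> \<in> carrier N" using cl[OF M.one_closed] assms(6) by simp
    fix x assume "x \<in> carrier N"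
    then obtain a where a: "a \<in> carrier M" "x = h a" using ex by blast
    show "\<one>\<^bsub>N\<^esub> \<otimes>\<^bsub>N\<^esub> x = x" "x \<otimes>\<^bsub>N\<^esub> \<one>\<^bsub>N\<^esub> = x" using a by (simp_all add: assms(5,6)[symmetric])
    fix y assume "y \<in> carrier N"
    then obtain b where b: "b \<in> carrier M" "y = h b" using ex by blast
    show "x \<otimes>\<^bsub>N\<^esub> y \<in> carrier N" using a b cl by (simp add: assms(5)[symmetric])
    fix z assume "z \<in> carrier N"
    then obtain c where c: "c \<in> carrier M" "z = h c" using ex by blast
    show "x \<otimes>\<^bsub>N\<^esub> y \<otimes>\<^bsub>N\<^esub> z = x \<otimes>\<^bsub>N\<^esub> (y \<otimes>\<^bsub>N\<^esub> z)" using a b c by (simp add: assms(5)[symmetric] M.m_assoc)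
    show "(x \<oplus>\<^bsub>N\<^esub> y) \<otimes>\<^bsub>N\<^esub> z = x \<otimes>\<^bsub>N\<^esub> z \<oplus>\<^bsub>N\<^esub> y \<otimes>\<^bsub>N\<^esub> z" "z \<otimes>\<^bsub>N\<^esub> (x \<oplus>\<^bsub>N\<^esub> y) = z \<otimes>\<^bsub>N\<^esub> x \<oplus>\<^bsub>N\<^esub> z \<otimes>\<^bsub>N\<^esub> y"
      using a b c by (simp_all add: assms(3,5)[symmetric] M.l_distr M.r_distr)
  qed
qed

lemma cring_surj:
  assumes "cring M" "h ` carrier M = carrier N"
    "\<And>x y. \<lbrakk>x \<in> carrier M; y \<in> carrier M\<rbrakk> \<Longrightarrow> h (x \<oplus>\<^bsub>M\<^esub> y) = h x \<oplus>\<^bsub>N\<^esub> h y" "h \<zero>\<^bsub>M\<^esub> = \<zero>\<^bsub>N\<^esub>"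
    "\<And>x y. \<lbrakk>x \<in> carrier M; y \<in> carrier M\<rbrakk> \<Longrightarrow> h (x \<otimes>\<^bsub>M\<^esub> y) = h x \<otimes>\<^bsub>N\<^esub> h y" "h \<one>\<^bsub>M\<^esub> = \<one>\<^bsub>N\<^esub>"
  shows "cring N"
proof -
  interpret M: cring M by fact
  interpret N: ring N by (rule ring_surj[OF M.ring_axioms assms(2-6)])
  have ex: "\<exists>x\<in>carrier M. y = h x" if "y \<in> carrier N" for y using that assms(2) by (metis imageE)
  show ?thesis
  proof (rule cringI[OF N.abelian_group_axioms comm_monoidI])
    fix x y assume x: "x \<in> carrier N" and y: "y \<in> carrier N"
    obtain a where "a \<in> carrier M" "x = h a" using ex[OF x] by blast
    moreover obtain b where "b \<in> carrier M" "y = h b" using ex[OF y] by blast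
    ultimately show "x \<otimes>\<^bsub>N\<^esub> y = y \<otimes>\<^bsub>N\<^esub> x" by (simp add: assms(5)[symmetric] M.m_comm)
  qed (simp_all add: N.m_assoc N.l_distr)
qed

section \<open>Polynomial rings inside the universe\<close>

lemma ex_inj_pair:
  assumes "infinite (UNIV :: 'u set)" shows "\<exists>f :: 'u \<times> 'u \<Rightarrow> 'u. inj f"
proof -
  have "\<exists>f :: 'u \<times> 'u \<Rightarrow> 'u. bij_betw f (UNIV \<times> UNIV) UNIV"
    unfolding card_of_ordIso by (rule card_of_Times_same_infinite[OF assms])
  then obtain f :: "'u \<times> 'u \<Rightarrow> 'u" where "bij_betw f (UNIV \<times> UNIV) UNIV" by blast
  then have "inj f" by (simp add: bij_betw_def)
  then show ?thesis by blast
qed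

text \<open>A sequence is coded by its last relevant index and by its initial segment, folded with a
  pairing function. Folding is injective only among lists of one length, hence the index is coded as
  well.\<close>

lemma ex_inj_finite_support:
  assumes inf: "infinite (UNIV :: 'u set)"
  shows "\<exists>e :: (nat \<Rightarrow> 'u) \<Rightarrow> 'u. inj_on e {f. \<exists>n. \<forall>m>n. f m = z}"
proof -
  obtain c :: "'u \<times> 'u \<Rightarrow> 'u" where c: "inj c" using ex_inj_pair[OF inf] by blast
  obtain \<nu> :: "nat \<Rightarrow> 'u" where nu: "inj \<nu>" using infinite_countable_subset[OF inf] by blast
  define enc where "enc l = foldr (\<lambda>x y. c (x, y)) l z" for l
  have enc: "length l = length l' \<Longrightarrow> enc l = enc l' \<Longrightarrow> l = l'" for l l'
  proof (induct l l' rule: list_induct2)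
    case (Cons x xs y ys)
    have "(x, enc xs) = (y, enc ys)" using Cons(3) by (intro injD[OF c]) (simp add: enc_def)
    then show ?case using Cons(2) by simp
  qed simp
  let ?N = "\<lambda>f. LEAST n. \<forall>m>n. f m = z"
  define e where "e f = c (\<nu> (?N f), enc (map f [0..<Suc (?N f)]))" for f
  have "inj_on e {f. \<exists>n. \<forall>m>n. f m = z}"
  proof (rule inj_onI, rule ext)
    fix f g m assume f: "f \<in> {f. \<exists>n. \<forall>m>n. f m = z}" and g: "g \<in> {f. \<exists>n. \<forall>m>n. f m = z}" and eq: "e f = e g"
    have n: "?N f = ?N g" and l: "enc (map f [0..<Suc (?N f)]) = enc (map g [0..<Suc (?N g)])"
      using injD[OF c eq[unfolded e_def]] injD[OF nu, of "?N f" "?N g"] by simp_all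
    have l': "map f [0..<Suc (?N f)] = map g [0..<Suc (?N f)]" by (rule enc) (use l n in simp_all)
    have zf: "\<forall>m>?N f. f m = z" and zg: "\<forall>m>?N g. g m = z" using f g LeastI_ex[of "\<lambda>n. \<forall>m>n. f m = z"] LeastI_ex[of "\<lambda>n. \<forall>m>n. g m = z"] by blast+
    show "f m = g m"
    proof (cases "m < Suc (?N f)")
      case True
      then have m: "m \<in> set [0..<Suc (?N f)]" by (simp del: upt_Suc)
      from l' have "\<forall>k\<in>set [0..<Suc (?N f)]. f k = g k" unfolding map_eq_conv .
      then show ?thesis using m by (rule bspec)
    next
      case False
      then have m: "?N f < m" by simp
      then have m': "?N g < m" unfolding n .
      have "f m = z" by (rule zf[rule_format, OF m])
      moreover have "g m = z" by (rule zg[rule_format, OF m'])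
      ultimately show ?thesis by (rule trans[OF _ sym])
    qed
  qed
  then show ?thesis by blast
qed

lemma finsum_restr: "finsum (restr f A) = finsum A"
  by (simp add: finsum_def finprod_def fun_eq_iff)

lemma finsum_self_alg: "finsum (self_alg A) = finsum A"
  by (simp add: finsum_def finprod_def fun_eq_iff)

lemma UP_restr [simp]: "UP (restr f A) = UP A"
  by (simp add: UP_def up_def finsum_restr cong: if_cong)

lemma UP_self_alg [simp]: "UP (self_alg A) = UP A"
  by (simp add: UP_def up_def finsum_self_alg cong: if_cong)

lemma deg_restr [simp]: "deg (restr f A) p = deg A p"
  by (simp add: deg_def)

lemma poly_code_restr [simp]: "poly_code (restr f A) = poly_code A" "poly_decode (restr f A) = poly_decode A"
  "poly_const (restr f A) = poly_const A" "poly_var (restr f A) = poly_var A"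
  by (simp_all add: poly_code_def poly_decode_def poly_const_def poly_var_def fun_eq_iff)

lemma str_map_restr: "str_map (restr f A) r = str_map A (f r)" by (simp add: str_map_def)

text \<open>Restriction of scalars does not touch the ring, so the polynomial ring and the chosen
  coding are literally the same. This lets characteristic polynomials over R and over R' be compared
  as one object.\<close>

lemma poly_alg_restr: "poly_alg (restr f A) = restr f (poly_alg A)"
  by (simp add: poly_alg_def str_map_restr) (simp add: restr_def)

locale poly_univ =
  fixes R :: "('r, 'x) ring_scheme" and A :: "('r, 'u) module"
  assumes inf: "infinite (UNIV :: 'u set)" and algA: "algebra R A"
begin

sublocale A: cring A using algebraD[OF algA] by simp

abbreviation "P \<equiv> UP A"
abbreviation "code \<equiv> (poly_code A :: (nat \<Rightarrow> 'u) \<Rightarrow> 'u)"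
abbreviation "B \<equiv> (poly_alg A :: ('r, 'u) module)"

sublocale P: UP_cring A P
  by (intro UP_cring.intro A.cring_axioms)

lemma UP_carrier: "p \<in> carrier P \<longleftrightarrow> (\<forall>n. p n \<in> carrier A) \<and> (\<exists>n. \<forall>m>n. p m = \<zero>\<^bsub>A\<^esub>)"
  by (simp add: UP_def up_def bound_def Pi_iff)

text \<open>The coding is chosen by an indefinite description; this existence result is what gives
  the choice its meaning.\<close>

lemma code_inj: "inj_on code (carrier P)"
proof -
  obtain e :: "(nat \<Rightarrow> 'u) \<Rightarrow> 'u" where "inj_on e {f. \<exists>n. \<forall>m>n. f m = \<zero>\<^bsub>A\<^esub>}" using ex_inj_finite_support[OF inf] by blast
  then have "inj_on e (carrier P)" by (rule inj_on_subset) (use UP_carrier in blast)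
  then show ?thesis unfolding poly_code_def by (rule someI[of "\<lambda>e. inj_on e (carrier P)"])
qed

lemma decode_code: "p \<in> carrier P \<Longrightarrow> poly_decode A (code p) = p"
  unfolding poly_decode_def using code_inj by (rule inv_into_f_f)

lemma B_carrier: "carrier B = code ` carrier P" by (simp add: poly_alg_def)

lemma code_closed: "p \<in> carrier P \<Longrightarrow> code p \<in> carrier B" by (simp add: B_carrier)

lemma B_elem: "x \<in> carrier B \<Longrightarrow> \<exists>p\<in>carrier P. x = code p" by (auto simp: B_carrier)

lemma decode_closed: "x \<in> carrier B \<Longrightarrow> poly_decode A x \<in> carrier P" using B_elem decode_code by metis
lemma code_ops:
  "p \<in> carrier P \<Longrightarrow> q \<in> carrier P \<Longrightarrow> code (p \<oplus>\<^bsub>P\<^esub> q) = code p \<oplus>\<^bsub>B\<^esub> code q"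
  "p \<in> carrier P \<Longrightarrow> q \<in> carrier P \<Longrightarrow> code (p \<otimes>\<^bsub>P\<^esub> q) = code p \<otimes>\<^bsub>B\<^esub> code q"
  "code \<zero>\<^bsub>P\<^esub> = \<zero>\<^bsub>B\<^esub>" "code \<one>\<^bsub>P\<^esub> = \<one>\<^bsub>B\<^esub>"
  "p \<in> carrier P \<Longrightarrow> code (str_map A r \<odot>\<^bsub>P\<^esub> p) = r \<odot>\<^bsub>B\<^esub> code p"
  by (simp_all add: poly_alg_def decode_code)

lemma B_algebra: "algebra R B"
proof -
  have c: "cring B" by (rule cring_surj[OF P.UP_cring, where h = code]) (simp_all add: B_carrier code_ops)
  interpret B: cring B by (rule c)
  note s = str_map_closed[OF algA]
  note sr = str_map_ring_hom[OF algA]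
  have "Module.module R B"
  proof (rule moduleI[OF algebraD(4)[OF algA] B.abelian_group_axioms])
    fix r x assume r: "r \<in> carrier R" and "x \<in> carrier B"
    then obtain p where p: "p \<in> carrier P" "x = code p" using B_elem by blast
    show "r \<odot>\<^bsub>B\<^esub> x \<in> carrier B" using r p s by (simp add: code_ops[symmetric] code_closed)
    show "(r \<oplus>\<^bsub>R\<^esub> t) \<odot>\<^bsub>B\<^esub> x = r \<odot>\<^bsub>B\<^esub> x \<oplus>\<^bsub>B\<^esub> t \<odot>\<^bsub>B\<^esub> x" if "t \<in> carrier R" for t
      using r p s that by (simp add: code_ops[symmetric] ring_hom_add[OF sr] P.UP_smult_l_distr)
    show "(r \<otimes>\<^bsub>R\<^esub> t) \<odot>\<^bsub>B\<^esub> x = r \<odot>\<^bsub>B\<^esub> (t \<odot>\<^bsub>B\<^esub> x)" if "t \<in> carrier R" for t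
      using r p s that by (simp add: code_ops[symmetric] ring_hom_mult[OF sr] P.UP_smult_assoc1)
    fix y assume "y \<in> carrier B"
    then obtain q where q: "q \<in> carrier P" "y = code q" using B_elem by blast
    show "r \<odot>\<^bsub>B\<^esub> (x \<oplus>\<^bsub>B\<^esub> y) = r \<odot>\<^bsub>B\<^esub> x \<oplus>\<^bsub>B\<^esub> r \<odot>\<^bsub>B\<^esub> y"
      using r p q s by (simp add: code_ops[symmetric] P.UP_smult_r_distr)
  next
    fix x assume "x \<in> carrier B"
    then obtain p where p: "p \<in> carrier P" "x = code p" using B_elem by blast
    show "\<one>\<^bsub>R\<^esub> \<odot>\<^bsub>B\<^esub> x = x" using p by (simp add: code_ops[symmetric] ring_hom_one[OF sr])
  qed
  moreover have "(r \<odot>\<^bsub>B\<^esub> x) \<otimes>\<^bsub>B\<^esub> y = r \<odot>\<^bsub>B\<^esub> (x \<otimes>\<^bsub>B\<^esub> y)" if r: "r \<in> carrier R" and xy: "x \<in> carrier B" "y \<in> carrier B" for r x y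
  proof -
    obtain p q where "p \<in> carrier P" "x = code p" "q \<in> carrier P" "y = code q" using B_elem xy by blast
    then show ?thesis using r s by (simp add: code_ops[symmetric] P.UP_smult_assoc2)
  qed
  ultimately show ?thesis using c by (simp add: algebra_def algebra_axioms_def)
qed

lemma const_slin: "slin R (\<lambda>r. r) A B (poly_const A)"
proof (rule slinI[OF addhomI])
  note ch = P.const_ring_hom
  fix a assume a: "a \<in> carrier A"
  show "poly_const A a \<in> carrier B" using a by (simp add: poly_const_def code_closed)
  show "poly_const A (a \<oplus>\<^bsub>A\<^esub> b) = poly_const A a \<oplus>\<^bsub>B\<^esub> poly_const A b" if "b \<in> carrier A" for b
    using a that ring_hom_add[OF ch] by (simp add: poly_const_def code_ops[symmetric])
  show "poly_const A (r \<odot>\<^bsub>A\<^esub> a) = r \<odot>\<^bsub>B\<^esub> poly_const A a" if r: "r \<in> carrier R" for r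
    using a str_map_closed[OF algA r] ring_hom_mult[OF ch str_map_closed[OF algA r] a] str_map_mult[OF algA r a]
    by (simp add: poly_const_def code_ops[symmetric] P.monom_mult_is_smult)
qed

lemma var_closed: "poly_var A \<in> carrier B"
  by (simp add: poly_var_def code_closed)

end

section \<open>Transport of the Cayley--Hamilton property\<close>

lemma pseudorepD:
  fixes D :: "('r,'e,'u) law"
  assumes "pseudorep R E d D"
  shows "cring R" "assoc_algebra R E"
    "\<And>A x. algebra R A \<Longrightarrow> x \<in> carrier (tensor R E A) \<Longrightarrow> D A x \<in> carrier A"
    "\<And>A. algebra R A \<Longrightarrow> D A \<one>\<^bsub>tensor R E A\<^esub> = \<one>\<^bsub>A\<^esub>"
    "\<And>A B h x. algebra R A \<Longrightarrow> algebra R B \<Longrightarrow> h \<in> alg_hom R A B \<Longrightarrow> x \<in> carrier (tensor R E A) \<Longrightarrow>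
       D B (tmap R E B (\<lambda>e. e) h x) = h (D A x)"
  using assms unfolding pseudorep_def by (blast, blast, blast, blast, blast)

locale semilinear_hom = base_change R E R' E' f
  for R :: "('r,'x) ring_scheme" and E :: "('r,'e) module"
    and R' :: "('s,'y) ring_scheme" and E' :: "('s,'f) module" and f :: "'r \<Rightarrow> 's" +
  fixes g :: "'e \<Rightarrow> 'f"
  assumes gr: "g \<in> ring_hom E E'" and gs: "slin R f E E' g"
begin

lemma tensor_map_id: "algebra R' B \<Longrightarrow> tensor_map R E (restr f B) R' E' B f g (\<lambda>b. b)"
  by (rule tensor_mapI[OF tensor_alg.intro[OF E algebra_restr[OF _ f R]] tensor_alg.intro[OF E'] fPi gs slin_id])

lemma id_ring_hom: "(\<lambda>b. b) \<in> ring_hom (restr f B) B" by (simp add: ring_hom_def)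

text \<open>The element t - x over A[t] is mapped to t minus the image of x, and compatibility of
  the laws at A[t] equates their values.\<close>

lemma char_poly_transport:
  fixes D :: "('r,'e,'u) law" and D' :: "('s,'f,'u) law" and A :: "('s,'u) module"
  assumes inf: "infinite (UNIV :: 'u set)" and A: "algebra R' A" and lc: "law_compat R E D R' E' D' f g"
    and x: "x \<in> carrier (tensor R E (restr f A))"
  shows "char_poly R' E' D' A (tmap R' E' A g (\<lambda>b. b) x) = char_poly R E D (restr f A) x"
proof -
  interpret pu: poly_univ R' A using inf A by (rule poly_univ.intro)
  let ?B = "poly_alg A :: ('s,'u) module"
  note Balg = pu.B_algebra
  interpret m: tensor_map R E "restr f ?B" R' E' ?B f g "\<lambda>b. b" by (rule tensor_map_id[OF Balg])
  interpret mA: tensor_map R E "restr f A" R' E' A f g "\<lambda>b. b" by (rule tensor_map_id[OF A])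
  interpret c: tensor_map R E "restr f A" R E "restr f ?B" "\<lambda>r. r" "\<lambda>e. e" "poly_const A"
  proof (rule tensor_mapI[OF mA.S.tensor_alg_axioms m.S.tensor_alg_axioms])
    show "slin R (\<lambda>r. r) E E (\<lambda>e. e)" by (rule slinI[OF addhomI]) simp_all
    show "slin R (\<lambda>r. r) (restr f A) (restr f ?B) (poly_const A)" using pu.const_slin fc
      by (simp add: slin_def addhom_def)
  qed simp
  interpret c': tensor_map R' E' A R' E' ?B "\<lambda>r. r" "\<lambda>e. e" "poly_const A"
  proof (rule tensor_mapI[OF mA.T'.tensor_alg_axioms m.T'.tensor_alg_axioms _ _ pu.const_slin])
    show "slin R' (\<lambda>r. r) E' E' (\<lambda>e. e)" by (rule slinI[OF addhomI]) simp_all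
  qed simp
  let ?pi = "tmap R' E' ?B g (\<lambda>b. b)"
  let ?w = "pure R E (restr f ?B) \<one>\<^bsub>E\<^esub> (poly_var A) \<ominus>\<^bsub>tensor R E (restr f ?B)\<^esub> tmap R E (restr f ?B) (\<lambda>e. e) (poly_const A) x"
  have gc: "e \<in> carrier E \<Longrightarrow> g e \<in> carrier E'" for e using ring_hom_closed[OF gr] .
  have vc: "poly_var A \<in> carrier (restr f ?B)" using pu.var_closed by simp
  \<comment> \<open>Passing to A[t] and applying g commute: both composites send e (x) a to g e (x)
    a, with a read as a constant polynomial.\<close>
  have sq: "?pi (tmap R E (restr f ?B) (\<lambda>e. e) (poly_const A) x) = tmap R' E' ?B (\<lambda>e. e) (poly_const A) (tmap R' E' A g (\<lambda>b. b) x)"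
    by (rule mA.S.tensor_ext[OF addhom_comp[OF c.tmap_addhom m.tmap_addhom] addhom_comp[OF mA.tmap_addhom c'.tmap_addhom] m.T'.T_abelian_group x])
      (simp add: c.tmap_pure m.tmap_pure mA.tmap_pure c'.tmap_pure gc addhom_closed[OF slin_addhom[OF pu.const_slin]])
  have "?pi ?w = ?pi (pure R E (restr f ?B) \<one>\<^bsub>E\<^esub> (poly_var A)) \<ominus>\<^bsub>tensor R' E' ?B\<^esub> ?pi (tmap R E (restr f ?B) (\<lambda>e. e) (poly_const A) x)"
    by (rule addhom_minus[OF m.tmap_addhom m.S.T_abelian_group m.T'.T_abelian_group])
      (simp_all only: m.S.pure_closed E.one_closed vc c.tmap_closed[OF x])
  also have "?pi (pure R E (restr f ?B) \<one>\<^bsub>E\<^esub> (poly_var A)) = pure R' E' ?B \<one>\<^bsub>E'\<^esub> (poly_var A)"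
    using m.tmap_pure[OF E.one_closed vc] by (simp add: ring_hom_one[OF gr])
  finally have pw: "?pi ?w = pure R' E' ?B \<one>\<^bsub>E'\<^esub> (poly_var A) \<ominus>\<^bsub>tensor R' E' ?B\<^esub> tmap R' E' ?B (\<lambda>e. e) (poly_const A) (tmap R' E' A g (\<lambda>b. b) x)"
    unfolding sq .
  have "?w \<in> carrier (tensor R E (restr f ?B))"
    by (rule m.S.T.minus_closed) (simp_all only: m.S.pure_closed E.one_closed vc c.tmap_closed[OF x])
  then have "D (restr f ?B) ?w = D' ?B (?pi ?w)" using lc Balg unfolding law_compat_def by blast
  then show ?thesis unfolding char_poly_def Let_def poly_alg_restr poly_code_restr pw by simp
qed

text \<open>By surjectivity each x over A lifts to some y in E (x) A. The equation for y holds over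
  R, its coefficients agree with those for x, and it is mapped to the equation for x.\<close>

lemma cayley_hamilton_transport:
  fixes D :: "('r,'e,'u) law" and D' :: "('s,'f,'u) law"
  assumes inf: "infinite (UNIV :: 'u set)" and ch: "cayley_hamilton R E d D" and D': "pseudorep R' E' d D'"
    and lc: "law_compat R E D R' E' D' f g" and surj: "g ` carrier E = carrier E'"
  shows "cayley_hamilton R' E' d D'"
proof -
  have D: "pseudorep R E d D" using ch by (simp add: cayley_hamilton_def)
  have gc: "e \<in> carrier E \<Longrightarrow> g e \<in> carrier E'" for e using ring_hom_closed[OF gr] .
  have fg: "fg_algebra R' E'"
  proof -
    have "fg_algebra R E" using ch by (simp add: cayley_hamilton_def)
    then obtain S where S: "finite S" "S \<subseteq> carrier E"
      "\<forall>B. subring B E \<and> (\<forall>r\<in>carrier R. \<forall>x\<in>B. r \<odot>\<^bsub>E\<^esub> x \<in> B) \<and> S \<subseteq> B \<longrightarrow> B = carrier E"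
      unfolding fg_algebra_def by (elim exE conjE)
    have "B' = carrier E'" if B': "subring B' E'" "\<forall>r\<in>carrier R'. \<forall>x\<in>B'. r \<odot>\<^bsub>E'\<^esub> x \<in> B'" "g ` S \<subseteq> B'" for B'
    proof -
      \<comment> \<open>Preimages of subalgebras are subalgebras, so the images of generators
        generate.\<close>
      let ?B = "{x \<in> carrier E. g x \<in> B'}"
      note sE = subringE[OF B'(1)]
      have "subring ?B E"
        by (rule E.subringI) (use sE in \<open>auto simp: ring_hom_one[OF gr] ring_hom_mult[OF gr] ring_hom_add[OF gr]
          addhom_a_inv[OF ring_hom_addhom[OF gr] E.abelian_group_axioms E'.abelian_group_axioms]\<close>)
      moreover have "\<forall>r\<in>carrier R. \<forall>x\<in>?B. r \<odot>\<^bsub>E\<^esub> x \<in> ?B"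
        using B'(2) fc module.smult_closed[OF assoc_algebraD(1)[OF E]] by (auto simp: slin_smult[OF gs])
      moreover have "S \<subseteq> ?B" using S(2) B'(3) by auto
      ultimately have "?B = carrier E" by (intro S(3)[rule_format] conjI)
      then have "g ` carrier E \<subseteq> B'" by blast
      then show ?thesis using surj sE(1) by blast
    qed
    then show ?thesis unfolding fg_algebra_def using S(1,2) gc by (intro exI[of _ "g ` S"]) auto
  qed
  have "finsum (tensor R' E' A) (\<lambda>i. up_ring.coeff (UP A) (char_poly R' E' D' A x) i \<odot>\<^bsub>tensor R' E' A\<^esub> (x [^]\<^bsub>tensor R' E' A\<^esub> i))
          {..deg A (char_poly R' E' D' A x)} = \<zero>\<^bsub>tensor R' E' A\<^esub>"
    if A: "algebra R' A" and x: "x \<in> carrier (tensor R' E' A)" for A :: "('s,'u) module" and x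
  proof -
    interpret pu: poly_univ R' A using inf A by (rule poly_univ.intro)
    interpret m: tensor_map R E "restr f A" R' E' A f g "\<lambda>b. b" by (rule tensor_map_id[OF A])
    let ?T = "tensor R E (restr f A)" and ?T' = "tensor R' E' A" and ?pi = "tmap R' E' A g (\<lambda>b. b)"
    interpret T: ring ?T by (rule m.S.T_ring)
    interpret T': ring ?T' by (rule m.T'.T_ring)
    obtain y where y: "y \<in> carrier ?T" "?pi y = x" using m.tmap_surj[OF surj _ x] by auto
    let ?c = "char_poly R E D (restr f A) y"
    have ce: "char_poly R' E' D' A x = ?c" using char_poly_transport[OF inf A lc y(1)] y(2) by simp
    have pr: "?pi \<in> ring_hom ?T ?T'" by (rule m.tmap_ring_hom[OF gr id_ring_hom])
    have pow: "?pi (y [^]\<^bsub>?T\<^esub> (i::nat)) = x [^]\<^bsub>?T'\<^esub> i" for i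
    proof (induct i)
      case 0
      then show ?case by (simp add: ring_hom_one[OF pr])
    next
      case (Suc i)
      then show ?case using y T.nat_pow_closed[OF y(1), of i] ring_hom_mult[OF pr, of "y [^]\<^bsub>?T\<^esub> i" y] by simp
    qed
    \<comment> \<open>The coefficients must be known to lie in A before the map may be moved through
      the sum and past them.\<close>
    have cc: "up_ring.coeff (UP A) ?c i \<in> carrier A" for i
    proof -
      let ?B = "poly_alg A :: ('s,'u) module"
      have alg: "algebra R (restr f ?B)" by (rule algebra_restr[OF pu.B_algebra f R])
      interpret m2: tensor_map R E "restr f A" R E "restr f ?B" "\<lambda>r. r" "\<lambda>e. e" "poly_const A"
      proof (rule tensor_mapI[OF m.S.tensor_alg_axioms tensor_alg.intro[OF E alg]])
        show "slin R (\<lambda>r. r) E E (\<lambda>e. e)" by (rule slinI[OF addhomI]) simp_all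
        show "slin R (\<lambda>r. r) (restr f A) (restr f ?B) (poly_const A)" using pu.const_slin fc
          by (simp add: slin_def addhom_def)
      qed simp
      have vc: "poly_var A \<in> carrier (restr f ?B)" using pu.var_closed by simp
      have "pure R E (restr f ?B) \<one>\<^bsub>E\<^esub> (poly_var A) \<ominus>\<^bsub>tensor R E (restr f ?B)\<^esub> tmap R E (restr f ?B) (\<lambda>e. e) (poly_const A) y \<in> carrier (tensor R E (restr f ?B))"
        by (rule m2.T'.T.minus_closed) (simp_all only: m2.T'.pure_closed E.one_closed vc m2.tmap_closed[OF y(1)])
      then have "?c \<in> carrier (UP A)" unfolding char_poly_def Let_def poly_alg_restr poly_code_restr
        using pu.decode_closed pseudorepD(3)[OF D alg] by simp
      then show ?thesis by (rule pu.P.coeff_closed)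
    qed
    have "finsum ?T (\<lambda>i. up_ring.coeff (UP A) ?c i \<odot>\<^bsub>?T\<^esub> (y [^]\<^bsub>?T\<^esub> i)) {..deg A ?c} = \<zero>\<^bsub>?T\<^esub>"
      using ch[unfolded cayley_hamilton_def, THEN conjunct2, THEN conjunct2, rule_format, OF algebra_restr[OF A f R] y(1)]
      by (simp only: UP_restr deg_restr)
    then have "?pi (finsum ?T (\<lambda>i. up_ring.coeff (UP A) ?c i \<odot>\<^bsub>?T\<^esub> (y [^]\<^bsub>?T\<^esub> i)) {..deg A ?c}) = \<zero>\<^bsub>?T'\<^esub>"
      using addhom_zero[OF m.tmap_addhom m.S.T_abelian_group m.T'.T_abelian_group] by simp
    moreover have "?pi (finsum ?T (\<lambda>i. up_ring.coeff (UP A) ?c i \<odot>\<^bsub>?T\<^esub> (y [^]\<^bsub>?T\<^esub> i)) {..deg A ?c}) =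
      finsum ?T' (\<lambda>i. ?pi (up_ring.coeff (UP A) ?c i \<odot>\<^bsub>?T\<^esub> (y [^]\<^bsub>?T\<^esub> i))) {..deg A ?c}"
      by (rule addhom_finsum[OF m.tmap_addhom m.S.T_abelian_group m.T'.T_abelian_group])
        (use cc y(1) m.S.T_smult_closed in \<open>simp add: Pi_iff\<close>)
    moreover have "?pi (up_ring.coeff (UP A) ?c i \<odot>\<^bsub>?T\<^esub> (y [^]\<^bsub>?T\<^esub> i)) = up_ring.coeff (UP A) ?c i \<odot>\<^bsub>?T'\<^esub> (x [^]\<^bsub>?T'\<^esub> i)" for i
      using m.tmap_smult[OF id_ring_hom, of "up_ring.coeff (UP A) ?c i" "y [^]\<^bsub>?T\<^esub> i"] cc T.nat_pow_closed[OF y(1)] pow by simp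
    ultimately show ?thesis unfolding ce by simp
  qed
  then show ?thesis unfolding cayley_hamilton_def using D' fg by blast
qed

end

text \<open>If \<open>x\<close> maps to \<open>0\<close>, then \<open>1 - x t\<close> maps to \<open>1\<close>, so its law has constant image.\<close>

lemma rev_char_poly_killed:
  fixes R :: "('u,'x) ring_scheme" and E :: "('u,'e) module" and A :: "('u,'y) ring_scheme" and E' :: "('u,'f) module"
  fixes D :: "('u,'e,'u) law" and D' :: "('u,'f,'u) law"
  assumes inf: "infinite (UNIV :: 'u set)" and sh: "semilinear_hom R E A E' f g"
    and D: "pseudorep R E d D" and D': "pseudorep A E' d D'" and lc: "law_compat R E D A E' D' f g"
    and x: "x \<in> carrier E" "g x = \<zero>\<^bsub>E'\<^esub>" and i: "i \<ge> 1"
  shows "f (up_ring.coeff (UP (self_alg R)) (rev_char_poly R E D x) i) = \<zero>\<^bsub>A\<^esub>"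
    "up_ring.coeff (UP (self_alg R)) (rev_char_poly R E D x) i \<in> carrier R"
proof -
  interpret semilinear_hom R E A E' f g by (rule sh)
  note R = R and A = R'
  interpret pR: poly_univ R "self_alg R" using inf self_alg_algebra[OF R] by (rule poly_univ.intro)
  interpret pA: poly_univ A "self_alg A" using inf self_alg_algebra[OF A] by (rule poly_univ.intro)
  have Rab: "abelian_group R" using R by (simp add: cring_def ring_def)
  let ?BR = "poly_alg (self_alg R) :: ('u,'u) module" and ?BA = "poly_alg (self_alg A) :: ('u,'u) module"
  have fcar: "r \<in> carrier R \<Longrightarrow> f r \<in> carrier A" for r by (rule fc)
  have fz: "f \<zero>\<^bsub>R\<^esub> = \<zero>\<^bsub>A\<^esub>"
    using addhom_zero[OF ring_hom_addhom[OF f] Rab R'.abelian_group_axioms] .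
  \<comment> \<open>The map R[t] -> A[t] induced on coefficients by f. A polynomial in
    \<open>UP\<close> is its coefficient function, so composition with f is the whole
    definition.\<close>
  define F where "F p = (\<lambda>n::nat. f (p n))" for p
  have cR: "p \<in> carrier (UP R) \<longleftrightarrow> (\<forall>n. p n \<in> carrier R) \<and> (\<exists>n. \<forall>m>n. p m = \<zero>\<^bsub>R\<^esub>)" for p
    using pR.UP_carrier[of p] by simp
  have cA: "p \<in> carrier (UP A) \<longleftrightarrow> (\<forall>n. p n \<in> carrier A) \<and> (\<exists>n. \<forall>m>n. p m = \<zero>\<^bsub>A\<^esub>)" for p
    using pA.UP_carrier[of p] by simp
  have Fc: "F p \<in> carrier (UP A)" if p: "p \<in> carrier (UP R)" for p
  proof -
    obtain n where "\<forall>m>n. p m = \<zero>\<^bsub>R\<^esub>" using p unfolding cR by blast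
    then have "\<forall>m>n. F p m = \<zero>\<^bsub>A\<^esub>" by (simp add: F_def fz)
    moreover have "F p k \<in> carrier A" for k using p unfolding cR F_def by (simp add: fcar)
    ultimately show ?thesis unfolding cA by blast
  qed
  have co: "up_ring.coeff (UP S) p n = p n" if "p \<in> carrier (UP S)" for S :: "('u,'z) ring_scheme" and p n
    using that by (simp add: UP_def)
  have Fadd: "F (p \<oplus>\<^bsub>UP R\<^esub> q) = F p \<oplus>\<^bsub>UP A\<^esub> F q" and Fmult: "F (p \<otimes>\<^bsub>UP R\<^esub> q) = F p \<otimes>\<^bsub>UP A\<^esub> F q"
    if p: "p \<in> carrier (UP R)" and q: "q \<in> carrier (UP R)" for p q
  proof -
    have pc: "p n \<in> carrier R" "q n \<in> carrier R" for n using p q unfolding cR by blast+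
    have u: "p \<in> up R" "q \<in> up R" "F p \<in> up A" "F q \<in> up A" using p q Fc[OF p] Fc[OF q] by (simp_all add: UP_def)
    show "F (p \<oplus>\<^bsub>UP R\<^esub> q) = F p \<oplus>\<^bsub>UP A\<^esub> F q"
      using u pc by (simp add: UP_def) (simp add: F_def ring_hom_add[OF f])
    show "F (p \<otimes>\<^bsub>UP R\<^esub> q) = F p \<otimes>\<^bsub>UP A\<^esub> F q"
    proof (rule ext)
      fix n
      have "F (p \<otimes>\<^bsub>UP R\<^esub> q) n = f (finsum R (\<lambda>i. p i \<otimes>\<^bsub>R\<^esub> q (n - i)) {..n})" using u by (simp add: UP_def F_def)
      also have "\<dots> = finsum A (\<lambda>i. f (p i \<otimes>\<^bsub>R\<^esub> q (n - i))) {..n}"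
        by (rule addhom_finsum[OF ring_hom_addhom[OF f] Rab R'.abelian_group_axioms]) (use pc in simp)
      also have "\<dots> = finsum A (\<lambda>i. F p i \<otimes>\<^bsub>A\<^esub> F q (n - i)) {..n}" using pc by (simp add: F_def ring_hom_mult[OF f])
      also have "\<dots> = (F p \<otimes>\<^bsub>UP A\<^esub> F q) n" using u by (simp add: UP_def)
      finally show "F (p \<otimes>\<^bsub>UP R\<^esub> q) n = (F p \<otimes>\<^bsub>UP A\<^esub> F q) n" .
    qed
  qed
  have Fone: "F \<one>\<^bsub>UP R\<^esub> = \<one>\<^bsub>UP A\<^esub>" by (simp add: UP_def F_def fz ring_hom_one[OF f] fun_eq_iff)
  have Fsm: "F (r \<odot>\<^bsub>UP R\<^esub> p) = f r \<odot>\<^bsub>UP A\<^esub> F p" if r: "r \<in> carrier R" and p: "p \<in> carrier (UP R)" for r p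
  proof -
    have pc: "p n \<in> carrier R" for n using p unfolding cR by blast
    have u: "p \<in> up R" "F p \<in> up A" using p Fc[OF p] by (simp_all add: UP_def)
    show ?thesis using u pc r fcar[OF r] by (simp add: UP_def) (simp add: F_def ring_hom_mult[OF f])
  qed
  \<comment> \<open>The same map between the coded copies. It is linear over R when A[t] is
    restricted along f, so D is natural along it.\<close>
  define h :: "'u \<Rightarrow> 'u" where "h b = poly_code (self_alg A) (F (poly_decode (self_alg R) b))" for b :: 'u
  have hcode: "h (poly_code (self_alg R) p) = poly_code (self_alg A) (F p)" if "p \<in> carrier (UP R)" for p
    using pR.decode_code[of p] that by (simp add: h_def)
  have Bel: "\<exists>p\<in>carrier (UP R). b = poly_code (self_alg R) p" if "b \<in> carrier ?BR" for b using pR.B_elem[OF that] by simp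
  note opsR = pR.code_ops[simplified] and opsA = pA.code_ops[simplified]
  interpret UR: UP_cring R "UP R" by (intro UP_cring.intro R)
  have h: "h \<in> alg_hom R ?BR (restr f ?BA)"
    unfolding alg_hom_def
  proof (intro CollectI conjI ring_hom_memI ballI)
    fix a assume "a \<in> carrier ?BR"
    then obtain p where p: "p \<in> carrier (UP R)" "a = poly_code (self_alg R) p" using Bel by blast
    show "h a \<in> carrier (restr f ?BA)" using p Fc pA.code_closed[of "F p"] by (simp add: hcode)
    show "h (r \<odot>\<^bsub>?BR\<^esub> a) = r \<odot>\<^bsub>restr f ?BA\<^esub> h a" if r: "r \<in> carrier R" for r
    proof -
      have s1: "str_map (self_alg R) r = r" using r by (simp add: str_map_def)
      have s2: "str_map (self_alg A) (f r) = f r" using fcar[OF r] by (simp add: str_map_def)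
      have "r \<odot>\<^bsub>?BR\<^esub> a = poly_code (self_alg R) (r \<odot>\<^bsub>UP R\<^esub> p)" using opsR(5)[OF p(1), of r] p(2) s1 by simp
      then have "h (r \<odot>\<^bsub>?BR\<^esub> a) = poly_code (self_alg A) (f r \<odot>\<^bsub>UP A\<^esub> F p)" using p r by (simp add: hcode Fsm)
      also have "\<dots> = f r \<odot>\<^bsub>?BA\<^esub> h a" using opsA(5)[OF Fc[OF p(1)], of "f r"] s2 p by (simp add: hcode)
      finally show ?thesis by simp
    qed
    fix b assume "b \<in> carrier ?BR"
    then obtain q where q: "q \<in> carrier (UP R)" "b = poly_code (self_alg R) q" using Bel by blast
    show "h (a \<otimes>\<^bsub>?BR\<^esub> b) = h a \<otimes>\<^bsub>restr f ?BA\<^esub> h b"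
      using p q by (simp add: opsR(2)[symmetric] hcode Fmult opsA(2) Fc)
    show "h (a \<oplus>\<^bsub>?BR\<^esub> b) = h a \<oplus>\<^bsub>restr f ?BA\<^esub> h b"
      using p q by (simp add: opsR(1)[symmetric] hcode Fadd opsA(1) Fc)
  next
    show "h \<one>\<^bsub>?BR\<^esub> = \<one>\<^bsub>restr f ?BA\<^esub>"
      using hcode[OF UR.UP_one_closed] by (simp add: opsR(4) opsA(4) Fone)
  qed
  let ?vR = "poly_var (self_alg R) :: 'u" and ?vA = "poly_var (self_alg A) :: 'u"
  have hv: "h ?vR = ?vA"
  proof -
    have "F (up_ring.monom (UP R) \<one>\<^bsub>R\<^esub> 1) = up_ring.monom (UP A) \<one>\<^bsub>A\<^esub> 1"
      by (simp add: UP_def F_def fun_eq_iff fz ring_hom_one[OF f])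
    then show ?thesis using hcode[of "up_ring.monom (UP R) \<one>\<^bsub>R\<^esub> 1"] by (simp add: poly_var_def)
  qed
  note aR = pR.B_algebra and aA = pA.B_algebra
  have aA': "algebra R (restr f ?BA)" by (rule algebra_restr[OF aA f R])
  interpret m: tensor_map R E "restr f ?BA" A E' ?BA f g "\<lambda>b. b" by (rule tensor_map_id[OF aA])
  interpret n: tensor_map R E ?BR R E "restr f ?BA" "\<lambda>r. r" "\<lambda>e. e" h
  proof (rule tensor_mapI[OF tensor_alg.intro[OF E aR] m.S.tensor_alg_axioms])
    show "slin R (\<lambda>r. r) E E (\<lambda>e. e)" by (rule slinI[OF addhomI]) simp_all
    show "slin R (\<lambda>r. r) ?BR (restr f ?BA) h" using h by (auto simp: alg_hom_def slin_def ring_hom_addhom)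
  qed simp
  have hr: "h \<in> ring_hom ?BR (restr f ?BA)" using h by (simp add: alg_hom_def)
  have idr: "(\<lambda>e. e) \<in> ring_hom E E" by (simp add: ring_hom_def)
  let ?TR = "tensor R E ?BR" and ?TA = "tensor R E (restr f ?BA)" and ?T' = "tensor A E' ?BA"
  interpret TR: ring ?TR by (rule n.S.T_ring)
  interpret TA: ring ?TA by (rule m.S.T_ring)
  interpret T': ring ?T' by (rule m.T'.T_ring)
  let ?w = "\<one>\<^bsub>?TR\<^esub> \<ominus>\<^bsub>?TR\<^esub> pure R E ?BR x ?vR" and ?u = "\<one>\<^bsub>?TA\<^esub> \<ominus>\<^bsub>?TA\<^esub> pure R E (restr f ?BA) x ?vA"
  have vA: "?vA \<in> carrier (restr f ?BA)" using pA.var_closed by simp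
  have pRc: "pure R E ?BR x ?vR \<in> carrier ?TR" by (rule n.S.pure_closed[OF x(1) pR.var_closed])
  have pAc: "pure R E (restr f ?BA) x ?vA \<in> carrier ?TA" by (rule m.S.pure_closed[OF x(1) vA])
  have wc: "?w \<in> carrier ?TR" by (rule n.S.T.minus_closed[OF TR.one_closed pRc])
  have uc: "?u \<in> carrier ?TA" by (rule m.S.T.minus_closed[OF TA.one_closed pAc])
  have nw: "tmap R E (restr f ?BA) (\<lambda>e. e) h ?w = ?u"
    using addhom_minus[OF n.tmap_addhom n.S.T_abelian_group m.S.T_abelian_group TR.one_closed pRc]
      ring_hom_one[OF n.tmap_ring_hom[OF idr hr]] n.tmap_pure[OF x(1) pR.var_closed] hv by simp
  have mz: "tmap A E' ?BA g (\<lambda>b. b) (pure R E (restr f ?BA) x ?vA) = \<zero>\<^bsub>?T'\<^esub>"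
    using m.tmap_pure[OF x(1) vA] m.T'.pure_zero_left[OF pA.var_closed] x(2) by simp
  have "tmap A E' ?BA g (\<lambda>b. b) ?u = \<one>\<^bsub>?T'\<^esub> \<ominus>\<^bsub>?T'\<^esub> \<zero>\<^bsub>?T'\<^esub>"
    using addhom_minus[OF m.tmap_addhom m.S.T_abelian_group m.T'.T_abelian_group TA.one_closed pAc]
      ring_hom_one[OF m.tmap_ring_hom[OF gr id_ring_hom]] mz by simp
  then have mu: "tmap A E' ?BA g (\<lambda>b. b) ?u = \<one>\<^bsub>?T'\<^esub>" by (simp add: m.T'.T.minus_eq)
  \<comment> \<open>Naturality along h moves 1 - x t from R[t] to A[t], compatibility passes to D',
    and the law of the unit element is 1.\<close>
  have "h (D ?BR ?w) = D (restr f ?BA) ?u" using pseudorepD(5)[OF D aR aA' h wc] nw by simp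
  also have "\<dots> = D' ?BA (tmap A E' ?BA g (\<lambda>b. b) ?u)" using lc aA uc unfolding law_compat_def by blast
  also have "\<dots> = \<one>\<^bsub>?BA\<^esub>" using mu pseudorepD(4)[OF D' aA] by simp
  finally have e: "h (D ?BR ?w) = \<one>\<^bsub>?BA\<^esub>" .
  have Dc: "D ?BR ?w \<in> carrier ?BR" by (rule pseudorepD(3)[OF D aR wc])
  have rc: "rev_char_poly R E D x = poly_decode (self_alg R) (D ?BR ?w)" by (simp add: rev_char_poly_def Let_def)
  have rU: "rev_char_poly R E D x \<in> carrier (UP R)" unfolding rc using pR.decode_closed[OF Dc] by simp
  have "pA.code (F (rev_char_poly R E D x)) = pA.code \<one>\<^bsub>UP A\<^esub>"
    using e opsA(4) unfolding h_def rc by simp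
  then have "F (rev_char_poly R E D x) = \<one>\<^bsub>UP A\<^esub>"
    using pA.code_inj Fc[OF rU] pA.P.UP_one_closed unfolding inj_on_def by (metis UP_self_alg)
  then have "F (rev_char_poly R E D x) i = \<zero>\<^bsub>A\<^esub>" using i by (simp add: UP_def)
  moreover have ci: "up_ring.coeff (UP (self_alg R)) (rev_char_poly R E D x) i = rev_char_poly R E D x i" using co[OF rU] by simp
  ultimately show "f (up_ring.coeff (UP (self_alg R)) (rev_char_poly R E D x) i) = \<zero>\<^bsub>A\<^esub>" by (simp add: F_def)
  show "up_ring.coeff (UP (self_alg R)) (rev_char_poly R E D x) i \<in> carrier R" unfolding ci using rU unfolding cR by blast
qed

section \<open>Morphisms of Cayley--Hamilton representations\<close>

lemma ring_hom_cong:
  assumes "h \<in> ring_hom M N" "ring M" "\<And>x. x \<in> carrier M \<Longrightarrow> h' x = h x"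
  shows "h' \<in> ring_hom M N"
proof -
  interpret M: ring M by fact
  show ?thesis
    by (rule ring_hom_memI) (simp_all add: assms(3) ring_hom_closed[OF assms(1)] ring_hom_mult[OF assms(1)]
      ring_hom_add[OF assms(1)] ring_hom_one[OF assms(1)])
qed

lemma slin_cong:
  assumes "slin R f M N h" "Module.module R M" "\<And>r. r \<in> carrier R \<Longrightarrow> f' r = f r" "\<And>x. x \<in> carrier M \<Longrightarrow> h' x = h x"
  shows "slin R f' M N h'"
proof -
  interpret M: Module.module R M by fact
  show ?thesis
    by (rule slinI[OF addhomI]) (simp_all add: assms(3,4) addhom_closed[OF slin_addhom[OF assms(1)]]
      addhom_add[OF slin_addhom[OF assms(1)]] slin_smult[OF assms(1)])
qed

lemma semilinear_homI: "base_change R E R' E' f \<Longrightarrow> g \<in> ring_hom E E' \<Longrightarrow> slin R f E E' g \<Longrightarrow> semilinear_hom R E R' E' f g"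
  by (simp add: semilinear_hom_def semilinear_hom_axioms_def)

text \<open>Maps f and f' that agree on R may still differ elsewhere, and then
  \<open>restr f B\<close> and \<open>restr f' B\<close> are different arguments of the law. The
  identity is an algebra homomorphism between them, so naturality of D equates the two
  values.\<close>

lemma law_compat_cong:
  fixes D :: "('r,'e,'u) law" and D' :: "('s,'f,'u) law"
  assumes D: "pseudorep R E d D" and sh: "semilinear_hom R E R' E' f g" and sh': "semilinear_hom R E R' E' f' g'"
    and ff: "\<And>r. r \<in> carrier R \<Longrightarrow> f' r = f r" and gg: "\<And>x. x \<in> carrier E \<Longrightarrow> g' x = g x"
    and lc: "law_compat R E D R' E' D' f g"
  shows "law_compat R E D R' E' D' f' g'"
  unfolding law_compat_def
proof (intro allI impI ballI)
  interpret h: semilinear_hom R E R' E' f g by (rule sh)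
  interpret h': semilinear_hom R E R' E' f' g' by (rule sh')
  fix B :: "('s,'u) module" and x assume B: "algebra R' B" and x: "x \<in> carrier (tensor R E (restr f' B))"
  note a = algebra_restr[OF B h.f h.R] and a' = algebra_restr[OF B h'.f h.R]
  interpret m: tensor_map R E "restr f B" R' E' B f g "\<lambda>b. b" by (rule h.tensor_map_id[OF B])
  interpret m': tensor_map R E "restr f' B" R' E' B f' g' "\<lambda>b. b" by (rule h'.tensor_map_id[OF B])
  have idE: "slin R (\<lambda>r. r) E E (\<lambda>e. e)" by (rule slinI[OF addhomI]) simp_all
  have i1: "slin R (\<lambda>r. r) (restr f B) (restr f' B) (\<lambda>b. b)" and i2: "slin R (\<lambda>r. r) (restr f' B) (restr f B) (\<lambda>b. b)"
    by (rule slinI[OF addhomI]; simp add: ff)+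
  interpret n: tensor_map R E "restr f B" R E "restr f' B" "\<lambda>r. r" "\<lambda>e. e" "\<lambda>b. b"
    by (rule tensor_mapI[OF m.S.tensor_alg_axioms m'.S.tensor_alg_axioms _ idE i1]) simp
  interpret n': tensor_map R E "restr f' B" R E "restr f B" "\<lambda>r. r" "\<lambda>e. e" "\<lambda>b. b"
    by (rule tensor_mapI[OF m'.S.tensor_alg_axioms m.S.tensor_alg_axioms _ idE i2]) simp
  let ?y = "tmap R E (restr f B) (\<lambda>e. e) (\<lambda>b. b) x"
  have y: "?y \<in> carrier (tensor R E (restr f B))" by (rule n'.tmap_closed[OF x])
  \<comment> \<open>The agreement of the two maps on R is precisely what makes the identity linear
    over R here.\<close>
  have ah: "(\<lambda>b. b) \<in> alg_hom R (restr f B) (restr f' B)" by (simp add: alg_hom_def ring_hom_def ff)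
  have "tmap R E (restr f' B) (\<lambda>e. e) (\<lambda>b. b) ?y = x"
    by (rule m'.S.tensor_ext[OF addhom_comp[OF n'.tmap_addhom n.tmap_addhom] m'.S.addhom_id m'.S.T_abelian_group x])
      (simp add: n.tmap_pure n'.tmap_pure)
  then have "D (restr f' B) x = D (restr f B) ?y" using pseudorepD(5)[OF D a a' ah y] by simp
  also have "\<dots> = D' B (tmap R' E' B g (\<lambda>b. b) ?y)" using lc B y unfolding law_compat_def by blast
  also have "tmap R' E' B g (\<lambda>b. b) ?y = tmap R' E' B g' (\<lambda>b. b) x"
    by (rule m'.S.tensor_ext[OF addhom_comp[OF n'.tmap_addhom m.tmap_addhom] m'.tmap_addhom m.T'.T_abelian_group x])
      (simp add: m.tmap_pure m'.tmap_pure n'.tmap_pure gg)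
  finally show "D (restr f' B) x = D' B (tmap R' E' B g' (\<lambda>b. b) x)" .
qed

lemma law_compat_comp:
  fixes D :: "('r,'e,'u) law" and D' :: "('s,'f,'u) law" and D'' :: "('t,'h,'u) law"
  assumes q: "semilinear_hom R E R' E' q u" and f: "semilinear_hom R' E' R'' E'' f g"
    and lq: "law_compat R E D R' E' D' q u" and lf: "law_compat R' E' D' R'' E'' D'' f g"
  shows "law_compat R E D R'' E'' D'' (\<lambda>x. f (q x)) (\<lambda>x. g (u x))"
  unfolding law_compat_def
proof (intro allI impI ballI)
  interpret q: semilinear_hom R E R' E' q u by (rule q)
  interpret f: semilinear_hom R' E' R'' E'' f g by (rule f)
  fix B :: "('t,'u) module" and x assume B: "algebra R'' B" and x: "x \<in> carrier (tensor R E (restr (\<lambda>x. f (q x)) B))"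
  have a: "algebra R' (restr f B)" by (rule algebra_restr[OF B f.f f.R])
  have r: "restr (\<lambda>x. f (q x)) B = restr q (restr f B)" by (simp add: restr_restr)
  interpret mq: tensor_map R E "restr q (restr f B)" R' E' "restr f B" q u "\<lambda>b. b" by (rule q.tensor_map_id[OF a])
  interpret mf: tensor_map R' E' "restr f B" R'' E'' B f g "\<lambda>b. b" by (rule f.tensor_map_id[OF B])
  have x': "x \<in> carrier (tensor R E (restr q (restr f B)))" using x unfolding r .
  have slc: "slin R (\<lambda>x. f (q x)) E E'' (\<lambda>x. g (u x))"
    by (rule slinI[OF addhom_comp[OF slin_addhom[OF q.gs] slin_addhom[OF f.gs]]])
      (simp add: slin_smult[OF q.gs] slin_smult[OF f.gs] q.fc addhom_closed[OF slin_addhom[OF q.gs]])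
  interpret mc: tensor_map R E "restr (\<lambda>x. f (q x)) B" R'' E'' B "\<lambda>x. f (q x)" "\<lambda>x. g (u x)" "\<lambda>b. b"
    unfolding r by (rule tensor_mapI[OF mq.S.tensor_alg_axioms mf.T'.tensor_alg_axioms _ slc]) (auto simp: q.fc f.fc slin_def addhom_def)
  have "D (restr q (restr f B)) x = D' (restr f B) (tmap R' E' (restr f B) u (\<lambda>b. b) x)"
    using lq a x' unfolding law_compat_def by blast
  also have "\<dots> = D'' B (tmap R'' E'' B g (\<lambda>b. b) (tmap R' E' (restr f B) u (\<lambda>b. b) x))"
    using lf B mq.tmap_closed[OF x'] unfolding law_compat_def by blast
  also have "tmap R'' E'' B g (\<lambda>b. b) (tmap R' E' (restr f B) u (\<lambda>b. b) x) = tmap R'' E'' B (\<lambda>x. g (u x)) (\<lambda>b. b) x"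
    by (rule mq.S.tensor_ext[OF addhom_comp[OF mq.tmap_addhom mf.tmap_addhom] mc.tmap_addhom[unfolded r] mf.T'.T_abelian_group x'])
      (use mq.tmap_pure mf.tmap_pure mc.tmap_pure addhom_closed[OF slin_addhom[OF q.gs]] in \<open>simp add: r\<close>)
  finally show "D (restr (\<lambda>x. f (q x)) B) x = D'' B (tmap R'' E'' B (\<lambda>x. g (u x)) (\<lambda>b. b) x)" unfolding r .
qed

text \<open>Since u is surjective, elements of E' (x) B lift to E (x) B, where both values are
  computed by D. This produces the descended morphism out of a quotient.\<close>

lemma law_compat_factor:
  fixes D :: "('r,'e,'u) law" and D' :: "('s,'f,'u) law" and D'' :: "('t,'h,'u) law"
  assumes q: "semilinear_hom R E R' E' q u" and f: "semilinear_hom R' E' R'' E'' f g"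
    and lq: "law_compat R E D R' E' D' q u" and lc: "law_compat R E D R'' E'' D'' (\<lambda>x. f (q x)) (\<lambda>x. g (u x))"
    and surj: "u ` carrier E = carrier E'"
  shows "law_compat R' E' D' R'' E'' D'' f g"
  unfolding law_compat_def
proof (intro allI impI ballI)
  interpret q: semilinear_hom R E R' E' q u by (rule q)
  interpret f: semilinear_hom R' E' R'' E'' f g by (rule f)
  fix B :: "('t,'u) module" and y assume B: "algebra R'' B" and y: "y \<in> carrier (tensor R' E' (restr f B))"
  have a: "algebra R' (restr f B)" by (rule algebra_restr[OF B f.f f.R])
  have r: "restr (\<lambda>x. f (q x)) B = restr q (restr f B)" by (simp add: restr_restr)
  interpret mq: tensor_map R E "restr q (restr f B)" R' E' "restr f B" q u "\<lambda>b. b" by (rule q.tensor_map_id[OF a])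
  interpret mf: tensor_map R' E' "restr f B" R'' E'' B f g "\<lambda>b. b" by (rule f.tensor_map_id[OF B])
  have slc: "slin R (\<lambda>x. f (q x)) E E'' (\<lambda>x. g (u x))"
    by (rule slinI[OF addhom_comp[OF slin_addhom[OF q.gs] slin_addhom[OF f.gs]]])
      (simp add: slin_smult[OF q.gs] slin_smult[OF f.gs] q.fc addhom_closed[OF slin_addhom[OF q.gs]])
  interpret mc: tensor_map R E "restr (\<lambda>x. f (q x)) B" R'' E'' B "\<lambda>x. f (q x)" "\<lambda>x. g (u x)" "\<lambda>b. b"
    unfolding r by (rule tensor_mapI[OF mq.S.tensor_alg_axioms mf.T'.tensor_alg_axioms _ slc]) (auto simp: q.fc f.fc slin_def addhom_def)
  obtain x where x: "x \<in> carrier (tensor R E (restr q (restr f B)))" "tmap R' E' (restr f B) u (\<lambda>b. b) x = y"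
    using mq.tmap_surj[OF surj _ y] by auto
  have "D' (restr f B) y = D (restr q (restr f B)) x"
    using lq a x unfolding law_compat_def by metis
  also have "\<dots> = D'' B (tmap R'' E'' B (\<lambda>x. g (u x)) (\<lambda>b. b) x)"
    using lc[unfolded law_compat_def, rule_format, OF B, of x, unfolded r] x(1) by simp
  also have "tmap R'' E'' B (\<lambda>x. g (u x)) (\<lambda>b. b) x = tmap R'' E'' B g (\<lambda>b. b) (tmap R' E' (restr f B) u (\<lambda>b. b) x)"
    by (rule mq.S.tensor_ext[OF mc.tmap_addhom[unfolded r] addhom_comp[OF mq.tmap_addhom mf.tmap_addhom] mf.T'.T_abelian_group x(1)])
      (use mq.tmap_pure mf.tmap_pure mc.tmap_pure addhom_closed[OF slin_addhom[OF q.gs]] in \<open>simp add: r\<close>)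
  finally show "D' (restr f B) y = D'' B (tmap R'' E'' B g (\<lambda>b. b) y)" using x(2) by simp
qed

text \<open>The second component of a morphism is recovered as the restricted linear extension of
  its values on x (x) 1. Uniqueness of morphisms thus becomes uniqueness of the ring map and the
  semilinear map.\<close>

lemma CH_homD:
  fixes D :: "('r,'e,'u) law" and D' :: "('s,'f,'u) law"
  assumes E: "assoc_algebra R E" and E': "assoc_algebra A E'" and h: "(f, g) \<in> CH_hom G R E \<rho> D A E' \<rho>' D'"
  defines "g1 \<equiv> \<lambda>x. g (pure R E (restr f (self_alg A)) x \<one>\<^bsub>A\<^esub>)"
  shows "f \<in> extensional (carrier R)" "semilinear_hom R E A E' f g1" "law_compat R E D A E' D' f g1"
    "\<And>s. s \<in> carrier G \<Longrightarrow> g1 (\<rho> s) = \<rho>' s" "g = restrict (lin_ext E' g1) (carrier (bc_alg R E f A))"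
proof -
  have h': "f \<in> extensional (carrier R)" "g \<in> extensional (carrier (bc_alg R E f A))" "pseudo_morphism R E D A E' D' f g"
    "\<And>s. s \<in> carrier G \<Longrightarrow> g1 (\<rho> s) = \<rho>' s" using h by (auto simp: CH_hom_def g1_def)
  show "f \<in> extensional (carrier R)" "\<And>s. s \<in> carrier G \<Longrightarrow> g1 (\<rho> s) = \<rho>' s" using h' by simp_all
  interpret base_change R E A E' f using E E' h'(3) by (simp add: base_change_def pseudo_morphism_def)
  note pD = pseudo_morphismD[OF h'(3), folded g1_def]
  show "semilinear_hom R E A E' f g1" by (rule semilinear_homI[OF base_change_axioms pD(1,2)])
  show "law_compat R E D A E' D' f g1" by (rule pD(3))
  show "g = restrict (lin_ext E' g1) (carrier (bc_alg R E f A))"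
    by (rule extensionalityI[OF h'(2)]) (use pD(4) in simp_all)
qed

lemma CH_homI:
  fixes D :: "('r,'e,'u) law" and D' :: "('s,'f,'u) law"
  assumes sh: "semilinear_hom R E A E' f g1" and fe: "f \<in> extensional (carrier R)"
    and lc: "law_compat R E D A E' D' f g1" and s: "\<And>s. s \<in> carrier G \<Longrightarrow> \<rho> s \<in> carrier E \<and> g1 (\<rho> s) = \<rho>' s"
  shows "(f, restrict (lin_ext E' g1) (carrier (bc_alg R E f A))) \<in> CH_hom G R E \<rho> D A E' \<rho>' D'"
proof -
  interpret semilinear_hom R E A E' f g1 by (rule sh)
  have "restrict (lin_ext E' g1) (carrier (bc_alg R E f A)) (pure R E (restr f (self_alg A)) (\<rho> t) \<one>\<^bsub>A\<^esub>) = \<rho>' t"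
    if t: "t \<in> carrier G" for t
  proof -
    have c: "\<rho> t \<in> carrier E" "g1 (\<rho> t) = \<rho>' t" using s[OF t] by auto
    have "pure R E (restr f (self_alg A)) (\<rho> t) \<one>\<^bsub>A\<^esub> \<in> carrier (bc_alg R E f A)"
      using S.pure_closed[OF c(1), of "\<one>\<^bsub>A\<^esub>", folded bc_eq] by simp
    moreover have "\<one>\<^bsub>A\<^esub> \<odot>\<^bsub>E'\<^esub> g1 (\<rho> t) = g1 (\<rho> t)" using ring_hom_closed[OF gr c(1)] by simp
    ultimately show ?thesis using lin_ext_pure[OF gs c(1) R'.one_closed] c(2) by simp
  qed
  moreover have "pseudo_morphism R E D A E' D' f (restrict (lin_ext E' g1) (carrier (bc_alg R E f A)))"
    by (rule pseudo_morphismI[OF gr gs lc]) simp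
  ultimately show ?thesis using fe by (simp add: CH_hom_def)
qed

lemma lin_ext_cong:
  assumes sh: "semilinear_hom R E A E' f g" and sh': "semilinear_hom R E A E' f g'"
    and gg: "\<And>x. x \<in> carrier E \<Longrightarrow> g x = g' x" and X: "X \<in> carrier (bc_alg R E f A)"
  shows "lin_ext E' g X = lin_ext E' g' X"
proof -
  interpret h: semilinear_hom R E A E' f g by (rule sh)
  interpret h': semilinear_hom R E A E' f g' by (rule sh')
  show ?thesis
    by (rule h.bc_ext[OF h.lin_ext_addhom[OF h.gs] h.lin_ext_addhom[OF h'.gs] h.E'_ab X])
      (simp add: h.lin_ext_pure[OF h.gs] h.lin_ext_pure[OF h'.gs] gg)
qed

section \<open>Group algebras\<close>

lemma group_alg_simps:
  "\<phi> \<in> carrier (group_alg G A) \<longleftrightarrow> (\<forall>s. \<phi> s \<in> carrier A) \<and> finite {s. \<phi> s \<noteq> \<zero>\<^bsub>A\<^esub>} \<and> {s. \<phi> s \<noteq> \<zero>\<^bsub>A\<^esub>} \<subseteq> carrier G"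
  "\<phi> \<oplus>\<^bsub>group_alg G A\<^esub> \<psi> = (\<lambda>s. \<phi> s \<oplus>\<^bsub>A\<^esub> \<psi> s)" "a \<odot>\<^bsub>group_alg G A\<^esub> \<phi> = (\<lambda>s. a \<otimes>\<^bsub>A\<^esub> \<phi> s)" "\<zero>\<^bsub>group_alg G A\<^esub> = (\<lambda>s. \<zero>\<^bsub>A\<^esub>)"
  "\<one>\<^bsub>group_alg G A\<^esub> = (\<lambda>s. if s = \<one>\<^bsub>G\<^esub> then \<one>\<^bsub>A\<^esub> else \<zero>\<^bsub>A\<^esub>)"
  "\<phi> \<otimes>\<^bsub>group_alg G A\<^esub> \<psi> = (\<lambda>s. if s \<in> carrier G
        then finsum A (\<lambda>h. \<phi> h \<otimes>\<^bsub>A\<^esub> \<psi> (inv\<^bsub>G\<^esub> h \<otimes>\<^bsub>G\<^esub> s)) {h. \<phi> h \<noteq> \<zero>\<^bsub>A\<^esub>} else \<zero>\<^bsub>A\<^esub>)"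
  by (simp_all add: group_alg_def)

lemma group_alg_restr: "group_alg G (restr f A) = group_alg G A"
  by (simp add: group_alg_def finsum_restr cong: if_cong)

lemma group_alg_ext_slin:
  assumes R: "cring R" and E: "Module.module R E" and r: "\<And>s. s \<in> carrier G \<Longrightarrow> \<rho> s \<in> carrier E"
  shows "slin R (\<lambda>r. r) (group_alg G R) E (group_alg_ext R E \<rho>)"
proof -
  interpret R: cring R by fact
  interpret E: Module.module R E by fact
  \<comment> \<open>Supports may shrink under sums and scalar multiples, so the sum is first allowed
    to run over any finite subset of G containing the support.\<close>
  have sup: "group_alg_ext R E \<rho> \<phi> = finsum E (\<lambda>s. \<phi> s \<odot>\<^bsub>E\<^esub> \<rho> s) S"
    if p: "\<phi> \<in> carrier (group_alg G R)" and S: "finite S" "{s. \<phi> s \<noteq> \<zero>\<^bsub>R\<^esub>} \<subseteq> S" "S \<subseteq> carrier G" for \<phi> S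
    unfolding group_alg_ext_def
    by (rule E.add.finprod_mono_neutral_cong_left[OF S(1,2)]) (use p S r in \<open>auto simp: group_alg_simps\<close>)
  have fc: "(\<lambda>s. \<phi> s \<odot>\<^bsub>E\<^esub> \<rho> s) \<in> S \<rightarrow> carrier E" if "\<phi> \<in> carrier (group_alg G R)" "S \<subseteq> carrier G" for \<phi> S
    using that r by (auto simp: group_alg_simps)
  show ?thesis
  proof (rule slinI[OF addhomI])
    fix \<phi> assume p: "\<phi> \<in> carrier (group_alg G R)"
    let ?S = "{s. \<phi> s \<noteq> \<zero>\<^bsub>R\<^esub>}"
    have S: "finite ?S" "?S \<subseteq> carrier G" using p by (auto simp: group_alg_simps)
    show "group_alg_ext R E \<rho> \<phi> \<in> carrier E" unfolding group_alg_ext_def by (rule E.finsum_closed[OF fc[OF p S(2)]])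
    show "group_alg_ext R E \<rho> (a \<odot>\<^bsub>group_alg G R\<^esub> \<phi>) = a \<odot>\<^bsub>E\<^esub> group_alg_ext R E \<rho> \<phi>" if a: "a \<in> carrier R" for a
    proof -
      have sub: "{s. (a \<odot>\<^bsub>group_alg G R\<^esub> \<phi>) s \<noteq> \<zero>\<^bsub>R\<^esub>} \<subseteq> ?S" using a by (auto simp: group_alg_simps)
      have ap: "a \<odot>\<^bsub>group_alg G R\<^esub> \<phi> \<in> carrier (group_alg G R)"
        using p a finite_subset[OF sub S(1)] S(2) sub unfolding group_alg_simps(1) by (auto simp: group_alg_simps(3))
      have "group_alg_ext R E \<rho> (a \<odot>\<^bsub>group_alg G R\<^esub> \<phi>) = finsum E (\<lambda>s. (a \<odot>\<^bsub>group_alg G R\<^esub> \<phi>) s \<odot>\<^bsub>E\<^esub> \<rho> s) ?S"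
        by (rule sup[OF ap S(1) sub S(2)])
      also have "\<dots> = finsum E (\<lambda>s. a \<odot>\<^bsub>E\<^esub> (\<phi> s \<odot>\<^bsub>E\<^esub> \<rho> s)) ?S"
        by (rule E.finsum_cong') (use p a r S in \<open>auto simp: group_alg_simps E.smult_assoc1\<close>)
      also have "\<dots> = a \<odot>\<^bsub>E\<^esub> finsum E (\<lambda>s. \<phi> s \<odot>\<^bsub>E\<^esub> \<rho> s) ?S"
        using E.finsum_smult_ldistr[OF S(1) a, of "\<lambda>s. \<phi> s \<odot>\<^bsub>E\<^esub> \<rho> s"] fc[OF p S(2)] by simp
      finally show ?thesis by (simp add: group_alg_ext_def)
    qed
    fix \<psi> assume q: "\<psi> \<in> carrier (group_alg G R)"
    let ?S' = "?S \<union> {s. \<psi> s \<noteq> \<zero>\<^bsub>R\<^esub>}"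
    have S': "finite ?S'" "?S' \<subseteq> carrier G" using p q by (auto simp: group_alg_simps)
    have sub: "{s. (\<phi> \<oplus>\<^bsub>group_alg G R\<^esub> \<psi>) s \<noteq> \<zero>\<^bsub>R\<^esub>} \<subseteq> ?S'" by (auto simp: group_alg_simps)
    have pq: "\<phi> \<oplus>\<^bsub>group_alg G R\<^esub> \<psi> \<in> carrier (group_alg G R)"
      using p q finite_subset[OF sub S'(1)] S'(2) sub unfolding group_alg_simps(1) by (auto simp: group_alg_simps(2))
    have "group_alg_ext R E \<rho> (\<phi> \<oplus>\<^bsub>group_alg G R\<^esub> \<psi>) = finsum E (\<lambda>s. (\<phi> \<oplus>\<^bsub>group_alg G R\<^esub> \<psi>) s \<odot>\<^bsub>E\<^esub> \<rho> s) ?S'"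
      by (rule sup[OF pq S'(1) sub S'(2)])
    also have "\<dots> = finsum E (\<lambda>s. \<phi> s \<odot>\<^bsub>E\<^esub> \<rho> s \<oplus>\<^bsub>E\<^esub> \<psi> s \<odot>\<^bsub>E\<^esub> \<rho> s) ?S'"
      by (rule E.finsum_cong') (use p q r S' in \<open>auto simp: group_alg_simps E.smult_l_distr\<close>)
    also have "\<dots> = finsum E (\<lambda>s. \<phi> s \<odot>\<^bsub>E\<^esub> \<rho> s) ?S' \<oplus>\<^bsub>E\<^esub> finsum E (\<lambda>s. \<psi> s \<odot>\<^bsub>E\<^esub> \<rho> s) ?S'"
      by (rule E.finsum_addf[OF fc[OF p S'(2)] fc[OF q S'(2)]])
    finally show "group_alg_ext R E \<rho> (\<phi> \<oplus>\<^bsub>group_alg G R\<^esub> \<psi>) = group_alg_ext R E \<rho> \<phi> \<oplus>\<^bsub>E\<^esub> group_alg_ext R E \<rho> \<psi>"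
      using sup[OF p S'(1) _ S'(2)] sup[OF q S'(1) _ S'(2)] by simp
  qed
qed

lemma assoc_algebra_surj:
  assumes M: "assoc_algebra R M" and R': "cring R'" and q: "q ` carrier R = carrier R'" "q \<in> ring_hom R R'"
    and h: "h ` carrier M = carrier N"
    "\<And>x y. \<lbrakk>x \<in> carrier M; y \<in> carrier M\<rbrakk> \<Longrightarrow> h (x \<oplus>\<^bsub>M\<^esub> y) = h x \<oplus>\<^bsub>N\<^esub> h y" "h \<zero>\<^bsub>M\<^esub> = \<zero>\<^bsub>N\<^esub>"
    "\<And>x y. \<lbrakk>x \<in> carrier M; y \<in> carrier M\<rbrakk> \<Longrightarrow> h (x \<otimes>\<^bsub>M\<^esub> y) = h x \<otimes>\<^bsub>N\<^esub> h y" "h \<one>\<^bsub>M\<^esub> = \<one>\<^bsub>N\<^esub>"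
    "\<And>r x. \<lbrakk>r \<in> carrier R; x \<in> carrier M\<rbrakk> \<Longrightarrow> h (r \<odot>\<^bsub>M\<^esub> x) = q r \<odot>\<^bsub>N\<^esub> h x"
  shows "assoc_algebra R' N"
proof -
  interpret M: ring M using assoc_algebraD[OF M] by simp
  interpret MM: Module.module R M using assoc_algebraD[OF M] by simp
  interpret N: ring N by (rule ring_surj[OF M.ring_axioms h(1-5)])
  note sm = M[unfolded assoc_algebra_def, THEN conjunct2, THEN conjunct2, rule_format]
  have ex: "\<exists>x\<in>carrier M. y = h x" if "y \<in> carrier N" for y using that h(1) by (metis imageE)
  have exr: "\<exists>x\<in>carrier R. y = q x" if "y \<in> carrier R'" for y using that q(1) by (metis imageE)
  have cl: "x \<in> carrier M \<Longrightarrow> h x \<in> carrier N" for x using h(1) by (metis imageI)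
  have "Module.module R' N"
  proof (rule moduleI[OF R' N.abelian_group_axioms])
    fix r x assume r: "r \<in> carrier R'" and x: "x \<in> carrier N"
    obtain a where a: "a \<in> carrier M" "x = h a" using ex[OF x] by blast
    obtain t where t: "t \<in> carrier R" "r = q t" using exr[OF r] by blast
    show "r \<odot>\<^bsub>N\<^esub> x \<in> carrier N" using a t cl by (simp add: h(6)[symmetric])
    show "(r \<oplus>\<^bsub>R'\<^esub> r') \<odot>\<^bsub>N\<^esub> x = r \<odot>\<^bsub>N\<^esub> x \<oplus>\<^bsub>N\<^esub> r' \<odot>\<^bsub>N\<^esub> x" "(r \<otimes>\<^bsub>R'\<^esub> r') \<odot>\<^bsub>N\<^esub> x = r \<odot>\<^bsub>N\<^esub> (r' \<odot>\<^bsub>N\<^esub> x)" if r': "r' \<in> carrier R'" for r'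
    proof -
      obtain t' where t': "t' \<in> carrier R" "r' = q t'" using exr[OF r'] by blast
      show "(r \<oplus>\<^bsub>R'\<^esub> r') \<odot>\<^bsub>N\<^esub> x = r \<odot>\<^bsub>N\<^esub> x \<oplus>\<^bsub>N\<^esub> r' \<odot>\<^bsub>N\<^esub> x" "(r \<otimes>\<^bsub>R'\<^esub> r') \<odot>\<^bsub>N\<^esub> x = r \<odot>\<^bsub>N\<^esub> (r' \<odot>\<^bsub>N\<^esub> x)"
        using a t t' by (simp_all add: h(2,6)[symmetric] ring_hom_add[OF q(2), symmetric] ring_hom_mult[OF q(2), symmetric] MM.smult_l_distr MM.smult_assoc1)
    qed
    fix y assume y: "y \<in> carrier N"
    obtain b where b: "b \<in> carrier M" "y = h b" using ex[OF y] by blast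
    show "r \<odot>\<^bsub>N\<^esub> (x \<oplus>\<^bsub>N\<^esub> y) = r \<odot>\<^bsub>N\<^esub> x \<oplus>\<^bsub>N\<^esub> r \<odot>\<^bsub>N\<^esub> y" using a b t by (simp add: h(2,6)[symmetric] MM.smult_r_distr)
  next
    fix x assume x: "x \<in> carrier N"
    obtain a where a: "a \<in> carrier M" "x = h a" using ex[OF x] by blast
    show "\<one>\<^bsub>R'\<^esub> \<odot>\<^bsub>N\<^esub> x = x" using a h(6)[of "\<one>\<^bsub>R\<^esub>" a] by (simp add: ring_hom_one[OF q(2)])
  qed
  moreover have "(r \<odot>\<^bsub>N\<^esub> x) \<otimes>\<^bsub>N\<^esub> y = r \<odot>\<^bsub>N\<^esub> (x \<otimes>\<^bsub>N\<^esub> y) \<and> x \<otimes>\<^bsub>N\<^esub> (r \<odot>\<^bsub>N\<^esub> y) = r \<odot>\<^bsub>N\<^esub> (x \<otimes>\<^bsub>N\<^esub> y)"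
    if r: "r \<in> carrier R'" and x: "x \<in> carrier N" and y: "y \<in> carrier N" for r x y
  proof -
    obtain a where a: "a \<in> carrier M" "x = h a" using ex[OF x] by blast
    obtain b where b: "b \<in> carrier M" "y = h b" using ex[OF y] by blast
    obtain t where t: "t \<in> carrier R" "r = q t" using exr[OF r] by blast
    show ?thesis using a b t by (simp add: h(4,6)[symmetric] sm)
  qed
  ultimately show ?thesis unfolding assoc_algebra_def using N.ring_axioms by blast
qed

lemma group_alg_map:
  fixes G :: "'g monoid"
  assumes sc: "surj_cring_hom R R' q"
  defines "h \<equiv> \<lambda>\<phi> :: 'g \<Rightarrow> 'r. q \<circ> \<phi>"
  shows "h ` carrier (group_alg G R) = carrier (group_alg G R')"
    "\<phi> \<in> carrier (group_alg G R) \<Longrightarrow> \<psi> \<in> carrier (group_alg G R) \<Longrightarrow> h (\<phi> \<oplus>\<^bsub>group_alg G R\<^esub> \<psi>) = h \<phi> \<oplus>\<^bsub>group_alg G R'\<^esub> h \<psi>"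
    "h \<zero>\<^bsub>group_alg G R\<^esub> = \<zero>\<^bsub>group_alg G R'\<^esub>"
    "\<phi> \<in> carrier (group_alg G R) \<Longrightarrow> \<psi> \<in> carrier (group_alg G R) \<Longrightarrow> h (\<phi> \<otimes>\<^bsub>group_alg G R\<^esub> \<psi>) = h \<phi> \<otimes>\<^bsub>group_alg G R'\<^esub> h \<psi>"
    "h \<one>\<^bsub>group_alg G R\<^esub> = \<one>\<^bsub>group_alg G R'\<^esub>"
    "r \<in> carrier R \<Longrightarrow> \<phi> \<in> carrier (group_alg G R) \<Longrightarrow> h (r \<odot>\<^bsub>group_alg G R\<^esub> \<phi>) = q r \<odot>\<^bsub>group_alg G R'\<^esub> h \<phi>"
proof -
  interpret surj_cring_hom R R' q by (rule sc)
  have c: "\<phi> s \<in> carrier R" if "\<phi> \<in> carrier (group_alg G R)" for \<phi> s using that by (simp add: group_alg_simps)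
  have sup: "{s. q (\<phi> s) \<noteq> \<zero>\<^bsub>R'\<^esub>} \<subseteq> {s. \<phi> s \<noteq> \<zero>\<^bsub>R\<^esub>}" for \<phi> :: "'g \<Rightarrow> 'r" using q_zero by auto
  show "h ` carrier (group_alg G R) = carrier (group_alg G R')"
  proof (intro equalityI subsetI)
    fix \<psi> assume "\<psi> \<in> h ` carrier (group_alg G R)"
    then obtain \<phi> where p: "\<phi> \<in> carrier (group_alg G R)" "\<psi> = h \<phi>" by blast
    then show "\<psi> \<in> carrier (group_alg G R')"
      using finite_subset[OF sup[of \<phi>]] sup[of \<phi>] q_closed by (auto simp: group_alg_simps h_def)
  next
    fix \<psi> assume p: "\<psi> \<in> carrier (group_alg G R')"
    \<comment> \<open>Preimages are chosen pointwise, but over 0 the value 0 is forced; otherwise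
      the support could become infinite.\<close>
    define \<phi> where "\<phi> s = (if \<psi> s = \<zero>\<^bsub>R'\<^esub> then \<zero>\<^bsub>R\<^esub> else (SOME x. x \<in> carrier R \<and> q x = \<psi> s))" for s
    have e: "\<phi> s \<in> carrier R \<and> q (\<phi> s) = \<psi> s" for s
    proof (cases "\<psi> s = \<zero>\<^bsub>R'\<^esub>")
      case False
      have "\<psi> s \<in> carrier R'" using p by (simp add: group_alg_simps)
      then have "\<exists>x. x \<in> carrier R \<and> q x = \<psi> s" using q_ex by blast
      from someI_ex[OF this] show ?thesis using False by (simp add: \<phi>_def)
    qed (simp add: \<phi>_def q_zero)
    have "{s. \<phi> s \<noteq> \<zero>\<^bsub>R\<^esub>} \<subseteq> {s. \<psi> s \<noteq> \<zero>\<^bsub>R'\<^esub>}" by (auto simp: \<phi>_def)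
    then have "\<phi> \<in> carrier (group_alg G R)"
      using p e finite_subset[of "{s. \<phi> s \<noteq> \<zero>\<^bsub>R\<^esub>}" "{s. \<psi> s \<noteq> \<zero>\<^bsub>R'\<^esub>}"] unfolding group_alg_simps(1) by blast
    moreover have "\<psi> = h \<phi>" using e by (simp add: h_def fun_eq_iff)
    ultimately show "\<psi> \<in> h ` carrier (group_alg G R)" by blast
  qed
  show "h \<zero>\<^bsub>group_alg G R\<^esub> = \<zero>\<^bsub>group_alg G R'\<^esub>" "h \<one>\<^bsub>group_alg G R\<^esub> = \<one>\<^bsub>group_alg G R'\<^esub>"
    by (simp_all add: group_alg_simps h_def fun_eq_iff q_zero q_one)
  assume p: "\<phi> \<in> carrier (group_alg G R)"
  show "r \<in> carrier R \<Longrightarrow> h (r \<odot>\<^bsub>group_alg G R\<^esub> \<phi>) = q r \<odot>\<^bsub>group_alg G R'\<^esub> h \<phi>"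
    using c[OF p] by (simp add: group_alg_simps h_def fun_eq_iff q_mult)
  assume p': "\<psi> \<in> carrier (group_alg G R)"
  show "h (\<phi> \<oplus>\<^bsub>group_alg G R\<^esub> \<psi>) = h \<phi> \<oplus>\<^bsub>group_alg G R'\<^esub> h \<psi>"
    using c[OF p] c[OF p'] by (simp add: group_alg_simps h_def fun_eq_iff q_add)
  show "h (\<phi> \<otimes>\<^bsub>group_alg G R\<^esub> \<psi>) = h \<phi> \<otimes>\<^bsub>group_alg G R'\<^esub> h \<psi>"
  proof (rule ext)
    fix s
    have fin: "finite {k. \<phi> k \<noteq> \<zero>\<^bsub>R\<^esub>}" using p by (simp add: group_alg_simps)
    have 1: "q (finsum R (\<lambda>k. \<phi> k \<otimes>\<^bsub>R\<^esub> \<psi> (inv\<^bsub>G\<^esub> k \<otimes>\<^bsub>G\<^esub> s)) {k. \<phi> k \<noteq> \<zero>\<^bsub>R\<^esub>}) =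
      finsum R' (\<lambda>k. q (\<phi> k) \<otimes>\<^bsub>R'\<^esub> q (\<psi> (inv\<^bsub>G\<^esub> k \<otimes>\<^bsub>G\<^esub> s))) {k. \<phi> k \<noteq> \<zero>\<^bsub>R\<^esub>}"
      using addhom_finsum[OF ring_hom_addhom[OF q] R.abelian_group_axioms R'.abelian_group_axioms, of "\<lambda>k. \<phi> k \<otimes>\<^bsub>R\<^esub> \<psi> (inv\<^bsub>G\<^esub> k \<otimes>\<^bsub>G\<^esub> s)"]
        c[OF p] c[OF p'] by (simp add: q_mult)
    \<comment> \<open>The support of the image can be smaller than that of \<phi>; the extra terms
      are 0.\<close>
    have 2: "finsum R' (\<lambda>k. q (\<phi> k) \<otimes>\<^bsub>R'\<^esub> q (\<psi> (inv\<^bsub>G\<^esub> k \<otimes>\<^bsub>G\<^esub> s))) {k. q (\<phi> k) \<noteq> \<zero>\<^bsub>R'\<^esub>} =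
      finsum R' (\<lambda>k. q (\<phi> k) \<otimes>\<^bsub>R'\<^esub> q (\<psi> (inv\<^bsub>G\<^esub> k \<otimes>\<^bsub>G\<^esub> s))) {k. \<phi> k \<noteq> \<zero>\<^bsub>R\<^esub>}"
      by (rule R'.add.finprod_mono_neutral_cong_left[OF fin sup]) (use c[OF p] c[OF p'] q_closed in auto)
    show "h (\<phi> \<otimes>\<^bsub>group_alg G R\<^esub> \<psi>) s = (h \<phi> \<otimes>\<^bsub>group_alg G R'\<^esub> h \<psi>) s"
      by (simp add: group_alg_simps h_def 1 2 q_zero)
  qed
qed

section \<open>The adic topology\<close>

text \<open>\<open>topology\<close> reflects a predicate only once the predicate is known to define
  a topology. For intersections the larger of two exponents serves, as the submodules I^n M
  decrease.\<close>

lemma (in pmodule) openin_adic: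
  assumes I: "ideal I R"
  shows "openin (adic_topology R I M) U \<longleftrightarrow> U \<subseteq> carrier M \<and>
     (\<forall>x\<in>U. \<exists>n. ispan M (ideal_pow R I n) (carrier M) +>\<^bsub>M\<^esub> x \<subseteq> U)"
proof -
  let ?N = "\<lambda>n. ispan M (ideal_pow R I n) (carrier M)"
  let ?P = "\<lambda>U. U \<subseteq> carrier M \<and> (\<forall>x\<in>U. \<exists>n. ?N n +>\<^bsub>M\<^esub> x \<subseteq> U)"
  have eq: "ideal_smult R (ideal_pow R I n) M = ?N n" for n by (rule ideal_smult_eq[OF R.ideal_pow_ideal[OF I]])
  have mono: "?N n +>\<^bsub>M\<^esub> x \<subseteq> ?N m +>\<^bsub>M\<^esub> x" if "m \<le> n" for m n x
    using ispan_mono[OF R.ideal_pow_antimono[OF I that] order_refl, of M "carrier M"] by (auto simp: a_r_coset_def r_coset_def)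
  have "istopology ?P" unfolding istopology_def
  proof (intro conjI allI impI)
    fix U V assume UV: "?P U" "?P V"
    show "U \<inter> V \<subseteq> carrier M" using UV by blast
    show "\<forall>x\<in>U \<inter> V. \<exists>n. ?N n +>\<^bsub>M\<^esub> x \<subseteq> U \<inter> V"
    proof
      fix x assume x: "x \<in> U \<inter> V"
      then obtain m where m: "?N m +>\<^bsub>M\<^esub> x \<subseteq> U" using UV by blast
      obtain n where n: "?N n +>\<^bsub>M\<^esub> x \<subseteq> V" using x UV by blast
      have "?N (max m n) +>\<^bsub>M\<^esub> x \<subseteq> U \<inter> V" using m n mono[of m "max m n" x] mono[of n "max m n" x] by auto
      then show "\<exists>n. ?N n +>\<^bsub>M\<^esub> x \<subseteq> U \<inter> V" by blast
    qed
  next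
    fix \<K> assume K: "\<forall>U\<in>\<K>. ?P U"
    then show "\<Union>\<K> \<subseteq> carrier M" by blast
    show "\<forall>x\<in>\<Union>\<K>. \<exists>n. ?N n +>\<^bsub>M\<^esub> x \<subseteq> \<Union>\<K>" using K by (meson UnionE Union_upper subset_trans)
  qed
  then show ?thesis unfolding adic_topology_def eq by (rule topology_inverse'[THEN fun_cong])
qed

text \<open>In the theorem R is the deformation ring regarded over the p-adic integers instead of
  over W; ideals, and so the maximal ideal, do not notice the change.\<close>

lemma ideal_restr: "ideal I (restr f A) \<longleftrightarrow> ideal I A"
proof -
  have "ring (restr f A) \<longleftrightarrow> ring A"
  proof
    show "ring (restr f A) \<Longrightarrow> ring A" by (erule ring_cong) simp_all
  qed (rule restr_ring)
  then show ?thesis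
    by (simp add: ideal_def additive_subgroup_def subgroup_def ideal_axioms_def m_inv_def)
qed

lemma max_ideal_restr: "max_ideal (restr f A) = max_ideal A"
  by (simp add: max_ideal_def maximalideal_def maximalideal_axioms_def ideal_restr)

lemma rev_char_poly_closed:
  fixes R :: "('u,'x) ring_scheme" and E :: "('u,'e) module" and D :: "('u,'e,'u) law"
  assumes inf: "infinite (UNIV :: 'u set)" and D: "pseudorep R E d D" and x: "x \<in> carrier E"
  shows "up_ring.coeff (UP (self_alg R)) (rev_char_poly R E D x) i \<in> carrier R"
proof -
  interpret pR: poly_univ R "self_alg R" using inf self_alg_algebra[OF pseudorepD(1)[OF D]] by (rule poly_univ.intro)
  interpret t: tensor_alg R E pR.B by (rule tensor_alg.intro[OF pseudorepD(2)[OF D] pR.B_algebra])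
  interpret T: ring t.T by (rule t.T_ring)
  have "\<one>\<^bsub>t.T\<^esub> \<ominus>\<^bsub>t.T\<^esub> pure R E pR.B x (poly_var (self_alg R)) \<in> carrier t.T"
    by (rule t.T.minus_closed[OF T.one_closed t.pure_closed[OF x pR.var_closed]])
  then have "rev_char_poly R E D x \<in> carrier (UP (self_alg R))"
    unfolding rev_char_poly_def Let_def by (intro pR.decode_closed pseudorepD(3)[OF D pR.B_algebra])
  then show ?thesis using pR.P.coeff_closed[of "rev_char_poly R E D x" i] by simp
qed

section \<open>The quotient attached to a stable condition\<close>

locale C_quotient = CH_data p G T C R E \<rho>
  for p :: nat and G :: "'g monoid" and T :: "'g topology" and C :: "'g condition"
    and R :: "(padic, 'u) module" and E :: "('u, 'u) module" and \<rho> :: "'g \<Rightarrow> 'u" +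
  fixes d :: nat and D :: "('u, 'u, 'u) law" and DC :: "('u set, 'u set, 'u) law"
  assumes inf: "infinite (UNIV :: 'u set)"
    and ch: "cayley_hamilton R E d D"
    and isDC: "is_DC p G d C R E \<rho> D DC"
begin

abbreviation "aa \<equiv> aC p G C R E \<rho> D"
abbreviation "JJ \<equiv> JC p G C R E \<rho> D"
abbreviation "R1 \<equiv> RC p G C R E \<rho> D"
abbreviation "E1 \<equiv> EC p G C R E \<rho> D"
abbreviation "rho1 \<equiv> rhoC p G C R E \<rho> D"
abbreviation "qR \<equiv> \<lambda>r. aa +>\<^bsub>R\<^esub> r"
abbreviation "qE \<equiv> \<lambda>x. JJ +>\<^bsub>E\<^esub> x"

lemma psD: "pseudorep R E d D" using ch by (simp add: cayley_hamilton_def)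
lemma psDC: "pseudorep R1 E1 d DC" using isDC by (simp add: is_DC_def)
lemma pmDC: "pseudo_morphism R E D R1 E1 DC qR (lin_ext E1 qE)" using isDC by (simp add: is_DC_def)

lemma aa_ideal: "ideal aa R"
  unfolding aC_def by (rule R.genideal_ideal) (use rev_char_poly_closed[OF inf psD] KC_iff in blast)

lemma aa_sub: "subgroup aa (add_monoid R)"
  by (rule additive_subgroup.a_subgroup[OF ideal.axioms(1)[OF aa_ideal]])

lemma R1_simps: "carrier R1 = a_rcosets\<^bsub>R\<^esub> aa" "\<zero>\<^bsub>R1\<^esub> = aa" by (simp_all add: RC_def)

lemma qR_surj: "qR ` carrier R = carrier R1" unfolding R1_simps A_RCOSETS_def' by blast

text \<open>That the quotient is a commutative ring and the projection a ring map is contained in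
  the data of the pseudorepresentation on the quotient and of the morphism to it.\<close>

lemma sc: "surj_cring_hom R R1 qR"
  using cringR pseudorepD(1)[OF psDC] pmDC qR_surj by (simp add: surj_cring_hom_def pseudo_morphism_def)

sublocale q: surj_cring_hom R R1 qR by (rule sc)

lemma qR_zero_iff: "r \<in> carrier R \<Longrightarrow> qR r = \<zero>\<^bsub>R1\<^esub> \<longleftrightarrow> r \<in> aa"
  using R.rcos_zero_iff[OF aa_sub] by (simp add: R1_simps)

abbreviation "AE \<equiv> ispan E aa (carrier E)"

lemma AE_rsub: "rsub R E AE" by (rule EM.ispan_rsub[OF aa_ideal order_refl])

lemma JJ_mem: "x \<in> JJ \<longleftrightarrow> (\<exists>k\<in>KK. \<exists>a\<in>AE. x = k \<oplus>\<^bsub>E\<^esub> a)"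
  unfolding JC_def EM.ideal_smult_eq[OF aa_ideal] set_add_def set_mult_def by auto

lemma JJ_rsub: "rsub R E JJ"
proof (rule rsubI)
  note K = rsubD[OF KK_rsub] and A = rsubD[OF AE_rsub]
  show "\<zero>\<^bsub>E\<^esub> \<in> JJ" unfolding JJ_mem using K(2) A(2) by (intro bexI[of _ "\<zero>\<^bsub>E\<^esub>"]) simp_all
  fix x assume "x \<in> JJ"
  then obtain k a where x: "k \<in> KK" "a \<in> AE" "x = k \<oplus>\<^bsub>E\<^esub> a" by (auto simp: JJ_mem)
  note xc = K(5)[OF x(1)] A(5)[OF x(2)]
  show "x \<in> carrier E" using x xc by simp
  show "r \<odot>\<^bsub>E\<^esub> x \<in> JJ" if r: "r \<in> carrier R" for r
    unfolding JJ_mem using K(4)[OF r x(1)] A(4)[OF r x(2)] x(3) xc r EM.smult_r_distr by metis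
  fix y assume "y \<in> JJ"
  then obtain l b where y: "l \<in> KK" "b \<in> AE" "y = l \<oplus>\<^bsub>E\<^esub> b" by (auto simp: JJ_mem)
  note yc = K(5)[OF y(1)] A(5)[OF y(2)]
  have "x \<oplus>\<^bsub>E\<^esub> y = (k \<oplus>\<^bsub>E\<^esub> l) \<oplus>\<^bsub>E\<^esub> (a \<oplus>\<^bsub>E\<^esub> b)" using x(3) y(3) xc yc by (simp add: E.a_ac)
  then show "x \<oplus>\<^bsub>E\<^esub> y \<in> JJ" unfolding JJ_mem using K(3)[OF x(1) y(1)] A(3)[OF x(2) y(2)] by blast
qed

lemma KK_JJ: "KK \<subseteq> JJ"
proof
  fix x assume x: "x \<in> KK"
  show "x \<in> JJ" unfolding JJ_mem using x rsubD(2)[OF AE_rsub] rsubD(5)[OF KK_rsub x] by (intro bexI[of _ x] bexI[of _ "\<zero>\<^bsub>E\<^esub>"]) simp_all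
qed

lemma AE_JJ: "AE \<subseteq> JJ"
proof
  fix x assume x: "x \<in> AE"
  show "x \<in> JJ" unfolding JJ_mem using x rsubD(2)[OF KK_rsub] rsubD(5)[OF AE_rsub x] by (intro bexI[of _ "\<zero>\<^bsub>E\<^esub>"] bexI[of _ x]) simp_all
qed

lemma JJ_sub: "subgroup JJ (add_monoid E)" by (rule EM.rsub_subgroup[OF JJ_rsub])

lemma E1_simps: "carrier E1 = a_rcosets\<^bsub>E\<^esub> JJ" "\<zero>\<^bsub>E1\<^esub> = JJ" "add E1 = set_add E"
  by (simp_all add: EC_def quot_alg_def)

lemma qE_surj: "qE ` carrier E = carrier E1" unfolding E1_simps A_RCOSETS_def' by blast
lemma qE_closed: "x \<in> carrier E \<Longrightarrow> qE x \<in> carrier E1" using qE_surj by (metis imageI)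
lemma qE_ex: "y \<in> carrier E1 \<Longrightarrow> \<exists>x\<in>carrier E. y = qE x" using qE_surj by (metis imageE)

lemma qE_zero_iff: "x \<in> carrier E \<Longrightarrow> qE x = \<zero>\<^bsub>E1\<^esub> \<longleftrightarrow> x \<in> JJ"
  using E.rcos_zero_iff[OF JJ_sub] by (simp add: E1_simps)

text \<open>Scalars act on the quotient through unions over two cosets. Changing the scalar by a in
  the ideal and the vector by j in \<open>JJ\<close> alters the product by a y + r j, which lies in
  \<open>JJ\<close> because \<open>JJ\<close> contains both the submodule \<open>AE\<close> and all
  multiples r j.\<close>

lemma qE_smult:
  assumes r: "r \<in> carrier R" and x: "x \<in> carrier E"
  shows "qE (r \<odot>\<^bsub>E\<^esub> x) = qR r \<odot>\<^bsub>E1\<^esub> qE x"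
proof -
  have "qE (s \<odot>\<^bsub>E\<^esub> y) = qE (r \<odot>\<^bsub>E\<^esub> x)" if sy: "s \<in> qR r" "y \<in> qE x" for s y
  proof -
    obtain a where a: "a \<in> aa" "s = a \<oplus>\<^bsub>R\<^esub> r" using sy(1) by (auto simp: R.rcos_mem)
    obtain j where j: "j \<in> JJ" "y = j \<oplus>\<^bsub>E\<^esub> x" using sy(2) by (auto simp: E.rcos_mem)
    have ac: "a \<in> carrier R" using ideal.Icarr[OF aa_ideal a(1)] .
    have jc: "j \<in> carrier E" using rsubD(5)[OF JJ_rsub j(1)] .
    have yc: "y \<in> carrier E" using j jc x by simp
    have ay: "a \<odot>\<^bsub>E\<^esub> y \<in> JJ"
      using EM.ispan_base[OF a(1) yc _ order_refl] ideal.Icarr[OF aa_ideal] AE_JJ by blast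
    have rj: "r \<odot>\<^bsub>E\<^esub> j \<in> JJ" by (rule rsubD(4)[OF JJ_rsub r j(1)])
    have "s \<odot>\<^bsub>E\<^esub> y = (a \<odot>\<^bsub>E\<^esub> y \<oplus>\<^bsub>E\<^esub> r \<odot>\<^bsub>E\<^esub> j) \<oplus>\<^bsub>E\<^esub> r \<odot>\<^bsub>E\<^esub> x"
    proof -
      have "s \<odot>\<^bsub>E\<^esub> y = a \<odot>\<^bsub>E\<^esub> y \<oplus>\<^bsub>E\<^esub> r \<odot>\<^bsub>E\<^esub> y" using a(2) ac r yc by (simp add: EM.smult_l_distr)
      also have "r \<odot>\<^bsub>E\<^esub> y = r \<odot>\<^bsub>E\<^esub> j \<oplus>\<^bsub>E\<^esub> r \<odot>\<^bsub>E\<^esub> x" using j(2) jc r x by (simp add: EM.smult_r_distr)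
      finally show ?thesis using ac yc r jc x by (simp add: E.a_assoc)
    qed
    then have "s \<odot>\<^bsub>E\<^esub> y \<ominus>\<^bsub>E\<^esub> r \<odot>\<^bsub>E\<^esub> x = a \<odot>\<^bsub>E\<^esub> y \<oplus>\<^bsub>E\<^esub> r \<odot>\<^bsub>E\<^esub> j"
      using ac yc r jc x by (simp add: E.minus_eq E.a_assoc E.r_neg)
    then have "s \<odot>\<^bsub>E\<^esub> y \<ominus>\<^bsub>E\<^esub> r \<odot>\<^bsub>E\<^esub> x \<in> JJ" using rsubD(3)[OF JJ_rsub ay rj] by simp
    then show ?thesis using E.rcos_iff[OF JJ_sub, of "s \<odot>\<^bsub>E\<^esub> y" "r \<odot>\<^bsub>E\<^esub> x"] a(2) ac r yc x by simp
  qed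
  moreover have "r \<in> qR r" using R.subgroupD(2)[OF aa_sub] r by (force simp: R.rcos_mem)
  moreover have "x \<in> qE x" using E.subgroupD(2)[OF JJ_sub] x by (force simp: E.rcos_mem)
  ultimately have "(\<Union>s\<in>qR r. \<Union>y\<in>qE x. qE (s \<odot>\<^bsub>E\<^esub> y)) = qE (r \<odot>\<^bsub>E\<^esub> x)" by blast
  then show ?thesis by (simp add: EC_def quot_alg_def)
qed

lemma qE_slin: "slin R qR E E1 qE"
  by (rule slinI[OF addhomI]) (simp_all add: qE_closed qE_smult E1_simps(3) E.rcos_add[OF JJ_sub])

sublocale bq: base_change R E R1 E1 qR
  using assE pseudorepD(2)[OF psDC] q.q by (simp add: base_change_def)

text \<open>The given morphism is a linear extension of the projection; evaluated at x (x) 1 it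
  returns the projection, which thereby inherits multiplicativity and compatibility with the
  laws.\<close>

lemma shq: "semilinear_hom R E R1 E1 qR qE" and lcq: "law_compat R E D R1 E1 DC qR qE"
proof -
  let ?g1 = "\<lambda>x. lin_ext E1 qE (pure R E bq.S x \<one>\<^bsub>R1\<^esub>)"
  note pd = bq.pseudo_morphismD[OF pmDC]
  have e: "?g1 x = qE x" if x: "x \<in> carrier E" for x
    using bq.lin_ext_pure[OF qE_slin x q.R'.one_closed] qE_closed[OF x] by simp
  have "qE \<in> ring_hom E E1" by (rule ring_hom_cong[OF pd(1) E.ring_axioms]) (simp add: e)
  then show sh: "semilinear_hom R E R1 E1 qR qE" by (rule semilinear_homI[OF bq.base_change_axioms _ qE_slin])
  show "law_compat R E D R1 E1 DC qR qE"
    by (rule law_compat_cong[OF psD semilinear_homI[OF bq.base_change_axioms pd(1,2)] sh refl _ pd(3)]) (simp add: e)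
qed

sublocale sq: semilinear_hom R E R1 E1 qR qE by (rule shq)

lemma rho1_eq: "rho1 s = qE (\<rho> s)" by (simp add: rhoC_def)

subsection \<open>The quotient is universal\<close>

text \<open>The morphism from the original algebra kills everything that is divided out, so it
  descends; every morphism from the quotient pulls back to that one, which gives uniqueness.\<close>

lemma universal:
  fixes A :: "(padic, 'u) module" and E' :: "('u, 'u) module" and D' :: "('u, 'u, 'u) law" and Du :: "('u, 'g \<Rightarrow> 'u, 'u) law"
  assumes obj: "CH_object_C p G T d R Du C A E' \<rho>' D'"
    and init: "\<exists>!h. h \<in> CH_hom G R E \<rho> D A E' \<rho>' D'"
  shows "\<exists>!h. h \<in> CH_hom G R1 E1 rho1 DC A E' \<rho>' D'"
proof -
  have o: "algebra (Zp p) A" "complete_noetherian_local A" "cayley_hamilton A E' d D'" "\<rho>' \<in> hom G (units_of E')"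
    "fg_module A E'" "\<And>i. i \<ge> 1 \<Longrightarrow> inC (red_mod A E' i) (red_act A E' (left_act E' \<rho>') i)"
    using obj by (auto simp: CH_object_C_def CH_object_def CH_rep_def satisfies_def)
  have psD': "pseudorep A E' d D'" using o(3) by (simp add: cayley_hamilton_def)
  note assE' = pseudorepD(2)[OF psD']
  interpret Q: CH_data p G T C A E' \<rho>'
    using o assE' stab_cond_axioms by (simp add: CH_data_def CH_data_axioms_def)
  obtain f0 g0 where h0: "(f0, g0) \<in> CH_hom G R E \<rho> D A E' \<rho>' D'" and h0u: "\<And>h. h \<in> CH_hom G R E \<rho> D A E' \<rho>' D' \<Longrightarrow> h = (f0, g0)"
    using init by auto
  define g1 where "g1 x = g0 (pure R E (restr f0 (self_alg A)) x \<one>\<^bsub>A\<^esub>)" for x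
  note hd = CH_homD[OF assE assE' h0, folded g1_def]
  have sh1: "semilinear_hom R E A E' f0 g1" using hd(2) unfolding g1_def .
  interpret h1: semilinear_hom R E A E' f0 g1 by (rule sh1)
  have lc1: "law_compat R E D A E' D' f0 g1" using hd(3) unfolding g1_def .
  have g1s: "g1 (\<rho> s) = \<rho>' s" if "s \<in> carrier G" for s using hd(4)[OF that] .
  note f0h = h1.f and g1h = h1.gr and g1sl = h1.gs
  have f0c: "r \<in> carrier R \<Longrightarrow> f0 r \<in> carrier A" for r by (rule h1.fc)
  have g1c: "x \<in> carrier E \<Longrightarrow> g1 x \<in> carrier E'" for x using ring_hom_closed[OF g1h] .
  have Eab: "abelian_group E" and Rab: "abelian_group R" and Aab: "abelian_group A" and E'ab: "abelian_group E'"
    using assoc_algebraD(3)[OF assE] cringR Q.cringR assoc_algebraD(3)[OF assE'] by (simp_all add: cring_def ring_def)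
  have kill_KK: "g1 x = \<zero>\<^bsub>E'\<^esub>" if x: "x \<in> KK" for x
  proof -
    have xc: "x \<in> carrier E" using x KC_iff by blast
    \<comment> \<open>For fixed i the composite E -> E' -> E'/m'^i E' has an object of C as target,
      so it kills K once it kills some m^j E.\<close>
    have "g1 x \<in> Q.NN i" if i: "i \<ge> 1" for i
    proof -
      let ?P = "quot_module Q.MM (Q.NN i)" and ?g = "quot_act Q.MM (Q.NN i) Q.al"
      have P: "inC ?P ?g" using o(6)[OF i] unfolding Q.red_mod_eq Q.red_act_eq .
      note Qq = quot_gmod[OF G.group_axioms Q.MM_gmod Q.NN_gsub[of i]]
      have "ghom G MM al Q.MM Q.al g1"
        using ring_hom_addhom[OF g1h] g1s rho_closed ring_hom_mult[OF g1h] by (simp add: ghom_def addhom_def left_act_def)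
      note th = ghom_comp[OF this Qq(2)]
      let ?N = "quot_module E' (Q.NN i)"
      have N: "Module.module A ?N" by (rule Q.EM.quot_is_module[OF Q.NN_rsub])
      \<comment> \<open>The quotient of E' is needed in two guises: over the p-adic integers for
        membership in C, and over A for semilinearity along f0.\<close>
      have Neq: "carrier ?P = carrier ?N" "\<zero>\<^bsub>?P\<^esub> = \<zero>\<^bsub>?N\<^esub>"
        using quot_module_restr[of "str_map A" E' "Q.NN i"] by (metis restr_simps(1)) (metis restr_simps(4) quot_module_restr)
      have finN: "finite (carrier ?N)" using fin_gmodD(2)[OF inC_fing[OF P]] unfolding Neq .
      have sl: "slin R f0 E ?N (\<lambda>x. Q.NN i +>\<^bsub>E'\<^esub> g1 x)"
      proof -
        note pj = Q.EM.quot_proj[OF Q.NN_rsub, of i]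
        show ?thesis
          by (rule slinI[OF addhom_comp[OF slin_addhom[OF g1sl] slin_addhom[OF pj]]])
            (simp add: slin_smult[OF g1sl] slin_smult[OF pj f0c] g1c)
      qed
      have u: "a \<in> max_ideal R \<Longrightarrow> \<one>\<^bsub>R\<^esub> \<ominus>\<^bsub>R\<^esub> a \<in> Units R" for a
        using local_one_minus_unit[OF mD(1-3) mD(5)] .
      \<comment> \<open>This exponent comes from finiteness of the target; f0 is only known to be a
        ring homomorphism.\<close>
      obtain j where j: "\<And>y. y \<in> NN j \<Longrightarrow> Q.NN i +>\<^bsub>E'\<^esub> g1 y = \<zero>\<^bsub>?N\<^esub>"
        using finite_target_nilpotent[OF mD(1,2,4) u EM.module_axioms N finN f0h sl] by blast
      have "Q.NN i +>\<^bsub>Q.MM\<^esub> g1 x = \<zero>\<^bsub>?P\<^esub>"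
      proof (rule KK_killed[OF P th _ _ x])
        \<comment> \<open>K is an intersection over positive indices, so the exponent is raised to
          at least 1.\<close>
        show "1 \<le> max 1 j" by simp
        show "Q.NN i +>\<^bsub>Q.MM\<^esub> g1 y = \<zero>\<^bsub>?P\<^esub>" if "y \<in> NN (max 1 j)" for y
          using j[of y] that NN_antimono[of j "max 1 j"] Neq(2) by auto
      qed
      then show ?thesis using Qq(4)[of "g1 x"] g1c[OF xc] by simp
    qed
    \<comment> \<open>Krull's theorem asks for membership at every exponent; the exponent 0 follows
      from 1.\<close>
    moreover have "Q.NN (Suc 0) \<subseteq> Q.NN 0" by (rule Q.NN_antimono) simp
    ultimately have "g1 x \<in> Q.NN n" for n by (cases n) (auto simp del: ideal_pow.simps)
    moreover have "\<one>\<^bsub>A\<^esub> \<ominus>\<^bsub>A\<^esub> a \<in> Units A" if "a \<in> max_ideal A" for a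
      using local_one_minus_unit[OF Q.mD(1-3) Q.mD(5) that] .
    ultimately show ?thesis using Q.EM.krull[OF o(5) Q.mD(4)] by blast
  qed
  have kill_aa: "f0 r = \<zero>\<^bsub>A\<^esub>" if "r \<in> aa" for r
  proof -
    interpret A: cring A by (rule Q.cringR)
    \<comment> \<open>The kernel of f0 is an ideal, so it is enough that it contains the generating
      coefficients.\<close>
    have "ideal {r \<in> carrier R. f0 r = \<zero>\<^bsub>A\<^esub>} R"
      by (rule R.idealI') (simp_all add: addhom_zero[OF ring_hom_addhom[OF f0h] Rab Aab] ring_hom_add[OF f0h] ring_hom_mult[OF f0h] f0c)
    then have "aa \<subseteq> {r \<in> carrier R. f0 r = \<zero>\<^bsub>A\<^esub>}" unfolding aC_def
    proof (rule R.genideal_minimal)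
      show "{up_ring.coeff (UP (self_alg R)) (rev_char_poly R E D x) i | x i. x \<in> KK \<and> i \<ge> 1} \<subseteq> {r \<in> carrier R. f0 r = \<zero>\<^bsub>A\<^esub>}"
        using rev_char_poly_killed[OF inf sh1 psD psD' lc1 _ kill_KK] KC_iff by blast
    qed
    then show ?thesis using that by blast
  qed
  have kill_JJ: "g1 x = \<zero>\<^bsub>E'\<^esub>" if "x \<in> JJ" for x
  proof -
    interpret E': abelian_group E' by (rule E'ab)
    have z: "g1 \<zero>\<^bsub>E\<^esub> = \<zero>\<^bsub>E'\<^esub>" using addhom_zero[OF ring_hom_addhom[OF g1h] Eab E'ab] .
    have "AE \<subseteq> {y \<in> carrier E. g1 y = \<zero>\<^bsub>E'\<^esub>}"
      by (rule EM.ispan_minimal)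
        (use ideal.Icarr[OF aa_ideal] in \<open>simp_all add: z ring_hom_add[OF g1h] slin_smult[OF g1sl] kill_aa g1c\<close>)
    moreover obtain k a where ka: "k \<in> KK" "a \<in> AE" "x = k \<oplus>\<^bsub>E\<^esub> a" using \<open>x \<in> JJ\<close> by (auto simp: JJ_mem)
    ultimately show ?thesis using kill_KK[OF ka(1)] rsubD(5)[OF KK_rsub ka(1)] by (auto simp: ring_hom_add[OF g1h])
  qed
  have R1ab: "abelian_group R1" and E1ab: "abelian_group E1"
    using q.R'.abelian_group_axioms bq.E'_ab by simp_all
  obtain f1 where f1: "addhom R1 A f1" "\<And>r. r \<in> carrier R \<Longrightarrow> f1 (qR r) = f0 r"
    using addhom_factor[OF Rab R1ab Aab ring_hom_addhom[OF q.q] qR_surj ring_hom_addhom[OF f0h]] kill_aa qR_zero_iff by blast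
  obtain gb where gb: "addhom E1 E' gb" "\<And>x. x \<in> carrier E \<Longrightarrow> gb (qE x) = g1 x"
    using addhom_factor[OF Eab E1ab E'ab slin_addhom[OF qE_slin] qE_surj ring_hom_addhom[OF g1h]] kill_JJ qE_zero_iff by blast
  \<comment> \<open>Morphisms are compared as functions, so the descended ring map is cut down to
    the carrier.\<close>
  define f where "f = restrict f1 (carrier R1)"
  have f: "f (qR r) = f0 r" if "r \<in> carrier R" for r using f1(2)[OF that] q.q_closed[OF that] by (simp add: f_def)
  have fh: "f \<in> ring_hom R1 A"
  proof (rule ring_hom_memI)
    fix x assume x: "x \<in> carrier R1"
    obtain r where r: "r \<in> carrier R" "qR r = x" using q.q_ex[OF x] by blast
    show "f x \<in> carrier A" using r f f0c by metis
    fix y assume y: "y \<in> carrier R1"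
    obtain t where t: "t \<in> carrier R" "qR t = y" using q.q_ex[OF y] by blast
    have "x \<otimes>\<^bsub>R1\<^esub> y = qR (r \<otimes>\<^bsub>R\<^esub> t)" "x \<oplus>\<^bsub>R1\<^esub> y = qR (r \<oplus>\<^bsub>R\<^esub> t)" using r t q.q_mult q.q_add by metis+
    then show "f (x \<otimes>\<^bsub>R1\<^esub> y) = f x \<otimes>\<^bsub>A\<^esub> f y" "f (x \<oplus>\<^bsub>R1\<^esub> y) = f x \<oplus>\<^bsub>A\<^esub> f y"
      using f[OF r(1)] f[OF t(1)] f[OF R.m_closed[OF r(1) t(1)]] f[OF R.add.m_closed[OF r(1) t(1)]] r t
        ring_hom_mult[OF f0h r(1) t(1)] ring_hom_add[OF f0h r(1) t(1)] by simp_all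
  next
    show "f \<one>\<^bsub>R1\<^esub> = \<one>\<^bsub>A\<^esub>" using f[OF R.one_closed] q.q_one ring_hom_one[OF f0h] by simp
  qed
  have gbh: "gb \<in> ring_hom E1 E'"
  proof (rule ring_hom_memI)
    fix x assume x: "x \<in> carrier E1"
    obtain e where e: "e \<in> carrier E" "x = qE e" using qE_ex[OF x] by blast
    show "gb x \<in> carrier E'" using addhom_closed[OF gb(1) x] .
    fix y assume y: "y \<in> carrier E1"
    obtain e' where e': "e' \<in> carrier E" "y = qE e'" using qE_ex[OF y] by blast
    show "gb (x \<oplus>\<^bsub>E1\<^esub> y) = gb x \<oplus>\<^bsub>E'\<^esub> gb y" using addhom_add[OF gb(1) x y] .
    have "x \<otimes>\<^bsub>E1\<^esub> y = qE (e \<otimes>\<^bsub>E\<^esub> e')" using e e' ring_hom_mult[OF sq.gr] by simp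
    then show "gb (x \<otimes>\<^bsub>E1\<^esub> y) = gb x \<otimes>\<^bsub>E'\<^esub> gb y" using gb(2) e e' ring_hom_mult[OF g1h] by simp
  next
    show "gb \<one>\<^bsub>E1\<^esub> = \<one>\<^bsub>E'\<^esub>" using gb(2)[OF E.one_closed] ring_hom_one[OF sq.gr] ring_hom_one[OF g1h] by simp
  qed
  have gbs: "slin R1 f E1 E' gb"
  proof (rule slinI[OF gb(1)])
    fix x y assume x: "x \<in> carrier R1" and y: "y \<in> carrier E1"
    obtain r where r: "r \<in> carrier R" "qR r = x" using q.q_ex[OF x] by blast
    obtain e where e: "e \<in> carrier E" "y = qE e" using qE_ex[OF y] by blast
    have "gb (x \<odot>\<^bsub>E1\<^esub> y) = gb (qE (r \<odot>\<^bsub>E\<^esub> e))" using qE_smult[OF r(1) e(1)] r e by simp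
    also have "\<dots> = f0 r \<odot>\<^bsub>E'\<^esub> g1 e" using gb(2) slin_smult[OF g1sl r(1) e(1)] r e by simp
    also have "\<dots> = f x \<odot>\<^bsub>E'\<^esub> gb y" using f[OF r(1)] gb(2)[OF e(1)] r e by simp
    finally show "gb (x \<odot>\<^bsub>E1\<^esub> y) = f x \<odot>\<^bsub>E'\<^esub> gb y" .
  qed
  have bcf: "base_change R1 E1 A E' f" using pseudorepD(2)[OF psDC] assE' fh by (simp add: base_change_def)
  have shf: "semilinear_hom R1 E1 A E' f gb" by (rule semilinear_homI[OF bcf gbh gbs])
  \<comment> \<open>Stated for an arbitrary semilinear map out of the quotient, since existence and
    uniqueness both precompose with the projection.\<close>
  have comp: "semilinear_hom R E A E' (\<lambda>r. f2 (qR r)) (\<lambda>x. g2 (qE x))" if sh2: "semilinear_hom R1 E1 A E' f2 g2" for f2 g2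
  proof (rule semilinear_homI)
    interpret s2: semilinear_hom R1 E1 A E' f2 g2 by (rule sh2)
    show "base_change R E A E' (\<lambda>r. f2 (qR r))"
      using assE assE' ring_hom_trans[OF q.q s2.f] by (simp add: base_change_def comp_def)
    show "(\<lambda>x. g2 (qE x)) \<in> ring_hom E E'" using ring_hom_trans[OF sq.gr s2.gr] by (simp add: comp_def)
    then show "slin R (\<lambda>r. f2 (qR r)) E E' (\<lambda>x. g2 (qE x))"
      by (intro slinI ring_hom_addhom) (simp_all add: qE_smult slin_smult[OF s2.gs] q.q_closed qE_closed)
  qed
  \<comment> \<open>The law equation is known after composing with the projection and is cancelled
    there, as the projection is surjective.\<close>
  have lcf: "law_compat R1 E1 DC A E' D' f gb"
    by (rule law_compat_factor[OF shq shf lcq _ qE_surj])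
      (rule law_compat_cong[OF psD sh1 comp[OF shf] _ _ lc1], simp_all add: f gb(2))
  have ex: "(f, restrict (lin_ext E' gb) (carrier (bc_alg R1 E1 f A))) \<in> CH_hom G R1 E1 rho1 DC A E' \<rho>' D'"
    by (rule CH_homI[OF shf _ lcf]) (simp_all add: f_def rho1_eq qE_closed rho_closed gb(2) g1s)
  have uni: "f2 = f \<and> g2 = restrict (lin_ext E' gb) (carrier (bc_alg R1 E1 f A))"
    if h2: "(f2, g2) \<in> CH_hom G R1 E1 rho1 DC A E' \<rho>' D'" for f2 g2
  proof -
    define k where "k x = g2 (pure R1 E1 (restr f2 (self_alg A)) x \<one>\<^bsub>A\<^esub>)" for x
    have c: "f2 \<in> extensional (carrier R1)" "semilinear_hom R1 E1 A E' f2 k" "law_compat R1 E1 DC A E' D' f2 k"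
      "\<And>s. s \<in> carrier G \<Longrightarrow> k (rho1 s) = \<rho>' s" "g2 = restrict (lin_ext E' k) (carrier (bc_alg R1 E1 f2 A))"
      unfolding k_def by (rule CH_homD[OF pseudorepD(2)[OF psDC] assE' h2], assumption?)+
    interpret s2: semilinear_hom R1 E1 A E' f2 k by (rule c(2))
    \<comment> \<open>The pulled back ring map must be restricted to become extensional. The law
      equation is transferred to the restricted map by \<open>law_compat_cong\<close>.\<close>
    let ?f = "restrict (\<lambda>r. f2 (qR r)) (carrier R)" and ?k = "\<lambda>x. k (qE x)"
    note cp = comp[OF c(2)]
    interpret cp: semilinear_hom R E A E' "\<lambda>r. f2 (qR r)" ?k by (rule cp)
    have lc2: "law_compat R E D A E' D' (\<lambda>r. f2 (qR r)) ?k" by (rule law_compat_comp[OF shq c(2) lcq c(3)])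
    have sh2: "semilinear_hom R E A E' ?f ?k"
    proof (rule semilinear_homI)
      have "?f \<in> ring_hom R A" by (rule ring_hom_cong[OF cp.f R.ring_axioms]) simp
      then show "base_change R E A E' ?f" using assE assE' by (simp add: base_change_def)
      show "?k \<in> ring_hom E E'" by (rule cp.gr)
      show "slin R ?f E E' ?k" by (rule slin_cong[OF cp.gs EM.module_axioms]) simp_all
    qed
    have "law_compat R E D A E' D' ?f ?k" by (rule law_compat_cong[OF psD cp sh2 _ _ lc2]) simp_all
    then have "(?f, restrict (lin_ext E' ?k) (carrier (bc_alg R E ?f A))) \<in> CH_hom G R E \<rho> D A E' \<rho>' D'"
      by (intro CH_homI[OF sh2]) (simp_all add: rho_closed c(4)[unfolded rho1_eq])
    then have e: "?f = f0" "restrict (lin_ext E' ?k) (carrier (bc_alg R E ?f A)) = g0" using h0u by blast+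
    have ff: "f2 = f"
    proof (rule extensionalityI[OF c(1)])
      show "f \<in> extensional (carrier R1)" by (simp add: f_def)
      fix x assume "x \<in> carrier R1"
      then obtain r where r: "r \<in> carrier R" "qR r = x" using q.q_ex by blast
      show "f2 x = f x" using f[OF r(1)] fun_cong[OF e(1), of r] r by simp
    qed
    \<comment> \<open>Evaluating the equality with g0 at x (x) 1 gives k (qE x) = g1 x, and the
      projection is surjective.\<close>
    have gg: "k y = gb y" if y: "y \<in> carrier E1" for y
    proof -
      obtain x where x: "x \<in> carrier E" "y = qE x" using qE_ex[OF y] by blast
      interpret t2: semilinear_hom R E A E' ?f ?k by (rule sh2)
      have "pure R E (restr ?f (self_alg A)) x \<one>\<^bsub>A\<^esub> \<in> carrier (bc_alg R E ?f A)"
        using t2.S.pure_closed[OF x(1), of "\<one>\<^bsub>A\<^esub>", folded t2.bc_eq] by simp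
      then have "g0 (pure R E (restr ?f (self_alg A)) x \<one>\<^bsub>A\<^esub>) = \<one>\<^bsub>A\<^esub> \<odot>\<^bsub>E'\<^esub> k (qE x)"
        using t2.lin_ext_pure[OF t2.gs x(1) Q.R.one_closed] unfolding e(2)[symmetric] by simp
      then have "g1 x = k (qE x)" using ring_hom_closed[OF t2.gr x(1)] unfolding g1_def e(1) by simp
      then show ?thesis using gb(2)[OF x(1)] x(2) by simp
    qed
    have "restrict (lin_ext E' k) (carrier (bc_alg R1 E1 f A)) = restrict (lin_ext E' gb) (carrier (bc_alg R1 E1 f A))"
      by (rule restrict_ext) (rule lin_ext_cong[OF c(2)[unfolded ff] shf gg])
    then show ?thesis using ff c(5) by simp
  qed
  show ?thesis
  proof (rule ex1I[where a = "(f, restrict (lin_ext E' gb) (carrier (bc_alg R1 E1 f A)))"], rule ex)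
    fix h assume "h \<in> CH_hom G R1 E1 rho1 DC A E' \<rho>' D'"
    then show "h = (f, restrict (lin_ext E' gb) (carrier (bc_alg R1 E1 f A)))" using uni by (cases h) blast
  qed
qed

subsection \<open>The quotient satisfies the condition\<close>

text \<open>The zero ring has no maximal ideal, so a nonzero quotient ring is where locality starts.
  Membership in C comes from the lifting of K_i to K, everything else by transport along the
  projections.\<close>

lemma object:
  fixes Du :: "('u, 'g \<Rightarrow> 'u, 'u) law"
  assumes ne: "carrier R1 \<noteq> {\<zero>\<^bsub>R1\<^esub>}"
    and finR: "\<exists>X. finite X \<and> X \<subseteq> carrier R \<and> (\<forall>r\<in>carrier R. \<exists>t\<in>X. r \<ominus>\<^bsub>R\<^esub> t \<in> max_ideal R)"
    and cont: "continuous_map T (adic_topology R (max_ideal R) E) \<rho>"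
    and ga: "assoc_algebra R (group_alg G R)"
    and Du: "law_eq R (group_alg G R) (induced_law R E \<rho> D) Du"
  shows "CH_object_C p G T d R Du C R1 E1 rho1 DC"
proof -
  have one: "\<one>\<^bsub>R1\<^esub> \<noteq> \<zero>\<^bsub>R1\<^esub>" using ne q.R'.carrier_one_zero by blast
  have cnl1: "complete_noetherian_local R1" by (rule q.surj_complete_noetherian_local[OF cnl one])
  have m1: "max_ideal R1 = qR ` max_ideal R" by (rule q.surj_max_ideal[OF cnl one])
  \<comment> \<open>All filtrations on the quotient are images of those on E, hence continuity and
    membership in C can be checked upstairs.\<close>
  have mp1: "ideal_pow R1 (max_ideal R1) n = qR ` mp n" for n unfolding m1 by (rule q.im_pow[OF mD(4)])
  have alg1: "algebra (Zp p) R1"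
  proof -
    interpret A: algebra "Zp p" R by (rule algR)
    interpret Z: pmodule "Zp p" R using algebraD(5)[OF algR] by (simp add: pmodule_def)
    \<comment> \<open>The quotient carries its own scalar multiplication by p-adic integers; it is
      well defined because these act through R, under which the ideal is stable.\<close>
    have aaZ: "rsub (Zp p) R aa"
    proof (rule rsubI)
      fix z x assume z: "z \<in> carrier (Zp p)" and x: "x \<in> aa"
      have "str_map R z \<otimes>\<^bsub>R\<^esub> x \<in> aa" using ideal.I_l_closed[OF aa_ideal x str_map_closed[OF algR z]] .
      then show "z \<odot>\<^bsub>R\<^esub> x \<in> aa" using str_map_mult[OF algR z] ideal.Icarr[OF aa_ideal x] by simp
    qed (use R.subgroupD[OF aa_sub] in auto)
    have m: "Module.module (Zp p) R1" unfolding RC_def by (rule Z.quot_is_module[OF aaZ])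
    have s: "z \<odot>\<^bsub>R1\<^esub> qR x = qR (z \<odot>\<^bsub>R\<^esub> x)" if "z \<in> carrier (Zp p)" "x \<in> carrier R" for z x
      unfolding RC_def by (rule Z.quot_smult[OF aaZ that])
    have "(z \<odot>\<^bsub>R1\<^esub> x) \<otimes>\<^bsub>R1\<^esub> y = z \<odot>\<^bsub>R1\<^esub> (x \<otimes>\<^bsub>R1\<^esub> y)" if z: "z \<in> carrier (Zp p)" and x: "x \<in> carrier R1" and y: "y \<in> carrier R1" for z x y
    proof -
      obtain a where a: "a \<in> carrier R" "qR a = x" using q.q_ex[OF x] by blast
      obtain b where b: "b \<in> carrier R" "qR b = y" using q.q_ex[OF y] by blast
      have "(z \<odot>\<^bsub>R1\<^esub> x) \<otimes>\<^bsub>R1\<^esub> y = qR ((z \<odot>\<^bsub>R\<^esub> a) \<otimes>\<^bsub>R\<^esub> b)" using s[OF z a(1)] q.q_mult[OF A.smult_closed[OF z a(1)] b(1)] a b by simp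
      also have "\<dots> = qR (z \<odot>\<^bsub>R\<^esub> (a \<otimes>\<^bsub>R\<^esub> b))" using A.smult_assoc2[OF z a(1) b(1)] by simp
      also have "\<dots> = z \<odot>\<^bsub>R1\<^esub> (x \<otimes>\<^bsub>R1\<^esub> y)" using s[OF z, of "a \<otimes>\<^bsub>R\<^esub> b"] q.q_mult[OF a(1) b(1)] a b by simp
      finally show ?thesis .
    qed
    then show ?thesis using m q.cR' by (simp add: algebra_def algebra_axioms_def)
  qed
  have ch1: "cayley_hamilton R1 E1 d DC" by (rule sq.cayley_hamilton_transport[OF inf ch psDC lcq qE_surj])
  have hom1: "rho1 \<in> hom G (units_of E1)"
  proof -
    have "qE u \<in> Units E1" if u: "u \<in> Units E" for u
    proof -
      have c: "u \<in> carrier E" "inv\<^bsub>E\<^esub> u \<in> carrier E" "u \<otimes>\<^bsub>E\<^esub> inv\<^bsub>E\<^esub> u = \<one>\<^bsub>E\<^esub>" "inv\<^bsub>E\<^esub> u \<otimes>\<^bsub>E\<^esub> u = \<one>\<^bsub>E\<^esub>" using u by auto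
      then have "qE u \<otimes>\<^bsub>E1\<^esub> qE (inv\<^bsub>E\<^esub> u) = \<one>\<^bsub>E1\<^esub>" "qE (inv\<^bsub>E\<^esub> u) \<otimes>\<^bsub>E1\<^esub> qE u = \<one>\<^bsub>E1\<^esub>"
        using ring_hom_mult[OF sq.gr] ring_hom_one[OF sq.gr] by metis+
      then show ?thesis using qE_closed c unfolding Units_def by blast
    qed
    moreover have "\<rho> s \<in> Units E" if "s \<in> carrier G" for s using rho that by (auto simp: hom_def units_of_def)
    ultimately show ?thesis using rho_mult rho_closed ring_hom_mult[OF sq.gr]
      by (auto simp: hom_def units_of_def rho1_eq)
  qed
  have fg1: "fg_module R1 E1"
  proof -
    interpret P1: pmodule R1 E1 using assoc_algebraD(1)[OF bq.E'] by (simp add: pmodule_def)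
    obtain S where S: "finite S" "S \<subseteq> carrier E" "carrier E = ispan E (carrier R) S" using fgE by (auto simp: EM.fg_module_iff)
    have S1: "qE ` S \<subseteq> carrier E1" using S(2) qE_closed by auto
    have "qE x \<in> ispan E1 (carrier R1) (qE ` S)" if x: "x \<in> ispan E (carrier R) S" for x
      using x
    proof (induct rule: ispan.induct)
      case zero
      have "qE \<zero>\<^bsub>E\<^esub> = \<zero>\<^bsub>E1\<^esub>" using qE_zero_iff rsubD(2)[OF JJ_rsub] by simp
      then show ?case using ispan.zero by metis
    next
      case (add a s y)
      have yc: "y \<in> carrier E" using add(3) S(3) by simp
      have "qE (a \<odot>\<^bsub>E\<^esub> s \<oplus>\<^bsub>E\<^esub> y) = qR a \<odot>\<^bsub>E1\<^esub> qE s \<oplus>\<^bsub>E1\<^esub> qE y"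
        using add S(2) yc addhom_add[OF slin_addhom[OF qE_slin]] by (simp add: qE_smult subset_iff)
      then show ?case using ispan.add[OF q.q_closed[OF add(1)] imageI[OF add(2)] add(4)] by simp
    qed
    then have "carrier E1 \<subseteq> ispan E1 (carrier R1) (qE ` S)" unfolding qE_surj[symmetric] using S(3) by blast
    then have "carrier E1 = ispan E1 (carrier R1) (qE ` S)" using P1.ispan_closed[OF order_refl S1] by blast
    then show ?thesis unfolding P1.fg_module_iff using S(1) S1 by (intro exI[of _ "qE ` S"]) simp
  qed
  interpret Q: CH_data p G T C R1 E1 rho1
    using alg1 cnl1 bq.E' fg1 hom1 stab_cond_axioms by (simp add: CH_data_def CH_data_axioms_def)
  have qNN: "qE x \<in> Q.NN n" if x: "x \<in> NN n" for x n
    using x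
  proof (induct rule: ispan.induct)
    case zero
    have "qE \<zero>\<^bsub>E\<^esub> = \<zero>\<^bsub>E1\<^esub>" using qE_zero_iff rsubD(2)[OF JJ_rsub] by simp
    then show ?case using ispan.zero by metis
  next
    case (add a s y)
    have c: "a \<in> carrier R" "y \<in> carrier E" using ideal.Icarr[OF mp_ideal add(1)] rsubD(5)[OF NN_rsub add(3)] by auto
    have "qE (a \<odot>\<^bsub>E\<^esub> s \<oplus>\<^bsub>E\<^esub> y) = qR a \<odot>\<^bsub>E1\<^esub> qE s \<oplus>\<^bsub>E1\<^esub> qE y"
      using add(2) c addhom_add[OF slin_addhom[OF qE_slin]] by (simp add: qE_smult)
    moreover have "qR a \<in> Q.mp n" unfolding mp1 using add(1) by (rule imageI)
    ultimately show ?case using ispan.add[OF _ qE_closed[OF add(2)] add(4)] by simp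
  qed
  have cont1: "continuous_map T (adic_topology R1 (max_ideal R1) E1) rho1"
    unfolding continuous_map_def
  proof (intro conjI allI impI)
    note op = EM.openin_adic[OF mD(4)] and op1 = Q.EM.openin_adic[OF Q.mD(4)]
    have "openin (adic_topology R1 (max_ideal R1) E1) (carrier E1)"
      unfolding op1 using bq.E'.rcos_mem rsubD(5)[OF Q.NN_rsub] by (auto intro!: exI[of _ 0] simp del: ideal_pow.simps)
    then have t: "carrier E1 \<subseteq> topspace (adic_topology R1 (max_ideal R1) E1)" by (rule openin_subset)
    have "rho1 s \<in> carrier E1" if "s \<in> topspace T" for s
      using qE_closed[OF rho_closed[OF that[unfolded topT]]] that[unfolded topT] by (simp only: rho1_eq)
    then show "rho1 \<in> topspace T \<rightarrow> topspace (adic_topology R1 (max_ideal R1) E1)" using t by (intro Pi_I) blast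
    fix U assume U: "openin (adic_topology R1 (max_ideal R1) E1) U"
    \<comment> \<open>The projection is continuous for the adic topologies, as it maps m^n E into
      the n-th step of the quotient; so preimages of open sets are open and continuity of \<rho>
      applies.\<close>
    let ?V = "{x \<in> carrier E. qE x \<in> U}"
    have "openin (adic_topology R (max_ideal R) E) ?V" unfolding op
    proof (intro conjI ballI)
      fix x assume x: "x \<in> ?V"
      then obtain n where n: "Q.NN n +>\<^bsub>E1\<^esub> qE x \<subseteq> U" using U unfolding op1 by blast
      have "NN n +>\<^bsub>E\<^esub> x \<subseteq> ?V"
      proof
        fix y assume "y \<in> NN n +>\<^bsub>E\<^esub> x"
        then obtain w where w: "w \<in> NN n" "y = w \<oplus>\<^bsub>E\<^esub> x" by (auto simp: E.rcos_mem)
        have c: "w \<in> carrier E" "x \<in> carrier E" using x rsubD(5)[OF NN_rsub w(1)] by simp_all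
        have "qE y = qE w \<oplus>\<^bsub>E1\<^esub> qE x" unfolding w(2) by (rule addhom_add[OF slin_addhom[OF qE_slin] c])
        then have "qE y \<in> Q.NN n +>\<^bsub>E1\<^esub> qE x" using qNN[OF w(1)] by (auto simp: bq.E'.rcos_mem)
        then show "y \<in> ?V" using n w(2) c by auto
      qed
      then show "\<exists>n. NN n +>\<^bsub>E\<^esub> x \<subseteq> ?V" by blast
    qed blast
    then have "openin T {s \<in> topspace T. \<rho> s \<in> ?V}" by (rule openin_continuous_map_preimage[OF cont])
    moreover have "{s \<in> topspace T. \<rho> s \<in> ?V} = {s \<in> topspace T. rho1 s \<in> U}" using rho_closed by (auto simp: topT rho1_eq)
    ultimately show "openin T {s \<in> topspace T. rho1 s \<in> U}" by simp
  qed
  have res: "has_residual G R Du R1 (induced_law R1 E1 rho1 DC)"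
  proof -
    \<comment> \<open>The projection of rings is itself the local map that exhibits the residual
      pseudorepresentation: the induced law on the quotient is the base change of \<open>Du\<close>
      along it.\<close>
    let ?g = "\<lambda>\<phi> :: 'g \<Rightarrow> 'u. qR \<circ> \<phi>"
    let ?RG = "group_alg G R" and ?RG1 = "group_alg G R1"
    note gm = group_alg_map[OF sc, where G = G]
    have ga1: "assoc_algebra R1 ?RG1"
      by (rule assoc_algebra_surj[where h = ?g, OF ga q.cR' qR_surj q.q gm(1,2,3,4,5,6)])
    have bcg: "base_change R ?RG R1 ?RG1 qR" using ga ga1 q.q by (simp add: base_change_def)
    have gc: "?g \<phi> \<in> carrier ?RG1" if "\<phi> \<in> carrier ?RG" for \<phi> using gm(1) that by blast
    have gr: "?g \<in> ring_hom ?RG ?RG1" by (rule ring_hom_memI[where h = ?g, OF gc gm(4) gm(2) gm(5)])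
    have gsl: "slin R qR ?RG ?RG1 ?g" by (rule slinI[where h = ?g, OF ring_hom_addhom[OF gr] gm(6)])
    have shg: "semilinear_hom R ?RG R1 ?RG1 qR ?g" by (rule semilinear_homI[OF bcg gr gsl])
    interpret g: semilinear_hom R ?RG R1 ?RG1 qR ?g by (rule shg)
    note ex = group_alg_ext_slin[OF cringR EM.module_axioms rho_closed]
    note ex1 = group_alg_ext_slin[OF q.cR' assoc_algebraD(1)[OF bq.E'] Q.rho_closed]
    \<comment> \<open>Extending \<rho> linearly and then projecting is the same as projecting the
      coefficients first. The supports may differ, so the sums are matched by adding zero
      terms.\<close>
    have exq: "group_alg_ext R1 E1 rho1 (?g \<phi>) = qE (group_alg_ext R E \<rho> \<phi>)" if ph: "\<phi> \<in> carrier ?RG" for \<phi>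
    proof -
      have c: "\<phi> s \<in> carrier R" for s using ph by (simp add: group_alg_simps)
      have S: "finite {s. \<phi> s \<noteq> \<zero>\<^bsub>R\<^esub>}" "{s. \<phi> s \<noteq> \<zero>\<^bsub>R\<^esub>} \<subseteq> carrier G" using ph by (simp_all add: group_alg_simps)
      have q0: "qR (\<phi> s) = \<zero>\<^bsub>R1\<^esub>" if "\<phi> s = \<zero>\<^bsub>R\<^esub>" for s unfolding that by (rule q.q_zero)
      have sup: "{s. qR (\<phi> s) \<noteq> \<zero>\<^bsub>R1\<^esub>} \<subseteq> {s. \<phi> s \<noteq> \<zero>\<^bsub>R\<^esub>}" by (rule Collect_mono) (use q0 in blast)
      have cl: "qR (\<phi> s) \<odot>\<^bsub>E1\<^esub> rho1 s \<in> carrier E1" if "s \<in> {s. \<phi> s \<noteq> \<zero>\<^bsub>R\<^esub>}" for s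
        by (rule bq.EM'.smult_closed[OF q.q_closed[OF c] Q.rho_closed[OF subsetD[OF S(2) that]]])
      have "qE (group_alg_ext R E \<rho> \<phi>) = finsum E1 (\<lambda>s. qE (\<phi> s \<odot>\<^bsub>E\<^esub> \<rho> s)) {s. \<phi> s \<noteq> \<zero>\<^bsub>R\<^esub>}"
        unfolding group_alg_ext_def
        by (rule addhom_finsum[OF slin_addhom[OF qE_slin] E.abelian_group_axioms bq.E'.abelian_group_axioms])
          (rule Pi_I, rule EM.smult_closed[OF c rho_closed[OF subsetD[OF S(2)]]])
      also have "\<dots> = finsum E1 (\<lambda>s. qR (\<phi> s) \<odot>\<^bsub>E1\<^esub> rho1 s) {s. \<phi> s \<noteq> \<zero>\<^bsub>R\<^esub>}"
      proof (rule bq.E'.finsum_cong'[OF refl])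
        show "(\<lambda>s. qR (\<phi> s) \<odot>\<^bsub>E1\<^esub> rho1 s) \<in> {s. \<phi> s \<noteq> \<zero>\<^bsub>R\<^esub>} \<rightarrow> carrier E1" by (rule Pi_I) (rule cl)
        show "qE (\<phi> s \<odot>\<^bsub>E\<^esub> \<rho> s) = qR (\<phi> s) \<odot>\<^bsub>E1\<^esub> rho1 s" if "s \<in> {s. \<phi> s \<noteq> \<zero>\<^bsub>R\<^esub>}" for s
          unfolding rho1_eq by (rule qE_smult[OF c rho_closed[OF subsetD[OF S(2) that]]])
      qed
      also have "\<dots> = finsum E1 (\<lambda>s. qR (\<phi> s) \<odot>\<^bsub>E1\<^esub> rho1 s) {s. qR (\<phi> s) \<noteq> \<zero>\<^bsub>R1\<^esub>}"
      proof (rule bq.E'.add.finprod_mono_neutral_cong_right[OF S(1) sup _ refl])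
        show "(\<lambda>s. qR (\<phi> s) \<odot>\<^bsub>E1\<^esub> rho1 s) \<in> {s. \<phi> s \<noteq> \<zero>\<^bsub>R\<^esub>} \<rightarrow> carrier E1" by (rule Pi_I) (rule cl)
        show "qR (\<phi> s) \<odot>\<^bsub>E1\<^esub> rho1 s = \<zero>\<^bsub>E1\<^esub>" if "s \<in> {s. \<phi> s \<noteq> \<zero>\<^bsub>R\<^esub>} - {s. qR (\<phi> s) \<noteq> \<zero>\<^bsub>R1\<^esub>}" for s
        proof -
          have z: "qR (\<phi> s) = \<zero>\<^bsub>R1\<^esub>" and sg: "s \<in> {s. \<phi> s \<noteq> \<zero>\<^bsub>R\<^esub>}" using that by blast+
          show ?thesis unfolding z by (rule bq.EM'.smult_l_null[OF Q.rho_closed[OF subsetD[OF S(2) sg]]])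
        qed
      qed
      finally show ?thesis by (simp add: group_alg_ext_def)
    qed
    have lc: "law_compat R ?RG Du R1 ?RG1 (induced_law R1 E1 rho1 DC) qR ?g"
      unfolding law_compat_def
    proof (intro allI impI ballI)
      fix B :: "('u set, 'u) module" and x assume B: "algebra R1 B" and x: "x \<in> carrier (tensor R ?RG (restr qR B))"
      have a: "algebra R (restr qR B)" by (rule algebra_restr[OF B q.q cringR])
      interpret m: tensor_map R ?RG "restr qR B" R1 ?RG1 B qR ?g "\<lambda>b. b" by (rule g.tensor_map_id[OF B])
      interpret mE: tensor_map R E "restr qR B" R1 E1 B qR qE "\<lambda>b. b" by (rule sq.tensor_map_id[OF B])
      interpret e: tensor_map R ?RG "restr qR B" R E "restr qR B" "\<lambda>r. r" "group_alg_ext R E \<rho>" "\<lambda>b. b"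
        by (rule tensor_mapI[OF m.S.tensor_alg_axioms mE.S.tensor_alg_axioms _ ex]) (auto intro!: slinI addhomI)
      interpret e1: tensor_map R1 ?RG1 B R1 E1 B "\<lambda>r. r" "group_alg_ext R1 E1 rho1" "\<lambda>b. b"
        by (rule tensor_mapI[OF m.T'.tensor_alg_axioms mE.T'.tensor_alg_axioms _ ex1]) (auto intro!: slinI addhomI)
      have "Du (restr qR B) x = D (restr qR B) (tmap R E (restr qR B) (group_alg_ext R E \<rho>) (\<lambda>b. b) x)"
        using Du a x unfolding law_eq_def induced_law_def by metis
      also have "\<dots> = DC B (tmap R1 E1 B qE (\<lambda>b. b) (tmap R E (restr qR B) (group_alg_ext R E \<rho>) (\<lambda>b. b) x))"
        using lcq B e.tmap_closed[OF x] unfolding law_compat_def by blast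
      also have "tmap R1 E1 B qE (\<lambda>b. b) (tmap R E (restr qR B) (group_alg_ext R E \<rho>) (\<lambda>b. b) x) =
        tmap R1 E1 B (group_alg_ext R1 E1 rho1) (\<lambda>b. b) (tmap R1 ?RG1 B ?g (\<lambda>b. b) x)"
        by (rule m.S.tensor_ext[OF addhom_comp[OF e.tmap_addhom mE.tmap_addhom] addhom_comp[OF m.tmap_addhom e1.tmap_addhom] mE.T'.T_abelian_group x])
          (simp add: e.tmap_pure mE.tmap_pure m.tmap_pure e1.tmap_pure gc exq addhom_closed[OF slin_addhom[OF ex]])
      finally show "Du (restr qR B) x = induced_law R1 E1 rho1 DC B (tmap R1 ?RG1 B ?g (\<lambda>b. b) x)"
        by (simp add: induced_law_def)
    qed
    have "group_base_change G R Du R1 (induced_law R1 E1 rho1 DC) qR"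
      unfolding group_base_change_def by (rule g.pseudo_morphismI[OF gr gsl lc refl])
    moreover have "qR \<in> local_hom R R1" using q.q m1 by (simp add: local_hom_def)
    ultimately show ?thesis unfolding has_residual_def by blast
  qed
  have sat: "satisfies p G T C R1 E1 (left_act E1 rho1)" unfolding satisfies_def
  proof (intro conjI allI impI fg1)
    fix i :: nat
    note Qq = quot_gmod[OF G.group_axioms Q.MM_gmod Q.NN_gsub[of i]]
    have qg: "ghom G MM al Q.MM Q.al qE"
      using slin_addhom[OF qE_slin] rho_closed ring_hom_mult[OF sq.gr] by (simp add: ghom_def addhom_def left_act_def rho1_eq)
    have "(\<lambda>x. Q.NN i +>\<^bsub>Q.MM\<^esub> qE x) ` carrier E = (\<lambda>X. Q.NN i +>\<^bsub>Q.MM\<^esub> X) ` (qE ` carrier E)"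
      by (simp only: image_image)
    also have "\<dots> = carrier (quot_module Q.MM (Q.NN i))" using Qq(3) unfolding qE_surj by simp
    finally have surj: "(\<lambda>x. Q.NN i +>\<^bsub>Q.MM\<^esub> qE x) ` carrier E = carrier (quot_module Q.MM (Q.NN i))" .
    show "inC (red_mod R1 E1 i) (red_act R1 E1 (left_act E1 rho1) i)"
      unfolding Q.red_mod_eq Q.red_act_eq
    \<comment> \<open>The reduction modulo the i-th power is presented as a quotient of E that kills
      K and m^i E.\<close>
    proof (rule quotient_inC[OF finR Qq(1) ghom_comp[OF qg Qq(2)] surj, where i = i])
      show "Q.NN i +>\<^bsub>Q.MM\<^esub> qE x = \<zero>\<^bsub>quot_module Q.MM (Q.NN i)\<^esub>" if x: "x \<in> KK" for x
      proof -
        have xc: "x \<in> carrier E" using rsubD(5)[OF KK_rsub x] .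
        have "qE x = \<zero>\<^bsub>E1\<^esub>" using qE_zero_iff[OF xc] KK_JJ x by blast
        then have "qE x \<in> Q.NN i" using rsubD(2)[OF Q.NN_rsub] by metis
        then show ?thesis using Qq(4)[of "qE x"] qE_closed[OF xc] by simp
      qed
      show "Q.NN i +>\<^bsub>Q.MM\<^esub> qE x = \<zero>\<^bsub>quot_module Q.MM (Q.NN i)\<^esub>" if x: "x \<in> NN i" for x
        using Qq(4)[of "qE x"] qE_closed[OF rsubD(5)[OF NN_rsub x]] qNN[OF x] by simp
    qed
  qed
  show ?thesis
    unfolding CH_object_C_def CH_object_def CH_rep_def
    using alg1 cnl1 ch1 hom1 cont1 res sat by blast
qed

end

theorem theorem2p5p3:
  fixes p d :: nat
    and G :: "'g monoid" and T :: "'g topology"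
    and F :: "'u ring" and Dbar :: "('u, 'g \<Rightarrow> 'u, 'u) law"
    and W :: "(padic, 'u) module" and \<pi> :: "'u \<Rightarrow> 'u"
    and R\<^sub>W :: "('u, 'u) module" and r :: "'u \<Rightarrow> 'u" and Du :: "('u, 'g \<Rightarrow> 'u, 'u) law"
    and R :: "(padic, 'u) module"
    and E :: "('u, 'u) module" and \<rho> :: "'g \<Rightarrow> 'u" and D :: "('u, 'u, 'u) law"
    and C :: "'g condition"
    and DC :: "('u set, 'u set, 'u) law"
  assumes "infinite (UNIV :: 'u set)"
    and "Factorial_Ring.prime p"
    and "profinite_group G T" and "mazur_Phi p G T"
    and "field F" and "finite (carrier F)" and "[p] \<cdot>\<^bsub>F\<^esub> \<one>\<^bsub>F\<^esub> = \<zero>\<^bsub>F\<^esub>"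
    and "group_pseudorep G T F d Dbar"
    and "witt_ring p F W \<pi>"
    and "universal_deformation G T d F Dbar W \<pi> R\<^sub>W r Du"
    and R_def: "R = restr (str_map W) R\<^sub>W"
    and "universal_CH p G T d R Du E \<rho> D"
    and "fg_module R E"
    and "group_alg_ext R E \<rho> ` carrier (group_alg G R) = carrier E"
    and "law_eq R (group_alg G R) (induced_law R E \<rho> D) Du"
    and "stable_condition p G T C"
    and "is_DC p G d C R E \<rho> D DC"
  shows "(carrier (RC p G C R E \<rho> D) \<noteq> {\<zero>\<^bsub>RC p G C R E \<rho> D\<^esub>} \<longrightarrow>
           CH_object_C p G T d R Du C
             (RC p G C R E \<rho> D) (EC p G C R E \<rho> D) (rhoC p G C R E \<rho> D) DC) \<and>
         (\<forall>(A :: (padic, 'u) module) (E' :: ('u, 'u) module) \<rho>' D'.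
           CH_object_C p G T d R Du C A E' \<rho>' D' \<longrightarrow>
           (\<exists>!h. h \<in> CH_hom G (RC p G C R E \<rho> D) (EC p G C R E \<rho> D) (rhoC p G C R E \<rho> D) DC
                      A E' \<rho>' D'))"
proof -
  have p0: "p > 0" using assms(2) by (simp add: prime_gt_0_nat)
  have obj: "CH_object p G T d R Du R E \<rho> D"
    and init: "\<And>(A :: (padic, 'u) module) (E' :: ('u, 'u) module) \<rho>' D'.
        CH_object p G T d R Du A E' \<rho>' D' \<Longrightarrow> \<exists>!h. h \<in> CH_hom G R E \<rho> D A E' \<rho>' D'"
    using assms(12) unfolding universal_CH_def by blast+
  have o: "algebra (Zp p) R" "complete_noetherian_local R" "cayley_hamilton R E d D" "\<rho> \<in> hom G (units_of E)"
    "continuous_map T (adic_topology R (max_ideal R) E) \<rho>"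
    using obj by (auto simp: CH_object_def CH_rep_def)
  have aE: "assoc_algebra R E" using o(3) unfolding cayley_hamilton_def by (blast dest: pseudorepD(2))
  interpret C_quotient p G T C R E \<rho> d D DC
    using p0 assms(1,3,13,16,17) o aE
    by (simp add: C_quotient_def C_quotient_axioms_def CH_data_def CH_data_axioms_def stab_cond_def)
  have cf: "coeff_ring F W \<pi> R\<^sub>W r" and df: "deformation G T d F Dbar R\<^sub>W r Du"
    using assms(10) unfolding universal_deformation_def by blast+
  have rh: "r \<in> ring_hom R\<^sub>W F" "r ` carrier R\<^sub>W = carrier F" "a_kernel R\<^sub>W F r = max_ideal R\<^sub>W" "complete_noetherian_local R\<^sub>W"
    using cf by (simp_all add: coeff_ring_def)
  have finR: "\<exists>X. finite X \<and> X \<subseteq> carrier R \<and> (\<forall>s\<in>carrier R. \<exists>t\<in>X. s \<ominus>\<^bsub>R\<^esub> t \<in> max_ideal R)"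
  proof -
    interpret RW: cring "R\<^sub>W" using complete_noetherian_localD(1)[OF rh(4)] .
    interpret F: field F by (rule assms(5))
    \<comment> \<open>One chosen preimage for every element of the finite residue field; the
      difference from the preimage of its own residue lies in the kernel, which is the maximal
      ideal.\<close>
    let ?X = "inv_into (carrier R\<^sub>W) r ` carrier F"
    have X: "?X \<subseteq> carrier R\<^sub>W" using rh(2) by (metis (no_types, lifting) image_subsetI inv_into_into)
    have "s \<ominus>\<^bsub>R\<^sub>W\<^esub> inv_into (carrier R\<^sub>W) r (r s) \<in> max_ideal R\<^sub>W" if s: "s \<in> carrier R\<^sub>W" for s
    proof -
      let ?t = "inv_into (carrier R\<^sub>W) r (r s)"
      have t: "?t \<in> carrier R\<^sub>W" "r ?t = r s" using s by (simp_all add: inv_into_into f_inv_into_f)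
      have "r (s \<ominus>\<^bsub>R\<^sub>W\<^esub> ?t) = \<zero>\<^bsub>F\<^esub>"
        using addhom_minus[OF ring_hom_addhom[OF rh(1)] RW.abelian_group_axioms F.abelian_group_axioms s t(1)] t(2) ring_hom_closed[OF rh(1) s]
        by (simp add: F.minus_eq F.r_neg)
      then have "s \<ominus>\<^bsub>R\<^sub>W\<^esub> ?t \<in> a_kernel R\<^sub>W F r" using s t(1) by (simp add: a_kernel_def')
      then show ?thesis using rh(3) by simp
    qed
    then have "\<forall>s\<in>carrier R\<^sub>W. \<exists>t\<in>?X. s \<ominus>\<^bsub>R\<^sub>W\<^esub> t \<in> max_ideal R\<^sub>W" using ring_hom_closed[OF rh(1)] by blast
    then show ?thesis using X assms(6) unfolding R_def max_ideal_restr by (intro exI[of _ ?X]) simp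
  qed
  \<comment> \<open>The ring axioms of the group algebra are read off from the universal
    deformation, a pseudorepresentation on that very algebra, and carried over to the scalars of
    R.\<close>
  have "assoc_algebra R\<^sub>W (group_alg G R\<^sub>W)"
    using df unfolding deformation_def group_pseudorep_def by (blast dest: pseudorepD(2))
  then have ga: "assoc_algebra R (group_alg G R)"
    unfolding R_def group_alg_restr by (rule assoc_algebra_cong) simp_all
  show ?thesis
  proof (intro conjI impI allI)
    show "CH_object_C p G T d R Du C R1 E1 rho1 DC" if "carrier R1 \<noteq> {\<zero>\<^bsub>R1\<^esub>}"
      by (rule object[OF that finR o(5) ga assms(15)])
    fix A :: "(padic, 'u) module" and E' :: "('u, 'u) module" and \<rho>' D'
    assume a: "CH_object_C p G T d R Du C A E' \<rho>' D'"
    then have "CH_object p G T d R Du A E' \<rho>' D'" by (simp add: CH_object_C_def)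
    from universal[OF a init[OF this]] show "\<exists>!h. h \<in> CH_hom G R1 E1 rho1 DC A E' \<rho>' D'" .
  qed
qed

end
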